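(* Let $\mathfrak g\subset J^1(TM)$ be a transitive, torsion-reduced infinitesimal geometric structure with structure kernel $\mathfrak h$, and suppose that the associated upper coboundary morphism $\Delta$ is injective. Then $\mathfrak g$ has an associated Cartan algebroid, namely $\mathfrak g$ itself, equipped with a Cartan connection $\nabla^{(1)}$ described below, and the $\nabla^{(1)}$-parallel sections of $\mathfrak g$ coincide with the prolonged symmetries of $\mathfrak g$ (the sections $J^1W$, $W$ a symmetry of $\mathfrak g$). Choose a generator $\nabla$ for $\mathfrak g$. Then: (1) The equation $$\Delta(\epsilon(V\oplus\phi))=\bar\nabla_V\,\mathrm{tor}\,\bar\nabla+\phi\cdot\mathrm{tor}\,\bar\nabla\qquad(V\in\Gamma(TM),\ \phi\in\Gamma(\mathfrak h)\text{ arbitrary})$$ has a unique solution vector bundle morphism $\epsilon\colon TM\oplus\mathfrak h\to T^*M\otimes\mathfrak h$. (2) Identifying $\mathfrak g$ with $TM\oplus\mathfrak h$ using the generator $\nabla$, we have $$\nabla^{(1)}_U(V\oplus\phi)=(\nabla_UV+\phi(U))\oplus(\bar\nabla_U\phi+\epsilon(V\oplus\phi)U+\mathrm{curv}\,\bar\nabla(U,V)).$$ (3) If $\mathfrak g$ is reductive and $\nabla$ is normal, or if the intrinsic torsion $\tau$ of $\mathfrak g$ vanishes and $\nabla$ is torsion-free, then $\epsilon=0$.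
   Context: Everything is $C^\infty$. $J^1(TM)$ is the bundle of 1-jets of vector fields, a Lie algebroid with anchor the projection $J^1(TM)\to TM$ and the unique bracket with $[J^1X,J^1Y]=J^1[X,Y]$. In $0\to T^*M\otimes TM\to J^1(TM)\to TM\to0$ the inclusion sends, on sections, $df\otimes X$ to $fJ^1X-J^1(fX)$. An infinitesimal geometric structure on $TM$ is a subalgebroid (constant-rank subbundle closed under bracket) $\mathfrak g\subset J^1(TM)$; it is transitive (equivalently, surjective) if the projection $a\colon\mathfrak g\to TM$ is surjective; its structure kernel is $\mathfrak h=\ker a\subset T^*M\otimes TM$. A symmetry of $\mathfrak g$ is a vector field $W$ with $J^1W$ a section of $\mathfrak g$. A generator of (surjective) $\mathfrak g$ is a linear connection $\nabla$ on $TM$ whose splitting $s_\nabla V=J^1V+\nabla V$ takes values in $\mathfrak g$; it identifies $\mathfrak g$ with $TM\oplus\mathfrak h$ via $V\oplus\phi\mapsto s_\nabla V+\phi$. The dual connection is $\bar\nabla_UV=\nabla_VU+[U,V]$, with $\mathrm{tor}\,\bar\nabla(U,V)=\bar\nabla_UV-\bar\nabla_VU-[U,V]$ and $\mathrm{curv}\,\bar\nabla(U,V)=[\bar\nabla_U,\bar\nabla_V]-\bar\nabla_{[U,V]}$, which for a generator takes values in $\mathfrak h$. $\bar\nabla$ acts on tensors as usual; in particular $(\bar\nabla_U\phi)(V)=\bar\nabla_U(\phi V)-\phi(\bar\nabla_UV)$, which preserves sections of $\mathfrak h$. For $\phi\in\mathfrak h$ and $T\in\Lambda^2(T^*M)\otimes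 TM$, $(\phi\cdot T)(U_1,U_2)=\phi(T(U_1,U_2))-T(\phi U_1,U_2)-T(U_1,\phi U_2)$. The upper coboundary morphism is $\Delta\colon T^*M\otimes\mathfrak h\to\Lambda^2(T^*M)\otimes TM$, $\Delta(\epsilon)(U_1,U_2)=\epsilon(U_1)U_2-\epsilon(U_2)U_1$. $\mathfrak g$ acts on $TM$ by the restriction of the adjoint representation $\mathrm{ad}_{J^1X}Y=[X,Y]$ of $J^1(TM)$, hence on associated tensor bundles, and $\Delta$ is equivariant. Put $H(\mathfrak g)=(\Lambda^2(T^*M)\otimes TM)/\mathrm{im}\,\Delta$. The intrinsic torsion $\tau\in\Gamma(H(\mathfrak g))$ is the class of $\mathrm{tor}\,\bar\nabla$ for any generator $\nabla$ (it is independent of the choice). $\mathfrak g$ is torsion-reduced if $\tau$ is $\mathfrak g$-invariant. $\mathfrak g$ is reductive if $\Delta$ has constant rank and $\mathrm{im}\,\Delta$ admits a $\mathfrak g$-invariant complement $C\subset\Lambda^2(T^*M)\otimes TM$; a generator $\nabla$ is normal if $\mathrm{tor}\,\bar\nabla$ is a section of some such $C$. A Cartan connection on a Lie algebroid $\mathfrak g$ is a linear connection $\nabla$ on $\mathfrak g$ for which the splitting $X\mapsto J^1X+\nabla X$, $\mathfrak g\to J^1\mathfrak g$, is a Lie algebroid morphism ($J^1\mathfrak g$ having anchor $J^1\mathfrak g\to\mathfrak g\to TM$ and bracket determined by $[J^1X,J^1Y]=J^1[X,Y]$, with $T^*M\otimes\mathfrak g\subset J^1\mathfrak g$ by the inclusion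 sending, on sections, $df\otimes X$ to $fJ^1X-J^1(fX)$ for $X\in\Gamma(\mathfrak g)$ and $f$ a smooth function). A Cartan algebroid is a Lie algebroid equipped with a Cartan connection. An associated Cartan algebroid of $\mathfrak g$ is one whose parallel sections are in natural one-to-one correspondence with the symmetries of $\mathfrak g$. *)

theory Defs
  imports "HOL-Analysis.Analysis" "HOL-Library.Function_Algebras"
begin

text \<open>Functions with values in a real vector space form a real vector space pointwise.\<close>

instantiation "fun" :: (type, real_vector) real_vector
begin
definition scaleR_fun :: "real \<Rightarrow> ('a \<Rightarrow> 'b) \<Rightarrow> 'a \<Rightarrow> 'b"
  where "scaleR_fun c f = (\<lambda>x. c *\<^sub>R f x)"
instance
  by standard (simp_all add: scaleR_fun_def fun_eq_iff scaleR_add_right scaleR_add_left)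
end

lemma scaleR_fun_apply [simp]: "(c *\<^sub>R f) x = c *\<^sub>R f x"
  by (simp add: scaleR_fun_def)


section \<open>Smooth manifolds\<close>

primrec Ck_on :: "nat \<Rightarrow> 'e::euclidean_space set \<Rightarrow> ('e \<Rightarrow> 'f::real_normed_vector) \<Rightarrow> bool" where
  "Ck_on 0 S f \<longleftrightarrow> continuous_on S f"
| "Ck_on (Suc k) S f \<longleftrightarrow>
     f differentiable_on S \<and> (\<forall>v. Ck_on k S (\<lambda>x. frechet_derivative f (at x) v))"

text \<open>To be used for open \<open>S\<close> only.\<close>

definition smooth_on :: "'e::euclidean_space set \<Rightarrow> ('e \<Rightarrow> 'f::real_normed_vector) \<Rightarrow> bool" where
  "smooth_on S f \<longleftrightarrow> (\<forall>k. Ck_on k S f)"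

text \<open>The manifold \<open>M\<close> is the whole type \<open>'m\<close>, with its topology, and its smooth structure is given
  by an atlas of charts \<open>(U, \<phi>)\<close> with values in \<open>'e\<close>, so that \<open>dim M = DIM('e)\<close>.\<close>

type_synonym ('m, 'e) atlas = "('m set \<times> ('m \<Rightarrow> 'e)) set"

definition smooth_atlas ::
  "('m::{t2_space, second_countable_topology}, 'e::euclidean_space) atlas \<Rightarrow> bool" where
  "smooth_atlas A \<longleftrightarrow>
     (\<Union>(U, \<phi>)\<in>A. U) = UNIV \<and>
     (\<forall>(U, \<phi>)\<in>A. open U \<and> open (\<phi> ` U) \<and> homeomorphism U (\<phi> ` U) \<phi> (inv_into U \<phi>)) \<and>
     (\<forall>(U, \<phi>)\<in>A. \<forall>(V, \<psi>)\<in>A. smooth_on (\<phi> ` (U \<inter> V)) (\<psi> \<circ> inv_into U \<phi>))"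

definition Cinf :: "('m::topological_space, 'e::euclidean_space) atlas \<Rightarrow> ('m \<Rightarrow> real) set" where
  "Cinf A = {f. \<forall>(U, \<phi>)\<in>A. smooth_on (\<phi> ` U) (f \<circ> inv_into U \<phi>)}"

text \<open>Tangent vectors at \<open>p\<close> are derivations at \<open>p\<close> of the algebra of smooth functions.
  Here and below, maps defined on a subset of a type are taken to be zero off that subset, so that
  equal maps are equal as HOL functions and the usual pointwise operations apply.\<close>

type_synonym 'm tvec = "('m \<Rightarrow> real) \<Rightarrow> real"

definition tangent :: "('m::topological_space, 'e::euclidean_space) atlas \<Rightarrow> 'm \<Rightarrow> 'm tvec set" where
  "tangent A p = {v.
     (\<forall>f\<in>Cinf A. \<forall>g\<in>Cinf A. v (\<lambda>q. f q + g q) = v f + v g) \<and>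
     (\<forall>c. \<forall>f\<in>Cinf A. v (\<lambda>q. c * f q) = c * v f) \<and>
     (\<forall>f\<in>Cinf A. \<forall>g\<in>Cinf A. v (\<lambda>q. f q * g q) = v f * g p + f p * v g) \<and>
     (\<forall>f. f \<notin> Cinf A \<longrightarrow> v f = 0)}"


section \<open>Vector bundles\<close>

text \<open>A vector bundle over \<open>M\<close> is presented by its fibres, which are linear subspaces of a common
  real vector space, together with its set of smooth global sections.\<close>

record ('m, 'v) vbundle =
  fibre :: "'m \<Rightarrow> 'v set"
  sections :: "('m \<Rightarrow> 'v) set"

definition fmul :: "('m \<Rightarrow> real) \<Rightarrow> ('m \<Rightarrow> 'v::real_vector) \<Rightarrow> 'm \<Rightarrow> 'v" where
  "fmul f s = (\<lambda>p. f p *\<^sub>R s p)"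

definition linmap_on :: "'v::real_vector set \<Rightarrow> ('v \<Rightarrow> 'w::real_vector) \<Rightarrow> bool" where
  "linmap_on S f \<longleftrightarrow>
     (\<forall>x\<in>S. \<forall>y\<in>S. f (x + y) = f x + f y) \<and> (\<forall>c. \<forall>x\<in>S. f (c *\<^sub>R x) = c *\<^sub>R f x)"

text \<open>Local frames are given by global sections; nothing is lost, since local sections can be
  multiplied by cut-off functions and neighbourhoods shrunk.\<close>

definition local_frame ::
  "('m::topological_space, 'v::real_vector, 'z) vbundle_scheme \<Rightarrow> 'm set \<Rightarrow> nat \<Rightarrow> (nat \<Rightarrow> 'm \<Rightarrow> 'v) \<Rightarrow> bool" where
  "local_frame E U r b \<longleftrightarrow>
     (\<forall>i<r. b i \<in> sections E) \<and>
     (\<forall>q\<in>U. inj_on (\<lambda>i. b i q) {..<r} \<and> independent ((\<lambda>i. b i q) ` {..<r}) \<and>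
            span ((\<lambda>i. b i q) ` {..<r}) = fibre E q)"

definition vector_bundle ::
  "('m::topological_space, 'e::euclidean_space) atlas \<Rightarrow> ('m, 'v::real_vector, 'z) vbundle_scheme \<Rightarrow> bool" where
  "vector_bundle A E \<longleftrightarrow>
     (\<forall>s\<in>sections E. \<forall>p. s p \<in> fibre E p) \<and>
     0 \<in> sections E \<and>
     (\<forall>s\<in>sections E. \<forall>t\<in>sections E. s + t \<in> sections E) \<and>
     (\<forall>f\<in>Cinf A. \<forall>s\<in>sections E. fmul f s \<in> sections E) \<and>
     (\<forall>s. (\<forall>p. \<exists>U. open U \<and> p \<in> U \<and> (\<exists>t\<in>sections E. \<forall>q\<in>U. s q = t q)) \<longrightarrow> s \<in> sections E) \<and>
     (\<exists>r. \<forall>p. \<exists>U b. open U \<and> p \<in> U \<and> local_frame E U r b \<and>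
        (\<forall>s\<in>sections E. \<exists>V f. open V \<and> p \<in> V \<and> (\<forall>i<r. f i \<in> Cinf A) \<and>
           (\<forall>q\<in>V. s q = (\<Sum>i<r. f i q *\<^sub>R b i q))))"

definition restrict_bundle ::
  "('m, 'v, 'z) vbundle_scheme \<Rightarrow> ('m \<Rightarrow> 'v set) \<Rightarrow> ('m, 'v) vbundle" where
  "restrict_bundle E F = \<lparr>fibre = F, sections = {s \<in> sections E. \<forall>p. s p \<in> F p}\<rparr>"

text \<open>Smooth subbundle of constant rank\<close>

definition subbundle ::
  "('m::topological_space, 'v::real_vector, 'z) vbundle_scheme \<Rightarrow> ('m \<Rightarrow> 'v set) \<Rightarrow> bool" where
  "subbundle E F \<longleftrightarrow>
     (\<forall>p. F p \<subseteq> fibre E p) \<and>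
     (\<exists>r. \<forall>p. \<exists>U b. open U \<and> p \<in> U \<and> local_frame (restrict_bundle E F) U r b)"

definition trivial_line ::
  "('m::topological_space, 'e::euclidean_space) atlas \<Rightarrow> ('m, real) vbundle" where
  "trivial_line A = \<lparr>fibre = (\<lambda>p. UNIV), sections = Cinf A\<rparr>"

text \<open>\<open>hom_bundle E F\<close> is the bundle \<open>E\<^sup>* \<otimes> F\<close>. Its sections are the vector bundle morphisms
  \<open>E \<rightarrow> F\<close> covering the identity of \<open>M\<close>.\<close>

definition hom_bundle ::
  "('m, 'v::real_vector, 'z) vbundle_scheme \<Rightarrow> ('m, 'w::real_vector, 'y) vbundle_scheme \<Rightarrow> ('m, 'v \<Rightarrow> 'w) vbundle" where
  "hom_bundle E F =
     \<lparr>fibre = (\<lambda>p. {h. linmap_on (fibre E p) h \<and> h ` fibre E p \<subseteq> fibre F p \<and>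
                       (\<forall>x. x \<notin> fibre E p \<longrightarrow> h x = 0)}),
      sections = {h. (\<forall>p. linmap_on (fibre E p) (h p) \<and> h p ` fibre E p \<subseteq> fibre F p \<and>
                       (\<forall>x. x \<notin> fibre E p \<longrightarrow> h p x = 0)) \<and>
                     (\<forall>s\<in>sections E. (\<lambda>p. h p (s p)) \<in> sections F)}\<rparr>"

definition sum_bundle ::
  "('m, 'v, 'z) vbundle_scheme \<Rightarrow> ('m, 'w, 'y) vbundle_scheme \<Rightarrow> ('m, 'v \<times> 'w) vbundle" where
  "sum_bundle E F =
     \<lparr>fibre = (\<lambda>p. fibre E p \<times> fibre F p),
      sections = {s. (\<lambda>p. fst (s p)) \<in> sections E \<and> (\<lambda>p. snd (s p)) \<in> sections F}\<rparr>"

text \<open>The bundle map (resp. bilinear bundle map) determined by an operator on sections that is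
  linear over smooth functions. For such an operator the value at \<open>p\<close> does not depend on the
  choice of the sections extending given elements of the fibres.\<close>

definition extend :: "('m, 'v, 'z) vbundle_scheme \<Rightarrow> 'm \<Rightarrow> 'v \<Rightarrow> 'm \<Rightarrow> 'v" where
  "extend E p x = (SOME s. s \<in> sections E \<and> s p = x)"

definition tensorial ::
  "('m, 'v, 'z) vbundle_scheme \<Rightarrow> (('m \<Rightarrow> 'v) \<Rightarrow> ('m \<Rightarrow> 'w::zero)) \<Rightarrow> 'm \<Rightarrow> 'v \<Rightarrow> 'w" where
  "tensorial E F = (\<lambda>p x. if x \<in> fibre E p then F (extend E p x) p else 0)"

definition tensorial2 ::
  "('m, 'v, 'z) vbundle_scheme \<Rightarrow> (('m \<Rightarrow> 'v) \<Rightarrow> ('m \<Rightarrow> 'v) \<Rightarrow> ('m \<Rightarrow> 'w::zero)) \<Rightarrow> 'm \<Rightarrow> 'v \<Rightarrow> 'v \<Rightarrow> 'w" where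
  "tensorial2 E F = (\<lambda>p x y. if x \<in> fibre E p \<and> y \<in> fibre E p
                             then F (extend E p x) (extend E p y) p else 0)"


section \<open>Lie algebroids\<close>

record ('m, 'v) algebroid = "('m, 'v) vbundle" +
  anchor :: "'m \<Rightarrow> 'v \<Rightarrow> 'm tvec"
  bracket :: "('m \<Rightarrow> 'v) \<Rightarrow> ('m \<Rightarrow> 'v) \<Rightarrow> ('m \<Rightarrow> 'v)"

text \<open>Lie brackets on sections of \<open>E\<close> satisfying the Leibniz rule with respect to the anchor \<open>a\<close>\<close>

definition lie_bracket_on ::
  "('m::topological_space, 'e::euclidean_space) atlas \<Rightarrow> ('m, 'v::real_vector, 'z) vbundle_scheme \<Rightarrow>
   ('m \<Rightarrow> 'v \<Rightarrow> 'm tvec) \<Rightarrow> (('m \<Rightarrow> 'v) \<Rightarrow> ('m \<Rightarrow> 'v) \<Rightarrow> ('m \<Rightarrow> 'v)) \<Rightarrow> bool" where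
  "lie_bracket_on A E a br \<longleftrightarrow>
     (\<forall>s\<in>sections E. \<forall>t\<in>sections E. br s t \<in> sections E) \<and>
     (\<forall>s\<in>sections E. \<forall>t\<in>sections E. \<forall>u\<in>sections E. br s (t + u) = br s t + br s u) \<and>
     (\<forall>c. \<forall>s\<in>sections E. \<forall>t\<in>sections E. br s (c *\<^sub>R t) = c *\<^sub>R br s t) \<and>
     (\<forall>s\<in>sections E. \<forall>t\<in>sections E. br s t = - br t s) \<and>
     (\<forall>s\<in>sections E. \<forall>t\<in>sections E. \<forall>u\<in>sections E.
        br s (br t u) + br t (br u s) + br u (br s t) = 0) \<and>
     (\<forall>f\<in>Cinf A. \<forall>s\<in>sections E. \<forall>t\<in>sections E.
        br s (fmul f t) = fmul f (br s t) + fmul (\<lambda>p. a p (s p) f) t) \<and>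
     (\<forall>s t. s \<notin> sections E \<or> t \<notin> sections E \<longrightarrow> br s t = 0)"

definition vf_bracket :: "('m \<Rightarrow> 'm tvec) \<Rightarrow> ('m \<Rightarrow> 'm tvec) \<Rightarrow> 'm \<Rightarrow> 'm tvec" where
  "vf_bracket X Y = (\<lambda>p f. X p (\<lambda>q. Y q f) - Y p (\<lambda>q. X q f))"

definition TM_bundle ::
  "('m::topological_space, 'e::euclidean_space) atlas \<Rightarrow> ('m, 'm tvec) vbundle" where
  "TM_bundle A =
     \<lparr>fibre = tangent A,
      sections = {X. (\<forall>p. X p \<in> tangent A p) \<and> (\<forall>f\<in>Cinf A. (\<lambda>p. X p f) \<in> Cinf A)}\<rparr>"

abbreviation VF :: "('m::topological_space, 'e::euclidean_space) atlas \<Rightarrow> ('m \<Rightarrow> 'm tvec) set" where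
  "VF A \<equiv> sections (TM_bundle A)"

definition TM :: "('m::topological_space, 'e::euclidean_space) atlas \<Rightarrow> ('m, 'm tvec) algebroid" where
  "TM A =
     \<lparr>fibre = fibre (TM_bundle A), sections = VF A,
      anchor = (\<lambda>p v. if v \<in> tangent A p then v else 0),
      bracket = (\<lambda>X Y. if X \<in> VF A \<and> Y \<in> VF A then vf_bracket X Y else 0)\<rparr>"

definition lie_algebroid ::
  "('m::topological_space, 'e::euclidean_space) atlas \<Rightarrow> ('m, 'v::real_vector) algebroid \<Rightarrow> bool" where
  "lie_algebroid A L \<longleftrightarrow>
     vector_bundle A L \<and> anchor L \<in> sections (hom_bundle L (TM A)) \<and>
     lie_bracket_on A L (anchor L) (bracket L)"

definition algebroid_morphism ::
  "('m, 'v::real_vector) algebroid \<Rightarrow> ('m, 'w::real_vector) algebroid \<Rightarrow> ('m \<Rightarrow> 'v \<Rightarrow> 'w) \<Rightarrow> bool" where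
  "algebroid_morphism L L' \<Phi> \<longleftrightarrow>
     \<Phi> \<in> sections (hom_bundle L L') \<and>
     (\<forall>p. \<forall>x\<in>fibre L p. anchor L' p (\<Phi> p x) = anchor L p x) \<and>
     (\<forall>s\<in>sections L. \<forall>t\<in>sections L.
        (\<lambda>p. \<Phi> p (bracket L s t p)) = bracket L' (\<lambda>p. \<Phi> p (s p)) (\<lambda>p. \<Phi> p (t p)))"

definition subalgebroid :: "('m::topological_space, 'v::real_vector) algebroid \<Rightarrow> ('m \<Rightarrow> 'v set) \<Rightarrow> bool" where
  "subalgebroid L F \<longleftrightarrow>
     subbundle L F \<and>
     (\<forall>s\<in>sections (restrict_bundle L F). \<forall>t\<in>sections (restrict_bundle L F).
        bracket L s t \<in> sections (restrict_bundle L F))"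

definition restrict_algebroid ::
  "('m, 'v::real_vector) algebroid \<Rightarrow> ('m \<Rightarrow> 'v set) \<Rightarrow> ('m, 'v) algebroid" where
  "restrict_algebroid L F =
     \<lparr>fibre = F, sections = sections (restrict_bundle L F),
      anchor = (\<lambda>p x. if x \<in> F p then anchor L p x else 0),
      bracket = (\<lambda>s t. if s \<in> sections (restrict_bundle L F) \<and> t \<in> sections (restrict_bundle L F)
                       then bracket L s t else 0)\<rparr>"


section \<open>One-jets\<close>

text \<open>Two sections \<open>s\<close>, \<open>t\<close> of a vector bundle \<open>E\<close> agree to first order at \<open>p\<close> iff, for every
  section \<open>\<alpha>\<close> of the dual bundle, the functions \<open>\<alpha>(s)\<close> and \<open>\<alpha>(t)\<close> have the same value and the
  same differential at \<open>p\<close>. We represent the 1-jet of \<open>s\<close> at \<open>p\<close> by the collection of all these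
  values and differentials; it depends linearly on \<open>s\<close>.\<close>

type_synonym ('m, 'v) jet = "('m \<Rightarrow> 'v \<Rightarrow> real) \<Rightarrow> 'm tvec \<Rightarrow> real \<times> real"

definition jet1 ::
  "('m::topological_space, 'e::euclidean_space) atlas \<Rightarrow> ('m, 'v::real_vector, 'z) vbundle_scheme \<Rightarrow>
   ('m \<Rightarrow> 'v) \<Rightarrow> 'm \<Rightarrow> ('m, 'v) jet" where
  "jet1 A E s p = (\<lambda>\<alpha> v.
     if \<alpha> \<in> sections (hom_bundle E (trivial_line A)) \<and> v \<in> tangent A p
     then (\<alpha> p (s p), v (\<lambda>q. \<alpha> q (s q))) else 0)"

text \<open>Smooth sections of the jet bundle are locally combinations of prolonged sections.\<close>

definition jet_bundle ::
  "('m::topological_space, 'e::euclidean_space) atlas \<Rightarrow> ('m, 'v::real_vector, 'z) vbundle_scheme \<Rightarrow>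
   ('m, ('m, 'v) jet) vbundle" where
  "jet_bundle A E =
     \<lparr>fibre = (\<lambda>p. (\<lambda>s. jet1 A E s p) ` sections E),
      sections = {\<sigma>. \<forall>p. \<exists>U. open U \<and> p \<in> U \<and>
        (\<exists>(n::nat) f s. (\<forall>i<n. f i \<in> Cinf A \<and> s i \<in> sections E) \<and>
           (\<forall>q\<in>U. \<sigma> q = (\<Sum>i<n. f i q *\<^sub>R jet1 A E (s i) q)))}\<rparr>"

definition jet_proj ::
  "('m::topological_space, 'e::euclidean_space) atlas \<Rightarrow> ('m, 'v::real_vector, 'z) vbundle_scheme \<Rightarrow>
   'm \<Rightarrow> ('m, 'v) jet \<Rightarrow> 'v" where
  "jet_proj A E p j = (THE x. \<exists>s\<in>sections E. j = jet1 A E s p \<and> x = s p)"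

text \<open>The inclusion \<open>T\<^sup>*M \<otimes> E \<rightarrow> J\<^sup>1E\<close>; the minus sign comes from the convention
  \<open>df \<otimes> s \<mapsto> f J\<^sup>1s - J\<^sup>1(fs)\<close>, verified below.\<close>

definition jet_incl ::
  "('m::topological_space, 'e::euclidean_space) atlas \<Rightarrow> ('m, 'v::real_vector, 'z) vbundle_scheme \<Rightarrow>
   'm \<Rightarrow> ('m tvec \<Rightarrow> 'v) \<Rightarrow> ('m, 'v) jet" where
  "jet_incl A E p h = (\<lambda>\<alpha> v.
     if \<alpha> \<in> sections (hom_bundle E (trivial_line A)) \<and> v \<in> tangent A p
     then (0, - \<alpha> p (h v)) else 0)"

lemma jet_incl_df_tensor:
  assumes f: "f \<in> Cinf A" and s: "s \<in> sections E" "\<And>q. s q \<in> fibre E q"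
  shows "jet_incl A E p (\<lambda>v. if v \<in> tangent A p then v f *\<^sub>R s p else 0)
           = f p *\<^sub>R jet1 A E s p - jet1 A E (fmul f s) p"
proof (rule ext, rule ext)
  fix \<alpha> :: "'a \<Rightarrow> 'c \<Rightarrow> real" and v :: "'a tvec"
  show "jet_incl A E p (\<lambda>v. if v \<in> tangent A p then v f *\<^sub>R s p else 0) \<alpha> v
           = (f p *\<^sub>R jet1 A E s p - jet1 A E (fmul f s) p) \<alpha> v"
  proof (cases "\<alpha> \<in> sections (hom_bundle E (trivial_line A)) \<and> v \<in> tangent A p")
    case True
    then have lin: "\<alpha> q (c *\<^sub>R s q) = c * \<alpha> q (s q)" for c q
      using s(2) by (auto simp: hom_bundle_def linmap_on_def)
    have "(\<lambda>q. \<alpha> q (s q)) \<in> Cinf A"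
      using True s(1) by (auto simp: hom_bundle_def trivial_line_def)
    then have "v (\<lambda>q. f q * \<alpha> q (s q)) = v f * \<alpha> p (s p) + f p * v (\<lambda>q. \<alpha> q (s q))"
      using True f by (auto simp: tangent_def)
    then show ?thesis
      using True by (simp add: jet_incl_def jet1_def fmul_def lin)
  qed (auto simp: jet_incl_def jet1_def)
qed

definition incl_section ::
  "('m::topological_space, 'e::euclidean_space) atlas \<Rightarrow> ('m, 'v::real_vector, 'z) vbundle_scheme \<Rightarrow>
   ('m \<Rightarrow> 'm tvec \<Rightarrow> 'v) \<Rightarrow> 'm \<Rightarrow> ('m, 'v) jet" where
  "incl_section A E h = (\<lambda>p. jet_incl A E p (h p))"

definition jet_anchor ::
  "('m::topological_space, 'e::euclidean_space) atlas \<Rightarrow> ('m, 'v::real_vector) algebroid \<Rightarrow>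
   'm \<Rightarrow> ('m, 'v) jet \<Rightarrow> 'm tvec" where
  "jet_anchor A L = (\<lambda>p j. if j \<in> fibre (jet_bundle A L) p then anchor L p (jet_proj A L p j) else 0)"

text \<open>The unique bracket with \<open>[J\<^sup>1s, J\<^sup>1t] = J\<^sup>1[s, t]\<close>\<close>

definition jet_bracket ::
  "('m::topological_space, 'e::euclidean_space) atlas \<Rightarrow> ('m, 'v::real_vector) algebroid \<Rightarrow>
   ('m \<Rightarrow> ('m, 'v) jet) \<Rightarrow> ('m \<Rightarrow> ('m, 'v) jet) \<Rightarrow> 'm \<Rightarrow> ('m, 'v) jet" where
  "jet_bracket A L = (THE br.
     lie_bracket_on A (jet_bundle A L) (jet_anchor A L) br \<and>
     (\<forall>s\<in>sections L. \<forall>t\<in>sections L. br (jet1 A L s) (jet1 A L t) = jet1 A L (bracket L s t)))"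

definition jet_algebroid ::
  "('m::topological_space, 'e::euclidean_space) atlas \<Rightarrow> ('m, 'v::real_vector) algebroid \<Rightarrow>
   ('m, ('m, 'v) jet) algebroid" where
  "jet_algebroid A L =
     \<lparr>fibre = fibre (jet_bundle A L), sections = sections (jet_bundle A L),
      anchor = jet_anchor A L, bracket = jet_bracket A L\<rparr>"


section \<open>Connections and Cartan algebroids\<close>

text \<open>A linear connection on \<open>E\<close> is given as \<open>D : \<Gamma>(E) \<rightarrow> \<Gamma>(T\<^sup>*M \<otimes> E)\<close>.\<close>

definition linear_connection ::
  "('m::topological_space, 'e::euclidean_space) atlas \<Rightarrow> ('m, 'v::real_vector, 'z) vbundle_scheme \<Rightarrow>
   (('m \<Rightarrow> 'v) \<Rightarrow> 'm \<Rightarrow> 'm tvec \<Rightarrow> 'v) \<Rightarrow> bool" where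
  "linear_connection A E D \<longleftrightarrow>
     (\<forall>s\<in>sections E. D s \<in> sections (hom_bundle (TM A) E)) \<and>
     (\<forall>s\<in>sections E. \<forall>t\<in>sections E. D (s + t) = D s + D t) \<and>
     (\<forall>f\<in>Cinf A. \<forall>s\<in>sections E. \<forall>p. \<forall>v\<in>tangent A p.
        D (fmul f s) p v = v f *\<^sub>R s p + f p *\<^sub>R D s p v)"

definition cov :: "(('m \<Rightarrow> 'v) \<Rightarrow> 'm \<Rightarrow> 'm tvec \<Rightarrow> 'v) \<Rightarrow> ('m \<Rightarrow> 'm tvec) \<Rightarrow> ('m \<Rightarrow> 'v) \<Rightarrow> 'm \<Rightarrow> 'v" where
  "cov D U s = (\<lambda>p. D s p (U p))"

definition split_section ::
  "('m::topological_space, 'e::euclidean_space) atlas \<Rightarrow> ('m, 'v::real_vector, 'z) vbundle_scheme \<Rightarrow>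
   (('m \<Rightarrow> 'v) \<Rightarrow> 'm \<Rightarrow> 'm tvec \<Rightarrow> 'v) \<Rightarrow> ('m \<Rightarrow> 'v) \<Rightarrow> 'm \<Rightarrow> ('m, 'v) jet" where
  "split_section A E D s = jet1 A E s + incl_section A E (D s)"

definition cartan_connection ::
  "('m::topological_space, 'e::euclidean_space) atlas \<Rightarrow> ('m, 'v::real_vector) algebroid \<Rightarrow>
   (('m \<Rightarrow> 'v) \<Rightarrow> 'm \<Rightarrow> 'm tvec \<Rightarrow> 'v) \<Rightarrow> bool" where
  "cartan_connection A L D \<longleftrightarrow>
     linear_connection A L D \<and>
     algebroid_morphism L (jet_algebroid A L) (tensorial L (split_section A L D))"

definition cartan_algebroid ::
  "('m::topological_space, 'e::euclidean_space) atlas \<Rightarrow> ('m, 'v::real_vector) algebroid \<Rightarrow>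
   (('m \<Rightarrow> 'v) \<Rightarrow> 'm \<Rightarrow> 'm tvec \<Rightarrow> 'v) \<Rightarrow> bool" where
  "cartan_algebroid A L D \<longleftrightarrow> lie_algebroid A L \<and> cartan_connection A L D"

definition parallel_sections ::
  "('m, 'v, 'z) vbundle_scheme \<Rightarrow> (('m \<Rightarrow> 'v) \<Rightarrow> 'm \<Rightarrow> 'm tvec \<Rightarrow> 'v::real_vector) \<Rightarrow> ('m \<Rightarrow> 'v) set" where
  "parallel_sections E D = {s \<in> sections E. D s = 0}"


section \<open>Infinitesimal geometric structures\<close>

type_synonym 'm jet_TM = "('m, 'm tvec) jet"
type_synonym 'm endo = "'m tvec \<Rightarrow> 'm tvec"
type_synonym 'm tor = "'m tvec \<Rightarrow> 'm tvec \<Rightarrow> 'm tvec"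
type_synonym 'm conn = "('m \<Rightarrow> 'm tvec) \<Rightarrow> 'm \<Rightarrow> 'm endo"

abbreviation J1TM :: "('m::topological_space, 'e::euclidean_space) atlas \<Rightarrow> ('m, 'm jet_TM) algebroid" where
  "J1TM A \<equiv> jet_algebroid A (TM A)"

abbreviation EndTM :: "('m::topological_space, 'e::euclidean_space) atlas \<Rightarrow> ('m, 'm endo) vbundle" where
  "EndTM A \<equiv> hom_bundle (TM A) (TM A)"

definition igs ::
  "('m::topological_space, 'e::euclidean_space) atlas \<Rightarrow> ('m \<Rightarrow> 'm jet_TM set) \<Rightarrow> bool" where
  "igs A g \<longleftrightarrow> subalgebroid (J1TM A) g"

definition igs_algebroid ::
  "('m::topological_space, 'e::euclidean_space) atlas \<Rightarrow> ('m \<Rightarrow> 'm jet_TM set) \<Rightarrow> ('m, 'm jet_TM) algebroid" where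
  "igs_algebroid A g = restrict_algebroid (J1TM A) g"

definition transitive ::
  "('m::topological_space, 'e::euclidean_space) atlas \<Rightarrow> ('m \<Rightarrow> 'm jet_TM set) \<Rightarrow> bool" where
  "transitive A g \<longleftrightarrow> (\<forall>p. jet_proj A (TM A) p ` g p = tangent A p)"

definition kernel_bundle ::
  "('m::topological_space, 'e::euclidean_space) atlas \<Rightarrow> ('m \<Rightarrow> 'm jet_TM set) \<Rightarrow> ('m, 'm endo) vbundle" where
  "kernel_bundle A g =
     restrict_bundle (EndTM A) (\<lambda>p. {h \<in> fibre (EndTM A) p. jet_incl A (TM A) p h \<in> g p})"

definition symmetries ::
  "('m::topological_space, 'e::euclidean_space) atlas \<Rightarrow> ('m \<Rightarrow> 'm jet_TM set) \<Rightarrow> ('m \<Rightarrow> 'm tvec) set" where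
  "symmetries A g = {W \<in> VF A. jet1 A (TM A) W \<in> sections (igs_algebroid A g)}"

definition generator ::
  "('m::topological_space, 'e::euclidean_space) atlas \<Rightarrow> ('m \<Rightarrow> 'm jet_TM set) \<Rightarrow> 'm conn \<Rightarrow> bool" where
  "generator A g D \<longleftrightarrow>
     linear_connection A (TM A) D \<and>
     (\<forall>V\<in>VF A. split_section A (TM A) D V \<in> sections (igs_algebroid A g))"

text \<open>The section of \<open>J\<^sup>1(TM)\<close> corresponding to \<open>V \<oplus> \<phi>\<close>\<close>

definition gen_section ::
  "('m::topological_space, 'e::euclidean_space) atlas \<Rightarrow> 'm conn \<Rightarrow> ('m \<Rightarrow> 'm tvec) \<Rightarrow> ('m \<Rightarrow> 'm endo) \<Rightarrow>
   'm \<Rightarrow> 'm jet_TM" where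
  "gen_section A D V \<phi> = split_section A (TM A) D V + incl_section A (TM A) \<phi>"

definition dual_conn :: "'m conn \<Rightarrow> ('m \<Rightarrow> 'm tvec) \<Rightarrow> ('m \<Rightarrow> 'm tvec) \<Rightarrow> 'm \<Rightarrow> 'm tvec" where
  "dual_conn D U V = cov D V U + vf_bracket U V"

definition torsion_free ::
  "('m::topological_space, 'e::euclidean_space) atlas \<Rightarrow> 'm conn \<Rightarrow> bool" where
  "torsion_free A D \<longleftrightarrow> (\<forall>U\<in>VF A. \<forall>V\<in>VF A. cov D U V - cov D V U - vf_bracket U V = 0)"

definition dual_tor ::
  "('m::topological_space, 'e::euclidean_space) atlas \<Rightarrow> 'm conn \<Rightarrow> 'm \<Rightarrow> 'm tor" where
  "dual_tor A D = tensorial2 (TM A)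
     (\<lambda>U V. dual_conn D U V - dual_conn D V U - vf_bracket U V)"

text \<open>The endomorphism field \<open>curv \<nabla>\<^sup>-(U, V)\<close> of the dual connection, for vector fields \<open>U\<close>, \<open>V\<close>\<close>

definition dual_curv ::
  "('m::topological_space, 'e::euclidean_space) atlas \<Rightarrow> 'm conn \<Rightarrow> ('m \<Rightarrow> 'm tvec) \<Rightarrow> ('m \<Rightarrow> 'm tvec) \<Rightarrow>
   'm \<Rightarrow> 'm endo" where
  "dual_curv A D U V = tensorial (TM A)
     (\<lambda>W. dual_conn D U (dual_conn D V W) - dual_conn D V (dual_conn D U W)
          - dual_conn D (vf_bracket U V) W)"

text \<open>The action on tensors induced by a derivation \<open>\<delta>\<close> of the module of vector fields\<close>

definition act_endo ::
  "('m::topological_space, 'e::euclidean_space) atlas \<Rightarrow>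
   (('m \<Rightarrow> 'm tvec) \<Rightarrow> ('m \<Rightarrow> 'm tvec)) \<Rightarrow> ('m \<Rightarrow> 'm endo) \<Rightarrow> 'm \<Rightarrow> 'm endo" where
  "act_endo A \<delta> \<phi> = tensorial (TM A)
     (\<lambda>V. \<delta> (\<lambda>q. \<phi> q (V q)) - (\<lambda>q. \<phi> q (\<delta> V q)))"

definition act_tor ::
  "('m::topological_space, 'e::euclidean_space) atlas \<Rightarrow>
   (('m \<Rightarrow> 'm tvec) \<Rightarrow> ('m \<Rightarrow> 'm tvec)) \<Rightarrow> ('m \<Rightarrow> 'm tor) \<Rightarrow> 'm \<Rightarrow> 'm tor" where
  "act_tor A \<delta> T = tensorial2 (TM A)
     (\<lambda>U V. \<delta> (\<lambda>q. T q (U q) (V q)) - (\<lambda>q. T q (\<delta> U q) (V q)) - (\<lambda>q. T q (U q) (\<delta> V q)))"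

definition endo_act :: "'m endo \<Rightarrow> 'm tor \<Rightarrow> 'm tor" where
  "endo_act h T = (\<lambda>u v. h (T u v) - T (h u) v - T u (h v))"

definition tor_bundle ::
  "('m::topological_space, 'e::euclidean_space) atlas \<Rightarrow> ('m, 'm tor) vbundle" where
  "tor_bundle A = restrict_bundle (hom_bundle (TM A) (EndTM A))
     (\<lambda>p. {T \<in> fibre (hom_bundle (TM A) (EndTM A)) p. \<forall>u v. T u v = - T v u})"


section \<open>Upper coboundary morphism and intrinsic torsion\<close>

abbreviation Delta_dom ::
  "('m::topological_space, 'e::euclidean_space) atlas \<Rightarrow> ('m \<Rightarrow> 'm jet_TM set) \<Rightarrow> ('m, 'm tvec \<Rightarrow> 'm endo) vbundle" where
  "Delta_dom A g \<equiv> hom_bundle (TM A) (kernel_bundle A g)"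

definition Delta :: "('m tvec \<Rightarrow> 'm endo) \<Rightarrow> 'm tor" where
  "Delta e = (\<lambda>u v. e u v - e v u)"

definition im_Delta ::
  "('m::topological_space, 'e::euclidean_space) atlas \<Rightarrow> ('m \<Rightarrow> 'm jet_TM set) \<Rightarrow> 'm \<Rightarrow> 'm tor set" where
  "im_Delta A g p = Delta ` fibre (Delta_dom A g) p"

definition Delta_injective ::
  "('m::topological_space, 'e::euclidean_space) atlas \<Rightarrow> ('m \<Rightarrow> 'm jet_TM set) \<Rightarrow> bool" where
  "Delta_injective A g \<longleftrightarrow> (\<forall>p. inj_on Delta (fibre (Delta_dom A g) p))"

definition Delta_const_rank ::
  "('m::topological_space, 'e::euclidean_space) atlas \<Rightarrow> ('m \<Rightarrow> 'm jet_TM set) \<Rightarrow> bool" where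
  "Delta_const_rank A g \<longleftrightarrow> (\<exists>r. \<forall>p. dim (im_Delta A g p) = r)"

text \<open>The operator \<open>ad\<^sub>\<sigma>\<close> on vector fields of a section \<open>\<sigma>\<close> of \<open>J\<^sup>1(TM)\<close>: as \<open>[X, Y](p)\<close> depends
  on \<open>X\<close> only through its 1-jet at \<open>p\<close>, the rule \<open>ad\<^bsub>J\<^sup>1X\<^esub> Y = [X, Y]\<close> determines it pointwise.\<close>

definition ad_op ::
  "('m::topological_space, 'e::euclidean_space) atlas \<Rightarrow> ('m \<Rightarrow> 'm jet_TM) \<Rightarrow> ('m \<Rightarrow> 'm tvec) \<Rightarrow> 'm \<Rightarrow> 'm tvec" where
  "ad_op A \<sigma> Y = (\<lambda>p. vf_bracket (SOME X. X \<in> VF A \<and> jet1 A (TM A) X p = \<sigma> p) Y p)"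

text \<open>The class in the fibre of \<open>H(g)\<close> at \<open>p\<close>, as a coset of the image of \<open>\<Delta>\<close>\<close>

definition H_class ::
  "('m::topological_space, 'e::euclidean_space) atlas \<Rightarrow> ('m \<Rightarrow> 'm jet_TM set) \<Rightarrow> 'm \<Rightarrow> 'm tor \<Rightarrow> 'm tor set" where
  "H_class A g p T = {T + S | S. S \<in> im_Delta A g p}"

definition intrinsic_torsion ::
  "('m::topological_space, 'e::euclidean_space) atlas \<Rightarrow> ('m \<Rightarrow> 'm jet_TM set) \<Rightarrow> 'm \<Rightarrow> 'm tor set" where
  "intrinsic_torsion A g =
     (THE \<tau>. \<forall>D. generator A g D \<longrightarrow> \<tau> = (\<lambda>p. H_class A g p (dual_tor A D p)))"

text \<open>The induced action of a section \<open>\<sigma>\<close> of \<open>g\<close> on a section of \<open>H(g)\<close> represented by \<open>T\<close> is the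
  class of \<open>\<sigma> \<cdot> T\<close>.\<close>

definition H_invariant ::
  "('m::topological_space, 'e::euclidean_space) atlas \<Rightarrow> ('m \<Rightarrow> 'm jet_TM set) \<Rightarrow> ('m \<Rightarrow> 'm tor set) \<Rightarrow> bool" where
  "H_invariant A g \<eta> \<longleftrightarrow>
     (\<forall>\<sigma>\<in>sections (igs_algebroid A g). \<forall>T\<in>sections (tor_bundle A).
        (\<forall>p. \<eta> p = H_class A g p (T p)) \<longrightarrow>
        (\<forall>p. H_class A g p (act_tor A (ad_op A \<sigma>) T p) = H_class A g p 0))"

definition torsion_reduced ::
  "('m::topological_space, 'e::euclidean_space) atlas \<Rightarrow> ('m \<Rightarrow> 'm jet_TM set) \<Rightarrow> bool" where
  "torsion_reduced A g \<longleftrightarrow> H_invariant A g (intrinsic_torsion A g)"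

definition invariant_complement ::
  "('m::topological_space, 'e::euclidean_space) atlas \<Rightarrow> ('m \<Rightarrow> 'm jet_TM set) \<Rightarrow> ('m \<Rightarrow> 'm tor set) \<Rightarrow> bool" where
  "invariant_complement A g C \<longleftrightarrow>
     subbundle (tor_bundle A) C \<and>
     (\<forall>p. im_Delta A g p \<inter> C p = {0} \<and>
          fibre (tor_bundle A) p = {S + T | S T. S \<in> im_Delta A g p \<and> T \<in> C p}) \<and>
     (\<forall>\<sigma>\<in>sections (igs_algebroid A g). \<forall>T\<in>sections (restrict_bundle (tor_bundle A) C).
        act_tor A (ad_op A \<sigma>) T \<in> sections (restrict_bundle (tor_bundle A) C))"

definition reductive ::
  "('m::topological_space, 'e::euclidean_space) atlas \<Rightarrow> ('m \<Rightarrow> 'm jet_TM set) \<Rightarrow> bool" where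
  "reductive A g \<longleftrightarrow> Delta_const_rank A g \<and> (\<exists>C. invariant_complement A g C)"

definition normal_generator ::
  "('m::topological_space, 'e::euclidean_space) atlas \<Rightarrow> ('m \<Rightarrow> 'm jet_TM set) \<Rightarrow> 'm conn \<Rightarrow> bool" where
  "normal_generator A g D \<longleftrightarrow>
     generator A g D \<and>
     (\<exists>C. invariant_complement A g C \<and> dual_tor A D \<in> sections (restrict_bundle (tor_bundle A) C))"

text \<open>Solutions \<open>\<epsilon> : TM \<oplus> h \<rightarrow> T\<^sup>*M \<otimes> h\<close>, as vector bundle morphisms, of
  \<open>\<Delta>(\<epsilon>(V \<oplus> \<phi>)) = \<nabla>\<^sup>-\<^sub>V tor \<nabla>\<^sup>- + \<phi> \<cdot> tor \<nabla>\<^sup>-\<close>\<close>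

definition epsilon_solution ::
  "('m::topological_space, 'e::euclidean_space) atlas \<Rightarrow> ('m \<Rightarrow> 'm jet_TM set) \<Rightarrow> 'm conn \<Rightarrow>
   ('m \<Rightarrow> 'm tvec \<times> 'm endo \<Rightarrow> 'm tvec \<Rightarrow> 'm endo) \<Rightarrow> bool" where
  "epsilon_solution A g D \<epsilon> \<longleftrightarrow>
     \<epsilon> \<in> sections (hom_bundle (sum_bundle (TM A) (kernel_bundle A g)) (Delta_dom A g)) \<and>
     (\<forall>V\<in>VF A. \<forall>\<phi>\<in>sections (kernel_bundle A g). \<forall>p.
        Delta (\<epsilon> p (V p, \<phi> p)) =
          act_tor A (dual_conn D V) (dual_tor A D) p + endo_act (\<phi> p) (dual_tor A D p))"

end

theory Submission
  imports Defs
begin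

text \<open>A section \<open>\<sigma>\<close> of \<open>g\<close> acts on vector fields by \<open>ad\<^sub>\<sigma>\<close>, and \<open>\<sigma>\<close> is determined by \<open>ad\<^sub>\<sigma>\<close> and its anchor. A bundle map
  \<open>\<psi> : TM \<rightarrow> g\<close> makes \<open>J\<^sup>1\<sigma> + \<psi>\<close> a section of the prolongation of \<open>g\<close> iff \<open>anc (\<psi> U) = ad\<^sub>\<sigma> U - [anc \<sigma>, U]\<close> and
  \<open>ad\<^bsub>\<psi> V\<^esub> U - ad\<^bsub>\<psi> U\<^esub> V\<close> is the failure of \<open>ad\<^sub>\<sigma>\<close> to be a derivation of \<open>[U, V]\<close>. Two such \<open>\<psi>\<close> differ by an element of the
  kernel of \<open>\<Delta>\<close>, so \<open>\<psi>\<close> is unique. Solving these equations in terms of a generator leads to the equation for \<open>\<epsilon>\<close>, which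
  has a solution because the right-hand side lies in the image of \<open>\<Delta>\<close> when the torsion is reduced; the solution is
  smooth because it solves a smooth linear system with trivial kernel. The Cartan connection maps \<open>\<sigma>\<close> to its unique
  \<open>\<psi>\<close>: both conditions on \<open>\<psi>\<close> are compatible with the Leibniz rule and with brackets of jets, and \<open>\<psi> = 0\<close> says that
  \<open>\<sigma> = J\<^sup>1(anc \<sigma>)\<close>.\<close>

section \<open>Calculus of smooth functions\<close>

text \<open>The formula for the connection involves a generator and \<open>\<epsilon>\<close>, so
  proving directly that it is Cartan would mean differentiating \<open>\<epsilon>\<close>. The two
  equations for \<open>\<psi>\<close> (\<open>prol\<close>) mention neither, and their closure under
  brackets needs only that ad is a representation. A generator enters for existence: its dual
  connection is ad composed with its splitting, so the right-hand side for \<open>\<epsilon>\<close>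
  is the action of the section \<open>V \<oplus> \<phi>\<close> on the torsion, which is what
  torsion reduction controls. Some generator must exist globally, both for the connection and for
  the definite description behind the intrinsic torsion to be meaningful; this is why bump functions
  and a partition of unity are developed. The structure kernel comes without frames, only
  \<open>g\<close> has them, and fibrewise solutions are not obviously smooth; hence linear systems
  are solved in frames of \<open>g\<close>, after selecting rows that form an identity matrix at the
  point. Jets are encoded by values and differentials of dual sections, so dual sections must
  separate points of the fibres; for \<open>g\<close> this rests itself on the faithfulness of
  ad.\<close>

lemma Ck_on_SucD:
  assumes "open S" "Ck_on (Suc k) S f"
  shows "\<And>x. x \<in> S \<Longrightarrow> (f has_derivative frechet_derivative f (at x)) (at x)"
    and "\<And>v. Ck_on k S (\<lambda>x. frechet_derivative f (at x) v)"
proof -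
  show "(f has_derivative frechet_derivative f (at x)) (at x)" if "x \<in> S" for x
  proof -
    have "f differentiable (at x within S)"
      using assms(2) that by (simp add: differentiable_on_def)
    then show ?thesis
      by (simp only: at_within_open[OF that assms(1)] frechet_derivative_works)
  qed
qed (use assms(2) in simp)

lemma Ck_on_cong:
  "open S \<Longrightarrow> Ck_on k S f \<Longrightarrow> (\<And>x. x \<in> S \<Longrightarrow> f x = g x) \<Longrightarrow> Ck_on k S g"
proof (induction k arbitrary: f g)
  case 0
  then show ?case by (simp cong: continuous_on_cong)
next
  case (Suc k)
  note d = Ck_on_SucD[OF Suc.prems(1,2)]
  have D: "(g has_derivative frechet_derivative f (at x)) (at x)" if "x \<in> S" for x
    by (rule has_derivative_transform_within_open[OF d(1)[OF that] Suc.prems(1) that Suc.prems(3)])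
  have e: "frechet_derivative f (at x) = frechet_derivative g (at x)" if "x \<in> S" for x
    by (rule frechet_derivative_at[OF D[OF that]])
  have "g differentiable_on S"
    by (rule differentiable_at_imp_differentiable_on) (use D differentiable_def in blast)
  moreover have "Ck_on k S (\<lambda>x. frechet_derivative g (at x) v)" for v
    by (rule Suc.IH[OF Suc.prems(1) d(2)[of v]]) (simp add: e)
  ultimately show ?case by simp
qed

text \<open>Together with \<open>Ck_on_SucD\<close> this rule takes the place of the recursive
  equation, which mixes differentiability within \<open>S\<close> with the unrestricted derivative;
  the two agree because \<open>S\<close> is open. Any derivative \<open>D\<close> may be supplied,
  by uniqueness of derivatives.\<close>

lemma Ck_on_SucI:
  assumes "open S" "\<And>x. x \<in> S \<Longrightarrow> (f has_derivative D x) (at x)"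
    and "\<And>v. Ck_on k S (\<lambda>x. D x v)"
  shows "Ck_on (Suc k) S f"
proof -
  have eq: "D x = frechet_derivative f (at x)" if "x \<in> S" for x
    by (rule frechet_derivative_at[OF assms(2)[OF that]])
  have "f differentiable_on S"
    by (rule differentiable_at_imp_differentiable_on) (use assms(2) differentiable_def in blast)
  moreover have "Ck_on k S (\<lambda>x. frechet_derivative f (at x) v)" for v
    by (rule Ck_on_cong[OF assms(1) assms(3)[of v]]) (simp add: eq)
  ultimately show ?thesis by simp
qed

declare Ck_on.simps(2) [simp del]

lemma Ck_on_imp_continuous_on: "Ck_on k S f \<Longrightarrow> continuous_on S f"
  by (cases k) (auto simp: differentiable_imp_continuous_on Ck_on.simps(2))

lemma Ck_on_Suc_imp: "open S \<Longrightarrow> Ck_on (Suc k) S f \<Longrightarrow> Ck_on k S f"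
proof (induction k arbitrary: f)
  case 0
  show ?case using Ck_on_imp_continuous_on[OF 0(2)] by simp
next
  case (Suc k)
  show ?case
    by (rule Ck_on_SucI[OF Suc.prems(1) Ck_on_SucD(1)[OF Suc.prems]])
       (assumption, rule Suc.IH[OF Suc.prems(1) Ck_on_SucD(2)[OF Suc.prems]])
qed

lemma Ck_on_subset: "Ck_on k S f \<Longrightarrow> open S \<Longrightarrow> open T \<Longrightarrow> T \<subseteq> S \<Longrightarrow> Ck_on k T f"
proof (induction k arbitrary: f)
  case 0
  then show ?case using continuous_on_subset by auto
next
  case (Suc k)
  show ?case
    by (rule Ck_on_SucI[OF Suc.prems(3) Ck_on_SucD(1)[OF Suc.prems(2,1) subsetD[OF Suc.prems(4)]]])
       (assumption, rule Suc.IH[OF Ck_on_SucD(2)[OF Suc.prems(2,1)] Suc.prems(2-4)])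
qed

lemma Ck_on_local:
  "(\<And>x. x \<in> S \<Longrightarrow> \<exists>T. open T \<and> x \<in> T \<and> Ck_on k T f) \<Longrightarrow> open S \<Longrightarrow> Ck_on k S f"
proof (induction k arbitrary: f)
  case 0
  have "isCont f x" if "x \<in> S" for x
    using 0(1)[OF that] continuous_on_eq_continuous_at by fastforce
  then show ?case by (simp add: continuous_at_imp_continuous_on)
next
  case (Suc k)
  show ?case
  proof (rule Ck_on_SucI[OF Suc.prems(2)])
    show "(f has_derivative frechet_derivative f (at x)) (at x)" if x: "x \<in> S" for x
    proof -
      obtain T where "open T" "x \<in> T" "Ck_on (Suc k) T f" using Suc.prems(1)[OF x] by blast
      then show ?thesis using Ck_on_SucD(1)[of T k f x] by simp
    qed
    show "Ck_on k S (\<lambda>x. frechet_derivative f (at x) v)" for v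
    proof (rule Suc.IH[OF _ Suc.prems(2)])
      fix x assume x: "x \<in> S"
      obtain T where T: "open T" "x \<in> T" "Ck_on (Suc k) T f" using Suc.prems(1)[OF x] by blast
      from Ck_on_SucD(2)[OF T(1,3)] T
      show "\<exists>T. open T \<and> x \<in> T \<and> Ck_on k T (\<lambda>x. frechet_derivative f (at x) v)" by blast
    qed
  qed
qed

lemma Ck_on_const: "open S \<Longrightarrow> Ck_on k S (\<lambda>x. c)"
proof (induction k arbitrary: c)
  case (Suc k)
  show ?case by (rule Ck_on_SucI[OF Suc.prems, where D = "\<lambda>x v. 0"]) (use Suc in auto)
qed auto

lemma Ck_on_add: "open S \<Longrightarrow> Ck_on k S f \<Longrightarrow> Ck_on k S g \<Longrightarrow> Ck_on k S (\<lambda>x. f x + g x)"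
proof (induction k arbitrary: f g)
  case (Suc k)
  note d = Ck_on_SucD[OF Suc.prems(1,2)] Ck_on_SucD[OF Suc.prems(1,3)]
  show ?case
    by (rule Ck_on_SucI[OF Suc.prems(1) has_derivative_add[OF d(1,3)]])
       (assumption, assumption, rule Suc.IH[OF Suc.prems(1) d(2,4)])
qed (simp add: continuous_on_add)

lemma Ck_on_sum:
  assumes "open S" "\<And>i. i \<in> I \<Longrightarrow> Ck_on k S (f i)"
  shows "Ck_on k S (\<lambda>x. \<Sum>i\<in>I. f i x)"
  using assms(2)
  by (induction I rule: infinite_finite_induct)
     (simp_all add: Ck_on_add Ck_on_const assms(1))

lemma Ck_on_linear_compose:
  "bounded_linear L \<Longrightarrow> open S \<Longrightarrow> Ck_on k S f \<Longrightarrow> Ck_on k S (\<lambda>x. L (f x))"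
proof (induction k arbitrary: f)
  case 0
  then show ?case using bounded_linear.continuous_on[OF 0(1)] by simp
next
  case (Suc k)
  note d = Ck_on_SucD[OF Suc.prems(2,3)]
  show ?case
    by (rule Ck_on_SucI[OF Suc.prems(2) bounded_linear.has_derivative[OF Suc.prems(1) d(1)]])
       (assumption, rule Suc.IH[OF Suc.prems(1,2) d(2)])
qed

lemma Ck_on_scaleR:
  fixes f :: "'e::euclidean_space \<Rightarrow> real"
  shows "open S \<Longrightarrow> Ck_on k S f \<Longrightarrow> Ck_on k S g \<Longrightarrow> Ck_on k S (\<lambda>x. f x *\<^sub>R g x)"
proof (induction k arbitrary: f g)
  case (Suc k)
  note d = Ck_on_SucD[OF Suc.prems(1,2)] Ck_on_SucD[OF Suc.prems(1,3)]
  show ?case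
    by (rule Ck_on_SucI[OF Suc.prems(1) has_derivative_scaleR[OF d(1,3)]])
       (assumption, assumption, rule Ck_on_add[OF Suc.prems(1)
          Suc.IH[OF Suc.prems(1) Ck_on_Suc_imp[OF Suc.prems(1,2)] d(4)]
          Suc.IH[OF Suc.prems(1) d(2) Ck_on_Suc_imp[OF Suc.prems(1,3)]]])
qed (simp add: continuous_on_scaleR)

lemma Ck_on_mult:
  fixes f g :: "'e::euclidean_space \<Rightarrow> real"
  shows "open S \<Longrightarrow> Ck_on k S f \<Longrightarrow> Ck_on k S g \<Longrightarrow> Ck_on k S (\<lambda>x. f x * g x)"
  using Ck_on_scaleR[of S k f g] by simp

lemma Ck_on_bounded_linear: "bounded_linear L \<Longrightarrow> open S \<Longrightarrow> Ck_on k S L"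
proof (cases k)
  case 0
  then show "bounded_linear L \<Longrightarrow> open S \<Longrightarrow> Ck_on k S L"
    by (simp add: linear_continuous_on)
next
  case (Suc n)
  show "Ck_on k S L" if L: "bounded_linear L" and S: "open S"
    unfolding Suc
    by (rule Ck_on_SucI[OF S bounded_linear_imp_has_derivative[OF L] Ck_on_const[OF S]])
qed

lemma Ck_on_compose:
  fixes f :: "'e::euclidean_space \<Rightarrow> 'd::euclidean_space"
  shows "open S \<Longrightarrow> open T \<Longrightarrow> Ck_on k S f \<Longrightarrow> Ck_on k T g \<Longrightarrow> f ` S \<subseteq> T \<Longrightarrow> Ck_on k S (\<lambda>x. g (f x))"
proof (induction k arbitrary: g)
  case 0
  then show ?case using continuous_on_compose2[of T g S f] by simp
next
  case (Suc k)
  note f = Ck_on_SucD[OF Suc.prems(1,3)] and g = Ck_on_SucD[OF Suc.prems(2,4)]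
  \<comment> \<open>\<open>Ck_on\<close> speaks only of derivatives in fixed directions, while the
    chain rule evaluates the derivative of \<open>g\<close> in a direction that moves with
    \<open>x\<close>. Expanding this direction in the basis leaves fixed directions with scalar
    coefficients of class \<open>k\<close>.\<close>
  let ?D = "\<lambda>x v. \<Sum>b\<in>Basis. (frechet_derivative f (at x) v \<bullet> b) *\<^sub>R frechet_derivative g (at (f x)) b"
  show ?case
  proof (rule Ck_on_SucI[OF Suc.prems(1)])
    fix x assume x: "x \<in> S"
    then have fx: "f x \<in> T" using Suc.prems(5) by blast
    have lin: "linear (frechet_derivative g (at (f x)))"
      using g(1)[OF fx] by (rule has_derivative_linear)
    have "((\<lambda>x. g (f x)) has_derivative (\<lambda>v. frechet_derivative g (at (f x)) (frechet_derivative f (at x) v))) (at x)"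
      using has_derivative_compose[OF f(1)[OF x] g(1)[OF fx]] .
    moreover have "(\<lambda>v. frechet_derivative g (at (f x)) (frechet_derivative f (at x) v)) = ?D x"
    proof
      fix v
      have "frechet_derivative g (at (f x)) (frechet_derivative f (at x) v)
          = frechet_derivative g (at (f x)) (\<Sum>b\<in>Basis. (frechet_derivative f (at x) v \<bullet> b) *\<^sub>R b)"
        by (simp add: euclidean_representation)
      also have "\<dots> = ?D x v" by (simp add: linear_sum[OF lin] linear_scale[OF lin])
      finally show "frechet_derivative g (at (f x)) (frechet_derivative f (at x) v) = ?D x v" .
    qed
    ultimately show "((\<lambda>x. g (f x)) has_derivative ?D x) (at x)" by simp
  next
    fix v
    show "Ck_on k S (\<lambda>x. ?D x v)"
      by (rule Ck_on_sum[OF Suc.prems(1)], rule Ck_on_scaleR[OF Suc.prems(1)],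
          rule Ck_on_linear_compose[OF bounded_linear_inner_left Suc.prems(1) f(2)],
          rule Suc.IH[OF Suc.prems(1,2) Ck_on_Suc_imp[OF Suc.prems(1,3)] g(2) Suc.prems(5)])
  qed
qed

lemma Ck_on_inverse:
  fixes f :: "'e::euclidean_space \<Rightarrow> real"
  shows "open S \<Longrightarrow> Ck_on k S f \<Longrightarrow> (\<And>x. x \<in> S \<Longrightarrow> f x \<noteq> 0) \<Longrightarrow> Ck_on k S (\<lambda>x. inverse (f x))"
proof (induction k)
  case 0
  then show ?case by (simp add: continuous_on_inverse)
next
  case (Suc k)
  note d = Ck_on_SucD[OF Suc.prems(1,2)]
  have i: "Ck_on k S (\<lambda>x. inverse (f x))"
    by (rule Suc.IH[OF Suc.prems(1) Ck_on_Suc_imp[OF Suc.prems(1,2)] Suc.prems(3)])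
  let ?D = "\<lambda>x v. - (inverse (f x) * frechet_derivative f (at x) v * inverse (f x))"
  show ?case
  proof (rule Ck_on_SucI[OF Suc.prems(1)])
    show "((\<lambda>x. inverse (f x)) has_derivative ?D x) (at x)" if "x \<in> S" for x
      using Deriv.has_derivative_inverse[OF Suc.prems(3)[OF that] d(1)[OF that]] .
    show "Ck_on k S (\<lambda>x. ?D x v)" for v
      by (rule Ck_on_linear_compose[OF bounded_linear_minus[OF bounded_linear_ident] Suc.prems(1)])
         (rule Ck_on_mult[OF Suc.prems(1) Ck_on_mult[OF Suc.prems(1) i d(2)] i])
  qed
qed

lemma smooth_on_cong: "open S \<Longrightarrow> smooth_on S f \<Longrightarrow> (\<And>x. x \<in> S \<Longrightarrow> f x = g x) \<Longrightarrow> smooth_on S g"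
  unfolding smooth_on_def using Ck_on_cong by blast

lemma smooth_on_subset: "smooth_on S f \<Longrightarrow> open S \<Longrightarrow> open T \<Longrightarrow> T \<subseteq> S \<Longrightarrow> smooth_on T f"
  unfolding smooth_on_def using Ck_on_subset by blast

lemma smooth_on_local:
  "(\<And>x. x \<in> S \<Longrightarrow> \<exists>T. open T \<and> x \<in> T \<and> smooth_on T f) \<Longrightarrow> open S \<Longrightarrow> smooth_on S f"
  unfolding smooth_on_def by (intro allI Ck_on_local) blast+

lemma smooth_on_const: "open S \<Longrightarrow> smooth_on S (\<lambda>x. c)"
  unfolding smooth_on_def using Ck_on_const by blast

lemma smooth_on_add: "open S \<Longrightarrow> smooth_on S f \<Longrightarrow> smooth_on S g \<Longrightarrow> smooth_on S (\<lambda>x. f x + g x)"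
  unfolding smooth_on_def using Ck_on_add by blast

lemma smooth_on_mult:
  fixes f g :: "'e::euclidean_space \<Rightarrow> real"
  shows "open S \<Longrightarrow> smooth_on S f \<Longrightarrow> smooth_on S g \<Longrightarrow> smooth_on S (\<lambda>x. f x * g x)"
  unfolding smooth_on_def using Ck_on_mult by blast

lemma smooth_on_inverse:
  fixes f :: "'e::euclidean_space \<Rightarrow> real"
  shows "open S \<Longrightarrow> smooth_on S f \<Longrightarrow> (\<And>x. x \<in> S \<Longrightarrow> f x \<noteq> 0) \<Longrightarrow> smooth_on S (\<lambda>x. inverse (f x))"
  unfolding smooth_on_def using Ck_on_inverse by blast

lemma smooth_on_bounded_linear: "bounded_linear L \<Longrightarrow> open S \<Longrightarrow> smooth_on S L"
  unfolding smooth_on_def using Ck_on_bounded_linear by blast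

lemma smooth_on_compose:
  fixes f :: "'e::euclidean_space \<Rightarrow> 'd::euclidean_space"
  shows "open S \<Longrightarrow> open T \<Longrightarrow> smooth_on S f \<Longrightarrow> smooth_on T g \<Longrightarrow> f ` S \<subseteq> T \<Longrightarrow> smooth_on S (\<lambda>x. g (f x))"
  unfolding smooth_on_def using Ck_on_compose by blast

lemma smooth_on_derivative:
  assumes "open S" "smooth_on S f"
  shows "smooth_on S (\<lambda>x. frechet_derivative f (at x) v)"
  using assms Ck_on_SucD(2) unfolding smooth_on_def by blast

lemma smooth_on_has_derivative:
  assumes "open S" "smooth_on S f" "x \<in> S"
  shows "(f has_derivative frechet_derivative f (at x)) (at x)"
  using assms Ck_on_SucD(1) unfolding smooth_on_def by blast

section \<open>Smooth cut-off functions on Euclidean space\<close>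

definition flat :: "nat \<Rightarrow> real \<Rightarrow> real" where
  "flat n x = (if x \<le> 0 then 0 else inverse x ^ n * exp (- inverse x))"

text \<open>The free power of \<open>1/x\<close> makes the family \<open>flat n\<close> closed under
  differentiation up to linear combinations; this is what lets a single induction on the order prove
  smoothness for all \<open>n\<close> at once.\<close>

lemma flat_has_derivative: "(flat n has_real_derivative (flat (n + 2) x - real n * flat (n + 1) x)) (at x)"
proof -
  consider "x < 0" | "x > 0" | "x = 0" by linarith
  then show ?thesis
  proof cases
    case 1
    have "(flat n has_real_derivative 0) (at x)"
      by (rule has_field_derivative_transform_within_open[of "\<lambda>x. 0" _ _ "{..<0}"])
         (use 1 in \<open>auto simp: flat_def\<close>)
    with 1 show ?thesis by (simp add: flat_def)
  next
    case 2
    have "((\<lambda>x. inverse x ^ n * exp (- inverse x)) has_real_derivative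
        (flat (n + 2) x - real n * flat (n + 1) x)) (at x)"
      using 2 by (auto intro!: derivative_eq_intros simp: flat_def field_simps power2_eq_square)
        (cases n; simp add: field_simps)
    then show ?thesis
      by (rule has_field_derivative_transform_within_open[of _ _ _ "{0<..}"])
         (use 2 in \<open>auto simp: flat_def\<close>)
  next
    case 3
    \<comment> \<open>With \<open>y = 1/x\<close> the difference quotient at 0 from the right
      becomes \<open>y ^ (n + 1) / exp y\<close>; the extra power comes from dividing by
      \<open>x\<close>. From the left the quotient is zero.\<close>
    have "((\<lambda>y::real. y ^ (n + 1) / exp y) \<longlongrightarrow> 0) at_top"
      by (rule tendsto_power_div_exp_0)
    then have "((\<lambda>y::real. inverse y ^ (n + 1) / exp (inverse y)) \<longlongrightarrow> 0) (at_right 0)"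
      using filterlim_compose[OF _ filterlim_inverse_at_top_right] by blast
    then have r: "((\<lambda>y. flat n y / y) \<longlongrightarrow> 0) (at_right 0)"
      by (rule Lim_transform_eventually)
         (auto simp: eventually_at_filter flat_def exp_minus field_simps)
    have l: "((\<lambda>y. flat n y / y) \<longlongrightarrow> 0) (at_left 0)"
      by (rule Lim_transform_eventually[of "\<lambda>y. 0"])
         (auto simp: eventually_at_filter flat_def)
    have "((\<lambda>y. flat n y / y) \<longlongrightarrow> 0) (at 0)"
      using filterlim_split_at[OF l r] .
    then have "(flat n has_real_derivative 0) (at 0)"
      by (simp add: has_field_derivative_iff) (simp add: flat_def)
    with 3 show ?thesis by (simp add: flat_def)
  qed
qed

lemma smooth_on_flat: "smooth_on UNIV (flat n)"
  unfolding smooth_on_def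
proof
  fix k
  show "Ck_on k UNIV (flat n)"
  proof (induction k arbitrary: n)
    case 0
    show ?case
      using DERIV_isCont[OF flat_has_derivative] by (simp add: continuous_at_imp_continuous_on)
  next
    case (Suc k)
    show ?case
    proof (rule Ck_on_SucI[OF open_UNIV])
      show "(flat n has_derivative (\<lambda>v. (flat (n + 2) x + (- real n) * flat (n + 1) x) * v)) (at x)" for x
        using flat_has_derivative[of n x] by (simp add: has_field_derivative_def)
      show "Ck_on k UNIV (\<lambda>x. (flat (n + 2) x + (- real n) * flat (n + 1) x) * v)" for v
        by (rule Ck_on_mult[OF open_UNIV Ck_on_add[OF open_UNIV Suc.IH
              Ck_on_mult[OF open_UNIV Ck_on_const[OF open_UNIV] Suc.IH]] Ck_on_const[OF open_UNIV]])
    qed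
  qed
qed

text \<open>The quotient \<open>u / (u + w)\<close>, where \<open>u\<close> is positive for squared
  distance below \<open>4 * d^2\<close> and \<open>w\<close> for squared distance above
  \<open>d^2\<close>. The two regions cover the space, so the denominator never vanishes. The
  squared norm is used because the norm is not smooth at \<open>c\<close>.\<close>

lemma smooth_step:
  fixes c :: "'e::euclidean_space"
  assumes "d > 0"
  obtains f :: "'e \<Rightarrow> real" where "smooth_on UNIV f"
    and "\<And>x. norm (x - c) < d \<Longrightarrow> f x = 1" and "\<And>x. norm (x - c) \<ge> 2 * d \<Longrightarrow> f x = 0"
proof -
  define s where "s x = (x - c) \<bullet> (x - c)" for x :: 'e
  have s: "s x = (norm (x - c))\<^sup>2" for x by (simp add: s_def power2_norm_eq_inner)
  have sm: "smooth_on UNIV s"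
  proof -
    have "smooth_on UNIV (\<lambda>x. \<Sum>b\<in>Basis. (x \<bullet> b + - (c \<bullet> b)) * (x \<bullet> b + - (c \<bullet> b)))"
      unfolding smooth_on_def
      by (rule allI, rule Ck_on_sum[OF open_UNIV], rule Ck_on_mult[OF open_UNIV];
          rule Ck_on_add[OF open_UNIV Ck_on_bounded_linear[OF bounded_linear_inner_left open_UNIV]
            Ck_on_const[OF open_UNIV]])
    moreover have "s = (\<lambda>x. \<Sum>b\<in>Basis. (x \<bullet> b + - (c \<bullet> b)) * (x \<bullet> b + - (c \<bullet> b)))"
      unfolding s_def by (subst euclidean_inner) (simp add: inner_diff_left)
    ultimately show ?thesis by simp
  qed
  define u where "u x = flat 0 (4 * d\<^sup>2 + (-1) * s x)" for x
  define w where "w x = flat 0 (s x + (- d\<^sup>2))" for x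
  have us: "smooth_on UNIV u" and ws: "smooth_on UNIV w"
    unfolding u_def w_def
    by (rule smooth_on_compose[OF open_UNIV open_UNIV _ smooth_on_flat subset_UNIV],
        rule smooth_on_add[OF open_UNIV smooth_on_const[OF open_UNIV]
          smooth_on_mult[OF open_UNIV smooth_on_const[OF open_UNIV] sm]],
        rule smooth_on_compose[OF open_UNIV open_UNIV _ smooth_on_flat subset_UNIV],
        rule smooth_on_add[OF open_UNIV sm smooth_on_const[OF open_UNIV]])
  have nn: "u x \<ge> 0" "w x \<ge> 0" for x by (auto simp: u_def w_def flat_def)
  have pos: "u x + w x \<noteq> 0" for x
  proof -
    have "4 * d\<^sup>2 - s x > 0 \<or> s x - d\<^sup>2 > 0" using assms by (smt (verit) zero_less_power)
    then have "u x > 0 \<or> w x > 0" by (auto simp: u_def w_def flat_def)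
    then show ?thesis using nn[of x] by linarith
  qed
  show thesis
  proof (rule that[of "\<lambda>x. u x * inverse (u x + w x)"])
    show "smooth_on UNIV (\<lambda>x. u x * inverse (u x + w x))"
      by (rule smooth_on_mult[OF open_UNIV us
            smooth_on_inverse[OF open_UNIV smooth_on_add[OF open_UNIV us ws] pos]])
    show "u x * inverse (u x + w x) = 1" if "norm (x - c) < d" for x
    proof -
      have "s x \<le> d\<^sup>2" unfolding s using that by (intro power_mono) auto
      then have "w x = 0" by (simp add: w_def flat_def)
      then show ?thesis using pos[of x] by simp
    qed
    show "u x * inverse (u x + w x) = 0" if "norm (x - c) \<ge> 2 * d" for x
    proof -
      have "s x \<ge> (2 * d)\<^sup>2" unfolding s using that \<open>d > 0\<close> by (intro power_mono) auto
      then have "u x = 0" by (simp add: u_def flat_def power2_eq_square)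
      then show ?thesis by simp
    qed
  qed
qed

text \<open>Differentiation under the integral sign, iterated: a partial derivative in the
  \<open>x\<close>-direction is again an integrand of the same kind. The open set \<open>Q\<close>
  is there because \<open>Ck_on\<close> wants an open domain and \<open>S \<times> {0..1}\<close> is
  not open; convexity of \<open>S\<close> is what the Leibniz rule asks for.\<close>

lemma Ck_on_integral:
  fixes F :: "'e::euclidean_space \<times> real \<Rightarrow> real"
  assumes S: "open S" "convex S" and Q: "open Q" "S \<times> {0..1} \<subseteq> Q"
  shows "Ck_on k Q F \<Longrightarrow> Ck_on k S (\<lambda>x. integral {0..1} (\<lambda>t. F (x, t)))"
proof (induction k arbitrary: F)
  case 0
  have "continuous_on (S \<times> cbox 0 1) (\<lambda>(x, t). F (x, t))"
    using continuous_on_subset[OF _ Q(2)] 0 by (simp add: case_prod_unfold)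
  from integral_continuous_on_param[OF this] show ?case by simp
next
  case (Suc k)
  note d = Ck_on_SucD[OF Q(1) Suc.prems]
  \<comment> \<open>The Leibniz rule needs the derivative as a bounded linear map depending
    continuously on both parameters; it is assembled from the partial derivatives along the
    basis.\<close>
  define fx where "fx x t = (\<Sum>b\<in>Basis. frechet_derivative F (at (x, t)) (b, 0) *\<^sub>R blinfun_inner_left b)"
    for x :: 'e and t :: real
  have ap: "blinfun_apply (fx x t) v = frechet_derivative F (at (x, t)) (v, 0)"
    if "x \<in> S" "t \<in> {0..1}" for x t v
  proof -
    have lin: "linear (frechet_derivative F (at (x, t)))"
      by (rule has_derivative_linear[OF d(1)]) (use that Q(2) in auto)
    have "(v, 0) = (\<Sum>b\<in>Basis. (v \<bullet> b) *\<^sub>R (b, 0::real))"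
      by (simp add: prod_eq_iff fst_sum snd_sum euclidean_representation)
    then have "frechet_derivative F (at (x, t)) (v, 0)
        = (\<Sum>b\<in>Basis. (v \<bullet> b) *\<^sub>R frechet_derivative F (at (x, t)) (b, 0))"
      by (simp only: linear_sum[OF lin] linear_scale[OF lin])
    then show ?thesis
      by (simp add: fx_def blinfun.sum_left blinfun.scaleR_left mult.commute)
  qed
  have cF: "continuous_on (S \<times> cbox 0 1) F"
    using continuous_on_subset[OF Ck_on_imp_continuous_on[OF Suc.prems] Q(2)] by simp
  have cfx: "continuous_on (S \<times> cbox 0 1) (\<lambda>(x, t). fx x t)"
  proof -
    have "continuous_on (S \<times> cbox 0 1) (\<lambda>z. frechet_derivative F (at z) (b, 0))" for b
      using continuous_on_subset[OF Ck_on_imp_continuous_on[OF d(2)] Q(2)] by simp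
    then show ?thesis
      by (auto simp: fx_def case_prod_unfold intro!: continuous_intros)
  qed
  have int: "(\<lambda>t. fx x t) integrable_on {0..1}" if "x \<in> S" for x
  proof -
    have "continuous_on {0..1} ((\<lambda>(x, t). fx x t) \<circ> (\<lambda>t. (x, t)))"
      by (intro continuous_on_compose continuous_intros continuous_on_subset[OF cfx]) (use that in auto)
    then have "continuous_on {0..1} (\<lambda>t. fx x t)" by (simp add: o_def)
    then show ?thesis by (rule integrable_continuous_interval)
  qed
  show ?case
  proof (rule Ck_on_SucI[OF S(1)])
    fix x assume x: "x \<in> S"
    have "((\<lambda>x. integral (cbox 0 1) (\<lambda>t. F (x, t))) has_derivative integral (cbox 0 1) (fx x)) (at x within S)"
    proof (rule leibniz_rule[OF _ _ cfx x S(2)])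
      fix y t assume yt: "y \<in> S" "t \<in> cbox 0 (1::real)"
      have "((\<lambda>x. (x, t)) has_derivative (\<lambda>v. (v, 0))) (at y within S)"
        by (auto intro!: derivative_eq_intros)
      moreover have "(y, t) \<in> Q" using yt Q(2) by auto
      ultimately
      have "((\<lambda>x. F (x, t)) has_derivative (\<lambda>v. frechet_derivative F (at (y, t)) (v, 0))) (at y within S)"
        using has_derivative_compose[OF _ d(1)] by blast
      moreover have "(\<lambda>v. frechet_derivative F (at (y, t)) (v, 0)) = blinfun_apply (fx y t)"
        using ap yt by auto
      ultimately show "((\<lambda>x. F (x, t)) has_derivative blinfun_apply (fx y t)) (at y within S)"
        by simp
    next
      fix y assume y: "y \<in> S"
      have "continuous_on (cbox 0 1) (F \<circ> (\<lambda>t. (y, t)))"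
        by (intro continuous_on_compose continuous_intros continuous_on_subset[OF cF]) (use y in auto)
      then have "continuous_on {0..1} (\<lambda>t. F (y, t))" by (simp add: o_def)
      from integrable_continuous_interval[OF this]
      show "(\<lambda>t. F (y, t)) integrable_on cbox 0 1" by simp
    qed
    moreover have "blinfun_apply (integral {0..1} (fx x))
        = (\<lambda>v. integral {0..1} (\<lambda>t. frechet_derivative F (at (x, t)) (v, 0)))"
    proof
      fix v
      have "integral {0..1} (\<lambda>t. blinfun_apply (fx x t) v)
          = integral {0..1} (\<lambda>t. frechet_derivative F (at (x, t)) (v, 0))"
        by (rule integral_cong) (simp add: ap[OF x])
      then show "blinfun_apply (integral {0..1} (fx x)) v
          = integral {0..1} (\<lambda>t. frechet_derivative F (at (x, t)) (v, 0))"
        by (simp add: blinfun_apply_integral[OF int[OF x]])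
    qed
    ultimately show "((\<lambda>x. integral {0..1} (\<lambda>t. F (x, t))) has_derivative
        (\<lambda>v. integral {0..1} (\<lambda>t. frechet_derivative F (at (x, t)) (v, 0)))) (at x)"
      by (simp add: at_within_open[OF x S(1)])
  next
    fix v
    show "Ck_on k S (\<lambda>x. integral {0..1} (\<lambda>t. frechet_derivative F (at (x, t)) (v, 0)))"
      by (rule Suc.IH[OF d(2)])
  qed
qed

text \<open>Integrate the derivative of \<open>f\<close> along the segment \<open>m\<close> from
  \<open>c\<close> to \<open>x\<close>: the factor \<open>x - c\<close> leaves the integral, and
  what remains is smooth by \<open>Ck_on_integral\<close>. At \<open>x = c\<close> the segment is
  constant, which gives the value of \<open>g b\<close> there.\<close>

lemma Hadamard:
  fixes f :: "'e::euclidean_space \<Rightarrow> real"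
  assumes sm: "smooth_on (ball c r) f" and r: "r > 0"
  obtains g where "\<And>b. smooth_on (ball c r) (g b)"
    and "\<And>x. x \<in> ball c r \<Longrightarrow> f x = f c + (\<Sum>b\<in>Basis. ((x - c) \<bullet> b) * g b x)"
    and "\<And>b. g b c = frechet_derivative f (at c) b"
proof -
  let ?S = "ball c r"
  define m where "m z = c + snd z *\<^sub>R (fst z - c)" for z :: "'e \<times> real"
  define Q where "Q = m -` ?S"
  have cm: "continuous_on UNIV m" unfolding m_def by (intro continuous_intros)
  have oQ: "open Q" unfolding Q_def by (rule open_vimage[OF open_ball cm])
  have SQ: "?S \<times> {0..1} \<subseteq> Q"
  proof
    fix z assume "z \<in> ?S \<times> {0..1::real}"
    then have z: "norm (fst z - c) < r" "0 \<le> snd z" "snd z \<le> 1"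
      by (auto simp: dist_norm norm_minus_commute)
    have "snd z * norm (fst z - c) \<le> norm (fst z - c)" using z by (simp add: mult_left_le_one_le)
    then show "z \<in> Q" using z by (simp add: Q_def m_def dist_norm)
  qed
  have mC: "smooth_on Q m"
  proof -
    have eq: "m = (\<lambda>z. c + snd z *\<^sub>R (fst z + - c))" by (auto simp: m_def)
    show ?thesis unfolding eq smooth_on_def
      by (rule allI, rule Ck_on_add[OF oQ Ck_on_const[OF oQ]
            Ck_on_scaleR[OF oQ Ck_on_bounded_linear[OF bounded_linear_snd oQ]
              Ck_on_add[OF oQ Ck_on_bounded_linear[OF bounded_linear_fst oQ] Ck_on_const[OF oQ]]]])
  qed
  define g where "g b x = integral {0..1} (\<lambda>t. frechet_derivative f (at (m (x, t))) b)" for b x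
  show thesis
  proof
    show "smooth_on ?S (g b)" for b
    proof -
      have "smooth_on Q (\<lambda>z. frechet_derivative f (at (m z)) b)"
        by (rule smooth_on_compose[OF oQ open_ball mC smooth_on_derivative[OF open_ball sm]])
           (auto simp: Q_def)
      then show ?thesis unfolding g_def smooth_on_def
        using Ck_on_integral[OF open_ball convex_ball oQ SQ, of _ "\<lambda>z. frechet_derivative f (at (m z)) b"]
        by blast
    qed
    show "g b c = frechet_derivative f (at c) b" for b
      by (simp add: g_def m_def)
    fix x assume x: "x \<in> ?S"
    have mS: "m (x, t) \<in> ?S" if "t \<in> {0..1}" for t
      using subsetD[OF SQ, of "(x, t)"] x that by (simp add: Q_def)
    have der: "((\<lambda>t. f (m (x, t))) has_vector_derivative
        (\<Sum>b\<in>Basis. ((x - c) \<bullet> b) * frechet_derivative f (at (m (x, t))) b)) (at t within {0..1})"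
      if t: "t \<in> {0..1}" for t
    proof -
      have lin: "linear (frechet_derivative f (at (m (x, t))))"
        using smooth_on_has_derivative[OF open_ball sm mS[OF t]] by (rule has_derivative_linear)
      have "((\<lambda>t. m (x, t)) has_derivative (\<lambda>h. h *\<^sub>R (x - c))) (at t within {0..1})"
        unfolding m_def by (auto intro!: derivative_eq_intros)
      from has_derivative_compose[OF this smooth_on_has_derivative[OF open_ball sm mS[OF t]]]
      have "((\<lambda>t. f (m (x, t))) has_derivative
          (\<lambda>h. frechet_derivative f (at (m (x, t))) (h *\<^sub>R (x - c)))) (at t within {0..1})" .
      moreover have "frechet_derivative f (at (m (x, t))) (h *\<^sub>R (x - c))
          = h *\<^sub>R (\<Sum>b\<in>Basis. ((x - c) \<bullet> b) * frechet_derivative f (at (m (x, t))) b)" for h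
      proof -
        have "frechet_derivative f (at (m (x, t))) (x - c)
            = frechet_derivative f (at (m (x, t))) (\<Sum>b\<in>Basis. ((x - c) \<bullet> b) *\<^sub>R b)"
          by (simp only: euclidean_representation)
        also have "\<dots> = (\<Sum>b\<in>Basis. ((x - c) \<bullet> b) *\<^sub>R frechet_derivative f (at (m (x, t))) b)"
          by (simp only: linear_sum[OF lin] linear_scale[OF lin])
        finally show ?thesis by (simp add: linear_scale[OF lin])
      qed
      ultimately show ?thesis by (simp add: has_vector_derivative_def)
    qed
    have ftc: "((\<lambda>t. \<Sum>b\<in>Basis. ((x - c) \<bullet> b) * frechet_derivative f (at (m (x, t))) b)
        has_integral (f (m (x, 1)) - f (m (x, 0)))) {0..1}"
      by (rule fundamental_theorem_of_calculus[OF _ der]) auto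
    have int: "(\<lambda>t. frechet_derivative f (at (m (x, t))) b) integrable_on {0..1}" for b
    proof -
      have "continuous_on {0..1} (\<lambda>t. m (x, t))" unfolding m_def by (intro continuous_intros)
      moreover have "continuous_on ?S (\<lambda>y. frechet_derivative f (at y) b)"
        using smooth_on_derivative[OF open_ball sm] Ck_on_imp_continuous_on unfolding smooth_on_def by blast
      ultimately have "continuous_on {0..1} (\<lambda>t. frechet_derivative f (at (m (x, t))) b)"
        using continuous_on_compose2[of ?S _ "{0..1}" "\<lambda>t. m (x, t)"] mS by blast
      then show ?thesis using integrable_continuous_interval by blast
    qed
    have "f (m (x, 1)) - f (m (x, 0)) = integral {0..1}
        (\<lambda>t. \<Sum>b\<in>Basis. ((x - c) \<bullet> b) * frechet_derivative f (at (m (x, t))) b)"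
      using ftc by (simp add: integral_unique)
    also have "\<dots> = (\<Sum>b\<in>Basis. ((x - c) \<bullet> b) * g b x)"
      unfolding g_def by (subst integral_sum) (auto intro!: integrable_on_mult_right int)
    finally show "f x = f c + (\<Sum>b\<in>Basis. ((x - c) \<bullet> b) * g b x)" by (simp add: m_def)
  qed
qed

section \<open>Smooth functions and vector fields\<close>

locale smooth_manifold =
  fixes A :: "('m::{t2_space, second_countable_topology}, 'e::euclidean_space) atlas"
  assumes atlas: "smooth_atlas A"
begin

lemma chart_cover:
  obtains U \<phi> where "(U, \<phi>) \<in> A" "p \<in> U"
proof -
  have "p \<in> (\<Union>(U, \<phi>)\<in>A. U)"
    using atlas[unfolded smooth_atlas_def, THEN conjunct1] by (simp only: UNIV_I)
  then show thesis using that by auto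
qed

lemma
  assumes "(U, \<phi>) \<in> A"
  shows chart_open: "open U"
    and chart_open_image: "open (\<phi> ` U)"
    and chart_homeo: "homeomorphism U (\<phi> ` U) \<phi> (inv_into U \<phi>)"
  using bspec[OF atlas[unfolded smooth_atlas_def, THEN conjunct2, THEN conjunct1] assms] by simp_all

lemma chart_inv: "(U, \<phi>) \<in> A \<Longrightarrow> q \<in> U \<Longrightarrow> inv_into U \<phi> (\<phi> q) = q"
  by (rule homeomorphism_apply1[OF chart_homeo])

lemma chart_image_open:
  assumes "(U, \<phi>) \<in> A" "open W"
  shows "open (\<phi> ` (U \<inter> W))"
proof -
  have "\<phi> ` (U \<inter> W) = \<phi> ` U \<inter> inv_into U \<phi> -` W"
    using chart_inv[OF assms(1)] by auto
  moreover have "continuous_on (\<phi> ` U) (inv_into U \<phi>)"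
    using chart_homeo[OF assms(1)] by (simp add: homeomorphism_def)
  ultimately show ?thesis
    using continuous_open_preimage[OF _ chart_open_image[OF assms(1)] assms(2)] by simp
qed

lemma transition_smooth:
  "(U, \<phi>) \<in> A \<Longrightarrow> (V, \<psi>) \<in> A \<Longrightarrow> smooth_on (\<phi> ` (U \<inter> V)) (\<psi> \<circ> inv_into U \<phi>)"
proof -
  assume c: "(U, \<phi>) \<in> A" and d: "(V, \<psi>) \<in> A"
  have "\<forall>(V, \<psi>)\<in>A. smooth_on (\<phi> ` (U \<inter> V)) (\<psi> \<circ> inv_into U \<phi>)"
    using bspec[OF atlas[unfolded smooth_atlas_def, THEN conjunct2, THEN conjunct2] c] by simp
  from bspec[OF this d] show ?thesis by simp
qed

lemma CinfD: "f \<in> Cinf A \<Longrightarrow> (U, \<phi>) \<in> A \<Longrightarrow> smooth_on (\<phi> ` U) (\<lambda>y. f (inv_into U \<phi> y))"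
  using bspec[OF CollectD[of f, OF subsetD[OF equalityD1[OF Cinf_def]]], of A "(U, \<phi>)"] by (simp add: o_def)

lemma CinfI:
  "(\<And>U \<phi>. (U, \<phi>) \<in> A \<Longrightarrow> smooth_on (\<phi> ` U) (\<lambda>y. f (inv_into U \<phi> y))) \<Longrightarrow> f \<in> Cinf A"
  unfolding Cinf_def by (simp add: o_def split_beta)

lemma Cinf_chartI:
  assumes "\<And>p. \<exists>W. open W \<and> p \<in> W \<and> (\<forall>U \<phi>. (U, \<phi>) \<in> A \<longrightarrow> smooth_on (\<phi> ` (U \<inter> W)) (\<lambda>y. f (inv_into U \<phi> y)))"
  shows "f \<in> Cinf A"
proof -
  have "smooth_on (\<phi> ` U) (\<lambda>y. f (inv_into U \<phi> y))" if c: "(U, \<phi>) \<in> A" for U \<phi>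
  proof (rule smooth_on_local[OF _ chart_open_image[OF c]])
    fix y assume "y \<in> \<phi> ` U"
    then obtain p where p: "p \<in> U" "y = \<phi> p" by auto
    obtain W where "open W" "p \<in> W" "\<forall>U \<phi>. (U, \<phi>) \<in> A \<longrightarrow> smooth_on (\<phi> ` (U \<inter> W)) (\<lambda>y. f (inv_into U \<phi> y))"
      using assms by blast
    then show "\<exists>T. open T \<and> y \<in> T \<and> smooth_on T (\<lambda>y. f (inv_into U \<phi> y))"
      using p c chart_image_open[OF c, of W]
      by (intro exI[of _ "\<phi> ` (U \<inter> W)"]) auto
  qed
  then show ?thesis by (rule CinfI)
qed

lemma Cinf_local:
  assumes "\<And>p. \<exists>W. open W \<and> p \<in> W \<and> (\<exists>h\<in>Cinf A. \<forall>q\<in>W. f q = h q)"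
  shows "f \<in> Cinf A"
proof (rule Cinf_chartI)
  fix p
  obtain W h where W: "open W" "p \<in> W" "h \<in> Cinf A" "\<And>q. q \<in> W \<Longrightarrow> f q = h q"
    using assms[of p] by blast
  have "smooth_on (\<phi> ` (U \<inter> W)) (\<lambda>y. f (inv_into U \<phi> y))" if c: "(U, \<phi>) \<in> A" for U \<phi>
  proof (rule smooth_on_cong[OF chart_image_open[OF c W(1)]])
    show "smooth_on (\<phi> ` (U \<inter> W)) (\<lambda>y. h (inv_into U \<phi> y))"
      by (rule smooth_on_subset[OF CinfD[OF W(3) c] chart_open_image[OF c] chart_image_open[OF c W(1)]]) auto
    show "h (inv_into U \<phi> y) = f (inv_into U \<phi> y)" if "y \<in> \<phi> ` (U \<inter> W)" for y
      using that chart_inv[OF c] W(4) by auto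
  qed
  then show "\<exists>W. open W \<and> p \<in> W \<and> (\<forall>U \<phi>. (U, \<phi>) \<in> A \<longrightarrow> smooth_on (\<phi> ` (U \<inter> W)) (\<lambda>y. f (inv_into U \<phi> y)))"
    using W(1,2) by (intro exI[of _ W] conjI allI impI)
qed

lemma Cinf_const [simp]: "(\<lambda>q. c) \<in> Cinf A"
  by (rule CinfI) (rule smooth_on_const[OF chart_open_image])

lemma Cinf_add [simp]: "f \<in> Cinf A \<Longrightarrow> g \<in> Cinf A \<Longrightarrow> (\<lambda>q. f q + g q) \<in> Cinf A"
  by (rule CinfI) (rule smooth_on_add[OF chart_open_image CinfD CinfD])

lemma Cinf_mult [simp]: "f \<in> Cinf A \<Longrightarrow> g \<in> Cinf A \<Longrightarrow> (\<lambda>q. f q * g q) \<in> Cinf A"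
  by (rule CinfI) (rule smooth_on_mult[OF chart_open_image CinfD CinfD])

lemma Cinf_minus [simp]: "f \<in> Cinf A \<Longrightarrow> (\<lambda>q. - f q) \<in> Cinf A"
  using Cinf_mult[OF Cinf_const[of "-1"], of f] by simp

lemma Cinf_diff [simp]: "f \<in> Cinf A \<Longrightarrow> g \<in> Cinf A \<Longrightarrow> (\<lambda>q. f q - g q) \<in> Cinf A"
  using Cinf_add[OF _ Cinf_minus, of f g] by simp

lemma Cinf_sum: "(\<And>i. i \<in> I \<Longrightarrow> f i \<in> Cinf A) \<Longrightarrow> (\<lambda>q. \<Sum>i\<in>I. f i q) \<in> Cinf A"
  by (induction I rule: infinite_finite_induct) simp_all

lemma Cinf_prod: "(\<And>i. i \<in> I \<Longrightarrow> f i \<in> Cinf A) \<Longrightarrow> (\<lambda>q. \<Prod>i\<in>I. f i q) \<in> Cinf A"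
  by (induction I rule: infinite_finite_induct) simp_all

lemma Cinf_continuous:
  assumes f: "f \<in> Cinf A"
  shows "isCont f p"
proof -
  obtain U \<phi> where c: "(U, \<phi>) \<in> A" "p \<in> U" by (rule chart_cover)
  have "continuous_on (\<phi> ` U) (\<lambda>y. f (inv_into U \<phi> y))"
    using CinfD[OF f c(1)] Ck_on_imp_continuous_on unfolding smooth_on_def by blast
  moreover have "continuous_on U \<phi>"
    using chart_homeo[OF c(1)] by (simp add: homeomorphism_def)
  ultimately have "continuous_on U (\<lambda>q. f (inv_into U \<phi> (\<phi> q)))"
    by (rule continuous_on_compose2[OF _ _ subset_refl])
  then have "continuous_on U f"
    by (rule continuous_on_eq) (simp add: chart_inv[OF c(1)])
  then show ?thesis
    using continuous_on_eq_continuous_at chart_open[OF c(1)] c(2) by blast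
qed

text \<open>Extension by zero of a function given in a chart. That its support stays inside
  \<open>W\<close> is expressed by an open \<open>Q\<close> which together with \<open>W\<close>
  covers the manifold and on which the function vanishes; near every point one of the two
  descriptions is visibly smooth.\<close>

lemma Cinf_chart:
  assumes c: "(U, \<phi>) \<in> A" and W: "open W" "W \<subseteq> U" and F: "smooth_on (\<phi> ` W) F"
    and Q: "open Q" "Q \<union> W = UNIV" "\<And>q. q \<in> Q \<inter> W \<Longrightarrow> F (\<phi> q) = 0"
  shows "(\<lambda>q. if q \<in> W then F (\<phi> q) else 0) \<in> Cinf A"
proof (rule Cinf_chartI)
  fix p
  let ?f = "\<lambda>q. if q \<in> W then F (\<phi> q) else 0"
  have UW: "U \<inter> W = W" using W by auto
  show "\<exists>W. open W \<and> p \<in> W \<and> (\<forall>V \<psi>. (V, \<psi>) \<in> A \<longrightarrow> smooth_on (\<psi> ` (V \<inter> W)) (\<lambda>y. ?f (inv_into V \<psi> y)))"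
  proof (cases "p \<in> W")
    case True
    have "smooth_on (\<psi> ` (V \<inter> W)) (\<lambda>y. ?f (inv_into V \<psi> y))" if d: "(V, \<psi>) \<in> A" for V \<psi>
    proof -
      note o = chart_image_open[OF d W(1)]
      have t: "smooth_on (\<psi> ` (V \<inter> W)) (\<phi> \<circ> inv_into V \<psi>)"
        by (rule smooth_on_subset[OF transition_smooth[OF d c]
              chart_image_open[OF d chart_open[OF c]] o]) (use W in auto)
      have "smooth_on (\<psi> ` (V \<inter> W)) (\<lambda>y. F ((\<phi> \<circ> inv_into V \<psi>) y))"
        by (rule smooth_on_compose[OF o _ t F])
           (use chart_image_open[OF c W(1)] UW chart_inv[OF d] in auto)
      then show ?thesis
        by (rule smooth_on_cong[OF o]) (use chart_inv[OF d] in auto)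
    qed
    then show ?thesis using True W by blast
  next
    case False
    have "smooth_on (\<psi> ` (V \<inter> Q)) (\<lambda>y. ?f (inv_into V \<psi> y))" if d: "(V, \<psi>) \<in> A" for V \<psi>
    proof -
      note o = chart_image_open[OF d Q(1)]
      show ?thesis
        by (rule smooth_on_cong[OF o smooth_on_const[OF o, of 0]])
           (use chart_inv[OF d] Q(3) in auto)
    qed
    moreover have "p \<in> Q" using False Q by auto
    ultimately show ?thesis using Q by blast
  qed
qed

text \<open>Besides \<open>\<rho> = 1\<close> on the open set \<open>V\<close>, an open set
  \<open>Q\<close> around the complement of \<open>W\<close> is recorded on which
  \<open>\<rho>\<close> vanishes. This is the form of the support condition that
  \<open>Cinf_chart\<close> consumes.\<close>

definition bump :: "'m set \<Rightarrow> 'm set \<Rightarrow> ('m \<Rightarrow> real) \<Rightarrow> bool" where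
  "bump W V \<rho> \<longleftrightarrow> \<rho> \<in> Cinf A \<and> open V \<and> V \<subseteq> W \<and> (\<forall>q\<in>V. \<rho> q = 1) \<and>
     (\<exists>Q. open Q \<and> Q \<union> W = UNIV \<and> (\<forall>q\<in>Q. \<rho> q = 0))"

lemma bump_exists:
  assumes "open W" "p \<in> W"
  obtains V \<rho> where "bump W V \<rho>" "p \<in> V"
proof -
  obtain U \<phi> where c: "(U, \<phi>) \<in> A" "p \<in> U" by (rule chart_cover)
  have "\<phi> p \<in> \<phi> ` (U \<inter> W)" using c assms by auto
  then obtain r where r: "r > 0" "cball (\<phi> p) r \<subseteq> \<phi> ` (U \<inter> W)"
    using chart_image_open[OF c(1) assms(1)] open_contains_cball by blast
  \<comment> \<open>Chosen so that \<open>2 * d = r\<close>: the step function then vanishes outside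
    the ball of radius \<open>r\<close>, whose closed version lies in the image of the
    chart.\<close>
  define d where "d = r / 2"
  have d: "d > 0" using r by (simp add: d_def)
  obtain f where f: "smooth_on UNIV f" "\<And>x. norm (x - \<phi> p) < d \<Longrightarrow> f x = 1"
      "\<And>x. norm (x - \<phi> p) \<ge> 2 * d \<Longrightarrow> (f x::real) = 0"
    using smooth_step[OF d, where c = "\<phi> p"] by metis
  have hom: "continuous_on (\<phi> ` U) (inv_into U \<phi>)" "continuous_on U \<phi>"
    using chart_homeo[OF c(1)] by (simp_all add: homeomorphism_def)
  define K where "K = inv_into U \<phi> ` cball (\<phi> p) r"
  have "compact K"
    unfolding K_def by (rule compact_continuous_image[OF continuous_on_subset[OF hom(1)]]) (use r in auto)
  \<comment> \<open>Here the Hausdorff property enters: the compact set \<open>K\<close> is closed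
    in the whole manifold and not merely in the chart.\<close>
  then have oK: "open (- K)" by (simp add: compact_imp_closed open_Compl)
  have KU: "K \<subseteq> U \<inter> W"
  proof
    fix q assume "q \<in> K"
    then obtain y where y: "y \<in> cball (\<phi> p) r" "q = inv_into U \<phi> y" by (auto simp: K_def)
    then obtain q' where "q' \<in> U \<inter> W" "y = \<phi> q'" using r(2) by blast
    then show "q \<in> U \<inter> W" using y chart_inv[OF c(1)] by auto
  qed
  have out: "f (\<phi> q) = 0" if "q \<in> U" "q \<notin> K" for q
  proof (rule f(3))
    have "\<phi> q \<notin> cball (\<phi> p) r"
      using that chart_inv[OF c(1)] unfolding K_def by (metis image_eqI)
    then show "2 * d \<le> norm (\<phi> q - \<phi> p)" by (simp add: d_def dist_norm norm_minus_commute)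
  qed
  define \<rho> where "\<rho> q = (if q \<in> U then f (\<phi> q) else 0)" for q
  define V where "V = U \<inter> \<phi> -` ball (\<phi> p) d"
  show thesis
  proof (rule that[of V \<rho>])
    show "p \<in> V" using c d by (simp add: V_def)
    have "smooth_on (\<phi> ` U) f"
      by (rule smooth_on_subset[OF f(1) open_UNIV chart_open_image[OF c(1)] subset_UNIV])
    then have "\<rho> \<in> Cinf A" unfolding \<rho>_def
      by (rule Cinf_chart[OF c(1) chart_open[OF c(1)] subset_refl _ oK]) (use KU out in auto)
    then show "bump W V \<rho>" unfolding bump_def
    proof (intro conjI ballI exI[of _ "- K"])
      show "open V"
        unfolding V_def by (rule continuous_open_preimage[OF hom(2) chart_open[OF c(1)] open_ball])
      show "V \<subseteq> W"
      proof
        fix q assume q: "q \<in> V"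
        then have "\<phi> q \<in> cball (\<phi> p) r" using d by (auto simp: V_def d_def)
        then have "q \<in> K" using q chart_inv[OF c(1)] unfolding K_def V_def by (metis IntD1 image_eqI)
        then show "q \<in> W" using KU by auto
      qed
      show "\<rho> q = 1" if "q \<in> V" for q
        using that f(2)[of "\<phi> q"] by (auto simp: V_def \<rho>_def dist_norm norm_minus_commute)
      show "open (- K)" by (rule oK)
      show "- K \<union> W = UNIV" using KU by auto
      show "\<rho> q = 0" if "q \<in> - K" for q using that out by (auto simp: \<rho>_def)
    qed
  qed
qed

lemma bumpD:
  assumes "bump W V \<rho>"
  shows "\<rho> \<in> Cinf A" "open V" "V \<subseteq> W" "\<And>q. q \<in> V \<Longrightarrow> \<rho> q = 1" "\<And>q. q \<notin> W \<Longrightarrow> \<rho> q = 0"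
    and "\<exists>Q. open Q \<and> Q \<union> W = UNIV \<and> (\<forall>q\<in>Q. \<rho> q = 0)"
  using assms unfolding bump_def by blast+

section \<open>Tangent vectors as derivations, and coordinates\<close>

lemma tangentD:
  assumes "v \<in> tangent A p"
  shows tangent_add: "\<And>f g. f \<in> Cinf A \<Longrightarrow> g \<in> Cinf A \<Longrightarrow> v (\<lambda>q. f q + g q) = v f + v g"
    and tangent_scale: "\<And>c f. f \<in> Cinf A \<Longrightarrow> v (\<lambda>q. c * f q) = c * v f"
    and tangent_mult: "\<And>f g. f \<in> Cinf A \<Longrightarrow> g \<in> Cinf A \<Longrightarrow> v (\<lambda>q. f q * g q) = v f * g p + f p * v g"
    and tangent_off: "\<And>f. f \<notin> Cinf A \<Longrightarrow> v f = 0"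
  using assms unfolding tangent_def by blast+

lemma tangent_const:
  assumes v: "v \<in> tangent A p"
  shows "v (\<lambda>q. c) = 0"
proof -
  have "v (\<lambda>q. 1 * 1) = v (\<lambda>q. 1) * 1 + 1 * v (\<lambda>q. 1)"
    by (rule tangent_mult[OF v Cinf_const Cinf_const])
  then have "v (\<lambda>q. 1) = 0" by simp
  then show ?thesis using tangent_scale[OF v Cinf_const[of 1], of c] by simp
qed

lemma tangent_minus:
  assumes v: "v \<in> tangent A p" "f \<in> Cinf A"
  shows "v (\<lambda>q. - f q) = - v f"
  using tangent_scale[OF v(1) v(2), of "-1"] by simp

lemma tangent_diff:
  assumes v: "v \<in> tangent A p" "f \<in> Cinf A" "g \<in> Cinf A"
  shows "v (\<lambda>q. f q - g q) = v f - v g"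
  using tangent_add[OF v(1,2) Cinf_minus[OF v(3)]] tangent_minus[OF v(1,3)] by simp

lemma tangent_sum:
  assumes v: "v \<in> tangent A p" and f: "\<And>i. i \<in> I \<Longrightarrow> f i \<in> Cinf A"
  shows "v (\<lambda>q. \<Sum>i\<in>I. f i q) = (\<Sum>i\<in>I. v (f i))"
  using f by (induction I rule: infinite_finite_induct)
    (simp_all add: tangent_const[OF v] tangent_add[OF v] Cinf_sum)

text \<open>A derivation kills \<open>\<rho> * (f - g)\<close>, which is identically zero. The
  product rule at \<open>p\<close>, where \<open>\<rho> = 1\<close> and \<open>f = g\<close>, leaves
  the difference of the two values.\<close>

lemma tangent_local:
  assumes v: "v \<in> tangent A p" and fg: "f \<in> Cinf A" "g \<in> Cinf A"
    and W: "open W" "p \<in> W" "\<And>q. q \<in> W \<Longrightarrow> f q = g q"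
  shows "v f = v g"
proof -
  obtain V \<rho> where b: "bump W V \<rho>" "p \<in> V" using bump_exists[OF W(1,2)] .
  have "(\<lambda>q. \<rho> q * (f q - g q)) = (\<lambda>q. 0)"
  proof
    show "\<rho> q * (f q - g q) = 0" for q
      using W(3) bumpD(5)[OF b(1)] by (cases "q \<in> W") auto
  qed
  then have "v (\<lambda>q. \<rho> q * (f q - g q)) = 0" using tangent_const[OF v] by simp
  moreover have "v (\<lambda>q. \<rho> q * (f q - g q)) = v \<rho> * (f p - g p) + \<rho> p * v (\<lambda>q. f q - g q)"
    using tangent_mult[OF v bumpD(1)[OF b(1)] Cinf_diff[OF fg]] .
  ultimately show ?thesis
    using bumpD(4)[OF b] W(2,3) tangent_diff[OF v fg] by simp
qed

lemma VF_iff: "X \<in> VF A \<longleftrightarrow> (\<forall>p. X p \<in> tangent A p) \<and> (\<forall>f\<in>Cinf A. (\<lambda>p. X p f) \<in> Cinf A)"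
  by (simp add: TM_bundle_def)

lemma VF_tangent: "X \<in> VF A \<Longrightarrow> X p \<in> tangent A p" by (simp add: VF_iff)

text \<open>Holds for every \<open>f\<close>, because tangent vectors vanish off
  \<open>Cinf A\<close>; this spares side conditions in all later computations with
  brackets.\<close>

lemma VF_Cinf [simp]: "X \<in> VF A \<Longrightarrow> (\<lambda>p. X p f) \<in> Cinf A"
proof (cases "f \<in> Cinf A")
  assume X: "X \<in> VF A"
  case False
  have "X p f = 0" for p by (rule tangent_off[OF VF_tangent[OF X] False])
  then show ?thesis by simp
qed (simp add: VF_iff)

text \<open>The partial derivative in the chart is multiplied by a cut-off and so becomes a global
  vector field; where \<open>\<rho> = 1\<close> it is the coordinate field itself.\<close>

lemma coordinate_field:
  fixes e :: 'e
  assumes c: "(U, \<phi>) \<in> A" and W: "open W" "W \<subseteq> U" and b: "bump W V \<rho>"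
  defines "X \<equiv> \<lambda>q f. if f \<in> Cinf A \<and> q \<in> W
    then \<rho> q * frechet_derivative (\<lambda>y. f (inv_into U \<phi> y)) (at (\<phi> q)) e else 0"
  shows "X \<in> VF A"
proof -
  have UW: "U \<inter> W = W" using W by auto
  have der: "((\<lambda>y. f (inv_into U \<phi> y)) has_derivative
      frechet_derivative (\<lambda>y. f (inv_into U \<phi> y)) (at (\<phi> q))) (at (\<phi> q))"
    if "f \<in> Cinf A" "q \<in> W" for f q
    by (rule smooth_on_has_derivative[OF chart_open_image[OF c] CinfD[OF that(1) c]]) (use that W in auto)
  have "X q \<in> tangent A q" for q
  proof (cases "q \<in> W")
    case False
    then show ?thesis by (simp add: X_def tangent_def)
  next
    case q: True
    note d = der[OF _ q]
    have inv: "inv_into U \<phi> (\<phi> q) = q" using q W chart_inv[OF c] by auto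
    show ?thesis unfolding tangent_def
    proof (intro CollectI conjI ballI allI impI)
      fix f g assume fg: "f \<in> Cinf A" "g \<in> Cinf A"
      show "X q (\<lambda>q. f q + g q) = X q f + X q g"
        using fg q frechet_derivative_at[OF has_derivative_add[OF d[OF fg(1)] d[OF fg(2)]], symmetric]
        by (simp add: X_def distrib_left)
      show "X q (\<lambda>q. f q * g q) = X q f * g q + f q * X q g"
        using fg q frechet_derivative_at[OF has_derivative_mult[OF d[OF fg(1)] d[OF fg(2)]], symmetric]
        by (simp add: X_def inv algebra_simps)
    next
      fix c' f assume f: "f \<in> Cinf A"
      show "X q (\<lambda>q. c' * f q) = c' * X q f"
        using f q frechet_derivative_at[OF has_derivative_mult_right[OF d[OF f], of c'], symmetric]
        by (simp add: X_def)
    next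
      fix f assume "f \<notin> Cinf A"
      then show "X q f = 0" by (simp add: X_def)
    qed
  qed
  moreover have "(\<lambda>q. X q f) \<in> Cinf A" if f: "f \<in> Cinf A" for f
  proof -
    obtain Q where Q: "open Q" "Q \<union> W = UNIV" "\<forall>q\<in>Q. \<rho> q = 0"
      using bumpD(6)[OF b] by blast
    let ?F = "\<lambda>y. \<rho> (inv_into U \<phi> y) * frechet_derivative (\<lambda>y. f (inv_into U \<phi> y)) (at y) e"
    have "smooth_on (\<phi> ` U) ?F"
      by (rule smooth_on_mult[OF chart_open_image[OF c] CinfD[OF bumpD(1)[OF b] c]
            smooth_on_derivative[OF chart_open_image[OF c] CinfD[OF f c]]])
    then have "smooth_on (\<phi> ` W) ?F"
      by (rule smooth_on_subset[OF _ chart_open_image[OF c]])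
         (use chart_image_open[OF c W(1)] UW W in auto)
    from Cinf_chart[OF c W this Q(1,2)]
    have "(\<lambda>q. if q \<in> W then ?F (\<phi> q) else 0) \<in> Cinf A"
      using Q(3) chart_inv[OF c] W(2) by fastforce
    moreover have "X q f = (if q \<in> W then ?F (\<phi> q) else 0)" for q
    proof (cases "q \<in> W")
      case True
      then have "inv_into U \<phi> (\<phi> q) = q" using chart_inv[OF c] W(2) by blast
      then show ?thesis using f True by (simp add: X_def)
    qed (simp add: X_def)
    ultimately show ?thesis by simp
  qed
  ultimately show ?thesis by (simp add: VF_iff)
qed

text \<open>Hadamard's lemma makes every derivation at a point a combination of coordinate derivations.\<close>

proposition coordinates_exist:
  obtains W x X where "open W" "p \<in> W" "\<And>b. x b \<in> Cinf A" "\<And>b. X b \<in> VF A"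
    and "\<And>q b b'. q \<in> W \<Longrightarrow> b \<in> Basis \<Longrightarrow> b' \<in> Basis \<Longrightarrow> X b q (x b') = (if b = b' then 1 else 0)"
    and "\<And>q v f. q \<in> W \<Longrightarrow> v \<in> tangent A q \<Longrightarrow> v f = (\<Sum>b\<in>(Basis::'e set). v (x b) * X b q f)"
proof -
  obtain U \<phi> where c: "(U, \<phi>) \<in> A" "p \<in> U" by (rule chart_cover)
  note oU = chart_open[OF c(1)] and oi = chart_open_image[OF c(1)]
  obtain W \<rho> where b: "bump U W \<rho>" "p \<in> W" using bump_exists[OF oU c(2)] .
  note \<rho> = bumpD[OF b(1)]
  obtain Q where Q: "open Q" "Q \<union> U = UNIV" "\<forall>q\<in>Q. \<rho> q = 0" using \<rho>(6) by blast
  have iv: "inv_into U \<phi> (\<phi> q) = q" if "q \<in> U" for q using chart_inv[OF c(1) that] .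
  \<comment> \<open>The cut-off is written through the chart and back, so that the function
    literally has the shape \<open>F (\<phi> q)\<close> required by
    \<open>Cinf_chart\<close>.\<close>
  define x where "x b q = (if q \<in> U then \<rho> (inv_into U \<phi> (\<phi> q)) * (\<phi> q \<bullet> b) else 0)" for b q
  define X where "X b = (\<lambda>q f. if f \<in> Cinf A \<and> q \<in> U
    then \<rho> q * frechet_derivative (\<lambda>y. f (inv_into U \<phi> y)) (at (\<phi> q)) b else 0)" for b
  have xC: "x b \<in> Cinf A" for b
    unfolding x_def
    by (rule Cinf_chart[OF c(1) oU subset_refl _ Q(1,2)])
       (use Q(3) iv in \<open>auto intro!: smooth_on_mult[OF oi CinfD[OF \<rho>(1) c(1)]]
          smooth_on_bounded_linear[OF bounded_linear_inner_left oi]\<close>)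
  have XV: "X b \<in> VF A" for b
    unfolding X_def by (rule coordinate_field[OF c(1) oU subset_refl b(1)])
  have UW: "U \<inter> W = W" using \<rho>(3) by auto
  have oW: "open (\<phi> ` W)" using chart_image_open[OF c(1) \<rho>(2)] UW by simp
  show thesis
  proof (rule that[of W x X])
    show "open W" "p \<in> W" "\<And>b. x b \<in> Cinf A" "\<And>b. X b \<in> VF A" using \<rho> b xC XV by auto
    show "X b q (x b') = (if b = b' then 1 else 0)" if q: "q \<in> W" "b \<in> Basis" "b' \<in> Basis" for q b b'
    proof -
      have "((\<lambda>y. x b' (inv_into U \<phi> y)) has_derivative (\<lambda>v. v \<bullet> b')) (at (\<phi> q))"
      proof (rule has_derivative_transform_within_open[OF _ oW])
        show "((\<lambda>y. y \<bullet> b') has_derivative (\<lambda>v. v \<bullet> b')) (at (\<phi> q))"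
          by (auto intro!: derivative_eq_intros)
        show "\<phi> q \<in> \<phi> ` W" using q by simp
        show "y \<bullet> b' = x b' (inv_into U \<phi> y)" if "y \<in> \<phi> ` W" for y
          using that iv \<rho>(3,4) by (auto simp: x_def subset_iff)
      qed
      from frechet_derivative_at[OF this]
      have fd: "frechet_derivative (\<lambda>y. x b' (inv_into U \<phi> y)) (at (\<phi> q)) b = b \<bullet> b'"
        by (rule fun_cong[OF sym])
      have "X b q (x b') = b \<bullet> b'"
        using q(1) \<rho>(3,4) xC unfolding X_def by (simp add: fd subset_iff)
      then show ?thesis using q by (simp add: inner_Basis)
    qed
    show "v f = (\<Sum>b\<in>(Basis::'e set). v (x b) * X b q f)" if q: "q \<in> W" and v: "v \<in> tangent A q" for q v f
    proof (cases "f \<in> Cinf A")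
      case False
      then show ?thesis using tangent_off[OF v] by (simp add: X_def)
    next
      case f: True
      let ?F = "\<lambda>y. f (inv_into U \<phi> y)"
      have "\<phi> q \<in> \<phi> ` W" using q by simp
      from openE[OF oW this] obtain r where r: "r > 0" "ball (\<phi> q) r \<subseteq> \<phi> ` W" by blast
      have "smooth_on (ball (\<phi> q) r) ?F"
        by (rule smooth_on_subset[OF CinfD[OF f c(1)] oi open_ball order_trans[OF r(2) image_mono[OF \<rho>(3)]]])
      then obtain g where g: "\<And>b. smooth_on (ball (\<phi> q) r) (g b)"
          "\<And>y. y \<in> ball (\<phi> q) r \<Longrightarrow> ?F y = ?F (\<phi> q) + (\<Sum>b\<in>Basis. ((y - \<phi> q) \<bullet> b) * g b y)"
          "\<And>b. g b (\<phi> q) = frechet_derivative ?F (at (\<phi> q)) b"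
        using r(1) by (rule Hadamard) (rule that; assumption)
      define B where "B = U \<inter> \<phi> -` ball (\<phi> q) r"
      have oB: "open B" unfolding B_def
        by (rule continuous_open_preimage[OF _ oU open_ball])
           (use chart_homeo[OF c(1)] in \<open>simp add: homeomorphism_def\<close>)
      have qB: "q \<in> B" using q UW r(1) by (auto simp: B_def)
      have BW: "B \<subseteq> W"
      proof
        fix q' assume q': "q' \<in> B"
        then obtain q'' where "q'' \<in> W" "\<phi> q' = \<phi> q''" using r(2) by (auto simp: B_def)
        then show "q' \<in> W" using q' iv UW by (metis B_def IntD1)
      qed
      have iB: "\<phi> ` B \<subseteq> ball (\<phi> q) r" "open (\<phi> ` B)"
        using chart_image_open[OF c(1) oB] by (auto simp: B_def Int_assoc[symmetric])
      obtain V \<sigma> where s: "bump B V \<sigma>" "q \<in> V" using bump_exists[OF oB qB] .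
      note \<sigma> = bumpD[OF s(1)]
      obtain P where P: "open P" "P \<union> B = UNIV" "\<forall>q\<in>P. \<sigma> q = 0" using \<sigma>(6) by blast
      \<comment> \<open>Hadamard's coefficients live on a ball in the chart. Cutting them off with
        \<open>\<sigma>\<close> makes them global smooth functions without changing them near
        \<open>q\<close>, so that \<open>v\<close> can be applied to them.\<close>
      define G where "G b q' = (if q' \<in> B then \<sigma> (inv_into U \<phi> (\<phi> q')) * g b (\<phi> q') else 0)" for b q'
      have GC: "G b \<in> Cinf A" for b unfolding G_def
      proof (rule Cinf_chart[OF c(1) oB _ _ P(1,2)])
        show BU: "B \<subseteq> U" by (auto simp: B_def)
        show "smooth_on (\<phi> ` B) (\<lambda>y. \<sigma> (inv_into U \<phi> y) * g b y)"
          by (rule smooth_on_mult[OF iB(2) smooth_on_subset[OF CinfD[OF \<sigma>(1) c(1)] oi iB(2)]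
                smooth_on_subset[OF g(1) open_ball iB(2,1)]]) (use BU in auto)
        show "\<sigma> (inv_into U \<phi> (\<phi> q)) * g b (\<phi> q) = 0" if "q \<in> P \<inter> B" for q
          using that iv BU P(3) by auto
      qed
      have near: "f q' = f q + (\<Sum>b\<in>Basis. (x b q' - x b q) * G b q')" if "q' \<in> V" for q'
      proof -
        have q': "q' \<in> B" "q' \<in> U" "q' \<in> W" using that \<sigma>(3) BW by (auto simp: B_def)
        have "q \<in> U" using q UW by auto
        with g(2)[of "\<phi> q'"] q' have "f q' = f q + (\<Sum>b\<in>Basis. ((\<phi> q' - \<phi> q) \<bullet> b) * g b (\<phi> q'))"
          by (simp add: B_def iv)
        moreover have "x b q' = \<phi> q' \<bullet> b" "x b q = \<phi> q \<bullet> b" "G b q' = g b (\<phi> q')" for b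
          using q' q UW iv \<rho>(4) \<sigma>(4)[OF that] by (auto simp: x_def G_def)
        ultimately show ?thesis by (simp add: inner_diff_left)
      qed
      have "v f = v (\<lambda>q'. f q + (\<Sum>b\<in>Basis. (x b q' - x b q) * G b q'))"
        by (rule tangent_local[OF v f _ \<sigma>(2) s(2) near]) (simp_all add: Cinf_sum xC GC)
      also have "\<dots> = (\<Sum>b\<in>Basis. v (\<lambda>q'. (x b q' - x b q) * G b q'))"
        by (simp add: tangent_add[OF v] tangent_const[OF v] tangent_sum[OF v] Cinf_sum xC GC)
      \<comment> \<open>The factor \<open>x b q' - x b q\<close> vanishes at \<open>q' = q\<close>,
        so the product rule keeps only the term in which this factor is differentiated.\<close>
      also have "\<dots> = (\<Sum>b\<in>Basis. v (x b) * G b q)"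
        by (simp add: tangent_mult[OF v] tangent_diff[OF v] tangent_const[OF v] xC GC)
      also have "\<dots> = (\<Sum>b\<in>(Basis::'e set). v (x b) * X b q f)"
        using qB q UW iv f g(3) \<rho>(4)[OF q] \<sigma>(4)[OF s(2)] by (auto simp: G_def X_def intro!: sum.cong)
      finally show ?thesis .
    qed
  qed
qed

text \<open>The functions \<open>\<rho>\<^sub>n = b\<^sub>n (1 - b\<^sub>0) \<cdots> (1 - b\<^sub>n\<^sub>-\<^sub>1)\<close> built from a countable
  family of bump functions add up to \<open>1\<close>, and \<open>\<rho>\<^sub>n\<close> vanishes wherever an earlier \<open>b\<^sub>k\<close> is \<open>1\<close>.\<close>

lemma partition_of_unity:
  assumes W: "\<And>p. open (W p)" "\<And>p. p \<in> W p"
  obtains c :: "nat \<Rightarrow> 'm" and V \<rho> where "\<And>n. \<rho> n \<in> Cinf A" "\<And>n. open (V n)" "(\<Union>n. V n) = UNIV"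
    and "\<And>n. \<exists>Q. open Q \<and> Q \<union> W (c n) = UNIV \<and> (\<forall>q\<in>Q. \<rho> n q = 0)"
    and "\<And>k n q. k < n \<Longrightarrow> q \<in> V k \<Longrightarrow> \<rho> n q = 0"
    and "\<And>k q. q \<in> V k \<Longrightarrow> (\<Sum>n\<le>k. \<rho> n q) = 1"
proof -
  have "\<exists>V b. bump (W p) V b \<and> p \<in> V" for p
    using bump_exists[OF W(1,2)[of p]] by blast
  then obtain V b where b: "\<And>p. bump (W p) (V p) (b p)" "\<And>p. p \<in> V p" by metis
  \<comment> \<open>Second countability: countably many of the sets \<open>V p\<close> already cover
    the manifold.\<close>
  obtain F where F: "F \<subseteq> range V" "countable F" "\<Union>F = \<Union>(range V)"
    using Lindelof[of "range V"] bumpD(2)[OF b(1)] by blast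
  obtain C where C: "countable C" "F = V ` C"
    using F(1,2) countable_subset_image[of F V UNIV] by blast
  have "UNIV = (\<Union>p\<in>C. V p)" using F(3) C(2) b(2) by blast
  moreover from this have "C \<noteq> {}" by auto
  ultimately have cov: "(\<Union>n. V (from_nat_into C n)) = UNIV"
    using C(1) by (metis image_image range_from_nat_into)
  define c where "c = from_nat_into C"
  define \<rho> where "\<rho> n q = b (c n) q * (\<Prod>k<n. 1 - b (c k) q)" for n q
  note B = bumpD[OF b(1)]
  show thesis
  proof (rule that[of \<rho> "\<lambda>n. V (c n)" c])
    show "\<rho> n \<in> Cinf A" for n
      unfolding \<rho>_def by (intro Cinf_mult B(1) Cinf_prod Cinf_diff Cinf_const)
    show "open (V (c n))" for n by (rule B(2))
    show "(\<Union>n. V (c n)) = UNIV" using cov by (simp add: c_def)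
    show "\<exists>Q. open Q \<and> Q \<union> W (c n) = UNIV \<and> (\<forall>q\<in>Q. \<rho> n q = 0)" for n
      using B(6)[of "c n"] by (auto simp: \<rho>_def)
    have one: "b (c k) q = 1" if "q \<in> V (c k)" for k q using that B(4) by blast
    show "\<rho> n q = 0" if "k < n" "q \<in> V (c k)" for k n q
      using that one by (auto simp: \<rho>_def)
    \<comment> \<open>The partial sums telescope to one minus a product; the product vanishes as
      soon as one of its functions \<open>b (c k)\<close> equals 1 at \<open>q\<close>.\<close>
    have tele: "(\<Sum>n<m. \<rho> n q) = 1 - (\<Prod>k<m. 1 - b (c k) q)" for m q
      by (induction m) (simp_all add: \<rho>_def algebra_simps)
    show "(\<Sum>n\<le>k. \<rho> n q) = 1" if "q \<in> V (c k)" for k q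
    proof -
      have "(\<Prod>j\<le>k. 1 - b (c j) q) = 0" by (rule prod_zero) (use one[OF that] in auto)
      then show ?thesis using tele[of q "Suc k"] by (simp only: lessThan_Suc_atMost)
    qed
  qed
qed

section \<open>Germs of smooth functions and linear systems\<close>

text \<open>Smoothness near \<open>p\<close> for functions that are arbitrary away from
  \<open>p\<close>, such as coefficients with respect to a local frame. The representative is a
  global function because \<open>Cinf A\<close> contains only such functions.\<close>

definition gsm :: "'m \<Rightarrow> ('m \<Rightarrow> real) \<Rightarrow> bool" where
  "gsm p f \<longleftrightarrow> (\<exists>h\<in>Cinf A. \<forall>\<^sub>F q in nhds p. f q = h q)"

lemma gsm_Cinf: "f \<in> Cinf A \<Longrightarrow> gsm p f"
  unfolding gsm_def by (intro bexI[of _ f]) simp_all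

lemma gsm_cong:
  assumes "gsm p f" "\<forall>\<^sub>F q in nhds p. g q = f q"
  shows "gsm p g"
proof -
  obtain h where h: "h \<in> Cinf A" "\<forall>\<^sub>F q in nhds p. f q = h q" using assms(1) by (auto simp: gsm_def)
  from assms(2) h(2) have "\<forall>\<^sub>F q in nhds p. g q = h q" by eventually_elim simp
  with h(1) show ?thesis by (auto simp: gsm_def)
qed

lemma gsm_add: "gsm p f \<Longrightarrow> gsm p g \<Longrightarrow> gsm p (\<lambda>q. f q + g q)"
  unfolding gsm_def by (fastforce elim: eventually_elim2 intro: Cinf_add)

lemma gsm_mult: "gsm p f \<Longrightarrow> gsm p g \<Longrightarrow> gsm p (\<lambda>q. f q * g q)"
  unfolding gsm_def by (fastforce elim: eventually_elim2 intro: Cinf_mult)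

lemma gsm_diff: "gsm p f \<Longrightarrow> gsm p g \<Longrightarrow> gsm p (\<lambda>q. f q - g q)"
  unfolding gsm_def by (fastforce elim: eventually_elim2 intro: Cinf_diff)

lemma gsm_sum: "(\<And>i. i \<in> I \<Longrightarrow> gsm p (f i)) \<Longrightarrow> gsm p (\<lambda>q. \<Sum>i\<in>I. f i q)"
  by (induction I rule: infinite_finite_induct) (simp_all add: gsm_add gsm_Cinf)

lemma gsm_nonzero:
  assumes "gsm p f" "f p \<noteq> 0"
  shows "\<forall>\<^sub>F q in nhds p. f q \<noteq> 0"
proof -
  obtain h where h: "h \<in> Cinf A" "\<forall>\<^sub>F q in nhds p. f q = h q" using assms(1) by (auto simp: gsm_def)
  have "h p \<noteq> 0" using eventually_nhds_x_imp_x[OF h(2)] assms(2) by simp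
  moreover have "filterlim h (nhds (h p)) (nhds p)"
    using Cinf_continuous[OF h(1)] continuous_at by (metis tendsto_at_iff_tendsto_nhds)
  ultimately have "\<forall>\<^sub>F q in nhds p. h q \<noteq> 0"
    by (metis tendsto_imp_eventually_ne)
  with h(2) show ?thesis by eventually_elim simp
qed

text \<open>The reciprocal of the representative \<open>h\<close> is not smooth where
  \<open>h\<close> vanishes; a bump function supported where \<open>h\<close> is nonzero turns it
  into a global smooth function with the right germ.\<close>

lemma gsm_inverse:
  assumes "gsm p f" "f p \<noteq> 0"
  shows "gsm p (\<lambda>q. inverse (f q))"
proof -
  obtain h where h: "h \<in> Cinf A" "\<forall>\<^sub>F q in nhds p. f q = h q" using assms(1) by (auto simp: gsm_def)
  define W where "W = {q. h q \<noteq> 0}"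
  have oW: "open W"
  proof -
    have "continuous_on UNIV h" using Cinf_continuous[OF h(1)] by (simp add: continuous_at_imp_continuous_on)
    then have "open (h -` (- {0}))" by (intro open_vimage) auto
    moreover have "h -` (- {0}) = W" by (auto simp: W_def)
    ultimately show ?thesis by simp
  qed
  have "p \<in> W" using eventually_nhds_x_imp_x[OF h(2)] assms(2) by (simp add: W_def)
  then obtain V \<rho> where b: "bump W V \<rho>" "p \<in> V" using bump_exists[OF oW] by blast
  note \<rho> = bumpD[OF b(1)]
  obtain Q where Q: "open Q" "Q \<union> W = UNIV" "\<forall>q\<in>Q. \<rho> q = 0" using \<rho>(6) by blast
  let ?k = "\<lambda>q. \<rho> q * inverse (h q)"
  have "?k \<in> Cinf A"
  proof (rule Cinf_chartI)
    fix p'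
    show "\<exists>W. open W \<and> p' \<in> W \<and> (\<forall>U \<phi>. (U, \<phi>) \<in> A \<longrightarrow> smooth_on (\<phi> ` (U \<inter> W)) (\<lambda>y. ?k (inv_into U \<phi> y)))"
    proof (cases "p' \<in> W")
      case True
      have "smooth_on (\<phi> ` (U \<inter> W)) (\<lambda>y. ?k (inv_into U \<phi> y))" if c: "(U, \<phi>) \<in> A" for U \<phi>
      proof -
        note o = chart_image_open[OF c oW]
        have s: "smooth_on (\<phi> ` (U \<inter> W)) (\<lambda>y. f (inv_into U \<phi> y))" if "f \<in> Cinf A" for f
          by (rule smooth_on_subset[OF CinfD[OF that c] chart_open_image[OF c] o]) auto
        show ?thesis
          by (rule smooth_on_mult[OF o s[OF \<rho>(1)] smooth_on_inverse[OF o s[OF h(1)]]])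
             (use chart_inv[OF c] in \<open>auto simp: W_def\<close>)
      qed
      then show ?thesis using True oW by blast
    next
      case False
      have "smooth_on (\<phi> ` (U \<inter> Q)) (\<lambda>y. ?k (inv_into U \<phi> y))" if c: "(U, \<phi>) \<in> A" for U \<phi>
        by (rule smooth_on_cong[OF chart_image_open[OF c Q(1)] smooth_on_const[OF chart_image_open[OF c Q(1)], of 0]])
           (use chart_inv[OF c] Q(3) in auto)
      then show ?thesis using False Q by blast
    qed
  qed
  moreover have "\<forall>\<^sub>F q in nhds p. \<rho> q = 1"
    using \<rho>(2,4) b(2) by (auto simp: eventually_nhds)
  with h(2) have "\<forall>\<^sub>F q in nhds p. inverse (f q) = ?k q"
    by eventually_elim simp
  ultimately show ?thesis by (auto simp: gsm_def)
qed

text \<open>Gaussian elimination over germs. As the matrix is the identity at \<open>p\<close>, the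
  pivot \<open>a k k\<close> is nonzero near \<open>p\<close>, and the Schur complement
  \<open>?a\<close> is again the identity at \<open>p\<close>, so the induction repeats. The
  functions \<open>c\<close> are merely some pointwise solution; their smoothness is the
  point.\<close>

lemma smooth_solution:
  assumes "finite I"
  shows "(\<And>i j. i \<in> I \<Longrightarrow> j \<in> I \<Longrightarrow> gsm p (a i j)) \<Longrightarrow>
    (\<And>i j. i \<in> I \<Longrightarrow> j \<in> I \<Longrightarrow> a i j p = (if i = j then 1 else 0)) \<Longrightarrow>
    (\<And>i. i \<in> I \<Longrightarrow> gsm p (y i)) \<Longrightarrow>
    (\<And>i. i \<in> I \<Longrightarrow> \<forall>\<^sub>F q in nhds p. (\<Sum>j\<in>I. a i j q * c j q) = y i q) \<Longrightarrow>
    \<forall>j\<in>I. gsm p (c j)"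
  using assms
proof (induction I arbitrary: a y)
  case (insert k I)
  have k1: "a k k p \<noteq> 0" and gk: "gsm p (a k k)" using insert.prems(1,2) by auto
  note nz = gsm_nonzero[OF gk k1] and iv = gsm_inverse[OF gk k1]
  let ?a = "\<lambda>i j q. a i j q - a i k q * a k j q * inverse (a k k q)"
  let ?y = "\<lambda>i q. y i q - a i k q * y k q * inverse (a k k q)"
  have ek: "\<forall>\<^sub>F q in nhds p. a k k q * c k q + (\<Sum>j\<in>I. a k j q * c j q) = y k q"
    using insert.prems(4)[of k] insert.hyps by simp
  have I: "\<forall>j\<in>I. gsm p (c j)"
  proof (rule insert.IH[of ?a ?y])
    show "gsm p (?a i j)" if "i \<in> I" "j \<in> I" for i j
      using that by (intro gsm_diff gsm_mult iv insert.prems(1)) auto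
    show "?a i j p = (if i = j then 1 else 0)" if "i \<in> I" "j \<in> I" for i j
      using that insert.prems(2)[of i j] insert.prems(2)[of i k] insert.hyps by auto
    show "gsm p (?y i)" if "i \<in> I" for i
      using that by (intro gsm_diff gsm_mult iv insert.prems(1,3)) auto
    show "\<forall>\<^sub>F q in nhds p. (\<Sum>j\<in>I. ?a i j q * c j q) = ?y i q" if i: "i \<in> I" for i
    proof -
      have "\<forall>\<^sub>F q in nhds p. a i k q * c k q + (\<Sum>j\<in>I. a i j q * c j q) = y i q"
        using insert.prems(4)[of i] insert.hyps i by simp
      with ek nz show ?thesis
      proof eventually_elim
        case (elim q)
        have "(\<Sum>j\<in>I. ?a i j q * c j q)
            = (\<Sum>j\<in>I. a i j q * c j q) - a i k q * inverse (a k k q) * (\<Sum>j\<in>I. a k j q * c j q)"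
          by (simp add: left_diff_distrib sum_subtractf sum_distrib_left algebra_simps)
        also have "(\<Sum>j\<in>I. a i j q * c j q) = y i q - a i k q * c k q" using elim by simp
        also have "(\<Sum>j\<in>I. a k j q * c j q) = y k q - a k k q * c k q" using elim by simp
        finally show ?case using elim(2) by (simp add: field_simps)
      qed
    qed
  qed
  have "gsm p (\<lambda>q. (y k q - (\<Sum>j\<in>I. a k j q * c j q)) * inverse (a k k q))"
    by (intro gsm_mult gsm_diff gsm_sum iv insert.prems(1,3)) (use I in auto)
  moreover have "\<forall>\<^sub>F q in nhds p. c k q = (y k q - (\<Sum>j\<in>I. a k j q * c j q)) * inverse (a k k q)"
    using ek nz by eventually_elim (simp add: field_simps)
  ultimately have "gsm p (c k)" by (rule gsm_cong)
  then show ?case using I by simp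
qed simp

text \<open>The same elimination, used to construct a solution: solve the reduced system for the
  other unknowns, then read off the unknown at \<open>k\<close> from the pivot row.\<close>

lemma smooth_solution_exists:
  assumes "finite I"
  shows "(\<And>i j. i \<in> I \<Longrightarrow> j \<in> I \<Longrightarrow> gsm p (a i j)) \<Longrightarrow>
    (\<And>i j. i \<in> I \<Longrightarrow> j \<in> I \<Longrightarrow> a i j p = (if i = j then 1 else 0)) \<Longrightarrow>
    (\<And>i. i \<in> I \<Longrightarrow> gsm p (y i)) \<Longrightarrow>
    \<exists>c. (\<forall>j\<in>I. gsm p (c j)) \<and> (\<forall>i\<in>I. \<forall>\<^sub>F q in nhds p. (\<Sum>j\<in>I. a i j q * c j q) = y i q)"
  using assms
proof (induction I arbitrary: a y)
  case (insert k I)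
  have k1: "a k k p \<noteq> 0" and gk: "gsm p (a k k)" using insert.prems(1,2) by auto
  note nz = gsm_nonzero[OF gk k1] and iv = gsm_inverse[OF gk k1]
  let ?a = "\<lambda>i j q. a i j q - a i k q * a k j q * inverse (a k k q)"
  let ?y = "\<lambda>i q. y i q - a i k q * y k q * inverse (a k k q)"
  have "\<exists>c. (\<forall>j\<in>I. gsm p (c j)) \<and> (\<forall>i\<in>I. \<forall>\<^sub>F q in nhds p. (\<Sum>j\<in>I. ?a i j q * c j q) = ?y i q)"
  proof (rule insert.IH)
    show "gsm p (?a i j)" if "i \<in> I" "j \<in> I" for i j
      using that by (intro gsm_diff gsm_mult iv insert.prems(1)) auto
    show "?a i j p = (if i = j then 1 else 0)" if "i \<in> I" "j \<in> I" for i j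
      using that insert.prems(2)[of i j] insert.prems(2)[of i k] insert.hyps by auto
    show "gsm p (?y i)" if "i \<in> I" for i
      using that by (intro gsm_diff gsm_mult iv insert.prems(1,3)) auto
  qed
  then obtain c where c: "\<And>j. j \<in> I \<Longrightarrow> gsm p (c j)"
    "\<And>i. i \<in> I \<Longrightarrow> \<forall>\<^sub>F q in nhds p. (\<Sum>j\<in>I. ?a i j q * c j q) = ?y i q" by blast
  let ?ck = "\<lambda>q. (y k q - (\<Sum>j\<in>I. a k j q * c j q)) * inverse (a k k q)"
  let ?c = "c(k := ?ck)"
  have eq: "(\<Sum>j\<in>insert k I. a i j q * ?c j q) = a i k q * ?ck q + (\<Sum>j\<in>I. a i j q * c j q)" for i q
    using insert.hyps by (simp add: sum.insert) (intro sum.cong; auto)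
  have gck: "gsm p ?ck"
    by (intro gsm_mult gsm_diff gsm_sum iv insert.prems(1,3) c(1)) auto
  have "gsm p (?c j)" if "j \<in> insert k I" for j
    using that gck c(1) by auto
  moreover have "\<forall>\<^sub>F q in nhds p. (\<Sum>j\<in>insert k I. a i j q * ?c j q) = y i q" if i: "i \<in> insert k I" for i
  proof (cases "i = k")
    case True
    show ?thesis using nz unfolding eq True by eventually_elim (simp add: field_simps)
  next
    case False
    with i have i: "i \<in> I" by simp
    show ?thesis using c(2)[OF i] nz unfolding eq
    proof eventually_elim
      case (elim q)
      have "(\<Sum>j\<in>I. ?a i j q * c j q)
          = (\<Sum>j\<in>I. a i j q * c j q) - a i k q * inverse (a k k q) * (\<Sum>j\<in>I. a k j q * c j q)"
        by (simp add: left_diff_distrib sum_subtractf sum_distrib_left algebra_simps)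
      with elim show ?case by (simp add: field_simps)
    qed
  qed
  ultimately show ?case by blast
qed simp

end

text \<open>\<open>\<Lambda>\<close> is a linear space of rows, and the premise on \<open>c\<close>
  says that these rows have no common kernel on the unknowns \<open>I\<close>. Choosing rows that
  form an identity matrix turns an overdetermined system with injective matrix into the square
  system that \<open>smooth_solution\<close> can handle.\<close>

lemma unit_functionals:
  fixes \<Lambda> :: "('i \<Rightarrow> real) set"
  assumes "finite I" and zero: "(\<lambda>i. 0) \<in> \<Lambda>"
    and comb: "\<And>l m c. l \<in> \<Lambda> \<Longrightarrow> m \<in> \<Lambda> \<Longrightarrow> (\<lambda>i. l i + c * m i) \<in> \<Lambda>"
  shows "(\<And>c. (\<And>l. l \<in> \<Lambda> \<Longrightarrow> (\<Sum>i\<in>I. c i * l i) = 0) \<Longrightarrow> \<forall>i\<in>I. c i = 0) \<Longrightarrow>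
    \<exists>e. \<forall>i\<in>I. e i \<in> \<Lambda> \<and> (\<forall>j\<in>I. e i j = (if i = j then 1 else 0))"
  using assms(1)
proof (induction I)
  case (insert k I)
  have sums: "(\<lambda>j. l j + (\<Sum>i\<in>J. c i * e i j)) \<in> \<Lambda>"
    if "finite J" "l \<in> \<Lambda>" "\<And>i. i \<in> J \<Longrightarrow> e i \<in> \<Lambda>" for J l c e
    using that(1,3)
  proof (induction J)
    case empty
    then show ?case using that(2) by simp
  next
    case (insert i J)
    have "(\<lambda>j. (l j + (\<Sum>i\<in>J. c i * e i j)) + c i * e i j) \<in> \<Lambda>"
      using insert by (intro comb) auto
    then show ?case using insert.hyps by (simp add: algebra_simps)
  qed
  have "\<exists>e. \<forall>i\<in>I. e i \<in> \<Lambda> \<and> (\<forall>j\<in>I. e i j = (if i = j then 1 else 0))"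
  proof (rule insert.IH)
    fix c :: "'i \<Rightarrow> real" assume c: "\<And>l. l \<in> \<Lambda> \<Longrightarrow> (\<Sum>i\<in>I. c i * l i) = 0"
    have "\<forall>i\<in>insert k I. (c(k := 0)) i = 0"
    proof (rule insert.prems)
      fix l assume "l \<in> \<Lambda>"
      then have "(\<Sum>i\<in>I. c i * l i) = 0" by (rule c)
      moreover have "(\<Sum>i\<in>I. (c(k := 0)) i * l i) = (\<Sum>i\<in>I. c i * l i)"
        using insert.hyps by (intro sum.cong) auto
      ultimately show "(\<Sum>i\<in>insert k I. (c(k := 0)) i * l i) = 0" using insert.hyps by simp
    qed
    then show "\<forall>i\<in>I. c i = 0" using insert.hyps by (metis fun_upd_other insertI2)
  qed
  then obtain e where e: "\<And>i. i \<in> I \<Longrightarrow> e i \<in> \<Lambda>"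
    "\<And>i j. i \<in> I \<Longrightarrow> j \<in> I \<Longrightarrow> e i j = (if i = j then 1 else 0)" by metis
  \<comment> \<open>If the entry at \<open>k\<close> of every row were determined by its entries on
    \<open>I\<close> through the rows \<open>e\<close>, this vector would be a nonzero common zero
    of all rows. Hence some row \<open>l\<close> violates that relation.\<close>
  define c where "c = (\<lambda>i. - e i k)(k := 1)"
  have ck: "(\<Sum>i\<in>insert k I. c i * l i) = l k - (\<Sum>i\<in>I. l i * e i k)" for l
  proof -
    have "(\<Sum>i\<in>I. c i * l i) = (\<Sum>i\<in>I. - (l i * e i k))"
      using insert.hyps by (intro sum.cong) (auto simp: c_def)
    then show ?thesis using insert.hyps by (simp add: c_def sum_negf)
  qed
  have "\<exists>l\<in>\<Lambda>. l k - (\<Sum>i\<in>I. l i * e i k) \<noteq> 0"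
  proof (rule ccontr)
    assume "\<not> ?thesis"
    then have "\<forall>i\<in>insert k I. c i = 0" by (intro insert.prems) (simp add: ck)
    then show False by (simp add: c_def)
  qed
  then obtain l where l: "l \<in> \<Lambda>" "l k - (\<Sum>i\<in>I. l i * e i k) \<noteq> 0" by blast
  \<comment> \<open>Subtracting a combination of the old unit rows clears the entries of
    \<open>l\<close> on \<open>I\<close> and leaves a nonzero entry at \<open>k\<close>; after
    rescaling, this row clears the column \<open>k\<close> of the others.\<close>
  define m where "m j = l j - (\<Sum>i\<in>I. l i * e i j)" for j
  have m: "m \<in> \<Lambda>" using sums[OF insert.hyps(1) l(1) e(1), of _ "\<lambda>i. - l i"]
    by (simp add: m_def[abs_def] sum_negf)
  have mI: "m j = 0" if "j \<in> I" for j
    using that insert.hyps(1) by (simp add: m_def e(2) if_distrib[of "\<lambda>x. _ * x"] cong: if_cong)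
  have mk: "m k \<noteq> 0" using l by (simp add: m_def)
  define n where "n j = 0 + inverse (m k) * m j" for j
  have n: "n \<in> \<Lambda>" unfolding n_def by (rule comb[OF zero m])
  have nk: "n k = 1" "\<And>j. j \<in> I \<Longrightarrow> n j = 0" using mk mI by (auto simp: n_def)
  have en: "(\<lambda>j. e i j - e i k * n j) \<in> \<Lambda>" if "i \<in> I" for i
    using comb[OF e(1)[OF that] n, of "- e i k"] by simp
  let ?e = "\<lambda>i. if i = k then n else (\<lambda>j. e i j - e i k * n j)"
  have "?e i \<in> \<Lambda> \<and> (\<forall>j\<in>insert k I. ?e i j = (if i = j then 1 else 0))" if "i \<in> insert k I" for i
    using that nk n e insert.hyps en by auto
  then show ?case by (intro exI[of _ ?e]) blast
qed simp

section \<open>Bundles\<close>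

hide_const (open) algebroid.extend
hide_fact (open) algebroid.extend_def

lemma fmul_apply [simp]: "fmul f s p = f p *\<^sub>R s p"
  by (simp add: fmul_def)

lemma sum_fun_apply: "(\<Sum>i\<in>I. s i) p = (\<Sum>i\<in>I. s i p)"
  by (induction I rule: infinite_finite_induct) simp_all

text \<open>Keeping the action of a bundle map on sections as a named operation lets identities of
  bundle maps be treated as identities of operators on sections.\<close>

definition ap :: "('m \<Rightarrow> 'v \<Rightarrow> 'w) \<Rightarrow> ('m \<Rightarrow> 'v) \<Rightarrow> 'm \<Rightarrow> 'w" where
  "ap \<phi> s = (\<lambda>p. \<phi> p (s p))"

lemma ap_apply [simp]: "ap \<phi> s p = \<phi> p (s p)"
  by (simp add: ap_def)

lemma TM_simps [simp]: "sections (TM A) = VF A" "fibre (TM A) = tangent A"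
  by (simp_all add: TM_def TM_bundle_def)

lemma trivial_line_simps [simp]:
  "sections (trivial_line A) = Cinf A" "fibre (trivial_line A) p = UNIV"
  by (simp_all add: trivial_line_def)

lemma hom_fibre_iff: "h \<in> fibre (hom_bundle E F) p \<longleftrightarrow>
    (\<forall>x\<in>fibre E p. \<forall>y\<in>fibre E p. h (x + y) = h x + h y) \<and>
    (\<forall>c. \<forall>x\<in>fibre E p. h (c *\<^sub>R x) = c *\<^sub>R h x) \<and>
    (\<forall>x\<in>fibre E p. h x \<in> fibre F p) \<and> (\<forall>x. x \<notin> fibre E p \<longrightarrow> h x = 0)"
  by (auto simp: hom_bundle_def linmap_on_def image_subset_iff)

lemma hom_sec_iff: "\<phi> \<in> sections (hom_bundle E F) \<longleftrightarrow>
    (\<forall>p. \<phi> p \<in> fibre (hom_bundle E F) p) \<and> (\<forall>s\<in>sections E. ap \<phi> s \<in> sections F)"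
  by (auto simp: hom_bundle_def ap_def)

lemma hom_secD:
  assumes "\<phi> \<in> sections (hom_bundle E F)"
  shows "x \<in> fibre E p \<Longrightarrow> y \<in> fibre E p \<Longrightarrow> \<phi> p (x + y) = \<phi> p x + \<phi> p y"
    and "x \<in> fibre E p \<Longrightarrow> \<phi> p (c *\<^sub>R x) = c *\<^sub>R \<phi> p x"
    and "x \<in> fibre E p \<Longrightarrow> \<phi> p x \<in> fibre F p"
    and "x \<notin> fibre E p \<Longrightarrow> \<phi> p x = 0"
    and "s \<in> sections E \<Longrightarrow> ap \<phi> s \<in> sections F"
  using assms by (auto simp: hom_sec_iff hom_fibre_iff)

text \<open>The module and gluing axioms of a bundle, with no mention of local frames. Hom bundles,
  jet bundles and the structure kernel are handled at this level, so that no frames have to be built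
  for them.\<close>

locale mbundle = smooth_manifold A
  for A :: "('m::{t2_space, second_countable_topology}, 'e::euclidean_space) atlas" +
  fixes E :: "('m, 'v::real_vector, 'z) vbundle_scheme"
  assumes sec_fibre: "s \<in> sections E \<Longrightarrow> s p \<in> fibre E p"
    and fib_subspace: "subspace (fibre E p)"
    and sec_zero: "0 \<in> sections E"
    and sec_add: "s \<in> sections E \<Longrightarrow> t \<in> sections E \<Longrightarrow> s + t \<in> sections E"
    and sec_fmul: "f \<in> Cinf A \<Longrightarrow> s \<in> sections E \<Longrightarrow> fmul f s \<in> sections E"
    and sec_local: "(\<And>p. \<exists>U. open U \<and> p \<in> U \<and> (\<exists>t\<in>sections E. \<forall>q\<in>U. s q = t q)) \<Longrightarrow> s \<in> sections E"
begin

lemma fib_closed [simp]: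
  "0 \<in> fibre E p"
  "x \<in> fibre E p \<Longrightarrow> y \<in> fibre E p \<Longrightarrow> x + y \<in> fibre E p"
  "x \<in> fibre E p \<Longrightarrow> y \<in> fibre E p \<Longrightarrow> x - y \<in> fibre E p"
  "x \<in> fibre E p \<Longrightarrow> - x \<in> fibre E p"
  "x \<in> fibre E p \<Longrightarrow> c *\<^sub>R x \<in> fibre E p"
  using fib_subspace[of p] subspace_0 subspace_add subspace_diff subspace_neg subspace_scale by metis+

lemma sec_scaleR: "s \<in> sections E \<Longrightarrow> c *\<^sub>R s \<in> sections E"
proof -
  assume s: "s \<in> sections E"
  have "fmul (\<lambda>p. c) s = c *\<^sub>R s" by (rule ext) simp
  with sec_fmul[OF Cinf_const s] show ?thesis by metis
qed

lemma sec_minus: "s \<in> sections E \<Longrightarrow> - s \<in> sections E"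
  using sec_scaleR[of s "-1"] by simp

lemma sec_diff: "s \<in> sections E \<Longrightarrow> t \<in> sections E \<Longrightarrow> s - t \<in> sections E"
  using sec_add[OF _ sec_minus, of s t] by simp

lemma sec_sum: "(\<And>i. i \<in> I \<Longrightarrow> s i \<in> sections E) \<Longrightarrow> (\<Sum>i\<in>I. s i) \<in> sections E"
  by (induction I rule: infinite_finite_induct) (simp_all add: sec_zero sec_add)

lemma sec_lincomb:
  assumes "\<And>i. i \<in> I \<Longrightarrow> f i \<in> Cinf A" "\<And>i. i \<in> I \<Longrightarrow> s i \<in> sections E"
  shows "(\<lambda>p. \<Sum>i\<in>I. f i p *\<^sub>R s i p) \<in> sections E"
proof -
  have "(\<lambda>p. \<Sum>i\<in>I. f i p *\<^sub>R s i p) = (\<Sum>i\<in>I. fmul (f i) (s i))"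
    by (rule ext) (induction I rule: infinite_finite_induct, simp_all)
  moreover have "(\<Sum>i\<in>I. fmul (f i) (s i)) \<in> sections E"
    by (rule sec_sum) (rule sec_fmul[OF assms])
  ultimately show ?thesis by simp
qed

lemma sec_lincomb_const:
  "(\<And>i. i \<in> I \<Longrightarrow> s i \<in> sections E) \<Longrightarrow> (\<lambda>p. \<Sum>i\<in>I. c i *\<^sub>R s i p) \<in> sections E"
  using sec_lincomb[of I "\<lambda>i p. c i" s] by simp

lemma sec_eventually:
  assumes "\<And>p. \<exists>t\<in>sections E. \<forall>\<^sub>F q in nhds p. s q = t q"
  shows "s \<in> sections E"
proof (rule sec_local)
  fix p
  obtain t where "t \<in> sections E" "\<forall>\<^sub>F q in nhds p. s q = t q" using assms by blast
  then show "\<exists>U. open U \<and> p \<in> U \<and> (\<exists>t\<in>sections E. \<forall>q\<in>U. s q = t q)"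
    unfolding eventually_nhds by blast
qed

lemma dualD:
  assumes "\<alpha> \<in> sections (hom_bundle E (trivial_line A))"
  shows dual_add: "x \<in> fibre E p \<Longrightarrow> y \<in> fibre E p \<Longrightarrow> \<alpha> p (x + y) = \<alpha> p x + \<alpha> p y"
    and dual_scale: "x \<in> fibre E p \<Longrightarrow> \<alpha> p (c *\<^sub>R x) = c * \<alpha> p x"
    and dual_Cinf: "s \<in> sections E \<Longrightarrow> (\<lambda>p. \<alpha> p (s p)) \<in> Cinf A"
    and dual_zero: "\<alpha> p 0 = 0"
    and dual_minus: "x \<in> fibre E p \<Longrightarrow> \<alpha> p (- x) = - \<alpha> p x"
    and dual_diff: "x \<in> fibre E p \<Longrightarrow> y \<in> fibre E p \<Longrightarrow> \<alpha> p (x - y) = \<alpha> p x - \<alpha> p y"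
proof -
  note d = hom_secD[OF assms]
  show add: "\<alpha> p (x + y) = \<alpha> p x + \<alpha> p y" if "x \<in> fibre E p" "y \<in> fibre E p" for x y
    by (rule d(1)[OF that])
  show sc: "\<alpha> p (c *\<^sub>R x) = c * \<alpha> p x" if "x \<in> fibre E p" for c x using d(2)[OF that] by simp
  show "(\<lambda>p. \<alpha> p (s p)) \<in> Cinf A" if "s \<in> sections E" for s
    using d(5)[OF that] by (simp add: ap_def)
  show "\<alpha> p 0 = 0" using sc[OF fib_closed(1), of 0] by simp
  show mi: "\<alpha> p (- x) = - \<alpha> p x" if "x \<in> fibre E p" for x using sc[OF that, of "-1"] by simp
  show "\<alpha> p (x - y) = \<alpha> p x - \<alpha> p y" if "x \<in> fibre E p" "y \<in> fibre E p" for x y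
    using add[OF that(1) fib_closed(4)[OF that(2)]] mi[OF that(2)] by simp
qed

lemma dual_sum:
  assumes \<alpha>: "\<alpha> \<in> sections (hom_bundle E (trivial_line A))" and x: "\<And>i. i \<in> I \<Longrightarrow> x i \<in> fibre E p"
  shows "\<alpha> p (\<Sum>i\<in>I. c i *\<^sub>R x i) = (\<Sum>i\<in>I. c i * \<alpha> p (x i))"
proof -
  have "(\<Sum>i\<in>I. c i *\<^sub>R x i) \<in> fibre E p \<and> \<alpha> p (\<Sum>i\<in>I. c i *\<^sub>R x i) = (\<Sum>i\<in>I. c i * \<alpha> p (x i))"
    using x by (induction I rule: infinite_finite_induct)
      (simp_all add: dual_zero[OF \<alpha>] dual_add[OF \<alpha>] dual_scale[OF \<alpha>])
  then show ?thesis by simp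
qed

end

text \<open>The values are arbitrary functions instead of sections of a second bundle, so that the
  notion applies alike to anchors, to ad and to the difference of two brackets.\<close>

definition Clinear :: "('m::topological_space, 'e::euclidean_space) atlas \<Rightarrow> ('m, 'v::real_vector, 'z) vbundle_scheme \<Rightarrow>
    (('m \<Rightarrow> 'v) \<Rightarrow> ('m \<Rightarrow> 'w::real_vector)) \<Rightarrow> bool" where
  "Clinear A E F \<longleftrightarrow> (\<forall>s\<in>sections E. \<forall>t\<in>sections E. F (s + t) = F s + F t) \<and>
     (\<forall>f\<in>Cinf A. \<forall>s\<in>sections E. F (fmul f s) = fmul f (F s))"

lemma ClinearI:
  "(\<And>s t. s \<in> sections E \<Longrightarrow> t \<in> sections E \<Longrightarrow> F (s + t) = F s + F t) \<Longrightarrow>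
   (\<And>f s. f \<in> Cinf A \<Longrightarrow> s \<in> sections E \<Longrightarrow> F (fmul f s) = fmul f (F s)) \<Longrightarrow> Clinear A E F"
  by (simp add: Clinear_def)

lemma ClinearD:
  assumes "Clinear A E F"
  shows "s \<in> sections E \<Longrightarrow> t \<in> sections E \<Longrightarrow> F (s + t) = F s + F t"
    and "f \<in> Cinf A \<Longrightarrow> s \<in> sections E \<Longrightarrow> F (fmul f s) = fmul f (F s)"
  using assms by (simp_all add: Clinear_def)

text \<open>\<open>vector_bundle\<close> demands smooth coefficients with respect to frames. Here
  dual sections separate points of the fibres instead, and smooth coefficients follow in
  \<open>frame_coefficients\<close>. Separation is also what makes a section recoverable from its
  jet, since jets are encoded by dual sections.\<close>

locale sbundle = mbundle A E
  for A :: "('m::{t2_space, second_countable_topology}, 'e::euclidean_space) atlas"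
    and E :: "('m, 'v::real_vector, 'z) vbundle_scheme" +
  assumes frames: "\<exists>r. \<forall>p. \<exists>U b. open U \<and> p \<in> U \<and> local_frame E U r b"
    and dual_sep: "x \<in> fibre E p \<Longrightarrow>
      (\<And>\<alpha>. \<alpha> \<in> sections (hom_bundle E (trivial_line A)) \<Longrightarrow> \<alpha> p x = 0) \<Longrightarrow> x = 0"
begin

lemma dual_eq:
  assumes "x \<in> fibre E p" "y \<in> fibre E p"
    and "\<And>\<alpha>. \<alpha> \<in> sections (hom_bundle E (trivial_line A)) \<Longrightarrow> \<alpha> p x = \<alpha> p y"
  shows "x = y"
proof -
  have "x - y = 0"
    by (rule dual_sep[OF fib_closed(3)[OF assms(1,2)]]) (simp add: dual_diff[OF _ assms(1,2)] assms(3))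
  then show ?thesis by simp
qed

lemma frame_expansion:
  assumes fr: "local_frame E U r b" and q: "q \<in> U" and x: "x \<in> fibre E q"
  obtains c where "x = (\<Sum>i<r. c i *\<^sub>R b i q)"
proof -
  have inj: "inj_on (\<lambda>i. b i q) {..<r}" and sp: "span ((\<lambda>i. b i q) ` {..<r}) = fibre E q"
    using fr q by (auto simp: local_frame_def)
  have "x \<in> range (\<lambda>u. \<Sum>v\<in>(\<lambda>i. b i q) ` {..<r}. u v *\<^sub>R v)"
    using x span_finite[of "(\<lambda>i. b i q) ` {..<r}"] sp by auto
  then obtain u where "x = (\<Sum>v\<in>(\<lambda>i. b i q) ` {..<r}. u v *\<^sub>R v)" by auto
  then have "x = (\<Sum>i<r. u (b i q) *\<^sub>R b i q)" by (simp add: sum.reindex[OF inj])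
  then show thesis by (rule that)
qed

lemma frame_independent:
  assumes fr: "local_frame E U r b" and q: "q \<in> U" and z: "(\<Sum>i<r. c i *\<^sub>R b i q) = 0" and i: "i < r"
  shows "c i = 0"
proof -
  let ?B = "(\<lambda>i. b i q) ` {..<r}"
  have inj: "inj_on (\<lambda>i. b i q) {..<r}" and ind: "independent ?B"
    using fr q by (auto simp: local_frame_def)
  have "(\<Sum>v\<in>?B. c (the_inv_into {..<r} (\<lambda>i. b i q) v) *\<^sub>R v) = (\<Sum>i<r. c i *\<^sub>R b i q)"
    by (subst sum.reindex[OF inj]) (auto simp: the_inv_into_f_f[OF inj] intro!: sum.cong)
  then have "(\<Sum>v\<in>?B. c (the_inv_into {..<r} (\<lambda>i. b i q) v) *\<^sub>R v) = 0" using z by simp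
  from independentD[OF ind _ _ this, of "b i q"] i show ?thesis
    by (simp add: the_inv_into_f_f[OF inj])
qed

lemma frame_obtain:
  obtains U r b where "open U" "p \<in> U" "local_frame E U r b" "\<And>i. i < r \<Longrightarrow> b i \<in> sections E"
proof -
  obtain r U b where f: "open U" "p \<in> U" "local_frame E U r b" using frames by metis
  moreover have "b i \<in> sections E" if "i < r" for i using f(3) that by (simp add: local_frame_def)
  ultimately show thesis by (rule that)
qed

lemma fibre_extend:
  assumes x: "x \<in> fibre E p"
  obtains s where "s \<in> sections E" "s p = x"
proof -
  obtain U r b where f: "open U" "p \<in> U" "local_frame E U r b" "\<And>i. i < r \<Longrightarrow> b i \<in> sections E"
    using frame_obtain[where p = p] by metis
  obtain c where c: "x = (\<Sum>i<r. c i *\<^sub>R b i p)" using frame_expansion[OF f(3,2) x] .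
  have "(\<lambda>q. \<Sum>i<r. c i *\<^sub>R b i q) \<in> sections E" by (rule sec_lincomb_const) (simp add: f(4))
  with c show thesis by (intro that[of "\<lambda>q. \<Sum>i<r. c i *\<^sub>R b i q"]) auto
qed

lemma extend_sec:
  assumes "x \<in> fibre E p"
  shows "extend E p x \<in> sections E" "extend E p x p = x"
proof -
  obtain s where "s \<in> sections E \<and> s p = x" using fibre_extend[OF assms] by metis
  then have "extend E p x \<in> sections E \<and> extend E p x p = x"
    unfolding extend_def by (rule someI[where P = "\<lambda>s. s \<in> sections E \<and> s p = x"])
  then show "extend E p x \<in> sections E" "extend E p x p = x" by auto
qed

text \<open>Evaluating dual sections on the frame at \<open>p\<close> gives rows without common
  kernel, by separation and independence. \<open>unit_functionals\<close> selects dual sections that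
  are dual to the frame at \<open>p\<close>, and pairing \<open>s\<close> with them gives a square
  system for \<open>smooth_solution\<close>.\<close>

lemma frame_coefficients:
  assumes fr: "open U" "p \<in> U" "local_frame E U r b"
    and s: "\<And>\<alpha>. \<alpha> \<in> sections (hom_bundle E (trivial_line A)) \<Longrightarrow> gsm p (\<lambda>q. \<alpha> q (s q))"
    and c: "\<And>q. q \<in> U \<Longrightarrow> s q = (\<Sum>i<r. c i q *\<^sub>R b i q)"
  shows "\<forall>i<r. gsm p (c i)"
proof -
  let ?D = "sections (hom_bundle E (trivial_line A))"
  have bs: "\<And>i. i < r \<Longrightarrow> b i \<in> sections E" using fr(3) by (simp add: local_frame_def)
  define L where "L = {l. \<exists>\<alpha>\<in>?D. \<forall>i<r. l i = \<alpha> p (b i p)}"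
  have hom: "(\<lambda>q x. \<alpha> q x + k * \<beta> q x) \<in> ?D" if "\<alpha> \<in> ?D" "\<beta> \<in> ?D" for \<alpha> \<beta> k
    using hom_secD[OF that(1)] hom_secD[OF that(2)] dual_Cinf[OF that(1)] dual_Cinf[OF that(2)]
    by (auto simp: hom_sec_iff hom_fibre_iff ap_def algebra_simps intro!: Cinf_add Cinf_mult)
  have hom0: "(\<lambda>q x. 0) \<in> ?D"
    by (auto simp: hom_sec_iff hom_fibre_iff ap_def)
  have "\<exists>e. \<forall>i\<in>{..<r}. e i \<in> L \<and> (\<forall>j\<in>{..<r}. e i j = (if i = j then 1 else 0))"
  proof (rule unit_functionals)
    show "(\<lambda>i. 0) \<in> L" using hom0 unfolding L_def by force
    show "(\<lambda>i. l i + k * m i) \<in> L" if "l \<in> L" "m \<in> L" for l m k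
    proof -
      obtain \<alpha> \<beta> where "\<alpha> \<in> ?D" "\<forall>i<r. l i = \<alpha> p (b i p)" "\<beta> \<in> ?D" "\<forall>i<r. m i = \<beta> p (b i p)"
        using \<open>l \<in> L\<close> \<open>m \<in> L\<close> unfolding L_def by blast
      then show ?thesis using hom[of \<alpha> \<beta> k] unfolding L_def by (auto intro!: bexI)
    qed
    show "\<forall>i\<in>{..<r}. c i = 0" if z: "\<And>l. l \<in> L \<Longrightarrow> (\<Sum>i\<in>{..<r}. c i * l i) = 0" for c
    proof -
      have bp: "b i p \<in> fibre E p" if "i \<in> {..<r}" for i using that bs sec_fibre by auto
      have "(\<Sum>i<r. c i *\<^sub>R b i p) = 0"
      proof (rule dual_sep)
        show "(\<Sum>i<r. c i *\<^sub>R b i p) \<in> fibre E p"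
          by (rule subspace_sum[OF fib_subspace]) (simp add: bp)
        show "\<alpha> p (\<Sum>i<r. c i *\<^sub>R b i p) = 0" if \<alpha>: "\<alpha> \<in> ?D" for \<alpha>
        proof -
          have "(\<lambda>i. \<alpha> p (b i p)) \<in> L" using \<alpha> unfolding L_def by blast
          then have "(\<Sum>i<r. c i * \<alpha> p (b i p)) = 0" by (rule z)
          moreover have "\<alpha> p (\<Sum>i<r. c i *\<^sub>R b i p) = (\<Sum>i<r. c i * \<alpha> p (b i p))"
            by (rule dual_sum[OF \<alpha> bp])
          ultimately show ?thesis by simp
        qed
      qed
      then show ?thesis using frame_independent[OF fr(3,2)] by auto
    qed
  qed simp
  then obtain e where e: "\<And>i. i < r \<Longrightarrow> e i \<in> L" "\<And>i j. i < r \<Longrightarrow> j < r \<Longrightarrow> e i j = (if i = j then 1 else 0)"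
    by (metis (no_types) lessThan_iff)
  have "\<forall>i. \<exists>\<alpha>. i < r \<longrightarrow> \<alpha> \<in> ?D \<and> (\<forall>j<r. e i j = \<alpha> p (b j p))"
    using e(1) unfolding L_def by blast
  then obtain a where a: "\<And>i. i < r \<Longrightarrow> a i \<in> ?D" "\<And>i j. i < r \<Longrightarrow> j < r \<Longrightarrow> e i j = a i p (b j p)"
    by metis
  have "\<forall>j\<in>{..<r}. gsm p (c j)"
  proof (rule smooth_solution[of "{..<r}" p "\<lambda>i j q. a i q (b j q)" "\<lambda>i q. a i q (s q)"])
    show "gsm p (\<lambda>q. a i q (b j q))" if "i \<in> {..<r}" "j \<in> {..<r}" for i j
      using that by (intro gsm_Cinf dual_Cinf a bs) auto
    show "a i p (b j p) = (if i = j then 1 else 0)" if "i \<in> {..<r}" "j \<in> {..<r}" for i j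
      using that e(2) a(2) by auto
    show "gsm p (\<lambda>q. a i q (s q))" if "i \<in> {..<r}" for i using that by (intro s a) auto
    show "\<forall>\<^sub>F q in nhds p. (\<Sum>j\<in>{..<r}. a i q (b j q) * c j q) = a i q (s q)" if i: "i \<in> {..<r}" for i
      unfolding eventually_nhds
    proof (intro exI[of _ U] conjI ballI fr(1,2))
      fix q assume "q \<in> U"
      then have "a i q (s q) = a i q (\<Sum>j<r. c j q *\<^sub>R b j q)" using c by simp
      also have "\<dots> = (\<Sum>j<r. c j q * a i q (b j q))"
        by (rule dual_sum) (use i a(1) bs sec_fibre in auto)
      finally show "(\<Sum>j\<in>{..<r}. a i q (b j q) * c j q) = a i q (s q)" by (simp add: mult.commute)
    qed
  qed simp
  then show ?thesis by auto
qed

lemma local_expansion: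
  assumes fr: "open U" "p \<in> U" "local_frame E U r b"
    and s: "\<And>q. s q \<in> fibre E q" "\<And>\<alpha>. \<alpha> \<in> sections (hom_bundle E (trivial_line A)) \<Longrightarrow> gsm p (\<lambda>q. \<alpha> q (s q))"
  obtains V f where "open V" "p \<in> V" "\<And>i. f i \<in> Cinf A" "\<And>q. q \<in> V \<Longrightarrow> s q = (\<Sum>i<r. f i q *\<^sub>R b i q)"
proof -
  have "\<forall>q\<in>U. \<exists>c. s q = (\<Sum>i<r. c i *\<^sub>R b i q)"
    using frame_expansion[OF fr(3) _ s(1)] by metis
  then obtain c where c: "\<And>q. q \<in> U \<Longrightarrow> s q = (\<Sum>i<r. c q i *\<^sub>R b i q)" by metis
  have g: "\<forall>i<r. gsm p (\<lambda>q. c q i)" by (rule frame_coefficients[OF fr s(2)]) (use c in auto)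
  have "\<forall>i. \<exists>h. h \<in> Cinf A \<and> (i < r \<longrightarrow> (\<forall>\<^sub>F q in nhds p. c q i = h q))"
    using g Cinf_const unfolding gsm_def by metis
  then obtain h where h: "\<And>i. h i \<in> Cinf A" "\<And>i. i < r \<Longrightarrow> \<forall>\<^sub>F q in nhds p. c q i = h i q" by metis
  have "\<forall>\<^sub>F q in nhds p. \<forall>i\<in>{..<r}. c q i = h i q"
    by (rule eventually_ball_finite) (use h(2) in auto)
  moreover have "\<forall>\<^sub>F q in nhds p. q \<in> U" using fr(1,2) by (rule eventually_nhds_in_open)
  ultimately have "\<forall>\<^sub>F q in nhds p. s q = (\<Sum>i<r. h i q *\<^sub>R b i q)"
    by eventually_elim (simp add: c)
  then obtain V where "open V" "p \<in> V" "\<forall>q\<in>V. s q = (\<Sum>i<r. h i q *\<^sub>R b i q)"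
    unfolding eventually_nhds by blast
  with h(1) show thesis by (intro that[of V h]) auto
qed

lemma section_expansion:
  assumes fr: "open U" "p \<in> U" "local_frame E U r b" and s: "s \<in> sections E"
  obtains V f where "open V" "p \<in> V" "\<And>i. f i \<in> Cinf A" "\<And>q. q \<in> V \<Longrightarrow> s q = (\<Sum>i<r. f i q *\<^sub>R b i q)"
  by (rule local_expansion[OF fr, of s], rule sec_fibre[OF s], rule gsm_Cinf[OF dual_Cinf[OF _ s]], assumption)
     (rule that; assumption)

lemma is_vector_bundle: "vector_bundle A E"
proof -
  obtain r where r: "\<forall>p. \<exists>U b. open U \<and> p \<in> U \<and> local_frame E U r b" using frames by blast
  have "\<exists>U b. open U \<and> p \<in> U \<and> local_frame E U r b \<and>
      (\<forall>s\<in>sections E. \<exists>V f. open V \<and> p \<in> V \<and> (\<forall>i<r. f i \<in> Cinf A) \<and>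
         (\<forall>q\<in>V. s q = (\<Sum>i<r. f i q *\<^sub>R b i q)))" for p
  proof -
    obtain U b where f: "open U" "p \<in> U" "local_frame E U r b" using r by blast
    have "\<exists>V f. open V \<and> p \<in> V \<and> (\<forall>i<r. f i \<in> Cinf A) \<and> (\<forall>q\<in>V. s q = (\<Sum>i<r. f i q *\<^sub>R b i q))"
      if s: "s \<in> sections E" for s
    proof -
      obtain V h where V: "open V" "p \<in> V" "\<And>i. h i \<in> Cinf A" "\<And>q. q \<in> V \<Longrightarrow> s q = (\<Sum>i<r. h i q *\<^sub>R b i q)"
        by (rule section_expansion[OF f s]) (rule that; assumption)
      then show ?thesis by (intro exI[of _ V] exI[of _ h] conjI allI impI ballI)
    qed
    with f show ?thesis
      by (rule_tac exI[of _ U], rule_tac exI[of _ b], intro conjI ballI)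
  qed
  then have fr: "\<exists>r. \<forall>p. \<exists>U b. open U \<and> p \<in> U \<and> local_frame E U r b \<and>
      (\<forall>s\<in>sections E. \<exists>V f. open V \<and> p \<in> V \<and> (\<forall>i<r. f i \<in> Cinf A) \<and>
         (\<forall>q\<in>V. s q = (\<Sum>i<r. f i q *\<^sub>R b i q)))"
    by (intro exI[of _ r] allI)
  have loc: "\<forall>s. (\<forall>p. \<exists>U. open U \<and> p \<in> U \<and> (\<exists>t\<in>sections E. \<forall>q\<in>U. s q = t q)) \<longrightarrow> s \<in> sections E"
  proof (intro allI impI)
    fix s assume a: "\<forall>p. \<exists>U. open U \<and> p \<in> U \<and> (\<exists>t\<in>sections E. \<forall>q\<in>U. s q = t q)"
    show "s \<in> sections E" by (rule sec_local) (rule spec[OF a])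
  qed
  have 1: "\<forall>s\<in>sections E. \<forall>p. s p \<in> fibre E p" by (simp add: sec_fibre)
  have 2: "\<forall>s\<in>sections E. \<forall>t\<in>sections E. s + t \<in> sections E" by (simp add: sec_add)
  have 3: "\<forall>f\<in>Cinf A. \<forall>s\<in>sections E. fmul f s \<in> sections E" by (simp add: sec_fmul)
  show ?thesis unfolding vector_bundle_def
    by (rule conjI[OF 1 conjI[OF sec_zero conjI[OF 2 conjI[OF 3 conjI[OF loc fr]]]]])
qed

lemma Clinear_pointwise:
  fixes F :: "('m \<Rightarrow> 'v) \<Rightarrow> ('m \<Rightarrow> 'w::real_vector)"
  assumes F: "Clinear A E F" and st: "s \<in> sections E" "t \<in> sections E" "s p = t p"
  shows "F s p = F t p"
proof -
  note Fa = ClinearD(1)[OF F] and Ff = ClinearD(2)[OF F]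
  have F0: "F 0 = 0" using Fa[OF sec_zero sec_zero] by simp
  have Fsum: "F (\<Sum>i\<in>I. u i) = (\<Sum>i\<in>I. F (u i))" if "\<And>i. i \<in> I \<Longrightarrow> u i \<in> sections E"
    for I :: "nat set" and u
    using that by (induction I rule: infinite_finite_induct) (simp_all add: F0 Fa sec_sum)
  have vanish: "F u p = 0" if u: "u \<in> sections E" "u p = 0" for u
  proof -
    obtain U r b where f: "open U" "p \<in> U" "local_frame E U r b" "\<And>i. i < r \<Longrightarrow> b i \<in> sections E"
      using frame_obtain[where p = p] by metis
    obtain V h where V: "open V" "p \<in> V" "\<And>i. h i \<in> Cinf A" "\<And>q. q \<in> V \<Longrightarrow> u q = (\<Sum>i<r. h i q *\<^sub>R b i q)"
      by (rule section_expansion[OF f(1-3) u(1)]) (rule that; assumption)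
    have h0: "h i p = 0" if "i < r" for i
      using frame_independent[OF f(3,2) _ that, of "\<lambda>i. h i p"] V(2,4) u(2) by simp
    obtain W \<rho> where b: "bump V W \<rho>" "p \<in> W" using bump_exists[OF V(1,2)] .
    note \<rho> = bumpD[OF b(1)]
    \<comment> \<open>Near \<open>p\<close> the section is a frame combination whose coefficients
      vanish at \<open>p\<close>, and the remaining summand carries the factor
      \<open>1 - \<rho>\<close>, which vanishes at \<open>p\<close> too. Linearity over smooth
      functions carries these zeros over to \<open>F u\<close>.\<close>
    have "u = fmul (\<lambda>q. 1 - \<rho> q) u + (\<Sum>i<r. fmul (\<lambda>q. \<rho> q * h i q) (b i))"
    proof
      fix q
      have "(\<Sum>i<r. fmul (\<lambda>q. \<rho> q * h i q) (b i)) q = \<rho> q *\<^sub>R (\<Sum>i<r. h i q *\<^sub>R b i q)"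
        by (simp add: sum_fun_apply scaleR_sum_right)
      then show "u q = (fmul (\<lambda>q. 1 - \<rho> q) u + (\<Sum>i<r. fmul (\<lambda>q. \<rho> q * h i q) (b i))) q"
        using V(4)[of q] \<rho>(5)[of q] by (cases "q \<in> V") (auto simp: algebra_simps)
    qed
    then have "F u = F (fmul (\<lambda>q. 1 - \<rho> q) u + (\<Sum>i<r. fmul (\<lambda>q. \<rho> q * h i q) (b i)))"
      by (rule arg_cong)
    also have "\<dots> = F (fmul (\<lambda>q. 1 - \<rho> q) u) + F (\<Sum>i<r. fmul (\<lambda>q. \<rho> q * h i q) (b i))"
      by (rule Fa; intro sec_sum sec_fmul) (simp_all add: \<rho>(1) V(3) u(1) f(4))
    also have "F (\<Sum>i<r. fmul (\<lambda>q. \<rho> q * h i q) (b i)) = (\<Sum>i<r. F (fmul (\<lambda>q. \<rho> q * h i q) (b i)))"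
      by (rule Fsum, rule sec_fmul) (simp_all add: \<rho>(1) V(3) f(4))
    also have "F (fmul (\<lambda>q. 1 - \<rho> q) u) = fmul (\<lambda>q. 1 - \<rho> q) (F u)"
      by (rule Ff[OF _ u(1)]) (simp add: \<rho>(1))
    also have "(\<Sum>i<r. F (fmul (\<lambda>q. \<rho> q * h i q) (b i))) = (\<Sum>i<r. fmul (\<lambda>q. \<rho> q * h i q) (F (b i)))"
      by (rule sum.cong[OF refl], rule Ff) (simp_all add: \<rho>(1) V(3) f(4))
    finally have "F u p = (fmul (\<lambda>q. 1 - \<rho> q) (F u) + (\<Sum>i<r. fmul (\<lambda>q. \<rho> q * h i q) (F (b i)))) p"
      by (rule fun_cong)
    also have "\<dots> = (1 - \<rho> p) *\<^sub>R F u p + (\<Sum>i<r. (\<rho> p * h i p) *\<^sub>R F (b i) p)"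
      by (simp add: sum_fun_apply)
    finally show ?thesis using \<rho>(4)[OF b(2)] h0 by simp
  qed
  have "F s = F (s - t) + F t" using Fa[OF sec_diff[OF st(1,2)] st(2)] by simp
  then have "F s p = F (s - t) p + F t p" by simp
  moreover have "F (s - t) p = 0" by (rule vanish) (use st sec_diff in auto)
  ultimately show ?thesis by simp
qed

lemma tensorial_apply:
  assumes "Clinear A E F" "s \<in> sections E"
  shows "tensorial E F p (s p) = F s p"
  using Clinear_pointwise[OF assms(1) extend_sec(1)[OF sec_fibre[OF assms(2)]] assms(2) extend_sec(2)[OF sec_fibre[OF assms(2)]]]
    sec_fibre[OF assms(2)] by (simp add: tensorial_def)

lemma ap_tensorial: "Clinear A E F \<Longrightarrow> s \<in> sections E \<Longrightarrow> ap (tensorial E F) s = F s"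
  by (rule ext) (simp add: tensorial_apply)

lemma tensorial_off: "x \<notin> fibre E p \<Longrightarrow> tensorial E F p x = 0"
  by (simp add: tensorial_def)

lemma tensorial_hom:
  assumes F: "Clinear A E F" "\<And>s. s \<in> sections E \<Longrightarrow> F s \<in> sections E'"
    and E': "\<And>t p. t \<in> sections E' \<Longrightarrow> t p \<in> fibre E' p"
  shows "tensorial E F \<in> sections (hom_bundle E E')"
  unfolding hom_sec_iff hom_fibre_iff
proof (intro conjI allI ballI impI)
  fix p x y assume xy: "x \<in> fibre E p" "y \<in> fibre E p"
  obtain s t where st: "s \<in> sections E" "s p = x" "t \<in> sections E" "t p = y"
    using fibre_extend[OF xy(1)] fibre_extend[OF xy(2)] by metis
  show "tensorial E F p (x + y) = tensorial E F p x + tensorial E F p y"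
    using tensorial_apply[OF F(1) sec_add[OF st(1,3)], of p] tensorial_apply[OF F(1) st(1), of p]
      tensorial_apply[OF F(1) st(3), of p] st ClinearD(1)[OF F(1) st(1,3)] by simp
next
  fix p c x assume x: "x \<in> fibre E p"
  obtain s where s: "s \<in> sections E" "s p = x" using fibre_extend[OF x] .
  show "tensorial E F p (c *\<^sub>R x) = c *\<^sub>R tensorial E F p x"
    using tensorial_apply[OF F(1) sec_fmul[OF Cinf_const[of c] s(1)], of p] tensorial_apply[OF F(1) s(1), of p]
      s ClinearD(2)[OF F(1) Cinf_const[of c] s(1)] by simp
next
  fix p x assume x: "x \<in> fibre E p"
  show "tensorial E F p x \<in> fibre E' p"
    using x extend_sec(1)[OF x] by (simp add: tensorial_def E' F(2))
qed (simp_all add: tensorial_off ap_tensorial F)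

lemma hom_ext:
  assumes "\<phi> \<in> sections (hom_bundle E E')" "\<psi> \<in> sections (hom_bundle E E')"
    and "\<And>s. s \<in> sections E \<Longrightarrow> ap \<phi> s = ap \<psi> s"
  shows "\<phi> = \<psi>"
proof (intro ext)
  fix p x
  show "\<phi> p x = \<psi> p x"
  proof (cases "x \<in> fibre E p")
    case True
    then obtain s where s: "s \<in> sections E" "s p = x" by (rule fibre_extend)
    then show ?thesis using fun_cong[OF assms(3)[OF s(1)], of p] by simp
  qed (simp add: hom_secD[OF assms(1)] hom_secD[OF assms(2)])
qed

lemma ap_Clinear:
  assumes "\<phi> \<in> sections (hom_bundle E E')"
  shows "Clinear A E (ap \<phi>)"
  by (rule ClinearI; rule ext; simp add: hom_secD[OF assms] sec_fibre)

end

lemma hom_mbundle: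
  assumes "mbundle A E" "mbundle A F"
  shows "mbundle A (hom_bundle E F)"
proof -
  interpret E: mbundle A E by (rule assms(1))
  interpret F: mbundle A F by (rule assms(2))
  show ?thesis
  proof
    show "s p \<in> fibre (hom_bundle E F) p" if "s \<in> sections (hom_bundle E F)" for s p
      using that by (simp add: hom_sec_iff)
    show "subspace (fibre (hom_bundle E F) p)" for p
      unfolding subspace_def
    proof (intro conjI ballI allI)
      show "0 \<in> fibre (hom_bundle E F) p" by (simp add: hom_fibre_iff)
      show "h + k \<in> fibre (hom_bundle E F) p"
        if "h \<in> fibre (hom_bundle E F) p" "k \<in> fibre (hom_bundle E F) p" for h k
        using that by (simp add: hom_fibre_iff scaleR_add_right)
      show "c *\<^sub>R h \<in> fibre (hom_bundle E F) p" if "h \<in> fibre (hom_bundle E F) p" for c h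
        using that by (simp add: hom_fibre_iff scaleR_add_right)
    qed
    have z: "ap 0 s = 0" for s :: "'a \<Rightarrow> 'c" by (rule ext) simp
    show "0 \<in> sections (hom_bundle E F)"
      by (simp add: hom_sec_iff hom_fibre_iff z F.sec_zero)
    have a: "ap (\<phi> + \<psi>) s = ap \<phi> s + ap \<psi> s" for \<phi> \<psi> :: "'a \<Rightarrow> 'c \<Rightarrow> 'e" and s by (rule ext) simp
    show "\<phi> + \<psi> \<in> sections (hom_bundle E F)"
      if "\<phi> \<in> sections (hom_bundle E F)" "\<psi> \<in> sections (hom_bundle E F)" for \<phi> \<psi>
      using that by (simp add: hom_sec_iff hom_fibre_iff a F.sec_add scaleR_add_right)
    have f: "ap (fmul f \<phi>) s = fmul f (ap \<phi> s)" for f and \<phi> :: "'a \<Rightarrow> 'c \<Rightarrow> 'e" and s by (rule ext) simp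
    show "fmul f \<phi> \<in> sections (hom_bundle E F)"
      if "f \<in> Cinf A" "\<phi> \<in> sections (hom_bundle E F)" for f \<phi>
      using that by (simp add: hom_sec_iff hom_fibre_iff f F.sec_fmul scaleR_add_right)
    show "\<phi> \<in> sections (hom_bundle E F)"
      if loc: "\<And>p. \<exists>U. open U \<and> p \<in> U \<and> (\<exists>\<psi>\<in>sections (hom_bundle E F). \<forall>q\<in>U. \<phi> q = \<psi> q)" for \<phi>
      unfolding hom_sec_iff
    proof (intro conjI allI ballI)
      show "\<phi> p \<in> fibre (hom_bundle E F) p" for p
      proof -
        obtain U \<psi> where "p \<in> U" "\<psi> \<in> sections (hom_bundle E F)" "\<forall>q\<in>U. \<phi> q = \<psi> q"
          using loc[of p] by blast
        then show ?thesis by (simp add: hom_sec_iff)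
      qed
      show "ap \<phi> s \<in> sections F" if s: "s \<in> sections E" for s
      proof (rule F.sec_local)
        fix p
        obtain U \<psi> where u: "open U" "p \<in> U" "\<psi> \<in> sections (hom_bundle E F)" "\<forall>q\<in>U. \<phi> q = \<psi> q"
          using loc[of p] by blast
        have "ap \<psi> s \<in> sections F" using u(3) s by (simp add: hom_sec_iff)
        with u show "\<exists>U. open U \<and> p \<in> U \<and> (\<exists>t\<in>sections F. \<forall>q\<in>U. ap \<phi> s q = t q)"
          by (intro exI[of _ U] conjI bexI[of _ "ap \<psi> s"]) auto
      qed
    qed
  qed
qed

lemma ap_simps:
  "ap (\<phi> + \<psi>) s = ap \<phi> s + ap \<psi> s" "ap (\<phi> - \<psi>) s = ap \<phi> s - ap \<psi> s" "ap (- \<phi>) s = - ap \<phi> s"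
  "ap 0 s = 0" "ap (fmul f \<phi>) s = fmul f (ap \<phi> s)" "ap (c *\<^sub>R \<phi>) s = c *\<^sub>R ap \<phi> s"
  by (simp_all add: fun_eq_iff)

section \<open>The tangent bundle\<close>

context smooth_manifold
begin

lemma tangent_subspace: "subspace (tangent A p)"
  unfolding subspace_def
proof (intro conjI ballI allI)
  show "0 \<in> tangent A p" by (simp add: tangent_def)
  show "v + w \<in> tangent A p" if "v \<in> tangent A p" "w \<in> tangent A p" for v w
    using that by (simp add: tangent_def algebra_simps)
  show "c *\<^sub>R v \<in> tangent A p" if "v \<in> tangent A p" for c v
    using that by (simp add: tangent_def algebra_simps)
qed

lemma TM_mbundle: "mbundle A (TM A)"
proof
  show "s p \<in> fibre (TM A) p" if "s \<in> sections (TM A)" for s p using that by (simp add: VF_tangent)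
  show "subspace (fibre (TM A) p)" for p by (simp add: tangent_subspace)
  note ts = subspace_0[OF tangent_subspace] subspace_add[OF tangent_subspace] subspace_scale[OF tangent_subspace]
  show "0 \<in> sections (TM A)" by (simp add: VF_iff ts)
  show "s + t \<in> sections (TM A)" if "s \<in> sections (TM A)" "t \<in> sections (TM A)" for s t
    using that by (simp add: VF_iff ts)
  show "fmul f s \<in> sections (TM A)" if "f \<in> Cinf A" "s \<in> sections (TM A)" for f s
    using that by (simp add: VF_iff ts)
  show "X \<in> sections (TM A)"
    if loc: "\<And>p. \<exists>U. open U \<and> p \<in> U \<and> (\<exists>t\<in>sections (TM A). \<forall>q\<in>U. X q = t q)" for X
  proof -
    have "X p \<in> tangent A p" for p
      using loc[of p] VF_tangent by auto
    moreover have "(\<lambda>p. X p f) \<in> Cinf A" if f: "f \<in> Cinf A" for f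
    proof (rule Cinf_local)
      fix p
      obtain U Y where u: "open U" "p \<in> U" "Y \<in> VF A" "\<forall>q\<in>U. X q = Y q" using loc[of p] by auto
      have "(\<lambda>q. Y q f) \<in> Cinf A" using u(3) by simp
      with u show "\<exists>W. open W \<and> p \<in> W \<and> (\<exists>h\<in>Cinf A. \<forall>q\<in>W. X q f = h q)"
        by (intro exI[of _ U] conjI bexI[of _ "\<lambda>q. Y q f"]) auto
    qed
    ultimately show ?thesis by (simp add: VF_iff)
  qed
qed

text \<open>The differential of \<open>f\<close>. These sections of the cotangent bundle already
  separate tangent vectors, because a derivation is by definition its list of values on
  functions.\<close>

definition dform :: "('m \<Rightarrow> real) \<Rightarrow> 'm \<Rightarrow> 'm tvec \<Rightarrow> real" where
  "dform f = (\<lambda>p v. if v \<in> tangent A p then v f else 0)"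

lemma dform_dual: "dform f \<in> sections (hom_bundle (TM A) (trivial_line A))"
proof -
  interpret mbundle A "TM A" by (rule TM_mbundle)
  have "ap (dform f) X = (\<lambda>p. X p f)" if "X \<in> VF A" for X
    using VF_tangent[OF that] by (simp add: fun_eq_iff dform_def)
  then show ?thesis
    using fib_closed by (simp add: hom_sec_iff hom_fibre_iff dform_def)
qed

lemma TM_sbundle: "sbundle A (TM A)"
proof -
  interpret mbundle A "TM A" by (rule TM_mbundle)
  show ?thesis
  proof (intro sbundle.intro sbundle_axioms.intro TM_mbundle)
    obtain e where e: "bij_betw e {..<DIM('e)} (Basis :: 'e set)"
      using ex_bij_betw_nat_finite[OF finite_Basis] by (auto simp: atLeast0LessThan)
    have "\<exists>U b. open U \<and> p \<in> U \<and> local_frame (TM A) U DIM('e) b" for p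
    proof -
      obtain W x X where w: "open W" "p \<in> W" "\<And>b. x b \<in> Cinf A" "\<And>b. X b \<in> VF A"
        "\<And>q b b'. q \<in> W \<Longrightarrow> b \<in> Basis \<Longrightarrow> b' \<in> Basis \<Longrightarrow> X b q (x b') = (if b = b' then 1 else 0)"
        "\<And>q v f. q \<in> W \<Longrightarrow> v \<in> tangent A q \<Longrightarrow> v f = (\<Sum>b\<in>(Basis::'e set). v (x b) * X b q f)"
        by (rule coordinates_exist[where p = p]) (rule that; assumption)
      have eB: "e i \<in> Basis" if "i < DIM('e)" for i using e that by (auto simp: bij_betw_def)
      have ei: "inj_on e {..<DIM('e)}" "e ` {..<DIM('e)} = Basis" using e by (auto simp: bij_betw_def)
      have "local_frame (TM A) W DIM('e) (\<lambda>i. X (e i))"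
        unfolding local_frame_def
      proof (intro conjI allI impI ballI)
        show "X (e i) \<in> sections (TM A)" for i by (simp add: w(4))
        fix q assume q: "q \<in> W"
        have injB: "inj_on (\<lambda>b. X b q) Basis"
        proof (rule inj_onI)
          fix b b' :: 'e assume "b \<in> Basis" "b' \<in> Basis" "X b q = X b' q"
          then show "b = b'" using w(5)[OF q, of b b'] w(5)[OF q, of b' b'] by (cases "b = b'") auto
        qed
        show inj: "inj_on (\<lambda>i. X (e i) q) {..<DIM('e)}"
          using comp_inj_on[OF ei(1), of "\<lambda>b. X b q"] injB ei(2) by (simp add: o_def)
        have im: "(\<lambda>i. X (e i) q) ` {..<DIM('e)} = (\<lambda>b. X b q) ` Basis"
          using image_image[of "\<lambda>b. X b q" e "{..<DIM('e)}"] ei(2) by simp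
        show "independent ((\<lambda>i. X (e i) q) ` {..<DIM('e)})"
          unfolding im
          unfolding dependent_finite[OF finite_imageI[OF finite_Basis]]
        proof
          assume "\<exists>u. (\<exists>v\<in>(\<lambda>b. X b q) ` Basis. u v \<noteq> 0) \<and> (\<Sum>v\<in>(\<lambda>b. X b q) ` Basis. u v *\<^sub>R v) = 0"
          then obtain c b where z: "(\<Sum>v\<in>(\<lambda>b. X b q) ` Basis. c v *\<^sub>R v) = 0"
            and b: "b \<in> Basis" "c (X b q) \<noteq> 0" by auto
          have "(\<Sum>b'\<in>Basis. c (X b' q) *\<^sub>R X b' q) = 0" using z by (simp add: sum.reindex[OF injB])
          \<comment> \<open>Tangent vectors are functions on functions: applying the relation to the
            coordinate \<open>x b\<close> isolates one coefficient.\<close>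
          then have "(\<Sum>b'\<in>Basis. c (X b' q) *\<^sub>R X b' q) (x b) = 0" by simp
          then have s0: "(\<Sum>b'\<in>Basis. c (X b' q) * X b' q (x b)) = 0" by (simp add: sum_fun_apply)
          have s1: "(\<Sum>b'\<in>Basis. c (X b' q) * X b' q (x b)) = (\<Sum>b'\<in>Basis. if b' = b then c (X b q) else 0)"
            by (rule sum.cong) (auto simp: w(5)[OF q _ b(1)])
          have s2: "(\<Sum>b'\<in>Basis. if b' = b then c (X b q) else 0) = c (X b q)"
            using b(1) by simp
          have "c (X b q) = 0" by (rule trans[OF sym[OF trans[OF s1 s2]] s0])
          with b(2) show False by simp
        qed
        have 1: "span ((\<lambda>b. X b q) ` Basis) \<subseteq> tangent A q"
          by (rule span_minimal[OF _ tangent_subspace]) (rule image_subsetI, rule VF_tangent[OF w(4)])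
        have 2: "v \<in> span ((\<lambda>b. X b q) ` Basis)" if v: "v \<in> tangent A q" for v
        proof -
          have "v = (\<Sum>b\<in>Basis. v (x b) *\<^sub>R X b q)"
            by (rule ext) (simp add: sum_fun_apply w(6)[OF q v, symmetric])
          moreover have "(\<Sum>b\<in>Basis. v (x b) *\<^sub>R X b q) \<in> span ((\<lambda>b. X b q) ` Basis)"
            by (intro span_sum span_scale span_base imageI)
          ultimately show ?thesis by simp
        qed
        have "span ((\<lambda>b. X b q) ` Basis) = tangent A q"
          using 1 2 by (intro equalityI subsetI) auto
        then show "span ((\<lambda>i. X (e i) q) ` {..<DIM('e)}) = fibre (TM A) q"
          by (simp only: im TM_simps)
      qed
      with w(1,2) show ?thesis by blast
    qed
    then show "\<exists>r. \<forall>p. \<exists>U b. open U \<and> p \<in> U \<and> local_frame (TM A) U r b" by blast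
    show "v = 0" if "v \<in> fibre (TM A) p"
        "\<And>\<alpha>. \<alpha> \<in> sections (hom_bundle (TM A) (trivial_line A)) \<Longrightarrow> \<alpha> p v = 0" for v p
      using that(1) that(2)[OF dform_dual] by (auto simp: dform_def fun_eq_iff)
  qed
qed

end

section \<open>First jets of sections\<close>

lemma fmul_zero: "fmul f 0 = 0"
  by (rule ext) simp

text \<open>The normal form for sections of the jet bundle: each is the prolongation of a section
  plus a bundle map in exactly one way, so that computations with jets take place on pairs
  \<open>(s, \<phi>)\<close>.\<close>

definition jetJ :: "('m::topological_space, 'e::euclidean_space) atlas \<Rightarrow> ('m, 'v::real_vector, 'z) vbundle_scheme \<Rightarrow>
    ('m \<Rightarrow> 'v) \<Rightarrow> ('m \<Rightarrow> 'm tvec \<Rightarrow> 'v) \<Rightarrow> 'm \<Rightarrow> ('m, 'v) jet" where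
  "jetJ A E s \<phi> = jet1 A E s + incl_section A E \<phi>"

text \<open>The tensor \<open>df \<otimes> s\<close>, which measures how prolongation fails to be
  linear over functions.\<close>

definition dtens :: "('m::topological_space, 'e::euclidean_space) atlas \<Rightarrow> ('m \<Rightarrow> real) \<Rightarrow> ('m \<Rightarrow> 'v::real_vector) \<Rightarrow>
    'm \<Rightarrow> 'm tvec \<Rightarrow> 'v" where
  "dtens A f s = (\<lambda>p v. if v \<in> tangent A p then v f *\<^sub>R s p else 0)"

context smooth_manifold
begin

lemmas VF_zero = mbundle.sec_zero[OF TM_mbundle, unfolded TM_simps]
lemmas VF_add = mbundle.sec_add[OF TM_mbundle, unfolded TM_simps]
lemmas VF_diff = mbundle.sec_diff[OF TM_mbundle, unfolded TM_simps]
lemmas VF_minus = mbundle.sec_minus[OF TM_mbundle, unfolded TM_simps]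
lemmas VF_fmul = mbundle.sec_fmul[OF TM_mbundle, unfolded TM_simps]
lemmas tangent_closed = mbundle.fib_closed[OF TM_mbundle, unfolded TM_simps]
lemmas TM_extend = sbundle.fibre_extend[OF TM_sbundle, unfolded TM_simps]

lemma jetJ_apply:
  "\<alpha> \<in> sections (hom_bundle E (trivial_line A)) \<Longrightarrow> v \<in> tangent A p \<Longrightarrow>
   jetJ A E s \<phi> p \<alpha> v = (\<alpha> p (s p), v (\<lambda>q. \<alpha> q (s q)) - \<alpha> p (\<phi> p v))"
  by (simp add: jetJ_def jet1_def incl_section_def jet_incl_def)

lemma jet_ext:
  assumes "\<And>\<alpha> v. \<alpha> \<in> sections (hom_bundle E (trivial_line A)) \<Longrightarrow> v \<in> tangent A p \<Longrightarrow> j \<alpha> v = k \<alpha> v"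
    and "\<And>\<alpha> v. \<not> (\<alpha> \<in> sections (hom_bundle E (trivial_line A)) \<and> v \<in> tangent A p) \<Longrightarrow> j \<alpha> v = 0"
    and "\<And>\<alpha> v. \<not> (\<alpha> \<in> sections (hom_bundle E (trivial_line A)) \<and> v \<in> tangent A p) \<Longrightarrow> k \<alpha> v = 0"
  shows "j = k"
proof (intro ext)
  fix \<alpha> v
  show "j \<alpha> v = k \<alpha> v"
    using assms(1)[of \<alpha> v] assms(2)[of \<alpha> v] assms(3)[of \<alpha> v]
    by (cases "\<alpha> \<in> sections (hom_bundle E (trivial_line A)) \<and> v \<in> tangent A p") simp_all
qed

lemma jetJ_off:
  "\<not> (\<alpha> \<in> sections (hom_bundle E (trivial_line A)) \<and> v \<in> tangent A p) \<Longrightarrow> jetJ A E s \<phi> p \<alpha> v = 0"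
  by (simp only: jetJ_def jet1_def incl_section_def jet_incl_def plus_fun_apply if_False) simp

lemma jet1_jetJ: "jet1 A E s p = jetJ A E s 0 p" if "\<And>\<alpha>. \<alpha> \<in> sections (hom_bundle E (trivial_line A)) \<Longrightarrow> \<alpha> p 0 = 0"
  using that by (intro ext) (simp add: jetJ_def jet1_def incl_section_def jet_incl_def zero_prod_def)

end

context sbundle
begin

interpretation H: mbundle A "hom_bundle (TM A) E" by (rule hom_mbundle[OF TM_mbundle mbundle_axioms])

abbreviation Dual where "Dual \<equiv> sections (hom_bundle E (trivial_line A))"
abbreviation Hom where "Hom \<equiv> sections (hom_bundle (TM A) E)"

lemma HomD:
  assumes "\<phi> \<in> Hom"
  shows "v \<in> tangent A p \<Longrightarrow> w \<in> tangent A p \<Longrightarrow> \<phi> p (v + w) = \<phi> p v + \<phi> p w"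
    and "v \<in> tangent A p \<Longrightarrow> \<phi> p (c *\<^sub>R v) = c *\<^sub>R \<phi> p v"
    and "v \<in> tangent A p \<Longrightarrow> \<phi> p v \<in> fibre E p"
    and "v \<notin> tangent A p \<Longrightarrow> \<phi> p v = 0"
    and "X \<in> VF A \<Longrightarrow> ap \<phi> X \<in> sections E"
    and "\<phi> p v \<in> fibre E p"
proof -
  note h = hom_secD[OF assms, unfolded TM_simps]
  show "\<phi> p (v + w) = \<phi> p v + \<phi> p w" if "v \<in> tangent A p" "w \<in> tangent A p" by (rule h(1)[OF that])
  show "\<phi> p (c *\<^sub>R v) = c *\<^sub>R \<phi> p v" if "v \<in> tangent A p" by (rule h(2)[OF that])
  show f: "\<phi> p v \<in> fibre E p" if "v \<in> tangent A p" by (rule h(3)[OF that])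
  show z: "\<phi> p v = 0" if "v \<notin> tangent A p" by (rule h(4)[OF that])
  show "ap \<phi> X \<in> sections E" if "X \<in> VF A" by (rule h(5)[OF that])
  show "\<phi> p v \<in> fibre E p" using f z by (cases "v \<in> tangent A p") simp_all
qed

lemma Hom_sum:
  assumes \<phi>: "\<phi> \<in> Hom" and v: "\<And>i. i \<in> I \<Longrightarrow> v i \<in> tangent A p"
  shows "\<phi> p (\<Sum>i\<in>I. c i *\<^sub>R v i) = (\<Sum>i\<in>I. c i *\<^sub>R \<phi> p (v i))"
proof -
  have z: "\<phi> p 0 = 0" using HomD(2)[OF \<phi>, of 0 p 0] by (simp add: tangent_closed)
  have "(\<Sum>i\<in>I. c i *\<^sub>R v i) \<in> tangent A p \<and> \<phi> p (\<Sum>i\<in>I. c i *\<^sub>R v i) = (\<Sum>i\<in>I. c i *\<^sub>R \<phi> p (v i))"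
    using v by (induction I rule: infinite_finite_induct)
      (simp_all add: z tangent_closed HomD(1,2)[OF \<phi>])
  then show ?thesis by simp
qed

lemma HomI:
  assumes "\<And>p v w. v \<in> tangent A p \<Longrightarrow> w \<in> tangent A p \<Longrightarrow> \<phi> p (v + w) = \<phi> p v + \<phi> p w"
    and "\<And>p c v. v \<in> tangent A p \<Longrightarrow> \<phi> p (c *\<^sub>R v) = c *\<^sub>R \<phi> p v"
    and "\<And>p v. v \<in> tangent A p \<Longrightarrow> \<phi> p v \<in> fibre E p"
    and "\<And>p v. v \<notin> tangent A p \<Longrightarrow> \<phi> p v = 0"
    and "\<And>X. X \<in> VF A \<Longrightarrow> ap \<phi> X \<in> sections E"
  shows "\<phi> \<in> Hom"
  unfolding hom_sec_iff hom_fibre_iff TM_simps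
  by (intro conjI allI ballI impI; (rule assms; assumption))

lemma dtens_Hom:
  assumes "f \<in> Cinf A" "s \<in> sections E"
  shows "dtens A f s \<in> Hom"
proof (rule HomI)
  have "ap (dtens A f s) X = fmul (\<lambda>p. X p f) s" if "X \<in> VF A" for X
    by (rule ext) (simp add: dtens_def VF_tangent[OF that])
  then show "ap (dtens A f s) X \<in> sections E" if "X \<in> VF A" for X
    using that by (simp add: sec_fmul assms(2))
qed (simp_all add: dtens_def tangent_closed scaleR_add_left sec_fibre[OF assms(2)])

lemma ap_dtens: "X \<in> VF A \<Longrightarrow> ap (dtens A f s) X = fmul (\<lambda>p. X p f) s"
  by (rule ext) (simp add: dtens_def VF_tangent)

lemma jet1_eq: "jet1 A E s = jetJ A E s 0"
  by (rule ext, rule jet1_jetJ) (rule dual_zero)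

lemma jetJ_cong:
  assumes "s \<in> sections E" "t \<in> sections E" "\<forall>\<^sub>F q in nhds p. s q = t q" "\<phi> p = \<psi> p"
  shows "jetJ A E s \<phi> p = jetJ A E t \<psi> p"
proof (rule jet_ext[where E = E and p = p])
  fix \<alpha> v assume a: "\<alpha> \<in> Dual" and v: "v \<in> tangent A p"
  obtain W where W: "open W" "p \<in> W" "\<forall>q\<in>W. s q = t q" using assms(3) unfolding eventually_nhds by blast
  have "v (\<lambda>q. \<alpha> q (s q)) = v (\<lambda>q. \<alpha> q (t q))"
    by (rule tangent_local[OF v dual_Cinf[OF a assms(1)] dual_Cinf[OF a assms(2)] W(1,2)]) (simp add: W(3))
  then show "jetJ A E s \<phi> p \<alpha> v = jetJ A E t \<psi> p \<alpha> v"
    using W(2,3) assms(4) by (simp add: jetJ_apply[OF a v])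
qed (rule jetJ_off, assumption)+

lemma jetJ_eq_fst:
  assumes "s \<in> sections E" "t \<in> sections E" "jetJ A E s \<phi> p = jetJ A E t \<psi> p"
  shows "s p = t p"
proof (rule dual_eq)
  show "s p \<in> fibre E p" "t p \<in> fibre E p" using assms by (simp_all add: sec_fibre)
  fix \<alpha> assume a: "\<alpha> \<in> Dual"
  have "jetJ A E s \<phi> p \<alpha> 0 = jetJ A E t \<psi> p \<alpha> 0" using assms(3) by simp
  then show "\<alpha> p (s p) = \<alpha> p (t p)" by (simp add: jetJ_apply[OF a tangent_closed(1)])
qed

lemma jetJ_eq_snd:
  assumes "\<phi> \<in> Hom" "\<psi> \<in> Hom" "jetJ A E s \<phi> p = jetJ A E s \<psi> p"
  shows "\<phi> p = \<psi> p"
proof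
  fix v
  show "\<phi> p v = \<psi> p v"
  proof (cases "v \<in> tangent A p")
    case v: True
    show ?thesis
    proof (rule dual_eq)
      show "\<phi> p v \<in> fibre E p" "\<psi> p v \<in> fibre E p" using assms by (simp_all add: HomD(6))
      fix \<alpha> assume a: "\<alpha> \<in> Dual"
      have "jetJ A E s \<phi> p \<alpha> v = jetJ A E s \<psi> p \<alpha> v" using assms(3) by simp
      then show "\<alpha> p (\<phi> p v) = \<alpha> p (\<psi> p v)" by (simp add: jetJ_apply[OF a v])
    qed
  qed (simp add: HomD(4)[OF assms(1)] HomD(4)[OF assms(2)])
qed

lemma jetJ_inject:
  assumes "s \<in> sections E" "t \<in> sections E" "\<phi> \<in> Hom" "\<psi> \<in> Hom"
  shows "jetJ A E s \<phi> = jetJ A E t \<psi> \<longleftrightarrow> s = t \<and> \<phi> = \<psi>"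
proof
  assume e: "jetJ A E s \<phi> = jetJ A E t \<psi>"
  have st: "s = t"
    by (rule ext, rule jetJ_eq_fst[OF assms(1,2)]) (rule fun_cong[OF e])
  moreover have "\<phi> = \<psi>"
    by (rule ext, rule jetJ_eq_snd[OF assms(3,4)]) (use fun_cong[OF e] st in simp)
  ultimately show "s = t \<and> \<phi> = \<psi>" ..
qed simp

lemma jetJ_add:
  assumes "s \<in> sections E" "t \<in> sections E" "\<phi> \<in> Hom" "\<psi> \<in> Hom"
  shows "jetJ A E s \<phi> + jetJ A E t \<psi> = jetJ A E (s + t) (\<phi> + \<psi>)"
proof (rule ext, rule jet_ext[where E = E])
  fix p \<alpha> v assume a: "\<alpha> \<in> Dual" and v: "v \<in> tangent A p"
  have "v (\<lambda>q. \<alpha> q (s q) + \<alpha> q (t q)) = v (\<lambda>q. \<alpha> q (s q)) + v (\<lambda>q. \<alpha> q (t q))"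
    by (rule tangent_add[OF v dual_Cinf[OF a assms(1)] dual_Cinf[OF a assms(2)]])
  then show "(jetJ A E s \<phi> + jetJ A E t \<psi>) p \<alpha> v = jetJ A E (s + t) (\<phi> + \<psi>) p \<alpha> v"
    by (simp add: jetJ_apply[OF a v] dual_add[OF a] sec_fibre assms HomD(6))
qed (simp_all add: jetJ_off)

text \<open>By the sign convention of the inclusion,
  \<open>f J\<^sup>1 s = J\<^sup>1 (f s) + df \<otimes> s\<close>; this is the origin of every
  \<open>dtens\<close> term in the Leibniz rules that follow.\<close>

lemma jetJ_fmul:
  assumes "f \<in> Cinf A" "s \<in> sections E" "\<phi> \<in> Hom"
  shows "fmul f (jetJ A E s \<phi>) = jetJ A E (fmul f s) (fmul f \<phi> + dtens A f s)"
proof (rule ext, rule jet_ext[where E = E])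
  fix p \<alpha> v assume a: "\<alpha> \<in> Dual" and v: "v \<in> tangent A p"
  have "v (\<lambda>q. f q * \<alpha> q (s q)) = v f * \<alpha> p (s p) + f p * v (\<lambda>q. \<alpha> q (s q))"
    by (rule tangent_mult[OF v assms(1) dual_Cinf[OF a assms(2)]])
  then show "fmul f (jetJ A E s \<phi>) p \<alpha> v = jetJ A E (fmul f s) (fmul f \<phi> + dtens A f s) p \<alpha> v"
    by (simp add: jetJ_apply[OF a v] dual_add[OF a] dual_scale[OF a] sec_fibre assms HomD(6) dtens_def v algebra_simps)
qed (simp_all add: jetJ_off)

lemma jetJ_zero: "jetJ A E 0 0 = 0"
  using jetJ_add[OF sec_zero sec_zero H.sec_zero H.sec_zero] by simp

lemma jetJ_minus:
  assumes "s \<in> sections E" "\<phi> \<in> Hom"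
  shows "- jetJ A E s \<phi> = jetJ A E (- s) (- \<phi>)"
  using jetJ_add[OF assms(1) sec_minus[OF assms(1)] assms(2) H.sec_minus[OF assms(2)]]
  by (simp add: jetJ_zero minus_unique)

lemma jetJ_sum:
  assumes "\<And>i. i \<in> I \<Longrightarrow> s i \<in> sections E" "\<And>i. i \<in> I \<Longrightarrow> \<phi> i \<in> Hom"
  shows "(\<Sum>i\<in>I. jetJ A E (s i) (\<phi> i)) = jetJ A E (\<Sum>i\<in>I. s i) (\<Sum>i\<in>I. \<phi> i)"
  using assms
  by (induction I rule: infinite_finite_induct) (simp_all add: jetJ_zero jetJ_add sec_sum H.sec_sum)

lemma jet_combination:
  assumes "\<And>i. i < n \<Longrightarrow> f i \<in> Cinf A" "\<And>i. i < n \<Longrightarrow> s i \<in> sections E"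
  shows "(\<Sum>i<(n::nat). fmul (f i) (jet1 A E (s i))) = jetJ A E (\<Sum>i<n. fmul (f i) (s i)) (\<Sum>i<n. dtens A (f i) (s i))"
proof -
  have "(\<Sum>i<n. fmul (f i) (jet1 A E (s i))) = (\<Sum>i<n. jetJ A E (fmul (f i) (s i)) (dtens A (f i) (s i)))"
  proof (rule sum.cong[OF refl])
    fix i assume "i \<in> {..<n}"
    then have i: "f i \<in> Cinf A" "s i \<in> sections E" using assms by simp_all
    show "fmul (f i) (jet1 A E (s i)) = jetJ A E (fmul (f i) (s i)) (dtens A (f i) (s i))"
      using jetJ_fmul[OF i H.sec_zero] by (simp add: jet1_eq fmul_zero)
  qed
  also have "\<dots> = jetJ A E (\<Sum>i<n. fmul (f i) (s i)) (\<Sum>i<n. dtens A (f i) (s i))"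
    by (rule jetJ_sum) (simp_all add: sec_fmul dtens_Hom assms)
  finally show ?thesis .
qed

definition jloc :: "'m set \<Rightarrow> ('m \<Rightarrow> ('m, 'v) jet) \<Rightarrow> bool" where
  "jloc U \<sigma> \<longleftrightarrow> (\<exists>(n::nat) f s. (\<forall>i<n. f i \<in> Cinf A \<and> s i \<in> sections E) \<and>
     (\<forall>q\<in>U. \<sigma> q = (\<Sum>i<n. f i q *\<^sub>R jet1 A E (s i) q)))"

lemma jet_sections: "\<sigma> \<in> sections (jet_bundle A E) \<longleftrightarrow> (\<forall>p. \<exists>U. open U \<and> p \<in> U \<and> jloc U \<sigma>)"
  by (simp add: jet_bundle_def jloc_def)

lemma jet_fibre: "fibre (jet_bundle A E) p = (\<lambda>s. jet1 A E s p) ` sections E"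
  by (simp add: jet_bundle_def)

lemma jlocI:
  assumes "\<And>i. i < n \<Longrightarrow> f i \<in> Cinf A" "\<And>i. i < n \<Longrightarrow> s i \<in> sections E"
    and "\<And>q. q \<in> U \<Longrightarrow> \<sigma> q = (\<Sum>i<(n::nat). f i q *\<^sub>R jet1 A E (s i) q)"
  shows "jloc U \<sigma>"
  unfolding jloc_def
  by (rule exI[of _ n], rule exI[of _ f], rule exI[of _ s]) (simp add: assms)

lemma jloc_obtain:
  assumes "jloc U \<sigma>"
  obtains n :: nat and f s where "\<And>i. i < n \<Longrightarrow> f i \<in> Cinf A" "\<And>i. i < n \<Longrightarrow> s i \<in> sections E"
    and "\<And>q. q \<in> U \<Longrightarrow> \<sigma> q = (\<Sum>i<n. f i q *\<^sub>R jet1 A E (s i) q)"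
proof -
  from assms[unfolded jloc_def] obtain n :: nat and f s where
    *: "(\<forall>i<n. f i \<in> Cinf A \<and> s i \<in> sections E) \<and> (\<forall>q\<in>U. \<sigma> q = (\<Sum>i<n. f i q *\<^sub>R jet1 A E (s i) q))"
    by (elim exE)
  show thesis
    by (rule that[of n f s]) (simp_all add: *)
qed

lemma jloc_cong: "jloc U \<sigma> \<Longrightarrow> V \<subseteq> U \<Longrightarrow> (\<And>q. q \<in> V \<Longrightarrow> \<tau> q = \<sigma> q) \<Longrightarrow> jloc V \<tau>"
  by (erule jloc_obtain, rule jlocI, assumption, assumption) (simp add: subset_iff)

lemma jloc_fmul_jet1:
  assumes "f \<in> Cinf A" "s \<in> sections E"
  shows "jloc U (fmul f (jet1 A E s))"
  by (rule jlocI[of 1 "\<lambda>i. f" "\<lambda>i. s"]) (simp_all add: assms)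

lemma jloc_add:
  assumes "jloc U \<sigma>" "jloc U \<tau>"
  shows "jloc U (\<sigma> + \<tau>)"
proof -
  obtain n :: nat and f s where 1: "\<And>i. i < n \<Longrightarrow> f i \<in> Cinf A" "\<And>i. i < n \<Longrightarrow> s i \<in> sections E"
    "\<And>q. q \<in> U \<Longrightarrow> \<sigma> q = (\<Sum>i<n. f i q *\<^sub>R jet1 A E (s i) q)"
    by (rule jloc_obtain[OF assms(1)]) (rule that; assumption)
  obtain m :: nat and g t where 2: "\<And>i. i < m \<Longrightarrow> g i \<in> Cinf A" "\<And>i. i < m \<Longrightarrow> t i \<in> sections E"
    "\<And>q. q \<in> U \<Longrightarrow> \<tau> q = (\<Sum>i<m. g i q *\<^sub>R jet1 A E (t i) q)"
    by (rule jloc_obtain[OF assms(2)]) (rule that; assumption)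
  have split: "(\<Sum>i<n + m. if i < n then a i else b (i - n)) = (\<Sum>i<n. a i) + (\<Sum>i<m. b i)"
    for a b :: "nat \<Rightarrow> ('m, 'v) jet" by (induction m) (simp_all add: add.assoc)
  show ?thesis
  proof (rule jlocI[of "n + m" "\<lambda>i. if i < n then f i else g (i - n)" "\<lambda>i. if i < n then s i else t (i - n)"])
    fix q assume q: "q \<in> U"
    have "(\<Sum>i<n + m. (if i < n then f i else g (i - n)) q *\<^sub>R jet1 A E (if i < n then s i else t (i - n)) q)
        = (\<Sum>i<n + m. if i < n then f i q *\<^sub>R jet1 A E (s i) q else g (i - n) q *\<^sub>R jet1 A E (t (i - n)) q)"
      by (rule sum.cong) simp_all
    then show "(\<sigma> + \<tau>) q = (\<Sum>i<n + m. (if i < n then f i else g (i - n)) q *\<^sub>R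
        jet1 A E (if i < n then s i else t (i - n)) q)"
      using split[of "\<lambda>i. f i q *\<^sub>R jet1 A E (s i) q" "\<lambda>i. g i q *\<^sub>R jet1 A E (t i) q"]
      by (simp only: plus_fun_apply 1(3)[OF q] 2(3)[OF q])
  qed (simp_all add: 1(1,2) 2(1,2))
qed

lemma jloc_sum: "(\<And>i. i \<in> I \<Longrightarrow> jloc U (\<sigma> i)) \<Longrightarrow> jloc U (\<Sum>i\<in>I. \<sigma> i)"
proof (induction I rule: infinite_finite_induct)
  case (infinite I)
  then show ?case by (intro jlocI[of 0]) (simp_all add: zero_fun_def)
next
  case empty
  then show ?case by (intro jlocI[of 0]) (simp_all add: zero_fun_def)
next
  case (insert i I)
  show ?case unfolding sum.insert[OF insert.hyps]
    by (rule jloc_add[OF insert.prems insert.IH[OF insert.prems]]) simp_all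
qed

text \<open>In coordinates \<open>\<phi>\<close> is the sum of the tensors
  \<open>dx_b \<otimes> u_b\<close> with \<open>u_b\<close> the image of the coordinate field
  \<open>X b\<close>, and the inclusion sends such a tensor to
  \<open>x_b J\<^sup>1 u_b - J\<^sup>1 (x_b u_b)\<close>. This exhibits the section as a local
  combination of prolongations.\<close>

lemma jetJ_section:
  assumes s: "s \<in> sections E" and \<phi>: "\<phi> \<in> Hom"
  shows "jetJ A E s \<phi> \<in> sections (jet_bundle A E)"
  unfolding jet_sections
proof
  fix p
  obtain W x X where w: "open W" "p \<in> W" "\<And>b. x b \<in> Cinf A" "\<And>b. X b \<in> VF A"
    "\<And>q b b'. q \<in> W \<Longrightarrow> b \<in> Basis \<Longrightarrow> b' \<in> Basis \<Longrightarrow> X b q (x b') = (if b = b' then 1 else 0)"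
    "\<And>q v f. q \<in> W \<Longrightarrow> v \<in> tangent A q \<Longrightarrow> v f = (\<Sum>b\<in>(Basis::'e set). v (x b) * X b q f)"
    by (rule coordinates_exist[where p = p]) (rule that; assumption)
  define u where "u b = ap \<phi> (X b)" for b
  have u: "u b \<in> sections E" for b unfolding u_def by (rule HomD(5)[OF \<phi> w(4)])
  let ?\<sigma> = "fmul (\<lambda>q. 1) (jet1 A E s) + (\<Sum>b\<in>(Basis::'e set). fmul (x b) (jet1 A E (u b)) + fmul (\<lambda>q. -1) (jet1 A E (fmul (x b) (u b))))"
  have "jloc W ?\<sigma>"
    by (intro jloc_add jloc_sum jloc_fmul_jet1 Cinf_const s w(3) u sec_fmul)
  moreover have "jetJ A E s \<phi> q = ?\<sigma> q" if q: "q \<in> W" for q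
  proof (rule jet_ext[where E = E and p = q])
    fix \<alpha> v assume a: "\<alpha> \<in> Dual" and v: "v \<in> tangent A q"
    have "v = (\<Sum>b\<in>Basis. v (x b) *\<^sub>R X b q)"
      by (rule ext) (simp add: sum_fun_apply w(6)[OF q v, symmetric])
    then have "\<phi> q v = \<phi> q (\<Sum>b\<in>Basis. v (x b) *\<^sub>R X b q)" by (rule arg_cong)
    also have "\<dots> = (\<Sum>b\<in>Basis. v (x b) *\<^sub>R u b q)"
      by (subst Hom_sum[OF \<phi> VF_tangent[OF w(4)]]) (simp add: u_def)
    finally have ph: "\<alpha> q (\<phi> q v) = (\<Sum>b\<in>Basis. v (x b) * \<alpha> q (u b q))"
      by (simp add: dual_sum[OF a sec_fibre[OF u]])
    have vm: "v (\<lambda>q. x b q * \<alpha> q (u b q)) = v (x b) * \<alpha> q (u b q) + x b q * v (\<lambda>q. \<alpha> q (u b q))" for b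
      by (rule tangent_mult[OF v w(3) dual_Cinf[OF a u]])
    show "jetJ A E s \<phi> q \<alpha> v = ?\<sigma> q \<alpha> v"
      by (simp add: jet1_eq jetJ_apply[OF a v] sum_fun_apply ph dual_scale[OF a] sec_fibre[OF u]
          vm dual_zero[OF a] sum_negf prod_eq_iff fst_sum snd_sum)
  next
    fix \<alpha> v assume "\<not> (\<alpha> \<in> Dual \<and> v \<in> tangent A q)"
    then have "jetJ A E s' \<psi> q \<alpha> v = 0" for s' \<psi> by (rule jetJ_off)
    then show "?\<sigma> q \<alpha> v = 0" by (simp add: jet1_eq sum_fun_apply)
  qed (rule jetJ_off)
  ultimately have "jloc W (jetJ A E s \<phi>)" by (rule jloc_cong[OF _ subset_refl])
  with w(1,2) show "\<exists>U. open U \<and> p \<in> U \<and> jloc U (jetJ A E s \<phi>)" by (intro exI[of _ W] conjI)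
qed

lemma jet_section_local:
  assumes "\<sigma> \<in> sections (jet_bundle A E)"
  shows "\<exists>U s \<phi>. open U \<and> p \<in> U \<and> s \<in> sections E \<and> \<phi> \<in> Hom \<and> (\<forall>q\<in>U. \<sigma> q = jetJ A E s \<phi> q)"
proof -
  obtain U where U: "open U" "p \<in> U" "jloc U \<sigma>" using assms unfolding jet_sections by metis
  obtain n :: nat and f s where 1: "\<And>i. i < n \<Longrightarrow> f i \<in> Cinf A" "\<And>i. i < n \<Longrightarrow> s i \<in> sections E"
    "\<And>q. q \<in> U \<Longrightarrow> \<sigma> q = (\<Sum>i<n. f i q *\<^sub>R jet1 A E (s i) q)"
    by (rule jloc_obtain[OF U(3)]) (rule that; assumption)
  have 2: "(\<Sum>i<n. fmul (f i) (s i)) \<in> sections E" "(\<Sum>i<n. dtens A (f i) (s i)) \<in> Hom"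
    by (rule sec_sum, simp add: sec_fmul 1) (rule H.sec_sum, simp add: dtens_Hom 1)
  have 3: "\<sigma> q = jetJ A E (\<Sum>i<n. fmul (f i) (s i)) (\<Sum>i<n. dtens A (f i) (s i)) q" if "q \<in> U" for q
    using fun_cong[OF jet_combination[OF 1(1,2)], where x = q] 1(3)[OF that] by (simp add: sum_fun_apply)
  show ?thesis
    by (rule exI[of _ U], rule exI[of _ "\<Sum>i<n. fmul (f i) (s i)"], rule exI[of _ "\<Sum>i<n. dtens A (f i) (s i)"])
       (simp add: U(1,2) 2 3)
qed

text \<open>Local pairs exist by the definition of the jet bundle. As the pair is determined by the
  jet, the local pairs agree on overlaps and therefore glue.\<close>

proposition jet_section_decomposition:
  assumes \<sigma>: "\<sigma> \<in> sections (jet_bundle A E)"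
  obtains s \<phi> where "s \<in> sections E" "\<phi> \<in> Hom" "\<sigma> = jetJ A E s \<phi>"
proof -
  from jet_section_local[OF \<sigma>] obtain U S P where
    U: "\<And>p. open (U p)" "\<And>p. p \<in> U p" and S: "\<And>p. S p \<in> sections E" and P: "\<And>p. P p \<in> Hom"
    and e: "\<And>p q. q \<in> U p \<Longrightarrow> \<sigma> q = jetJ A E (S p) (P p) q"
    by metis
  have Seq: "S p q = S q q" if "q \<in> U p" for p q
    by (rule jetJ_eq_fst[OF S S trans[OF sym[OF e[OF that]] e[OF U(2)]]])
  have near: "\<forall>\<^sub>F q' in nhds q. q' \<in> U p" if "q \<in> U p" for p q
    by (rule eventually_nhds_in_open[OF U(1) that])
  have Peq: "P p q = P q q" if q: "q \<in> U p" for p q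
  proof -
    \<comment> \<open>Bundle-map parts can be compared only when they accompany the same section;
      hence \<open>S q\<close> is first replaced by \<open>S p\<close>, with which it agrees near
      \<open>q\<close>.\<close>
    have ev: "\<forall>\<^sub>F q' in nhds q. S q q' = S p q'"
      using near[OF q] near[OF U(2)] by eventually_elim (simp add: Seq)
    have "jetJ A E (S p) (P p) q = jetJ A E (S q) (P q) q"
      by (rule trans[OF sym[OF e[OF q]] e[OF U(2)]])
    also have "\<dots> = jetJ A E (S p) (P q) q" by (rule jetJ_cong[OF S S ev refl])
    finally show ?thesis by (rule jetJ_eq_snd[OF P P])
  qed
  define s where "s q = S q q" for q
  define \<phi> where "\<phi> q = P q q" for q
  have ev_s: "\<forall>\<^sub>F q in nhds p. s q = S p q" for p
    using near[OF U(2)] by eventually_elim (simp add: s_def Seq)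
  have ev_\<phi>: "\<forall>\<^sub>F q in nhds p. \<phi> q = P p q" for p
    using near[OF U(2)] by eventually_elim (simp add: \<phi>_def Peq)
  have s: "s \<in> sections E"
  proof (rule sec_eventually)
    show "\<exists>t\<in>sections E. \<forall>\<^sub>F q in nhds p. s q = t q" for p
      by (rule bexI[of _ "S p"]) (rule ev_s, rule S)
  qed
  have \<phi>: "\<phi> \<in> Hom"
  proof (rule H.sec_eventually)
    show "\<exists>t\<in>Hom. \<forall>\<^sub>F q in nhds p. \<phi> q = t q" for p
      by (rule bexI[of _ "P p"]) (rule ev_\<phi>, rule P)
  qed
  have "\<sigma> q = jetJ A E s \<phi> q" for q
    by (simp only: e[OF U(2), of q]) (rule jetJ_cong[OF S s _ \<phi>_def[symmetric]], use ev_s[of q] in \<open>simp add: eq_commute\<close>)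
  then have "\<sigma> = jetJ A E s \<phi>" by (rule ext)
  with s \<phi> show thesis by (rule that)
qed

text \<open>At a single point the coefficients of a local combination can be frozen to constants.
  Constants have zero differential, so the combination is the jet of one section.\<close>

lemma jetJ_fibre:
  assumes s: "s \<in> sections E" and \<phi>: "\<phi> \<in> Hom"
  shows "\<exists>t\<in>sections E. jetJ A E s \<phi> p = jet1 A E t p"
proof -
  have "jetJ A E s \<phi> \<in> sections (jet_bundle A E)" by (rule jetJ_section[OF s \<phi>])
  then obtain U where U: "open U" "p \<in> U" "jloc U (jetJ A E s \<phi>)" unfolding jet_sections by metis
  obtain n :: nat and f u where 1: "\<And>i. i < n \<Longrightarrow> f i \<in> Cinf A" "\<And>i. i < n \<Longrightarrow> u i \<in> sections E"
    "\<And>q. q \<in> U \<Longrightarrow> jetJ A E s \<phi> q = (\<Sum>i<n. f i q *\<^sub>R jet1 A E (u i) q)"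
    by (rule jloc_obtain[OF U(3)]) (rule that; assumption)
  define c where "c i = f i p" for i
  have 2: "(\<Sum>i<n. fmul (\<lambda>q. c i) (jet1 A E (u i))) = jetJ A E (\<Sum>i<n. fmul (\<lambda>q. c i) (u i)) (\<Sum>i<n. dtens A (\<lambda>q. c i) (u i))"
    by (rule jet_combination) (simp_all add: 1)
  have "dtens A (\<lambda>q. k) t = 0" for k and t :: "'m \<Rightarrow> 'v"
    by (intro ext) (simp add: dtens_def tangent_const)
  then have 3: "(\<Sum>i<n. fmul (\<lambda>q. c i) (jet1 A E (u i))) = jet1 A E (\<Sum>i<n. fmul (\<lambda>q. c i) (u i))"
    using 2 by (simp add: jet1_eq)
  have "jetJ A E s \<phi> p = (\<Sum>i<n. fmul (\<lambda>q. c i) (jet1 A E (u i))) p"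
    by (simp add: 1(3)[OF U(2)] sum_fun_apply c_def)
  then have "jetJ A E s \<phi> p = jet1 A E (\<Sum>i<n. fmul (\<lambda>q. c i) (u i)) p" unfolding 3 .
  moreover have "(\<Sum>i<n. fmul (\<lambda>q. c i) (u i)) \<in> sections E" by (rule sec_sum) (simp add: sec_fmul 1)
  ultimately show ?thesis by (rule bexI)
qed

lemma jet_proj_jetJ:
  assumes s: "s \<in> sections E" and \<phi>: "\<phi> \<in> Hom"
  shows "jet_proj A E p (jetJ A E s \<phi> p) = s p"
proof -
  obtain t where t: "t \<in> sections E" "jetJ A E s \<phi> p = jetJ A E t 0 p"
    using jetJ_fibre[OF s \<phi>, of p] by (auto simp: jet1_eq)
  have tp: "s p = t p" by (rule jetJ_eq_fst[OF s t])
  show ?thesis unfolding jet_proj_def jet1_eq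
  proof (rule the_equality)
    show "\<exists>s'\<in>sections E. jetJ A E s \<phi> p = jetJ A E s' 0 p \<and> s p = s' p"
      using t tp by (intro bexI[of _ t] conjI)
    fix x assume "\<exists>s'\<in>sections E. jetJ A E s \<phi> p = jetJ A E s' 0 p \<and> x = s' p"
    then obtain s' where "s' \<in> sections E" "jetJ A E s \<phi> p = jetJ A E s' 0 p" "x = s' p" by blast
    then show "x = s p" using jetJ_eq_fst[OF s, of s' \<phi> p 0] by simp
  qed
qed

lemma jet_mbundle: "mbundle A (jet_bundle A E)"
proof
  let ?J = "jet_bundle A E"
  show "\<sigma> p \<in> fibre ?J p" if \<sigma>: "\<sigma> \<in> sections ?J" for \<sigma> p
  proof (rule jet_section_decomposition[OF \<sigma>])
    fix s \<phi> assume *: "s \<in> sections E" "\<phi> \<in> Hom" "\<sigma> = jetJ A E s \<phi>"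
    obtain t where t: "t \<in> sections E" "jetJ A E s \<phi> p = jet1 A E t p"
      using jetJ_fibre[OF *(1,2), of p] by (elim bexE) (rule that)
    show ?thesis unfolding jet_fibre by (rule image_eqI[OF _ t(1)]) (simp add: *(3) t(2))
  qed
  have z: "(0::'m \<Rightarrow> 'm tvec \<Rightarrow> 'v) \<in> Hom" by (rule H.sec_zero)
  show "subspace (fibre ?J p)" for p
    unfolding subspace_def
  proof (intro conjI ballI allI)
    have "jet1 A E 0 p \<in> fibre ?J p" unfolding jet_fibre by (rule imageI) (rule sec_zero)
    then show "0 \<in> fibre ?J p" by (simp add: jet1_eq jetJ_zero)
    fix j assume "j \<in> fibre ?J p"
    then obtain s where s: "s \<in> sections E" "j = jetJ A E s 0 p" by (auto simp: jet_fibre jet1_eq)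
    have "dtens A (\<lambda>q. c) s = 0" for c
      by (intro ext) (simp add: dtens_def tangent_const)
    then have "c *\<^sub>R j = jet1 A E (fmul (\<lambda>q. c) s) p" for c
      using fun_cong[OF jetJ_fmul[OF Cinf_const[of c] s(1) z], where x = p] s(2) by (simp add: jet1_eq fmul_zero)
    then show "c *\<^sub>R j \<in> fibre ?J p" for c
      unfolding jet_fibre using imageI[OF sec_fmul[OF Cinf_const[of c] s(1)], of "\<lambda>s. jet1 A E s p"] by simp
    fix k assume "k \<in> fibre ?J p"
    then obtain t where t: "t \<in> sections E" "k = jetJ A E t 0 p" by (auto simp: jet_fibre jet1_eq)
    have "j + k = jet1 A E (s + t) p"
      using fun_cong[OF jetJ_add[OF s(1) t(1) z z], where x = p] s(2) t(2) by (simp add: jet1_eq)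
    then show "j + k \<in> fibre ?J p"
      unfolding jet_fibre using imageI[OF sec_add[OF s(1) t(1)], of "\<lambda>s. jet1 A E s p"] by simp
  qed
  show "0 \<in> sections ?J" using jetJ_section[OF sec_zero z] by (simp add: jetJ_zero)
  show "\<sigma> + \<tau> \<in> sections ?J" if \<sigma>: "\<sigma> \<in> sections ?J" and \<tau>: "\<tau> \<in> sections ?J" for \<sigma> \<tau>
  proof (rule jet_section_decomposition[OF \<sigma>], rule jet_section_decomposition[OF \<tau>])
    fix s \<phi> t \<psi> assume "s \<in> sections E" "\<phi> \<in> Hom" "\<sigma> = jetJ A E s \<phi>" "t \<in> sections E" "\<psi> \<in> Hom" "\<tau> = jetJ A E t \<psi>"
    then show ?thesis by (simp add: jetJ_add jetJ_section sec_add H.sec_add)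
  qed
  show "fmul f \<sigma> \<in> sections ?J" if f: "f \<in> Cinf A" and \<sigma>: "\<sigma> \<in> sections ?J" for f \<sigma>
  proof (rule jet_section_decomposition[OF \<sigma>])
    fix s \<phi> assume "s \<in> sections E" "\<phi> \<in> Hom" "\<sigma> = jetJ A E s \<phi>"
    then show ?thesis by (simp add: jetJ_fmul f jetJ_section sec_fmul H.sec_add H.sec_fmul dtens_Hom)
  qed
  show "\<sigma> \<in> sections ?J" if loc: "\<And>p. \<exists>U. open U \<and> p \<in> U \<and> (\<exists>\<tau>\<in>sections ?J. \<forall>q\<in>U. \<sigma> q = \<tau> q)" for \<sigma>
    unfolding jet_sections
  proof
    fix p
    obtain U \<tau> where U: "open U" "p \<in> U" "\<tau> \<in> sections ?J" "\<forall>q\<in>U. \<sigma> q = \<tau> q"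
      using loc[of p] by (elim exE conjE bexE) (rule that)
    obtain V where V: "open V" "p \<in> V" "jloc V \<tau>" 
      using U(3)[unfolded jet_sections, THEN spec, of p] by (elim exE conjE) (rule that)
    have "jloc (U \<inter> V) \<sigma>" by (rule jloc_cong[OF V(3)]) (simp_all add: U(4))
    then show "\<exists>U. open U \<and> p \<in> U \<and> jloc U \<sigma>"
      using U(1,2) V(1,2) by (rule_tac exI[of _ "U \<inter> V"]) (simp add: open_Int)
  qed
qed

text \<open>The jet bundle has been given no frames, so \<open>Clinear_pointwise\<close> does not
  apply to it; that prolonged sections generate it locally is enough. This is the tool for
  uniqueness of the bracket of jets.\<close>

lemma jet_Clinear_vanish:
  fixes F :: "('m \<Rightarrow> ('m, 'v) jet) \<Rightarrow> 'm \<Rightarrow> 'w::real_vector"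
  assumes F: "Clinear A (jet_bundle A E) F" and z: "\<And>s. s \<in> sections E \<Longrightarrow> F (jet1 A E s) = 0"
    and \<sigma>: "\<sigma> \<in> sections (jet_bundle A E)"
  shows "F \<sigma> = 0"
proof
  fix p
  interpret J: mbundle A "jet_bundle A E" by (rule jet_mbundle)
  have j1: "jet1 A E s \<in> sections (jet_bundle A E)" if "s \<in> sections E" for s
    unfolding jet1_eq by (rule jetJ_section[OF that H.sec_zero])
  have F0: "F 0 = 0" using ClinearD(1)[OF F J.sec_zero J.sec_zero] by simp
  have Fsum: "F (\<Sum>i\<in>I. u i) = (\<Sum>i\<in>I. F (u i))"
    if "\<And>i. i \<in> I \<Longrightarrow> u i \<in> sections (jet_bundle A E)" for I :: "nat set" and u
    using that by (induction I rule: infinite_finite_induct) (simp_all add: F0 ClinearD(1)[OF F] J.sec_sum)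
  obtain U where U: "open U" "p \<in> U" "jloc U \<sigma>" using \<sigma> unfolding jet_sections by metis
  obtain n :: nat and f s where 1: "\<And>i. i < n \<Longrightarrow> f i \<in> Cinf A" "\<And>i. i < n \<Longrightarrow> s i \<in> sections E"
    "\<And>q. q \<in> U \<Longrightarrow> \<sigma> q = (\<Sum>i<n. f i q *\<^sub>R jet1 A E (s i) q)"
    by (rule jloc_obtain[OF U(3)]) (rule that; assumption)
  obtain W \<rho> where b: "bump U W \<rho>" "p \<in> W" by (rule bump_exists[OF U(1,2)])
  note \<rho> = bumpD[OF b(1)]
  have "fmul \<rho> \<sigma> = (\<Sum>i<n. fmul (\<lambda>q. \<rho> q * f i q) (jet1 A E (s i)))"
  proof
    fix q
    show "fmul \<rho> \<sigma> q = (\<Sum>i<n. fmul (\<lambda>q. \<rho> q * f i q) (jet1 A E (s i))) q"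
      by (cases "q \<in> U") (simp_all add: 1(3) \<rho>(5) sum_fun_apply scaleR_sum_right)
  qed
  then have "F (fmul \<rho> \<sigma>) = F (\<Sum>i<n. fmul (\<lambda>q. \<rho> q * f i q) (jet1 A E (s i)))"
    by (rule arg_cong)
  also have "\<dots> = (\<Sum>i<n. F (fmul (\<lambda>q. \<rho> q * f i q) (jet1 A E (s i))))"
    by (rule Fsum, rule J.sec_fmul) (simp_all add: \<rho>(1) 1(1,2) j1)
  also have "\<dots> = 0"
  proof (rule sum.neutral, rule ballI)
    fix i assume "i \<in> {..<n}"
    then have i: "f i \<in> Cinf A" "s i \<in> sections E" by (simp_all add: 1)
    have "F (fmul (\<lambda>q. \<rho> q * f i q) (jet1 A E (s i))) = fmul (\<lambda>q. \<rho> q * f i q) (F (jet1 A E (s i)))"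
      by (rule ClinearD(2)[OF F Cinf_mult[OF \<rho>(1) i(1)] j1[OF i(2)]])
    also have "\<dots> = 0" unfolding z[OF i(2)] by (rule ext) simp
    finally show "F (fmul (\<lambda>q. \<rho> q * f i q) (jet1 A E (s i))) = 0" .
  qed
  finally have "fmul \<rho> (F \<sigma>) = 0" by (simp add: ClinearD(2)[OF F \<rho>(1) \<sigma>])
  from fun_cong[OF this, of p] show "F \<sigma> p = 0 p" using \<rho>(4)[OF b(2)] by simp
qed

end

section \<open>The bracket on jets\<close>

lemma lie_bracket_onD:
  assumes "lie_bracket_on A E a br"
  shows "s \<in> sections E \<Longrightarrow> t \<in> sections E \<Longrightarrow> br s t \<in> sections E"
    and "s \<in> sections E \<Longrightarrow> t \<in> sections E \<Longrightarrow> u \<in> sections E \<Longrightarrow> br s (t + u) = br s t + br s u"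
    and "s \<in> sections E \<Longrightarrow> t \<in> sections E \<Longrightarrow> br s (c *\<^sub>R t) = c *\<^sub>R br s t"
    and "s \<in> sections E \<Longrightarrow> t \<in> sections E \<Longrightarrow> br s t = - br t s"
    and "s \<in> sections E \<Longrightarrow> t \<in> sections E \<Longrightarrow> u \<in> sections E \<Longrightarrow>
      br s (br t u) + br t (br u s) + br u (br s t) = 0"
    and "f \<in> Cinf A \<Longrightarrow> s \<in> sections E \<Longrightarrow> t \<in> sections E \<Longrightarrow>
      br s (fmul f t) = fmul f (br s t) + fmul (\<lambda>p. a p (s p) f) t"
    and "s \<notin> sections E \<or> t \<notin> sections E \<Longrightarrow> br s t = 0"
proof -
  note c = assms[unfolded lie_bracket_on_def]
  note c2 = c[THEN conjunct2]
  note c3 = c2[THEN conjunct2]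
  note c4 = c3[THEN conjunct2]
  note c5 = c4[THEN conjunct2]
  note c6 = c5[THEN conjunct2]
  show "s \<in> sections E \<Longrightarrow> t \<in> sections E \<Longrightarrow> br s t \<in> sections E"
    by (rule c[THEN conjunct1, rule_format])
  show "s \<in> sections E \<Longrightarrow> t \<in> sections E \<Longrightarrow> u \<in> sections E \<Longrightarrow> br s (t + u) = br s t + br s u"
    by (rule c2[THEN conjunct1, rule_format])
  show "s \<in> sections E \<Longrightarrow> t \<in> sections E \<Longrightarrow> br s (c *\<^sub>R t) = c *\<^sub>R br s t"
    by (rule c3[THEN conjunct1, rule_format])
  show "s \<in> sections E \<Longrightarrow> t \<in> sections E \<Longrightarrow> br s t = - br t s"
    by (rule c4[THEN conjunct1, rule_format])
  show "s \<in> sections E \<Longrightarrow> t \<in> sections E \<Longrightarrow> u \<in> sections E \<Longrightarrow>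
      br s (br t u) + br t (br u s) + br u (br s t) = 0"
    by (rule c5[THEN conjunct1, rule_format])
  show "f \<in> Cinf A \<Longrightarrow> s \<in> sections E \<Longrightarrow> t \<in> sections E \<Longrightarrow>
      br s (fmul f t) = fmul f (br s t) + fmul (\<lambda>p. a p (s p) f) t"
    by (rule c6[THEN conjunct1, rule_format])
  show "s \<notin> sections E \<or> t \<notin> sections E \<Longrightarrow> br s t = 0"
    by (rule c6[THEN conjunct2, rule_format])
qed

lemma lie_bracket_onI:
  assumes "\<And>s t. s \<in> sections E \<Longrightarrow> t \<in> sections E \<Longrightarrow> br s t \<in> sections E"
    and "\<And>s t u. s \<in> sections E \<Longrightarrow> t \<in> sections E \<Longrightarrow> u \<in> sections E \<Longrightarrow> br s (t + u) = br s t + br s u"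
    and "\<And>s t c. s \<in> sections E \<Longrightarrow> t \<in> sections E \<Longrightarrow> br s (c *\<^sub>R t) = c *\<^sub>R br s t"
    and "\<And>s t. s \<in> sections E \<Longrightarrow> t \<in> sections E \<Longrightarrow> br s t = - br t s"
    and "\<And>s t u. s \<in> sections E \<Longrightarrow> t \<in> sections E \<Longrightarrow> u \<in> sections E \<Longrightarrow>
      br s (br t u) + br t (br u s) + br u (br s t) = 0"
    and "\<And>f s t. f \<in> Cinf A \<Longrightarrow> s \<in> sections E \<Longrightarrow> t \<in> sections E \<Longrightarrow>
      br s (fmul f t) = fmul f (br s t) + fmul (\<lambda>p. a p (s p) f) t"
    and "\<And>s t. s \<notin> sections E \<or> t \<notin> sections E \<Longrightarrow> br s t = 0"
  shows "lie_bracket_on A E a br"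
  unfolding lie_bracket_on_def
proof (intro conjI ballI allI impI)
qed (fact assms | (rule assms; assumption))+

context smooth_manifold
begin

section \<open>The Lie bracket of vector fields\<close>

lemma vf_apply: "vf_bracket X Y p f = X p (\<lambda>q. Y q f) - Y p (\<lambda>q. X q f)"
  by (simp add: vf_bracket_def)

lemma VF_fun_eqs:
  assumes X: "X \<in> VF A"
  shows "f \<in> Cinf A \<Longrightarrow> g \<in> Cinf A \<Longrightarrow> X p (\<lambda>q. f q + g q) = X p f + X p g"
    and "f \<in> Cinf A \<Longrightarrow> g \<in> Cinf A \<Longrightarrow> X p (\<lambda>q. f q - g q) = X p f - X p g"
    and "f \<in> Cinf A \<Longrightarrow> g \<in> Cinf A \<Longrightarrow> X p (\<lambda>q. f q * g q) = X p f * g p + f p * X p g"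
    and "f \<in> Cinf A \<Longrightarrow> X p (\<lambda>q. c * f q) = c * X p f"
    and "f \<in> Cinf A \<Longrightarrow> X p (\<lambda>q. - f q) = - X p f"
    and "X p (\<lambda>q. c) = 0"
proof -
  note v = VF_tangent[OF X, of p]
  show "f \<in> Cinf A \<Longrightarrow> g \<in> Cinf A \<Longrightarrow> X p (\<lambda>q. f q + g q) = X p f + X p g" by (rule tangent_add[OF v])
  show "f \<in> Cinf A \<Longrightarrow> g \<in> Cinf A \<Longrightarrow> X p (\<lambda>q. f q - g q) = X p f - X p g" by (rule tangent_diff[OF v])
  show "f \<in> Cinf A \<Longrightarrow> g \<in> Cinf A \<Longrightarrow> X p (\<lambda>q. f q * g q) = X p f * g p + f p * X p g" by (rule tangent_mult[OF v])
  show "f \<in> Cinf A \<Longrightarrow> X p (\<lambda>q. c * f q) = c * X p f" by (rule tangent_scale[OF v])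
  show "f \<in> Cinf A \<Longrightarrow> X p (\<lambda>q. - f q) = - X p f" by (rule tangent_minus[OF v])
  show "X p (\<lambda>q. c) = 0" by (rule tangent_const[OF v])
qed

lemma vf_closed:
  assumes X: "X \<in> VF A" and Y: "Y \<in> VF A"
  shows "vf_bracket X Y \<in> VF A"
proof -
  have "vf_bracket X Y p \<in> tangent A p" for p
    unfolding tangent_def
  proof (intro CollectI conjI ballI allI impI)
    fix f g assume f: "f \<in> Cinf A" and g: "g \<in> Cinf A"
    show "vf_bracket X Y p (\<lambda>q. f q + g q) = vf_bracket X Y p f + vf_bracket X Y p g"
      by (simp add: vf_apply VF_fun_eqs[OF X] VF_fun_eqs[OF Y] f g VF_Cinf[OF X] VF_Cinf[OF Y])
    show "vf_bracket X Y p (\<lambda>q. f q * g q) = vf_bracket X Y p f * g p + f p * vf_bracket X Y p g"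
      by (simp add: vf_apply VF_fun_eqs[OF X] VF_fun_eqs[OF Y] f g VF_Cinf[OF X] VF_Cinf[OF Y] algebra_simps)
  next
    fix c f assume f: "f \<in> Cinf A"
    show "vf_bracket X Y p (\<lambda>q. c * f q) = c * vf_bracket X Y p f"
      by (simp add: vf_apply VF_fun_eqs[OF X] VF_fun_eqs[OF Y] f VF_Cinf[OF X] VF_Cinf[OF Y] algebra_simps)
  next
    fix f assume f: "f \<notin> Cinf A"
    have "X q f = 0" "Y q f = 0" for q
      using tangent_off[OF VF_tangent[OF X] f] tangent_off[OF VF_tangent[OF Y] f] by simp_all
    then show "vf_bracket X Y p f = 0"
      by (simp add: vf_apply VF_fun_eqs(6)[OF X] VF_fun_eqs(6)[OF Y])
  qed
  then show ?thesis
    by (simp add: VF_iff vf_apply VF_Cinf[OF X] VF_Cinf[OF Y])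
qed

lemma vf_antisym: "vf_bracket X Y = - vf_bracket Y X"
  by (intro ext) (simp add: vf_apply)

lemma vf_add_right: "X \<in> VF A \<Longrightarrow> Y \<in> VF A \<Longrightarrow> Z \<in> VF A \<Longrightarrow> vf_bracket X (Y + Z) = vf_bracket X Y + vf_bracket X Z"
  by (intro ext) (simp add: vf_apply VF_fun_eqs[of X] VF_fun_eqs[of Y] VF_fun_eqs[of Z] VF_Cinf[of X] VF_Cinf[of Y] VF_Cinf[of Z])

lemma vf_add_left: "X \<in> VF A \<Longrightarrow> Y \<in> VF A \<Longrightarrow> Z \<in> VF A \<Longrightarrow> vf_bracket (X + Y) Z = vf_bracket X Z + vf_bracket Y Z"
  by (intro ext) (simp add: vf_apply VF_fun_eqs[of X] VF_fun_eqs[of Y] VF_fun_eqs[of Z] VF_Cinf[of X] VF_Cinf[of Y] VF_Cinf[of Z])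

lemma vf_minus_right: "X \<in> VF A \<Longrightarrow> Y \<in> VF A \<Longrightarrow> vf_bracket X (- Y) = - vf_bracket X Y"
  by (intro ext) (simp add: vf_apply VF_fun_eqs[of X] VF_fun_eqs[of Y] VF_fun_eqs[of Z] VF_Cinf[of X] VF_Cinf[of Y])

lemma vf_diff_right: "X \<in> VF A \<Longrightarrow> Y \<in> VF A \<Longrightarrow> Z \<in> VF A \<Longrightarrow> vf_bracket X (Y - Z) = vf_bracket X Y - vf_bracket X Z"
  by (intro ext) (simp add: vf_apply VF_fun_eqs[of X] VF_fun_eqs[of Y] VF_fun_eqs[of Z] VF_Cinf[of X] VF_Cinf[of Y] VF_Cinf[of Z])

lemma vf_diff_left: "X \<in> VF A \<Longrightarrow> Y \<in> VF A \<Longrightarrow> Z \<in> VF A \<Longrightarrow> vf_bracket (X - Y) Z = vf_bracket X Z - vf_bracket Y Z"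
  by (intro ext) (simp add: vf_apply VF_fun_eqs[of X] VF_fun_eqs[of Y] VF_fun_eqs[of Z] VF_Cinf[of X] VF_Cinf[of Y] VF_Cinf[of Z])

lemma vf_fmul_right: "f \<in> Cinf A \<Longrightarrow> X \<in> VF A \<Longrightarrow> Y \<in> VF A \<Longrightarrow>
    vf_bracket X (fmul f Y) = fmul f (vf_bracket X Y) + fmul (\<lambda>p. X p f) Y"
  by (intro ext) (simp add: vf_apply VF_fun_eqs[of X] VF_fun_eqs[of Y] VF_Cinf[of X] VF_Cinf[of Y] algebra_simps)

lemma vf_fmul_left: "f \<in> Cinf A \<Longrightarrow> X \<in> VF A \<Longrightarrow> Y \<in> VF A \<Longrightarrow>
    vf_bracket (fmul f X) Y = fmul f (vf_bracket X Y) - fmul (\<lambda>p. Y p f) X"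
  by (intro ext) (simp add: vf_apply VF_fun_eqs[of X] VF_fun_eqs[of Y] VF_Cinf[of X] VF_Cinf[of Y] algebra_simps)

lemma vf_jacobi: "X \<in> VF A \<Longrightarrow> Y \<in> VF A \<Longrightarrow> Z \<in> VF A \<Longrightarrow>
    vf_bracket (vf_bracket X Y) Z = vf_bracket X (vf_bracket Y Z) - vf_bracket Y (vf_bracket X Z)"
  by (intro ext) (simp add: vf_apply VF_fun_eqs[of X] VF_fun_eqs[of Y] VF_fun_eqs[of Z] VF_Cinf[of X] VF_Cinf[of Y] VF_Cinf[of Z] Cinf_diff)

end

lemma ap_diff_arg: "Clinear A E (ap \<phi>) \<Longrightarrow> mbundle A E \<Longrightarrow> s \<in> sections E \<Longrightarrow> t \<in> sections E \<Longrightarrow>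
    ap \<phi> (s - t) = ap \<phi> s - ap \<phi> t"
proof -
  assume c: "Clinear A E (ap \<phi>)" and m: "mbundle A E" and st: "s \<in> sections E" "t \<in> sections E"
  have "ap \<phi> ((s - t) + t) = ap \<phi> (s - t) + ap \<phi> t"
    by (rule ClinearD(1)[OF c mbundle.sec_diff[OF m st] st(2)])
  then show ?thesis by simp
qed

text \<open>That the anchor respects brackets is listed as an axiom; it is checked directly for the
  two instances, the tangent bundle and \<open>g\<close>.\<close>

locale algebroid_bundle = sbundle A L
  for A :: "('m::{t2_space, second_countable_topology}, 'e::euclidean_space) atlas"
    and L :: "('m, 'v::real_vector) algebroid" +
  assumes anchor_hom: "anchor L \<in> sections (hom_bundle L (TM A))"
    and bracket_lie: "lie_bracket_on A L (anchor L) (bracket L)"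
    and anchor_bracket: "s \<in> sections L \<Longrightarrow> t \<in> sections L \<Longrightarrow>
      ap (anchor L) (bracket L s t) = vf_bracket (ap (anchor L) s) (ap (anchor L) t)"
begin

interpretation TM: sbundle A "TM A" by (rule TM_sbundle)
interpretation H: mbundle A "hom_bundle (TM A) L" by (rule hom_mbundle[OF TM_mbundle mbundle_axioms])
interpretation J: mbundle A "jet_bundle A L" by (rule jet_mbundle)

abbreviation an where "an \<equiv> ap (anchor L)"
abbreviation br where "br \<equiv> bracket L"

lemma an_VF: "s \<in> sections L \<Longrightarrow> an s \<in> VF A"
  using hom_secD(5)[OF anchor_hom] by simp

lemma an_Cinf: "s \<in> sections L \<Longrightarrow> (\<lambda>p. an s p f) \<in> Cinf A"
  by (rule VF_Cinf[OF an_VF])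

lemma an_add: "s \<in> sections L \<Longrightarrow> t \<in> sections L \<Longrightarrow> an (s + t) = an s + an t"
  by (rule ClinearD(1)[OF ap_Clinear[OF anchor_hom]])

lemma an_fmul: "f \<in> Cinf A \<Longrightarrow> s \<in> sections L \<Longrightarrow> an (fmul f s) = fmul f (an s)"
  by (rule ClinearD(2)[OF ap_Clinear[OF anchor_hom]])

lemma an_diff: "s \<in> sections L \<Longrightarrow> t \<in> sections L \<Longrightarrow> an (s - t) = an s - an t"
  by (rule ap_diff_arg[OF ap_Clinear[OF anchor_hom] mbundle_axioms])

lemmas br_closed = lie_bracket_onD(1)[OF bracket_lie]
lemmas br_add_right = lie_bracket_onD(2)[OF bracket_lie]
lemmas br_antisym = lie_bracket_onD(4)[OF bracket_lie]

lemma br_fmul_right: "f \<in> Cinf A \<Longrightarrow> s \<in> sections L \<Longrightarrow> t \<in> sections L \<Longrightarrow>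
    br s (fmul f t) = fmul f (br s t) + fmul (\<lambda>p. an s p f) t"
  using lie_bracket_onD(6)[OF bracket_lie] by simp

lemma br_diff_right:
  assumes "s \<in> sections L" "t \<in> sections L" "u \<in> sections L"
  shows "br s (t - u) = br s t - br s u"
  using br_add_right[OF assms(1) sec_diff[OF assms(2,3)] assms(3)] by simp

lemma br_add_left:
  assumes "s \<in> sections L" "t \<in> sections L" "u \<in> sections L"
  shows "br (s + t) u = br s u + br t u"
  using br_antisym[OF sec_add[OF assms(1,2)] assms(3)] br_antisym[OF assms(1,3)] br_antisym[OF assms(2,3)]
    br_add_right[OF assms(3,1,2)] by simp

lemma fmul_minus: "fmul f (- s) = - fmul f s" for s :: "'m \<Rightarrow> 'v"
  by (rule ext) simp

lemma br_fmul_left: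
  assumes "f \<in> Cinf A" "s \<in> sections L" "t \<in> sections L"
  shows "br (fmul f s) t = fmul f (br s t) - fmul (\<lambda>p. an t p f) s"
proof -
  have 1: "br (fmul f s) t = - br t (fmul f s)" by (rule br_antisym[OF sec_fmul[OF assms(1,2)] assms(3)])
  have 2: "br t (fmul f s) = fmul f (br t s) + fmul (\<lambda>p. an t p f) s" by (rule br_fmul_right[OF assms(1,3,2)])
  have 3: "br t s = - br s t" by (rule br_antisym[OF assms(3,2)])
  show ?thesis by (simp only: 1 2 3 fmul_minus minus_add_distrib minus_minus add_uminus_conv_diff)
qed

lemma br_jacobi:
  assumes "s \<in> sections L" "t \<in> sections L" "u \<in> sections L"
  shows "br (br s t) u = br s (br t u) - br t (br s u)"
proof -
  have 1: "br (br s t) u = - br u (br s t)" by (rule br_antisym[OF br_closed[OF assms(1,2)] assms(3)])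
  have 2: "br t (br u s) = - br t (br s u)"
  proof -
    have "br u s + br s u = 0" using br_antisym[OF assms(3,1)] by simp
    then have "br t (br u s + br s u) = br t 0" by simp
    moreover have "br t 0 = 0" using br_diff_right[OF assms(2,2,2)] by simp
    ultimately have "br t (br u s) + br t (br s u) = 0"
      using br_add_right[OF assms(2) br_closed[OF assms(3,1)] br_closed[OF assms(1,3)]] by simp
    then show ?thesis by (simp add: eq_neg_iff_add_eq_0)
  qed
  have "br s (br t u) + br t (br u s) + br u (br s t) = 0" by (rule lie_bracket_onD(5)[OF bracket_lie assms])
  then show ?thesis unfolding 1 2 by (simp add: add_eq_0_iff2 eq_neg_iff_add_eq_0 algebra_simps)
qed

lemma Hom_add: "\<phi> \<in> Hom \<Longrightarrow> V \<in> VF A \<Longrightarrow> W \<in> VF A \<Longrightarrow> ap \<phi> (V + W) = ap \<phi> V + ap \<phi> W"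
  using ClinearD(1)[OF TM.ap_Clinear] by simp

lemma Hom_fmul: "\<phi> \<in> Hom \<Longrightarrow> f \<in> Cinf A \<Longrightarrow> V \<in> VF A \<Longrightarrow> ap \<phi> (fmul f V) = fmul f (ap \<phi> V)"
  using ClinearD(2)[OF TM.ap_Clinear] by simp

lemma Hom_diff: "\<phi> \<in> Hom \<Longrightarrow> V \<in> VF A \<Longrightarrow> W \<in> VF A \<Longrightarrow> ap \<phi> (V - W) = ap \<phi> V - ap \<phi> W"
  using ap_diff_arg[OF TM.ap_Clinear TM_mbundle] by simp

lemma Hom_ext: "\<phi> \<in> Hom \<Longrightarrow> \<psi> \<in> Hom \<Longrightarrow> (\<And>V. V \<in> VF A \<Longrightarrow> ap \<phi> V = ap \<psi> V) \<Longrightarrow> \<phi> = \<psi>"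
  by (rule TM.hom_ext) simp_all

lemmas closed = an_Cinf an_Cinf[unfolded ap_apply] an_VF br_closed sec_add sec_diff sec_fmul sec_minus VF_add VF_diff VF_fmul VF_minus vf_closed
  HomD(5) H.sec_add H.sec_diff H.sec_minus H.sec_fmul

lemmas expand = br_add_right br_diff_right br_add_left br_fmul_left br_fmul_right an_add an_diff an_fmul anchor_bracket
  Hom_add Hom_diff Hom_fmul vf_add_right vf_diff_right vf_fmul_right vf_add_left vf_diff_left vf_fmul_left

lemma hom_of:
  assumes "\<And>V W. V \<in> VF A \<Longrightarrow> W \<in> VF A \<Longrightarrow> F (V + W) = F V + F W"
    and "\<And>f V. f \<in> Cinf A \<Longrightarrow> V \<in> VF A \<Longrightarrow> F (fmul f V) = fmul f (F V)"
    and "\<And>V. V \<in> VF A \<Longrightarrow> F V \<in> sections L"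
  shows "tensorial (TM A) F \<in> Hom" "\<And>V. V \<in> VF A \<Longrightarrow> ap (tensorial (TM A) F) V = F V"
proof -
  have c: "Clinear A (TM A) F" by (rule ClinearI; simp add: assms)
  show "tensorial (TM A) F \<in> Hom"
    by (rule TM.tensorial_hom[OF c]) (simp_all add: assms(3) sec_fibre)
  show "ap (tensorial (TM A) F) V = F V" if "V \<in> VF A" for V
    using TM.ap_tensorial[OF c] that by simp
qed

text \<open>Writing sections of \<open>J\<^sup>1L\<close> as \<open>J\<^sup>1s + \<phi>\<close>, the bracket is that of the semidirect product of \<open>\<Gamma>(L)\<close>
  with the associative algebra of bundle maps \<open>TM \<rightarrow> L\<close>, multiplied through the anchor.\<close>

definition act :: "('m \<Rightarrow> 'v) \<Rightarrow> ('m \<Rightarrow> 'm tvec \<Rightarrow> 'v) \<Rightarrow> 'm \<Rightarrow> 'm tvec \<Rightarrow> 'v" where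
  "act s \<phi> = tensorial (TM A) (\<lambda>V. br s (ap \<phi> V) - ap \<phi> (vf_bracket (an s) V))"

definition comp :: "('m \<Rightarrow> 'm tvec \<Rightarrow> 'v) \<Rightarrow> ('m \<Rightarrow> 'm tvec \<Rightarrow> 'v) \<Rightarrow> 'm \<Rightarrow> 'm tvec \<Rightarrow> 'v" where
  "comp \<phi> \<psi> = tensorial (TM A) (\<lambda>V. ap \<phi> (an (ap \<psi> V)))"

definition jbr :: "('m \<Rightarrow> 'v) \<Rightarrow> ('m \<Rightarrow> 'm tvec \<Rightarrow> 'v) \<Rightarrow> ('m \<Rightarrow> 'v) \<Rightarrow> ('m \<Rightarrow> 'm tvec \<Rightarrow> 'v) \<Rightarrow> 'm \<Rightarrow> 'm tvec \<Rightarrow> 'v" where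
  "jbr s \<phi> t \<psi> = act s \<psi> - act t \<phi> + comp \<phi> \<psi> - comp \<psi> \<phi>"

lemma
  assumes s: "s \<in> sections L" and \<phi>: "\<phi> \<in> Hom"
  shows act_Hom: "act s \<phi> \<in> Hom"
    and ap_act: "V \<in> VF A \<Longrightarrow> ap (act s \<phi>) V = br s (ap \<phi> V) - ap \<phi> (vf_bracket (an s) V)"
proof -
  let ?F = "\<lambda>V. br s (ap \<phi> V) - ap \<phi> (vf_bracket (an s) V)"
  have a: "?F (V + W) = ?F V + ?F W" if "V \<in> VF A" "W \<in> VF A" for V W
    using that by (simp add: expand closed s \<phi>)
  have f: "?F (fmul f V) = fmul f (?F V)" if "f \<in> Cinf A" "V \<in> VF A" for f V
  proof -
    \<comment> \<open>Both Leibniz rules produce the same term with the derivative of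
      \<open>f\<close> along the anchor of \<open>s\<close>. The two copies cancel, which is why the
      operator is tensorial.\<close>
    have "?F (fmul f V) = fmul f (br s (ap \<phi> V)) + fmul (\<lambda>p. an s p f) (ap \<phi> V)
        - (fmul f (ap \<phi> (vf_bracket (an s) V)) + fmul (\<lambda>p. an s p f) (ap \<phi> V))"
      using that by (simp add: expand closed s \<phi>)
    then show ?thesis by (simp add: fun_eq_iff algebra_simps)
  qed
  have c: "?F V \<in> sections L" if "V \<in> VF A" for V
    using that by (simp add: closed s \<phi>)
  show "act s \<phi> \<in> Hom" unfolding act_def by (rule hom_of(1)[OF a f c])
  show "ap (act s \<phi>) V = ?F V" if "V \<in> VF A" unfolding act_def by (rule hom_of(2)[OF a f c that])
qed

lemma
  assumes \<phi>: "\<phi> \<in> Hom" and \<psi>: "\<psi> \<in> Hom"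
  shows comp_Hom: "comp \<phi> \<psi> \<in> Hom"
    and ap_comp: "V \<in> VF A \<Longrightarrow> ap (comp \<phi> \<psi>) V = ap \<phi> (an (ap \<psi> V))"
proof -
  let ?F = "\<lambda>V. ap \<phi> (an (ap \<psi> V))"
  have a: "?F (V + W) = ?F V + ?F W" if "V \<in> VF A" "W \<in> VF A" for V W
    using that by (simp add: expand closed \<psi> \<phi>)
  have f: "?F (fmul f V) = fmul f (?F V)" if "f \<in> Cinf A" "V \<in> VF A" for f V
    using that by (simp add: expand closed \<psi> \<phi>)
  have c: "?F V \<in> sections L" if "V \<in> VF A" for V
    using that by (simp add: closed \<psi> \<phi>)
  show "comp \<phi> \<psi> \<in> Hom" unfolding comp_def by (rule hom_of(1)[OF a f c])
  show "ap (comp \<phi> \<psi>) V = ?F V" if "V \<in> VF A" unfolding comp_def by (rule hom_of(2)[OF a f c that])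
qed

lemmas closed2 = closed act_Hom comp_Hom

lemma jbr_Hom:
  assumes "s \<in> sections L" "\<phi> \<in> Hom" "t \<in> sections L" "\<psi> \<in> Hom"
  shows "jbr s \<phi> t \<psi> \<in> Hom"
  unfolding jbr_def by (simp add: closed2 assms)

lemma ap_jbr:
  assumes "s \<in> sections L" "\<phi> \<in> Hom" "t \<in> sections L" "\<psi> \<in> Hom" "V \<in> VF A"
  shows "ap (jbr s \<phi> t \<psi>) V = br s (ap \<psi> V) - ap \<psi> (vf_bracket (an s) V)
    - (br t (ap \<phi> V) - ap \<phi> (vf_bracket (an t) V)) + ap \<phi> (an (ap \<psi> V)) - ap \<psi> (an (ap \<phi> V))"
  unfolding jbr_def by (simp add: ap_simps ap_act ap_comp assms)

lemma act_add_right: "s \<in> sections L \<Longrightarrow> \<phi> \<in> Hom \<Longrightarrow> \<psi> \<in> Hom \<Longrightarrow> act s (\<phi> + \<psi>) = act s \<phi> + act s \<psi>"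
  by (rule Hom_ext) (simp_all add: closed2 ap_act ap_simps expand)

lemma act_diff_right: "s \<in> sections L \<Longrightarrow> \<phi> \<in> Hom \<Longrightarrow> \<psi> \<in> Hom \<Longrightarrow> act s (\<phi> - \<psi>) = act s \<phi> - act s \<psi>"
  by (rule Hom_ext) (simp_all add: closed2 ap_act ap_simps expand)

lemma act_add_left: "s \<in> sections L \<Longrightarrow> t \<in> sections L \<Longrightarrow> \<phi> \<in> Hom \<Longrightarrow> act (s + t) \<phi> = act s \<phi> + act t \<phi>"
  by (rule Hom_ext) (simp_all add: closed2 ap_act ap_simps expand)

lemma comp_bilinear:
  assumes "\<phi> \<in> Hom" "\<psi> \<in> Hom" "\<xi> \<in> Hom"
  shows "comp (\<phi> + \<psi>) \<xi> = comp \<phi> \<xi> + comp \<psi> \<xi>" "comp \<phi> (\<psi> + \<xi>) = comp \<phi> \<psi> + comp \<phi> \<xi>"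
    and "comp (\<phi> - \<psi>) \<xi> = comp \<phi> \<xi> - comp \<psi> \<xi>" "comp \<phi> (\<psi> - \<xi>) = comp \<phi> \<psi> - comp \<phi> \<xi>"
  by (rule Hom_ext; simp add: closed2 ap_comp ap_simps expand assms)+

lemma comp_assoc:
  "\<phi> \<in> Hom \<Longrightarrow> \<psi> \<in> Hom \<Longrightarrow> \<xi> \<in> Hom \<Longrightarrow> comp (comp \<phi> \<psi>) \<xi> = comp \<phi> (comp \<psi> \<xi>)"
  by (rule Hom_ext) (simp_all add: closed2 ap_comp)

text \<open>With \<open>comp_assoc\<close> and \<open>act_bracket\<close> this says that sections
  act by derivations on an associative algebra, compatibly with their bracket. The commutator of
  that algebra and the action give a semidirect product, whose Jacobi identity is
  \<open>jbr_jacobi\<close>.\<close>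

lemma act_comp:
  "s \<in> sections L \<Longrightarrow> \<phi> \<in> Hom \<Longrightarrow> \<psi> \<in> Hom \<Longrightarrow> act s (comp \<phi> \<psi>) = comp (act s \<phi>) \<psi> + comp \<phi> (act s \<psi>)"
  by (rule Hom_ext) (simp_all add: closed2 ap_comp ap_act ap_simps expand)

lemma act_bracket:
  "s \<in> sections L \<Longrightarrow> t \<in> sections L \<Longrightarrow> \<phi> \<in> Hom \<Longrightarrow> act (br s t) \<phi> = act s (act t \<phi>) - act t (act s \<phi>)"
  by (rule Hom_ext) (simp_all add: closed2 ap_act ap_simps expand br_jacobi vf_jacobi)

lemma jbr_jacobi:
  assumes "s \<in> sections L" "t \<in> sections L" "u \<in> sections L" "\<phi> \<in> Hom" "\<psi> \<in> Hom" "\<xi> \<in> Hom"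
  shows "jbr s \<phi> (br t u) (jbr t \<psi> u \<xi>) + jbr t \<psi> (br u s) (jbr u \<xi> s \<phi>) + jbr u \<xi> (br s t) (jbr s \<phi> t \<psi>) = 0"
  unfolding jbr_def using assms
  by (simp add: closed2 act_add_right act_diff_right comp_bilinear act_comp act_bracket comp_assoc)

text \<open>The Leibniz rule in pair form. By \<open>jetJ_fmul\<close> each multiplied jet brings
  its own \<open>dtens\<close> term: one for \<open>f\<close> times the second argument, one for
  \<open>f\<close> times the bracket, one for the derivative of \<open>f\<close> times the second
  argument.\<close>

lemma jbr_leibniz:
  assumes st: "s \<in> sections L" "\<phi> \<in> Hom" "t \<in> sections L" "\<psi> \<in> Hom" and f: "f \<in> Cinf A"
  shows "jbr s \<phi> (fmul f t) (fmul f \<psi> + dtens A f t) = fmul f (jbr s \<phi> t \<psi>) + dtens A f (br s t)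
    + (fmul (\<lambda>p. an s p f) \<psi> + dtens A (\<lambda>p. an s p f) t)"
proof (rule Hom_ext)
  have sf: "(\<lambda>p. an s p f) \<in> Cinf A" using VF_Cinf[OF an_VF[OF st(1)]] .
  show "jbr s \<phi> (fmul f t) (fmul f \<psi> + dtens A f t) \<in> Hom"
    by (intro jbr_Hom closed dtens_Hom st f)
  show "fmul f (jbr s \<phi> t \<psi>) + dtens A f (br s t) + (fmul (\<lambda>p. an s p f) \<psi> + dtens A (\<lambda>p. an s p f) t) \<in> Hom"
    by (intro closed jbr_Hom dtens_Hom st f sf)
  fix V assume V: "V \<in> VF A"
  note d = dtens_Hom[OF f st(3)]
  have 1: "ap (fmul f \<psi> + dtens A f t) W = fmul f (ap \<psi> W) + fmul (\<lambda>p. W p f) t" if "W \<in> VF A" for W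
    by (simp only: ap_simps ap_dtens[OF that])
  have cV: "(\<lambda>p. W p g) \<in> Cinf A" if "W \<in> VF A" for W g by (rule VF_Cinf[OF that])
  note asV = vf_closed[OF an_VF[OF st(1)] V]
  note aphiV = an_VF[OF HomD(5)[OF st(2) V]]
  have "ap (jbr s \<phi> (fmul f t) (fmul f \<psi> + dtens A f t)) V =
      br s (fmul f (ap \<psi> V) + fmul (\<lambda>p. V p f) t)
      - (fmul f (ap \<psi> (vf_bracket (an s) V)) + fmul (\<lambda>p. vf_bracket (an s) V p f) t)
      - (br (fmul f t) (ap \<phi> V) - ap \<phi> (vf_bracket (an (fmul f t)) V))
      + ap \<phi> (an (fmul f (ap \<psi> V) + fmul (\<lambda>p. V p f) t))
      - (fmul f (ap \<psi> (an (ap \<phi> V))) + fmul (\<lambda>p. an (ap \<phi> V) p f) t)"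
    by (simp add: ap_jbr st closed f V d 1 asV aphiV)
  also have "\<dots> = fmul f (br s (ap \<psi> V)) + fmul (\<lambda>p. an s p f) (ap \<psi> V) + (fmul (\<lambda>p. V p f) (br s t) + fmul (\<lambda>p. an s p (\<lambda>q. V q f)) t)
      - (fmul f (ap \<psi> (vf_bracket (an s) V)) + fmul (\<lambda>p. vf_bracket (an s) V p f) t)
      - (fmul f (br t (ap \<phi> V)) - fmul (\<lambda>p. an (ap \<phi> V) p f) t - (fmul f (ap \<phi> (vf_bracket (an t) V)) - fmul (\<lambda>p. V p f) (ap \<phi> (an t))))
      + (fmul f (ap \<phi> (an (ap \<psi> V))) + fmul (\<lambda>p. V p f) (ap \<phi> (an t)))
      - (fmul f (ap \<psi> (an (ap \<phi> V))) + fmul (\<lambda>p. an (ap \<phi> V) p f) t)"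
    by (simp only: expand closed st f V cV)
  \<comment> \<open>The terms with \<open>ap \<phi> (an t)\<close> and those with the anchor of
    \<open>ap \<phi> V\<close> cancel. The second derivative of \<open>f\<close> along
    \<open>V\<close> and then \<open>an s\<close> is turned, by the bracket of the two fields, into
    the one in the opposite order.\<close>
  also have "\<dots> = fmul f (ap (jbr s \<phi> t \<psi>) V) + fmul (\<lambda>p. V p f) (br s t)
      + (fmul (\<lambda>p. an s p f) (ap \<psi> V) + fmul (\<lambda>p. V p (\<lambda>q. an s q f)) t)"
    by (rule ext) (simp add: ap_jbr[OF st V] vf_apply algebra_simps)
  also have "\<dots> = ap (fmul f (jbr s \<phi> t \<psi>) + dtens A f (br s t)
      + (fmul (\<lambda>p. an s p f) \<psi> + dtens A (\<lambda>p. an s p f) t)) V"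
    by (simp only: ap_simps ap_dtens[OF V])
  finally show "ap (jbr s \<phi> (fmul f t) (fmul f \<psi> + dtens A f t)) V =
      ap (fmul f (jbr s \<phi> t \<psi>) + dtens A f (br s t) + (fmul (\<lambda>p. an s p f) \<psi> + dtens A (\<lambda>p. an s p f) t)) V" .
qed

section \<open>Existence and uniqueness of the bracket on the jet bundle\<close>

definition jdec :: "('m \<Rightarrow> ('m, 'v) jet) \<Rightarrow> ('m \<Rightarrow> 'v) \<times> ('m \<Rightarrow> 'm tvec \<Rightarrow> 'v)" where
  "jdec \<sigma> = (SOME z. fst z \<in> sections L \<and> snd z \<in> Hom \<and> \<sigma> = jetJ A L (fst z) (snd z))"

lemma jdec_jetJ:
  assumes "s \<in> sections L" "\<phi> \<in> Hom"
  shows "jdec (jetJ A L s \<phi>) = (s, \<phi>)"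
  unfolding jdec_def
proof (rule some_equality)
  fix z assume z: "fst z \<in> sections L \<and> snd z \<in> Hom \<and> jetJ A L s \<phi> = jetJ A L (fst z) (snd z)"
  then show "z = (s, \<phi>)"
    using jetJ_inject[OF assms(1) _ assms(2), of "fst z" "snd z"] by (simp add: prod_eq_iff)
qed (simp add: assms)

definition jbracket :: "('m \<Rightarrow> ('m, 'v) jet) \<Rightarrow> ('m \<Rightarrow> ('m, 'v) jet) \<Rightarrow> 'm \<Rightarrow> ('m, 'v) jet" where
  "jbracket \<sigma> \<tau> = (if \<sigma> \<in> sections (jet_bundle A L) \<and> \<tau> \<in> sections (jet_bundle A L)
     then jetJ A L (br (fst (jdec \<sigma>)) (fst (jdec \<tau>)))
            (jbr (fst (jdec \<sigma>)) (snd (jdec \<sigma>)) (fst (jdec \<tau>)) (snd (jdec \<tau>)))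
     else 0)"

lemma jbracket_jetJ:
  assumes "s \<in> sections L" "\<phi> \<in> Hom" "t \<in> sections L" "\<psi> \<in> Hom"
  shows "jbracket (jetJ A L s \<phi>) (jetJ A L t \<psi>) = jetJ A L (br s t) (jbr s \<phi> t \<psi>)"
  by (simp add: jbracket_def jetJ_section jdec_jetJ assms)

lemma jet_anchor_jetJ:
  assumes "s \<in> sections L" "\<phi> \<in> Hom"
  shows "jet_anchor A L p (jetJ A L s \<phi> p) = an s p"
  using J.sec_fibre[OF jetJ_section[OF assms]] by (simp add: jet_anchor_def jet_proj_jetJ[OF assms])

lemma jbracket_lie: "lie_bracket_on A (jet_bundle A L) (jet_anchor A L) jbracket"
proof -
  let ?J = "sections (jet_bundle A L)"
  have leib: "jbracket \<sigma> (fmul f \<tau>) = fmul f (jbracket \<sigma> \<tau>) + fmul (\<lambda>p. jet_anchor A L p (\<sigma> p) f) \<tau>"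
    if f: "f \<in> Cinf A" and \<sigma>: "\<sigma> \<in> ?J" and \<tau>: "\<tau> \<in> ?J" for f \<sigma> \<tau>
  proof (rule jet_section_decomposition[OF \<sigma>], rule jet_section_decomposition[OF \<tau>])
    fix s \<phi> t \<psi> assume *: "s \<in> sections L" "\<phi> \<in> Hom" "\<sigma> = jetJ A L s \<phi>" "t \<in> sections L" "\<psi> \<in> Hom" "\<tau> = jetJ A L t \<psi>"
    have sf: "(\<lambda>p. an s p f) \<in> Cinf A" using VF_Cinf[OF an_VF[OF *(1)]] .
    have an: "jet_anchor A L p (\<sigma> p) f = an s p f" for p
      unfolding *(3) jet_anchor_jetJ[OF *(1,2)] ..
    note d = dtens_Hom[OF f *(4)] dtens_Hom[OF f br_closed[OF *(1,4)]] dtens_Hom[OF sf *(4)]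
    note cl = closed * f sf d jbr_Hom
    have "jbracket \<sigma> (fmul f \<tau>) = jetJ A L (br s (fmul f t)) (jbr s \<phi> (fmul f t) (fmul f \<psi> + dtens A f t))"
      unfolding *(3,6) jetJ_fmul[OF f *(4,5)] by (rule jbracket_jetJ) (simp_all add: closed * f d)
    also have "\<dots> = jetJ A L (fmul f (br s t) + fmul (\<lambda>p. an s p f) t) ((fmul f (jbr s \<phi> t \<psi>) + dtens A f (br s t))
        + (fmul (\<lambda>p. an s p f) \<psi> + dtens A (\<lambda>p. an s p f) t))"
      by (simp only: br_fmul_right[OF f *(1,4)] jbr_leibniz[OF *(1,2,4,5) f])
    also have "\<dots> = jetJ A L (fmul f (br s t)) (fmul f (jbr s \<phi> t \<psi>) + dtens A f (br s t))
        + jetJ A L (fmul (\<lambda>p. an s p f) t) (fmul (\<lambda>p. an s p f) \<psi> + dtens A (\<lambda>p. an s p f) t)"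
      by (rule jetJ_add[symmetric]; intro closed jbr_Hom * f sf d)
    also have "\<dots> = fmul f (jetJ A L (br s t) (jbr s \<phi> t \<psi>)) + fmul (\<lambda>p. an s p f) (jetJ A L t \<psi>)"
      by (subst jetJ_fmul[OF f br_closed[OF *(1,4)] jbr_Hom[OF *(1,2,4,5)]], subst jetJ_fmul[OF sf *(4,5)]) (rule refl)
    also have "\<dots> = fmul f (jbracket \<sigma> \<tau>) + fmul (\<lambda>p. jet_anchor A L p (\<sigma> p) f) \<tau>"
      by (simp only: an) (simp only: *(3,6) jbracket_jetJ[OF *(1,2,4,5)])
    finally show ?thesis .
  qed
  have cl: "jbracket \<sigma> \<tau> \<in> ?J" if \<sigma>: "\<sigma> \<in> ?J" and \<tau>: "\<tau> \<in> ?J" for \<sigma> \<tau>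
  proof (rule jet_section_decomposition[OF \<sigma>], rule jet_section_decomposition[OF \<tau>])
    fix s \<phi> t \<psi> assume *: "s \<in> sections L" "\<phi> \<in> Hom" "\<sigma> = jetJ A L s \<phi>" "t \<in> sections L" "\<psi> \<in> Hom" "\<tau> = jetJ A L t \<psi>"
    show ?thesis unfolding *(3,6) jbracket_jetJ[OF *(1,2,4,5)]
      by (rule jetJ_section[OF br_closed[OF *(1,4)] jbr_Hom[OF *(1,2,4,5)]])
  qed
  show ?thesis
  proof (rule lie_bracket_onI)
    show "jbracket \<sigma> \<tau> \<in> ?J" if "\<sigma> \<in> ?J" "\<tau> \<in> ?J" for \<sigma> \<tau> by (rule cl[OF that])
    show "jbracket \<sigma> (\<tau> + \<upsilon>) = jbracket \<sigma> \<tau> + jbracket \<sigma> \<upsilon>"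
      if \<sigma>: "\<sigma> \<in> ?J" and \<tau>: "\<tau> \<in> ?J" and \<upsilon>: "\<upsilon> \<in> ?J" for \<sigma> \<tau> \<upsilon>
    proof (rule jet_section_decomposition[OF \<sigma>], rule jet_section_decomposition[OF \<tau>], rule jet_section_decomposition[OF \<upsilon>])
      fix s \<phi> t \<psi> u \<xi> assume *: "s \<in> sections L" "\<phi> \<in> Hom" "\<sigma> = jetJ A L s \<phi>" "t \<in> sections L" "\<psi> \<in> Hom" "\<tau> = jetJ A L t \<psi>"
        "u \<in> sections L" "\<xi> \<in> Hom" "\<upsilon> = jetJ A L u \<xi>"
      have "jbr s \<phi> (t + u) (\<psi> + \<xi>) = jbr s \<phi> t \<psi> + jbr s \<phi> u \<xi>"
        unfolding jbr_def using * by (simp add: act_add_right act_add_left comp_bilinear)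
      then show ?thesis
        unfolding *(3,6,9) jetJ_add[OF *(4,7,5,8)] jbracket_jetJ[OF *(1,2,4,5)] jbracket_jetJ[OF *(1,2,7,8)]
          jbracket_jetJ[OF *(1,2) sec_add[OF *(4,7)] H.sec_add[OF *(5,8)]] br_add_right[OF *(1,4,7)]
          jetJ_add[OF br_closed[OF *(1,4)] br_closed[OF *(1,7)] jbr_Hom[OF *(1,2,4,5)] jbr_Hom[OF *(1,2,7,8)]]
        by simp
    qed
    \<comment> \<open>Real homogeneity is the Leibniz rule for a constant function, whose derivative
      along the anchor vanishes.\<close>
    show "jbracket \<sigma> (c *\<^sub>R \<tau>) = c *\<^sub>R jbracket \<sigma> \<tau>" if \<sigma>: "\<sigma> \<in> ?J" and \<tau>: "\<tau> \<in> ?J" for \<sigma> \<tau> c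
    proof -
      have c: "fmul (\<lambda>p. c) \<upsilon> = c *\<^sub>R \<upsilon>" for \<upsilon> :: "'m \<Rightarrow> ('m, 'v) jet" by (rule ext) simp
      have "jet_anchor A L p (\<sigma> p) (\<lambda>q. c) = 0" for p
      proof (rule jet_section_decomposition[OF \<sigma>])
        fix s \<phi> assume *: "s \<in> sections L" "\<phi> \<in> Hom" "\<sigma> = jetJ A L s \<phi>"
        show ?thesis unfolding *(3) jet_anchor_jetJ[OF *(1,2)]
          by (rule tangent_const[OF VF_tangent[OF an_VF[OF *(1)]]])
      qed
      then have "fmul (\<lambda>p. jet_anchor A L p (\<sigma> p) (\<lambda>q. c)) \<tau> = 0" by (intro ext) simp
      with leib[OF Cinf_const[of c] \<sigma> \<tau>] show ?thesis by (simp only: c add_0_right)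
    qed
    show "jbracket \<sigma> \<tau> = - jbracket \<tau> \<sigma>" if \<sigma>: "\<sigma> \<in> ?J" and \<tau>: "\<tau> \<in> ?J" for \<sigma> \<tau>
    proof (rule jet_section_decomposition[OF \<sigma>], rule jet_section_decomposition[OF \<tau>])
      fix s \<phi> t \<psi> assume *: "s \<in> sections L" "\<phi> \<in> Hom" "\<sigma> = jetJ A L s \<phi>" "t \<in> sections L" "\<psi> \<in> Hom" "\<tau> = jetJ A L t \<psi>"
      have "jbr s \<phi> t \<psi> = - jbr t \<psi> s \<phi>" by (simp add: jbr_def)
      then show ?thesis
        unfolding *(3,6) jbracket_jetJ[OF *(1,2,4,5)] jbracket_jetJ[OF *(4,5,1,2)]
          jetJ_minus[OF br_closed[OF *(4,1)] jbr_Hom[OF *(4,5,1,2)]] br_antisym[OF *(1,4)] by simp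
    qed
    show "jbracket \<sigma> (jbracket \<tau> \<upsilon>) + jbracket \<tau> (jbracket \<upsilon> \<sigma>) + jbracket \<upsilon> (jbracket \<sigma> \<tau>) = 0"
      if \<sigma>: "\<sigma> \<in> ?J" and \<tau>: "\<tau> \<in> ?J" and \<upsilon>: "\<upsilon> \<in> ?J" for \<sigma> \<tau> \<upsilon>
    proof (rule jet_section_decomposition[OF \<sigma>], rule jet_section_decomposition[OF \<tau>], rule jet_section_decomposition[OF \<upsilon>])
      fix s \<phi> t \<psi> u \<xi> assume *: "s \<in> sections L" "\<phi> \<in> Hom" "\<sigma> = jetJ A L s \<phi>" "t \<in> sections L" "\<psi> \<in> Hom" "\<tau> = jetJ A L t \<psi>"
        "u \<in> sections L" "\<xi> \<in> Hom" "\<upsilon> = jetJ A L u \<xi>"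
      have "jbracket \<sigma> (jbracket \<tau> \<upsilon>) + jbracket \<tau> (jbracket \<upsilon> \<sigma>) + jbracket \<upsilon> (jbracket \<sigma> \<tau>)
        = jetJ A L (br s (br t u) + br t (br u s) + br u (br s t))
           (jbr s \<phi> (br t u) (jbr t \<psi> u \<xi>) + jbr t \<psi> (br u s) (jbr u \<xi> s \<phi>) + jbr u \<xi> (br s t) (jbr s \<phi> t \<psi>))"
        using * by (simp add: jbracket_jetJ br_closed jbr_Hom jetJ_add sec_add H.sec_add)
      then show ?thesis
        unfolding jbr_jacobi[OF *(1,4,7,2,5,8)] lie_bracket_onD(5)[OF bracket_lie *(1,4,7)] jetJ_zero .
    qed
    show "jbracket \<sigma> (fmul f \<tau>) = fmul f (jbracket \<sigma> \<tau>) + fmul (\<lambda>p. jet_anchor A L p (\<sigma> p) f) \<tau>"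
      if "f \<in> Cinf A" "\<sigma> \<in> ?J" "\<tau> \<in> ?J" for f \<sigma> \<tau> by (rule leib[OF that])
    show "jbracket \<sigma> \<tau> = 0" if "\<sigma> \<notin> ?J \<or> \<tau> \<notin> ?J" for \<sigma> \<tau>
      using that by (auto simp: jbracket_def)
  qed
qed

lemma jbracket_jet1:
  assumes "s \<in> sections L" "t \<in> sections L"
  shows "jbracket (jet1 A L s) (jet1 A L t) = jet1 A L (br s t)"
proof -
  have z: "act u 0 = 0" if u: "u \<in> sections L" for u
    using act_diff_right[OF u H.sec_zero H.sec_zero] by simp
  have "comp 0 0 = 0" using comp_bilinear(3)[OF H.sec_zero H.sec_zero H.sec_zero] by simp
  then have "jbr s 0 t 0 = 0" by (simp add: jbr_def z assms)
  then show ?thesis by (simp add: jet1_eq jbracket_jetJ assms H.sec_zero)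
qed

text \<open>For uniqueness: two brackets with the same anchor differ by an operator that is linear
  over functions, as the derivative terms cancel. The difference vanishes on two prolonged sections;
  \<open>jet_Clinear_vanish\<close> frees the second argument, and then, after exchanging arguments
  by antisymmetry, the first.\<close>

lemma jet_bracket_eq: "jet_bracket A L = jbracket"
  unfolding jet_bracket_def
proof (rule the_equality)
  show "lie_bracket_on A (jet_bundle A L) (jet_anchor A L) jbracket \<and>
    (\<forall>s\<in>sections L. \<forall>t\<in>sections L. jbracket (jet1 A L s) (jet1 A L t) = jet1 A L (bracket L s t))"
    using jbracket_lie jbracket_jet1 by simp
  fix b assume "lie_bracket_on A (jet_bundle A L) (jet_anchor A L) b \<and>
    (\<forall>s\<in>sections L. \<forall>t\<in>sections L. b (jet1 A L s) (jet1 A L t) = jet1 A L (bracket L s t))"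
  then have b: "lie_bracket_on A (jet_bundle A L) (jet_anchor A L) b"
    and bj: "\<And>s t. s \<in> sections L \<Longrightarrow> t \<in> sections L \<Longrightarrow> b (jet1 A L s) (jet1 A L t) = jet1 A L (bracket L s t)"
    by simp_all
  let ?J = "sections (jet_bundle A L)"
  have j1: "jet1 A L s \<in> ?J" if "s \<in> sections L" for s
    unfolding jet1_eq by (rule jetJ_section[OF that H.sec_zero])
  have lin: "Clinear A (jet_bundle A L) (\<lambda>\<tau>. b \<sigma> \<tau> - jbracket \<sigma> \<tau>)" if \<sigma>: "\<sigma> \<in> ?J" for \<sigma>
  proof (rule ClinearI)
    fix f \<tau> assume f: "f \<in> Cinf A" and \<tau>: "\<tau> \<in> ?J"
    have "fmul f (b \<sigma> \<tau>) - fmul f (jbracket \<sigma> \<tau>) = fmul f (b \<sigma> \<tau> - jbracket \<sigma> \<tau>)"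
      by (rule ext) (simp add: scaleR_diff_right)
    then show "b \<sigma> (fmul f \<tau>) - jbracket \<sigma> (fmul f \<tau>) = fmul f (b \<sigma> \<tau> - jbracket \<sigma> \<tau>)"
      by (simp only: lie_bracket_onD(6)[OF b f \<sigma> \<tau>] lie_bracket_onD(6)[OF jbracket_lie f \<sigma> \<tau>] add_diff_cancel_right)
  qed (simp add: lie_bracket_onD(2)[OF b \<sigma>] lie_bracket_onD(2)[OF jbracket_lie \<sigma>])
  have 1: "b (jet1 A L s) \<tau> - jbracket (jet1 A L s) \<tau> = 0" if s: "s \<in> sections L" and \<tau>: "\<tau> \<in> ?J" for s \<tau>
    by (rule jet_Clinear_vanish[OF lin[OF j1[OF s]] _ \<tau>]) (simp add: bj jbracket_jet1 s)
  have 2: "b \<sigma> \<tau> - jbracket \<sigma> \<tau> = 0" if \<sigma>: "\<sigma> \<in> ?J" and \<tau>: "\<tau> \<in> ?J" for \<sigma> \<tau>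
  proof (rule jet_Clinear_vanish[OF lin[OF \<sigma>] _ \<tau>])
    fix t assume t: "t \<in> sections L"
    have "b (jet1 A L t) \<sigma> = jbracket (jet1 A L t) \<sigma>" using 1[OF t \<sigma>] by simp
    then show "b \<sigma> (jet1 A L t) - jbracket \<sigma> (jet1 A L t) = 0"
      using lie_bracket_onD(4)[OF b \<sigma> j1[OF t]] lie_bracket_onD(4)[OF jbracket_lie \<sigma> j1[OF t]] by simp
  qed
  show "b = jbracket"
  proof (intro ext)
    fix \<sigma> \<tau> p
    have "b \<sigma> \<tau> = jbracket \<sigma> \<tau>"
    proof (cases "\<sigma> \<in> ?J \<and> \<tau> \<in> ?J")
      case True
      then show ?thesis using 2[of \<sigma> \<tau>] by simp
    next
      case False
      then show ?thesis using lie_bracket_onD(7)[OF b, of \<sigma> \<tau>] lie_bracket_onD(7)[OF jbracket_lie, of \<sigma> \<tau>] by simp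
    qed
    then show "b \<sigma> \<tau> p \<alpha> v = jbracket \<sigma> \<tau> p \<alpha> v" for \<alpha> v by simp
  qed
qed

lemmas jet_bracket_lie = jbracket_lie[folded jet_bracket_eq]
lemmas jet_bracket_jetJ = jbracket_jetJ[folded jet_bracket_eq]

end

section \<open>Jets of vector fields and the adjoint action\<close>

lemma (in mbundle) hom_sum:
  fixes \<phi> :: "'m \<Rightarrow> 'v \<Rightarrow> 'w::real_vector"
  assumes \<phi>: "\<phi> \<in> sections (hom_bundle E F)" and x: "\<And>i. i \<in> I \<Longrightarrow> x i \<in> fibre E p"
  shows "\<phi> p (\<Sum>i\<in>I. c i *\<^sub>R x i) = (\<Sum>i\<in>I. c i *\<^sub>R \<phi> p (x i))"
proof -
  have z: "\<phi> p 0 = 0" using hom_secD(2)[OF \<phi>, of 0 p 0] by simp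
  have "(\<Sum>i\<in>I. c i *\<^sub>R x i) \<in> fibre E p \<and> \<phi> p (\<Sum>i\<in>I. c i *\<^sub>R x i) = (\<Sum>i\<in>I. c i *\<^sub>R \<phi> p (x i))"
    using x by (induction I rule: infinite_finite_induct)
      (simp_all add: z hom_secD(1,2)[OF \<phi>])
  then show ?thesis by simp
qed

lemma jet_algebroid_simps [simp]:
  "sections (jet_algebroid A L) = sections (jet_bundle A L)" "fibre (jet_algebroid A L) = fibre (jet_bundle A L)"
  "anchor (jet_algebroid A L) = jet_anchor A L" "bracket (jet_algebroid A L) = jet_bracket A L"
  by (simp_all add: jet_algebroid_def)

context smooth_manifold
begin

lemma ap_anchor_TM: "X \<in> VF A \<Longrightarrow> ap (anchor (TM A)) X = X"
  by (rule ext) (simp add: TM_def VF_tangent)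

lemma bracket_TM: "X \<in> VF A \<Longrightarrow> Y \<in> VF A \<Longrightarrow> bracket (TM A) X Y = vf_bracket X Y"
  by (simp add: TM_def)

lemma TM_algebroid: "algebroid_bundle A (TM A)"
proof (intro algebroid_bundle.intro algebroid_bundle_axioms.intro TM_sbundle)
  show "anchor (TM A) \<in> sections (hom_bundle (TM A) (TM A))"
    unfolding hom_sec_iff hom_fibre_iff TM_simps
  proof (intro conjI allI ballI impI)
    show "ap (anchor (TM A)) X \<in> VF A" if "X \<in> VF A" for X by (simp add: ap_anchor_TM that)
  qed (simp_all add: TM_def tangent_closed)
  have c: "bracket (TM A) X Y \<in> VF A" if "X \<in> VF A" "Y \<in> VF A" for X Y
    by (simp add: bracket_TM vf_closed that)
  show "ap (anchor (TM A)) (bracket (TM A) X Y) = vf_bracket (ap (anchor (TM A)) X) (ap (anchor (TM A)) Y)"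
    if "X \<in> sections (TM A)" "Y \<in> sections (TM A)" for X Y
    using that by (simp add: ap_anchor_TM bracket_TM vf_closed)
  show "lie_bracket_on A (TM A) (anchor (TM A)) (bracket (TM A))"
  proof (rule lie_bracket_onI; (unfold TM_simps)?)
    fix X Y Z :: "'m \<Rightarrow> 'm tvec" and c :: real and f :: "'m \<Rightarrow> real"
    assume X: "X \<in> VF A" and Y: "Y \<in> VF A"
    show "bracket (TM A) X Y \<in> VF A" by (rule c[OF X Y])
    show "bracket (TM A) X Y = - bracket (TM A) Y X" unfolding bracket_TM[OF X Y] bracket_TM[OF Y X] by (rule vf_antisym)
    have cY: "fmul (\<lambda>q. c) Y = c *\<^sub>R Y" for c by (rule ext) simp
    have cYV: "c *\<^sub>R Y \<in> VF A" using VF_fmul[OF Cinf_const Y, of c] unfolding cY .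
    have "vf_bracket X (fmul (\<lambda>q. c) Y) = fmul (\<lambda>q. c) (vf_bracket X Y) + fmul (\<lambda>p. X p (\<lambda>q. c)) Y"
      by (rule vf_fmul_right[OF Cinf_const X Y])
    then show "bracket (TM A) X (c *\<^sub>R Y) = c *\<^sub>R bracket (TM A) X Y"
      unfolding bracket_TM[OF X Y] bracket_TM[OF X cYV] cY by (simp add: VF_fun_eqs(6)[OF X] fun_eq_iff)
    show "bracket (TM A) X (fmul f Y) = fmul f (bracket (TM A) X Y) + fmul (\<lambda>p. anchor (TM A) p (X p) f) Y"
      if "f \<in> Cinf A"
      using vf_fmul_right[OF that X Y] fun_cong[OF ap_anchor_TM[OF X]]
      by (simp add: bracket_TM X Y VF_fmul that)
    assume Z: "Z \<in> VF A"
    show "bracket (TM A) X (Y + Z) = bracket (TM A) X Y + bracket (TM A) X Z"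
      by (simp add: bracket_TM X Y Z VF_add vf_add_right)
    have "vf_bracket X (vf_bracket Y Z) + vf_bracket Y (vf_bracket Z X) + vf_bracket Z (vf_bracket X Y) = 0"
      unfolding vf_antisym[of Z X] vf_antisym[of Z "vf_bracket X Y"] vf_jacobi[OF X Y Z]
        vf_minus_right[OF Y vf_closed[OF X Z]] by simp
    then show "bracket (TM A) X (bracket (TM A) Y Z) + bracket (TM A) Y (bracket (TM A) Z X)
        + bracket (TM A) Z (bracket (TM A) X Y) = 0"
      by (simp add: bracket_TM X Y Z vf_closed)
  next
    show "bracket (TM A) X Y = 0" if "X \<notin> VF A \<or> Y \<notin> VF A" for X Y
      using that by (auto simp: TM_def)
  qed
qed

interpretation T: algebroid_bundle A "TM A" by (rule TM_algebroid)
interpretation TJ: mbundle A "jet_bundle A (TM A)" by (rule T.jet_mbundle)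
interpretation TH: mbundle A "EndTM A" by (rule hom_mbundle[OF TM_mbundle TM_mbundle])

abbreviation JT where "JT \<equiv> sections (jet_bundle A (TM A))"
abbreviation End where "End \<equiv> sections (EndTM A)"

lemma JT_obtain:
  assumes "\<sigma> \<in> JT"
  obtains X \<phi> where "X \<in> VF A" "\<phi> \<in> End" "\<sigma> = jetJ A (TM A) X \<phi>"
  using T.jet_section_decomposition[OF assms] unfolding TM_simps .

lemma dform_zero: "dform f p 0 = 0"
  by (simp add: dform_def)

text \<open>\<open>ad_op\<close> uses some field \<open>Z\<close> with the same jet at
  \<open>p\<close>. Testing equality of the jets on differentials gives
  \<open>Y (Z f) = Y (X f) - \<phi> (Y) f\<close>, the minus sign being that of the inclusion; in
  the bracket it meets a second minus sign.\<close>

lemma ad_op_jet: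
  assumes X: "X \<in> VF A" and \<phi>: "\<phi> \<in> End" and Y: "Y \<in> VF A" and \<sigma>: "\<sigma> p = jetJ A (TM A) X \<phi> p"
  shows "ad_op A \<sigma> Y p = vf_bracket X Y p + \<phi> p (Y p)"
proof -
  define Z where "Z = (SOME Z. Z \<in> VF A \<and> jet1 A (TM A) Z p = \<sigma> p)"
  have "\<exists>t\<in>VF A. jetJ A (TM A) X \<phi> p = jet1 A (TM A) t p"
    using T.jetJ_fibre[of X \<phi> p] X \<phi> by simp
  then have "\<exists>Z. Z \<in> VF A \<and> jet1 A (TM A) Z p = \<sigma> p" using \<sigma> by auto
  then have "Z \<in> VF A \<and> jet1 A (TM A) Z p = \<sigma> p" unfolding Z_def by (rule someI_ex)
  then have Z: "Z \<in> VF A" "jetJ A (TM A) Z 0 p = jetJ A (TM A) X \<phi> p"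
    using \<sigma> by (simp_all add: T.jet1_eq)
  have "vf_bracket Z Y p f = vf_bracket X Y p f + \<phi> p (Y p) f" for f
  proof -
    have s: "dform f q (W q) = W q f" if "W \<in> VF A" for W q by (simp add: dform_def VF_tangent[OF that])
    have Zp: "Z p = X p"
      using T.jetJ_eq_fst[of Z X 0 p \<phi>] Z X by simp
    have "jetJ A (TM A) Z 0 p (dform f) (Y p) = jetJ A (TM A) X \<phi> p (dform f) (Y p)" using Z(2) by simp
    moreover have "dform f p (\<phi> p (Y p)) = \<phi> p (Y p) f"
      using T.HomD(3)[OF \<phi> VF_tangent[OF Y]] by (simp add: dform_def)
    ultimately have "Y p (\<lambda>q. Z q f) = Y p (\<lambda>q. X q f) - \<phi> p (Y p) f"
      by (simp add: jetJ_apply[OF dform_dual VF_tangent[OF Y]] s[OF Z(1)] s[OF X] T.dual_zero[OF dform_dual])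
    then show ?thesis by (simp add: vf_apply Zp)
  qed
  then have "vf_bracket Z Y p = vf_bracket X Y p + \<phi> p (Y p)" by (intro ext) simp
  then show ?thesis by (simp only: ad_op_def Z_def)
qed

lemma ad_op_jetJ:
  assumes "X \<in> VF A" "\<phi> \<in> End" "Y \<in> VF A"
  shows "ad_op A (jetJ A (TM A) X \<phi>) Y = vf_bracket X Y + ap \<phi> Y"
proof
  fix p
  show "ad_op A (jetJ A (TM A) X \<phi>) Y p = (vf_bracket X Y + ap \<phi> Y) p"
    using ad_op_jet[where \<sigma> = "jetJ A (TM A) X \<phi>" and p = p, OF assms refl]
    by (simp only: plus_fun_apply ap_apply)
qed

lemma ad_op_local: "\<sigma> p = \<tau> p \<Longrightarrow> ad_op A \<sigma> Y p = ad_op A \<tau> Y p"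
  by (simp add: ad_op_def)

definition anc :: "('m \<Rightarrow> 'm jet_TM) \<Rightarrow> 'm \<Rightarrow> 'm tvec" where
  "anc = ap (jet_anchor A (TM A))"

lemma anc_jetJ: "X \<in> VF A \<Longrightarrow> \<phi> \<in> End \<Longrightarrow> anc (jetJ A (TM A) X \<phi>) = X"
  unfolding anc_def
  by (rule ext) (simp add: T.jet_anchor_jetJ fun_cong[OF ap_anchor_TM, unfolded ap_apply])

lemma anc_local: "\<sigma> p = \<tau> p \<Longrightarrow> anc \<sigma> p = anc \<tau> p"
  by (simp add: anc_def)

lemma End_closed: "\<phi> \<in> End \<Longrightarrow> Y \<in> VF A \<Longrightarrow> ap \<phi> Y \<in> VF A"
  using T.HomD(5) by simp

lemma
  assumes \<sigma>: "\<sigma> \<in> JT"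
  shows anc_VF: "anc \<sigma> \<in> VF A"
    and ad_VF: "Y \<in> VF A \<Longrightarrow> ad_op A \<sigma> Y \<in> VF A"
    and ad_add: "Y \<in> VF A \<Longrightarrow> Z \<in> VF A \<Longrightarrow> ad_op A \<sigma> (Y + Z) = ad_op A \<sigma> Y + ad_op A \<sigma> Z"
    and ad_fmul: "f \<in> Cinf A \<Longrightarrow> Y \<in> VF A \<Longrightarrow>
      ad_op A \<sigma> (fmul f Y) = fmul f (ad_op A \<sigma> Y) + fmul (\<lambda>p. anc \<sigma> p f) Y"
proof -
  obtain X \<phi> where *: "X \<in> VF A" "\<phi> \<in> End" "\<sigma> = jetJ A (TM A) X \<phi>" by (rule JT_obtain[OF \<sigma>])
  note a = ad_op_jetJ[OF *(1,2)]
  show "anc \<sigma> \<in> VF A" by (simp add: *(3) anc_jetJ *(1,2))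
  show "ad_op A \<sigma> Y \<in> VF A" if Y: "Y \<in> VF A"
    unfolding *(3) a[OF Y] by (intro VF_add vf_closed End_closed * Y)
  show "ad_op A \<sigma> (Y + Z) = ad_op A \<sigma> Y + ad_op A \<sigma> Z" if Y: "Y \<in> VF A" and Z: "Z \<in> VF A"
    unfolding *(3) a[OF Y] a[OF Z] a[OF VF_add[OF Y Z]] vf_add_right[OF *(1) Y Z] T.Hom_add[OF *(2) Y Z]
    by simp
  show "ad_op A \<sigma> (fmul f Y) = fmul f (ad_op A \<sigma> Y) + fmul (\<lambda>p. anc \<sigma> p f) Y"
    if f: "f \<in> Cinf A" and Y: "Y \<in> VF A"
    unfolding *(3) a[OF Y] a[OF VF_fmul[OF f Y]] vf_fmul_right[OF f *(1) Y] T.Hom_fmul[OF *(2) f Y] anc_jetJ[OF *(1,2)]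
    by (rule ext) (simp add: scaleR_add_right)
qed

lemma ad_diff:
  assumes "\<sigma> \<in> JT" "Y \<in> VF A" "Z \<in> VF A"
  shows "ad_op A \<sigma> (Y - Z) = ad_op A \<sigma> Y - ad_op A \<sigma> Z"
  using ad_add[OF assms(1) VF_diff[OF assms(2,3)] assms(3)] by simp

text \<open>That ad is a representation reduces, in pair form, to the Jacobi identity of vector
  fields and the formula for \<open>jbr\<close>. The bracket identities for sections of
  \<open>g\<close> all go through this fact.\<close>

lemma
  assumes \<sigma>: "\<sigma> \<in> JT" and \<tau>: "\<tau> \<in> JT"
  shows anc_add: "anc (\<sigma> + \<tau>) = anc \<sigma> + anc \<tau>"
    and ad_add_left: "Y \<in> VF A \<Longrightarrow> ad_op A (\<sigma> + \<tau>) Y = ad_op A \<sigma> Y + ad_op A \<tau> Y"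
    and anc_bracket: "anc (jet_bracket A (TM A) \<sigma> \<tau>) = vf_bracket (anc \<sigma>) (anc \<tau>)"
    and ad_bracket: "Y \<in> VF A \<Longrightarrow> ad_op A (jet_bracket A (TM A) \<sigma> \<tau>) Y =
      ad_op A \<sigma> (ad_op A \<tau> Y) - ad_op A \<tau> (ad_op A \<sigma> Y)"
proof -
  obtain X \<phi> where *: "X \<in> VF A" "\<phi> \<in> End" "\<sigma> = jetJ A (TM A) X \<phi>" by (rule JT_obtain[OF \<sigma>])
  obtain Z \<psi> where #: "Z \<in> VF A" "\<psi> \<in> End" "\<tau> = jetJ A (TM A) Z \<psi>" by (rule JT_obtain[OF \<tau>])
  have s: "\<sigma> + \<tau> = jetJ A (TM A) (X + Z) (\<phi> + \<psi>)"
    unfolding *(3) #(3) by (rule T.jetJ_add) (simp_all add: * #)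
  have b: "jet_bracket A (TM A) \<sigma> \<tau> = jetJ A (TM A) (vf_bracket X Z) (T.jbr X \<phi> Z \<psi>)"
    unfolding *(3) #(3) by (subst T.jet_bracket_jetJ) (simp_all add: * # bracket_TM)
  have jE: "T.jbr X \<phi> Z \<psi> \<in> End" by (rule T.jbr_Hom) (simp_all add: * #)
  note XZ = vf_closed[OF *(1) #(1)]
  show "anc (\<sigma> + \<tau>) = anc \<sigma> + anc \<tau>"
    unfolding s anc_jetJ[OF VF_add[OF *(1) #(1)] TH.sec_add[OF *(2) #(2)]] by (simp add: *(3) #(3) anc_jetJ * #)
  show "ad_op A (\<sigma> + \<tau>) Y = ad_op A \<sigma> Y + ad_op A \<tau> Y" if Y: "Y \<in> VF A"
    unfolding s ad_op_jetJ[OF VF_add[OF *(1) #(1)] TH.sec_add[OF *(2) #(2)] Y] unfolding *(3) #(3)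
      ad_op_jetJ[OF *(1,2) Y] ad_op_jetJ[OF #(1,2) Y] vf_add_left[OF *(1) #(1) Y] by (simp add: ap_simps)
  show "anc (jet_bracket A (TM A) \<sigma> \<tau>) = vf_bracket (anc \<sigma>) (anc \<tau>)"
    unfolding b anc_jetJ[OF XZ jE] unfolding *(3) #(3) anc_jetJ[OF *(1,2)] anc_jetJ[OF #(1,2)] ..
  show "ad_op A (jet_bracket A (TM A) \<sigma> \<tau>) Y = ad_op A \<sigma> (ad_op A \<tau> Y) - ad_op A \<tau> (ad_op A \<sigma> Y)"
    if Y: "Y \<in> VF A"
  proof -
    have j: "ap (T.jbr X \<phi> Z \<psi>) Y = vf_bracket X (ap \<psi> Y) - ap \<psi> (vf_bracket X Y)
      - (vf_bracket Z (ap \<phi> Y) - ap \<phi> (vf_bracket Z Y)) + ap \<phi> (ap \<psi> Y) - ap \<psi> (ap \<phi> Y)"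
      by (subst T.ap_jbr) (simp_all add: * # Y ap_anchor_TM bracket_TM End_closed)
    have 1: "ad_op A \<sigma> (ad_op A \<tau> Y) = vf_bracket X (vf_bracket Z Y) + vf_bracket X (ap \<psi> Y)
        + (ap \<phi> (vf_bracket Z Y) + ap \<phi> (ap \<psi> Y))"
      unfolding *(3) #(3) using * # Y
      by (simp add: ad_op_jetJ VF_add vf_closed End_closed vf_add_right T.Hom_add)
    have 2: "ad_op A \<tau> (ad_op A \<sigma> Y) = vf_bracket Z (vf_bracket X Y) + vf_bracket Z (ap \<phi> Y)
        + (ap \<psi> (vf_bracket X Y) + ap \<psi> (ap \<phi> Y))"
      unfolding *(3) #(3) using * # Y
      by (simp add: ad_op_jetJ VF_add vf_closed End_closed vf_add_right T.Hom_add)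
    show ?thesis
      unfolding 1 2 b ad_op_jetJ[OF XZ jE Y] j vf_jacobi[OF *(1) #(1) Y] by simp
  qed
qed

text \<open>The \<open>dtens\<close> term from \<open>jetJ_fmul\<close> cancels the derivative term
  that the bracket of vector fields has in its first argument; this makes ad linear over functions
  in the jet.\<close>

lemma
  assumes \<sigma>: "\<sigma> \<in> JT" and f: "f \<in> Cinf A"
  shows anc_fmul: "anc (fmul f \<sigma>) = fmul f (anc \<sigma>)"
    and ad_fmul_left: "Y \<in> VF A \<Longrightarrow> ad_op A (fmul f \<sigma>) Y = fmul f (ad_op A \<sigma> Y)"
proof -
  obtain X \<phi> where *: "X \<in> VF A" "\<phi> \<in> End" "\<sigma> = jetJ A (TM A) X \<phi>" by (rule JT_obtain[OF \<sigma>])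
  have s: "fmul f \<sigma> = jetJ A (TM A) (fmul f X) (fmul f \<phi> + dtens A f X)"
    unfolding *(3) by (rule T.jetJ_fmul) (simp_all add: * f)
  have d: "dtens A f X \<in> End" by (rule T.dtens_Hom) (simp_all add: * f)
  have E: "fmul f \<phi> + dtens A f X \<in> End" by (rule TH.sec_add[OF TH.sec_fmul[OF f *(2)] d])
  show "anc (fmul f \<sigma>) = fmul f (anc \<sigma>)"
    unfolding s anc_jetJ[OF VF_fmul[OF f *(1)] E] unfolding *(3) anc_jetJ[OF *(1,2)] ..
  show "ad_op A (fmul f \<sigma>) Y = fmul f (ad_op A \<sigma> Y)" if Y: "Y \<in> VF A"
    unfolding s ad_op_jetJ[OF VF_fmul[OF f *(1)] E Y] unfolding *(3) ad_op_jetJ[OF *(1,2) Y]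
      vf_fmul_left[OF f *(1) Y] ap_simps T.ap_dtens[OF Y]
    by (rule ext) (simp add: scaleR_add_right)
qed

lemma anc_diff: "\<sigma> \<in> JT \<Longrightarrow> \<tau> \<in> JT \<Longrightarrow> anc (\<sigma> - \<tau>) = anc \<sigma> - anc \<tau>"
  using anc_add[OF TJ.sec_diff, of \<sigma> \<tau> \<tau>] by simp

lemma ad_diff_left: "\<sigma> \<in> JT \<Longrightarrow> \<tau> \<in> JT \<Longrightarrow> Y \<in> VF A \<Longrightarrow> ad_op A (\<sigma> - \<tau>) Y = ad_op A \<sigma> Y - ad_op A \<tau> Y"
  using ad_add_left[OF TJ.sec_diff, of \<sigma> \<tau> \<tau> Y] by simp

text \<open>Where \<open>Z\<close> vanishes, \<open>[Z, V] f\<close> equals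
  \<open>- V (Z f)\<close>, so vanishing of ad expresses \<open>\<phi>\<close> through the first
  derivatives of \<open>Z\<close>. Tested on a dual section, expanded in the coordinate fields, the
  differential of \<open>Z\<close> and the contribution of \<open>\<phi>\<close> then
  cancel.\<close>

lemma jet_faithful_zero:
  assumes \<sigma>: "\<sigma> \<in> JT" and a0: "anc \<sigma> p = 0" and ad0: "\<And>Y. Y \<in> VF A \<Longrightarrow> ad_op A \<sigma> Y p = 0"
  shows "\<sigma> p = 0"
proof -
  obtain Z \<phi> where *: "Z \<in> VF A" "\<phi> \<in> End" "\<sigma> = jetJ A (TM A) Z \<phi>" by (rule JT_obtain[OF \<sigma>])
  have Zp: "Z p = 0" using a0 unfolding *(3) anc_jetJ[OF *(1,2)] .
  obtain W x X where w: "open W" "p \<in> W" "\<And>b. x b \<in> Cinf A" "\<And>b. X b \<in> VF A"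
    "\<And>q b b'. q \<in> W \<Longrightarrow> b \<in> Basis \<Longrightarrow> b' \<in> Basis \<Longrightarrow> X b q (x b') = (if b = b' then 1 else 0)"
    "\<And>q v f. q \<in> W \<Longrightarrow> v \<in> tangent A q \<Longrightarrow> v f = (\<Sum>b\<in>(Basis::'e set). v (x b) * X b q f)"
    by (rule coordinates_exist[where p = p]) (rule that; assumption)
  have exp: "v = (\<Sum>b\<in>Basis. v (x b) *\<^sub>R X b q)" if "q \<in> W" "v \<in> tangent A q" for q v
    by (rule ext) (simp add: sum_fun_apply w(6)[OF that, symmetric])
  have "jetJ A (TM A) Z \<phi> p = 0"
  proof (rule jet_ext[where E = "TM A" and p = p])
    fix \<alpha> v assume a: "\<alpha> \<in> sections (hom_bundle (TM A) (trivial_line A))" and v: "v \<in> tangent A p"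
    obtain V where V: "V \<in> VF A" "V p = v" by (rule TM_extend[OF v])
    have aexp: "\<alpha> q u = (\<Sum>b\<in>Basis. u (x b) * \<alpha> q (X b q))" if q: "q \<in> W" and u: "u \<in> tangent A q" for q u
    proof -
      have "\<alpha> q u = \<alpha> q (\<Sum>b\<in>Basis. u (x b) *\<^sub>R X b q)" using exp[OF q u] by (rule arg_cong)
      also have "\<dots> = (\<Sum>b\<in>Basis. u (x b) * \<alpha> q (X b q))"
        by (rule T.dual_sum[OF a]) (simp add: VF_tangent[OF w(4)])
      finally show ?thesis .
    qed
    have aX: "(\<lambda>q. \<alpha> q (X b q)) \<in> Cinf A" for b by (rule T.dual_Cinf[OF a]) (simp add: w(4))
    have aZ: "(\<lambda>q. \<alpha> q (Z q)) \<in> Cinf A" by (rule T.dual_Cinf[OF a]) (simp add: *(1))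
    note Zx = VF_Cinf[OF *(1)]
    have "v (\<lambda>q. \<alpha> q (Z q)) = v (\<lambda>q. \<Sum>b\<in>Basis. Z q (x b) * \<alpha> q (X b q))"
      by (rule tangent_local[OF v aZ _ w(1,2)])
         (rule Cinf_sum, rule Cinf_mult[OF Zx aX], rule aexp[OF _ VF_tangent[OF *(1)]])
    also have "\<dots> = (\<Sum>b\<in>Basis. v (\<lambda>q. Z q (x b) * \<alpha> q (X b q)))"
      by (rule tangent_sum[OF v Cinf_mult[OF Zx aX]])
    also have "\<dots> = (\<Sum>b\<in>Basis. v (\<lambda>q. Z q (x b)) * \<alpha> p (X b p))"
      by (rule sum.cong[OF refl]) (simp add: tangent_mult[OF v Zx aX] Zp)
    finally have 1: "v (\<lambda>q. \<alpha> q (Z q)) = (\<Sum>b\<in>Basis. v (\<lambda>q. Z q (x b)) * \<alpha> p (X b p))" .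
    have "vf_bracket Z V p + \<phi> p v = 0"
      using ad0[OF V(1)] ad_op_jetJ[OF *(1,2) V(1)] V(2) by (simp add: *(3))
    from fun_cong[OF this] have e: "vf_bracket Z V p f + \<phi> p v f = 0" for f by simp
    have ph: "\<phi> p v f = v (\<lambda>q. Z q f)" for f
    proof -
      have "vf_bracket Z V p f = - v (\<lambda>q. Z q f)" by (simp add: vf_apply Zp V(2))
      with e[of f] show ?thesis by linarith
    qed
    have 2: "\<alpha> p (\<phi> p v) = (\<Sum>b\<in>Basis. v (\<lambda>q. Z q (x b)) * \<alpha> p (X b p))"
      unfolding aexp[OF w(2) T.HomD(3)[OF *(2), unfolded TM_simps, OF v]] ph ..
    show "jetJ A (TM A) Z \<phi> p \<alpha> v = 0 \<alpha> v"
      by (simp add: jetJ_apply[OF a v] Zp T.dual_zero[OF a] 1 2 zero_prod_def)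
  qed (simp_all add: jetJ_off)
  then show ?thesis by (simp add: *(3))
qed

lemma jet_faithful:
  assumes "\<sigma> \<in> JT" "\<tau> \<in> JT" "anc \<sigma> p = anc \<tau> p" "\<And>Y. Y \<in> VF A \<Longrightarrow> ad_op A \<sigma> Y p = ad_op A \<tau> Y p"
  shows "\<sigma> p = \<tau> p"
proof -
  have "(\<sigma> - \<tau>) p = 0"
    by (rule jet_faithful_zero[OF TJ.sec_diff[OF assms(1,2)]])
       (simp_all add: anc_diff ad_diff_left assms)
  then show ?thesis by simp
qed

lemma jet_faithful_section:
  assumes "\<sigma> \<in> JT" "\<tau> \<in> JT" "anc \<sigma> = anc \<tau>" "\<And>Y. Y \<in> VF A \<Longrightarrow> ad_op A \<sigma> Y = ad_op A \<tau> Y"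
  shows "\<sigma> = \<tau>"
  by (rule ext, rule jet_faithful) (simp_all add: assms)

lemma jetJ_JT: "X \<in> VF A \<Longrightarrow> \<phi> \<in> End \<Longrightarrow> jetJ A (TM A) X \<phi> \<in> JT"
  using T.jetJ_section[of X \<phi>] by simp

lemma jet_incl_jetJ: "incl_section A (TM A) \<phi> = jetJ A (TM A) 0 \<phi>"
proof -
  have "jet1 A (TM A) 0 = 0" using T.jet1_eq[of 0] T.jetJ_zero by simp
  then show ?thesis by (simp add: jetJ_def)
qed

lemmas TM_jet1 = T.jet1_eq
lemmas TM_jetJ_add = T.jetJ_add[unfolded TM_simps]
lemmas TM_jetJ_fmul = T.jetJ_fmul[unfolded TM_simps]
lemmas TM_jetJ_inject = T.jetJ_inject[unfolded TM_simps]
lemmas TM_jetJ_proj = T.jet_proj_jetJ[unfolded TM_simps]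
lemmas TM_jet_lie = T.jet_bracket_lie
lemmas TM_dtens_End = T.dtens_Hom[unfolded TM_simps]
lemmas End_add = T.Hom_add
lemmas End_fmul = T.Hom_fmul
lemmas EndD = T.HomD[unfolded TM_simps]
lemmas JT_mbundle = T.jet_mbundle
lemmas End_mbundle = TH.mbundle_axioms

lemma jet1_fibre_obtain:
  assumes "j \<in> fibre (jet_bundle A (TM A)) p"
  obtains X where "X \<in> VF A" "j = jetJ A (TM A) X 0 p"
  using assms by (auto simp: T.jet_fibre T.jet1_eq)

lemma jet_anchor_hom: "jet_anchor A (TM A) \<in> sections (hom_bundle (jet_bundle A (TM A)) (TM A))"
  unfolding hom_sec_iff hom_fibre_iff TM_simps
proof (intro conjI allI ballI impI)
  have jj: "jet_anchor A (TM A) p (jetJ A (TM A) X 0 p) = X p" if "X \<in> VF A" for X p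
    using fun_cong[OF anc_jetJ[OF that TH.sec_zero], of p] by (simp add: anc_def)
  fix p j assume j: "j \<in> fibre (jet_bundle A (TM A)) p"
  then obtain X where X: "X \<in> VF A" "j = jetJ A (TM A) X 0 p" by (rule jet1_fibre_obtain)
  show "jet_anchor A (TM A) p j \<in> tangent A p" by (simp add: X(2) jj[OF X(1)] VF_tangent[OF X(1)])
  have "jetJ A (TM A) (fmul (\<lambda>q. c) X) 0 p = c *\<^sub>R j" for c
  proof -
    have "dtens A (\<lambda>q. c) X = 0" by (intro ext) (simp add: dtens_def tangent_const)
    then show ?thesis
      using fun_cong[OF TM_jetJ_fmul[OF Cinf_const[of c] X(1) TH.sec_zero], where x = p] X(2) by (simp add: fmul_zero)
  qed
  then show "jet_anchor A (TM A) p (c *\<^sub>R j) = c *\<^sub>R jet_anchor A (TM A) p j" for c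
    using jj[OF VF_fmul[OF Cinf_const[of c] X(1)], of p] by (simp add: X(2) jj[OF X(1)])
  fix k assume "k \<in> fibre (jet_bundle A (TM A)) p"
  then obtain Y where Y: "Y \<in> VF A" "k = jetJ A (TM A) Y 0 p" by (rule jet1_fibre_obtain)
  have "j + k = jetJ A (TM A) (X + Y) 0 p"
    using fun_cong[OF TM_jetJ_add[OF X(1) Y(1) TH.sec_zero TH.sec_zero], where x = p] X(2) Y(2) by simp
  then show "jet_anchor A (TM A) p (j + k) = jet_anchor A (TM A) p j + jet_anchor A (TM A) p k"
    by (simp add: X(2) Y(2) jj[OF X(1)] jj[OF Y(1)] jj[OF VF_add[OF X(1) Y(1)]])
next
  show "jet_anchor A (TM A) p j = 0" if "j \<notin> fibre (jet_bundle A (TM A)) p" for p j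
    using that by (simp add: jet_anchor_def)
  show "ap (jet_anchor A (TM A)) \<sigma> \<in> VF A" if "\<sigma> \<in> JT" for \<sigma>
    using anc_VF[OF that] by (simp add: anc_def)
qed

end

section \<open>Transitive infinitesimal geometric structures\<close>

locale igs_structure = smooth_manifold A
  for A :: "('m::{t2_space, second_countable_topology}, 'e::euclidean_space) atlas" +
  fixes g :: "'m \<Rightarrow> 'm jet_TM set"
  assumes igs: "igs A g" and trans: "transitive A g"
begin

interpretation TJ: mbundle A "jet_bundle A (TM A)" by (rule JT_mbundle)
interpretation TH: mbundle A "EndTM A" by (rule End_mbundle)

abbreviation G where "G \<equiv> igs_algebroid A g"

lemma G_sections: "\<sigma> \<in> sections G \<longleftrightarrow> \<sigma> \<in> JT \<and> (\<forall>p. \<sigma> p \<in> g p)"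
  by (simp add: igs_algebroid_def restrict_algebroid_def restrict_bundle_def)

lemma G_fibre [simp]: "fibre G = g"
  by (simp add: igs_algebroid_def restrict_algebroid_def)

lemma G_JT: "\<sigma> \<in> sections G \<Longrightarrow> \<sigma> \<in> JT" by (simp add: G_sections)

lemma G_anchor: "anchor G p j = (if j \<in> g p then jet_anchor A (TM A) p j else 0)"
  by (simp add: igs_algebroid_def restrict_algebroid_def)

lemma G_bracket: "\<sigma> \<in> sections G \<Longrightarrow> \<tau> \<in> sections G \<Longrightarrow> bracket G \<sigma> \<tau> = jet_bracket A (TM A) \<sigma> \<tau>"
  by (simp add: igs_algebroid_def restrict_algebroid_def)

lemma G_bracket_closed: "\<sigma> \<in> sections G \<Longrightarrow> \<tau> \<in> sections G \<Longrightarrow> jet_bracket A (TM A) \<sigma> \<tau> \<in> sections G"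
  using igs unfolding igs_def subalgebroid_def by (simp add: igs_algebroid_def restrict_algebroid_def)

lemma ap_G_anchor: "\<sigma> \<in> sections G \<Longrightarrow> ap (anchor G) \<sigma> = anc \<sigma>"
  by (rule ext) (simp add: G_anchor G_sections anc_def)

lemma G_sub: "g p \<subseteq> fibre (jet_bundle A (TM A)) p"
  using igs unfolding igs_def subalgebroid_def subbundle_def by simp

lemma G_frames: "\<exists>r. \<forall>p. \<exists>U b. open U \<and> p \<in> U \<and> local_frame G U r b"
proof -
  have "local_frame (restrict_bundle (J1TM A) g) U r b = local_frame G U r b" for U r b
    by (simp add: local_frame_def igs_algebroid_def restrict_algebroid_def restrict_bundle_def)
  then show ?thesis using igs unfolding igs_def subalgebroid_def subbundle_def by simp
qed

lemma G_subspace: "subspace (g p)"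
proof -
  obtain r U b where "p \<in> U" "local_frame G U r b" using G_frames by metis
  then have "span ((\<lambda>i. b i p) ` {..<r}) = g p" by (simp add: local_frame_def)
  then show ?thesis using subspace_span by metis
qed

lemma G_mbundle: "mbundle A G"
proof
  note gs = subspace_0[OF G_subspace] subspace_add[OF G_subspace] subspace_scale[OF G_subspace]
  show "\<sigma> p \<in> fibre G p" if "\<sigma> \<in> sections G" for \<sigma> p using that by (simp add: G_sections)
  show "subspace (fibre G p)" for p by (simp add: G_subspace)
  show "0 \<in> sections G" by (simp add: G_sections TJ.sec_zero gs)
  show "\<sigma> + \<tau> \<in> sections G" if "\<sigma> \<in> sections G" "\<tau> \<in> sections G" for \<sigma> \<tau>
    using that by (simp add: G_sections TJ.sec_add gs)
  show "fmul f \<sigma> \<in> sections G" if "f \<in> Cinf A" "\<sigma> \<in> sections G" for f \<sigma>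
    using that by (simp add: G_sections TJ.sec_fmul gs)
  show "\<sigma> \<in> sections G" if loc: "\<And>p. \<exists>U. open U \<and> p \<in> U \<and> (\<exists>\<tau>\<in>sections G. \<forall>q\<in>U. \<sigma> q = \<tau> q)" for \<sigma>
    unfolding G_sections
  proof (intro conjI allI)
    show "\<sigma> \<in> JT"
    proof (rule TJ.sec_local)
      fix p
      obtain U \<tau> where "open U" "p \<in> U" "\<tau> \<in> sections G" "\<forall>q\<in>U. \<sigma> q = \<tau> q"
        using loc[of p] by (elim exE conjE bexE) (rule that)
      then show "\<exists>U. open U \<and> p \<in> U \<and> (\<exists>\<tau>\<in>JT. \<forall>q\<in>U. \<sigma> q = \<tau> q)"
        by (intro exI[of _ U] conjI bexI[of _ \<tau>]) (simp_all add: G_JT)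
    qed
    show "\<sigma> p \<in> g p" for p
    proof -
      obtain U \<tau> where "open U" "p \<in> U" "\<tau> \<in> sections G" "\<forall>q\<in>U. \<sigma> q = \<tau> q"
        using loc[of p] by (elim exE conjE bexE) (rule that)
      then show ?thesis by (simp add: G_sections)
    qed
  qed
qed

text \<open>Separation by dual sections has to be established for \<open>g\<close> itself. The
  functionals \<open>a1\<close> and \<open>a2\<close> read off the numbers \<open>X f\<close> and
  \<open>V (X f)\<close> from the jet of \<open>X\<close>; if all of them vanish, anchor and ad of
  the jet vanish at \<open>p\<close>, and faithfulness of ad applies.\<close>

lemma G_sbundle: "sbundle A G"
proof (intro sbundle.intro sbundle_axioms.intro G_mbundle G_frames)
  interpret G: mbundle A G by (rule G_mbundle)
  fix j p assume j: "j \<in> fibre G p"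
    and z: "\<And>\<alpha>. \<alpha> \<in> sections (hom_bundle G (trivial_line A)) \<Longrightarrow> \<alpha> p j = 0"
  from j G_sub have "j \<in> fibre (jet_bundle A (TM A)) p" by auto
  then obtain X where X: "X \<in> VF A" "j = jetJ A (TM A) X 0 p" by (rule jet1_fibre_obtain)
  have df: "dform f q (W q) = W q f" if "W \<in> VF A" for W q f by (simp add: dform_def VF_tangent[OF that])
  \<comment> \<open>The value component of a jet does not depend on the tangent vector, so it is
    read off at the zero vector, which is available in every tangent space.\<close>
  define a1 where "a1 f = (\<lambda>q k. if k \<in> g q then fst (k (dform f) 0) else 0)" for f and q :: 'm and k :: "'m jet_TM"
  define a2 where "a2 f V = (\<lambda>q k. if k \<in> g q then snd (k (dform f) (V q)) else 0)" for f V and q :: 'm and k :: "'m jet_TM"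
  have s: "(\<lambda>q. a1 f q (\<sigma> q)) \<in> Cinf A \<and> (\<lambda>q. a2 f V q (\<sigma> q)) \<in> Cinf A"
    if \<sigma>: "\<sigma> \<in> sections G" and V: "V \<in> VF A" for \<sigma> f V
  proof -
    obtain Y \<phi> where Y: "Y \<in> VF A" "\<phi> \<in> End" "\<sigma> = jetJ A (TM A) Y \<phi>" by (rule JT_obtain[OF G_JT[OF \<sigma>]])
    have sg: "\<sigma> q \<in> g q" for q using \<sigma> by (simp add: G_sections)
    have "a1 f q (\<sigma> q) = Y q f" for q
      using sg[of q] by (simp add: a1_def Y(3) jetJ_apply[OF dform_dual tangent_closed(1)] df[OF Y(1)])
    moreover have "dform f q (\<phi> q (V q)) = ap \<phi> V q f" for q
      using EndD(3)[OF Y(2) VF_tangent[OF V]] by (simp add: dform_def)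
    then have "a2 f V q (\<sigma> q) = V q (\<lambda>q. Y q f) - ap \<phi> V q f" for q
      using sg[of q] by (simp add: a2_def Y(3) jetJ_apply[OF dform_dual VF_tangent[OF V]] df[OF Y(1)])
    ultimately show ?thesis
      by (simp only: VF_Cinf[OF Y(1)] VF_Cinf[OF V] VF_Cinf[OF End_closed[OF Y(2) V]] Cinf_diff simp_thms)
  qed
  note gs = subspace_add[OF G_subspace] subspace_scale[OF G_subspace]
  have a1: "a1 f \<in> sections (hom_bundle G (trivial_line A))" for f
    using s[OF _ VF_zero] by (simp add: hom_sec_iff hom_fibre_iff ap_def a1_def gs)
  have a2: "a2 f V \<in> sections (hom_bundle G (trivial_line A))" if "V \<in> VF A" for f V
    using s[OF _ that] by (simp add: hom_sec_iff hom_fibre_iff ap_def a2_def gs)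
  have jg: "jetJ A (TM A) X 0 p \<in> g p" using j X(2) by simp
  have z1: "X p f = 0" for f
    using z[OF a1[of f]] jg by (simp add: a1_def X(2) jetJ_apply[OF dform_dual tangent_closed(1)] df[OF X(1)])
  have z2: "V p (\<lambda>q. X q f) = 0" if V: "V \<in> VF A" for V f
    using z[OF a2[OF V, of f]] jg
    by (simp add: a2_def X(2) jetJ_apply[OF dform_dual VF_tangent[OF V]] df[OF X(1)] dform_zero)
  have "jetJ A (TM A) X 0 p = 0"
  proof (rule jet_faithful_zero[OF jetJ_JT[OF X(1) TH.sec_zero]])
    show "anc (jetJ A (TM A) X 0) p = 0" by (simp add: anc_jetJ[OF X(1) TH.sec_zero] fun_eq_iff z1)
    show "ad_op A (jetJ A (TM A) X 0) Y p = 0" if "Y \<in> VF A" for Y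
      by (simp add: ad_op_jetJ[OF X(1) TH.sec_zero that] fun_eq_iff vf_apply z1 z2[OF that])
  qed
  then show "j = 0" by (simp add: X(2))
qed

lemma G_algebroid: "algebroid_bundle A G"
proof (intro algebroid_bundle.intro algebroid_bundle_axioms.intro G_sbundle)
  interpret G: mbundle A G by (rule G_mbundle)
  note ha = hom_secD[OF jet_anchor_hom, unfolded TM_simps]
  have gf: "j \<in> fibre (jet_bundle A (TM A)) p" if "j \<in> g p" for j p using G_sub that by auto
  note gs = subspace_add[OF G_subspace] subspace_scale[OF G_subspace]
  show "anchor G \<in> sections (hom_bundle G (TM A))"
    unfolding hom_sec_iff hom_fibre_iff TM_simps G_fibre
  proof (intro conjI allI ballI impI)
    show "ap (anchor G) \<sigma> \<in> VF A" if "\<sigma> \<in> sections G" for \<sigma>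
      by (simp add: ap_G_anchor[OF that] anc_VF[OF G_JT[OF that]])
  qed (simp_all add: G_anchor gs ha(1,2,3) gf)
  have cl: "bracket G \<sigma> \<tau> \<in> sections G" if "\<sigma> \<in> sections G" "\<tau> \<in> sections G" for \<sigma> \<tau>
    by (simp add: G_bracket[OF that] G_bracket_closed[OF that])
  show "ap (anchor G) (bracket G \<sigma> \<tau>) = vf_bracket (ap (anchor G) \<sigma>) (ap (anchor G) \<tau>)"
    if "\<sigma> \<in> sections G" "\<tau> \<in> sections G" for \<sigma> \<tau>
    unfolding G_bracket[OF that] ap_G_anchor[OF G_bracket_closed[OF that]] ap_G_anchor[OF that(1)] ap_G_anchor[OF that(2)]
    by (rule anc_bracket[OF G_JT[OF that(1)] G_JT[OF that(2)]])
  note lb = lie_bracket_onD[OF TM_jet_lie]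
  show "lie_bracket_on A G (anchor G) (bracket G)"
  proof (rule lie_bracket_onI)
    show "bracket G \<sigma> \<tau> = 0" if "\<sigma> \<notin> sections G \<or> \<tau> \<notin> sections G" for \<sigma> \<tau>
      using that by (auto simp: igs_algebroid_def restrict_algebroid_def)
    fix \<sigma> \<tau> \<upsilon> :: "'m \<Rightarrow> 'm jet_TM" and c :: real and f :: "'m \<Rightarrow> real"
    assume st: "\<sigma> \<in> sections G" "\<tau> \<in> sections G"
    note j = G_JT[OF st(1)] G_JT[OF st(2)]
    show "bracket G \<sigma> \<tau> \<in> sections G" by (rule cl[OF st])
    show "bracket G \<sigma> (c *\<^sub>R \<tau>) = c *\<^sub>R bracket G \<sigma> \<tau>"
      using lb(3)[OF j] by (simp add: G_bracket st G.sec_scaleR)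
    show "bracket G \<sigma> \<tau> = - bracket G \<tau> \<sigma>"
      using lb(4)[OF j] by (simp add: G_bracket st)
    show "bracket G \<sigma> (fmul f \<tau>) = fmul f (bracket G \<sigma> \<tau>) + fmul (\<lambda>p. anchor G p (\<sigma> p) f) \<tau>" if f: "f \<in> Cinf A"
    proof -
      have "anchor G p (\<sigma> p) = jet_anchor A (TM A) p (\<sigma> p)" for p using st(1) by (simp add: G_anchor G_sections)
      then show ?thesis using lb(6)[OF f j] by (simp add: G_bracket st G.sec_fmul f)
    qed
    assume u: "\<upsilon> \<in> sections G"
    show "bracket G \<sigma> (\<tau> + \<upsilon>) = bracket G \<sigma> \<tau> + bracket G \<sigma> \<upsilon>"
      using lb(2)[OF j G_JT[OF u]] by (simp add: G_bracket st u G.sec_add)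
    show "bracket G \<sigma> (bracket G \<tau> \<upsilon>) + bracket G \<tau> (bracket G \<upsilon> \<sigma>) + bracket G \<upsilon> (bracket G \<sigma> \<tau>) = 0"
      using lb(5)[OF j G_JT[OF u]] by (simp add: G_bracket st u G_bracket_closed)
  qed
qed

interpretation G: algebroid_bundle A G by (rule G_algebroid)
interpretation GH: mbundle A "hom_bundle (TM A) G" by (rule hom_mbundle[OF TM_mbundle G_mbundle])

lemma G_lie_algebroid: "lie_algebroid A G"
  unfolding lie_algebroid_def using G.is_vector_bundle G.anchor_hom G.bracket_lie by simp

section \<open>Existence of generators\<close>

text \<open>Transitivity prescribes anchors of sections of \<open>g\<close> only at the point
  \<open>p\<close>. In coordinates these anchors form an identity matrix at \<open>p\<close>, so
  \<open>smooth_solution_exists\<close> recombines the sections into ones whose anchors are the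
  coordinate fields near \<open>p\<close>; the splitting is the sum of the \<open>dx_k\<close>
  tensored with these sections.\<close>

lemma local_splitting:
  obtains W S where "open W" "p \<in> W" "S \<in> sections (hom_bundle (TM A) G)"
    and "\<And>q v. q \<in> W \<Longrightarrow> v \<in> tangent A q \<Longrightarrow> anchor G q (S q v) = v"
proof -
  obtain W x X where w: "open W" "p \<in> W" "\<And>b. x b \<in> Cinf A" "\<And>b. X b \<in> VF A"
    "\<And>q b b'. q \<in> W \<Longrightarrow> b \<in> Basis \<Longrightarrow> b' \<in> Basis \<Longrightarrow> X b q (x b') = (if b = b' then 1 else 0)"
    "\<And>q v f. q \<in> W \<Longrightarrow> v \<in> tangent A q \<Longrightarrow> v f = (\<Sum>b\<in>(Basis::'e set). v (x b) * X b q f)"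
    by (rule coordinates_exist[where p = p]) (rule that; assumption)
  have exp: "v = (\<Sum>b\<in>Basis. v (x b) *\<^sub>R X b q)" if "q \<in> W" "v \<in> tangent A q" for q v
    by (rule ext) (simp add: sum_fun_apply w(6)[OF that, symmetric])
  have "\<exists>\<sigma>. \<sigma> \<in> sections G \<and> anc \<sigma> p = X b p" for b
  proof -
    have "X b p \<in> jet_proj A (TM A) p ` g p"
      using trans VF_tangent[OF w(4)] unfolding transitive_def by simp
    then obtain j where j: "j \<in> g p" "X b p = jet_proj A (TM A) p j" by auto
    obtain \<sigma> where s: "\<sigma> \<in> sections G" "\<sigma> p = j" using G.fibre_extend[of j p] j(1) by auto
    obtain Y \<phi> where Y: "Y \<in> VF A" "\<phi> \<in> End" "\<sigma> = jetJ A (TM A) Y \<phi>" by (rule JT_obtain[OF G_JT[OF s(1)]])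
    have "anc \<sigma> p = X b p"
      using j(2) TM_jetJ_proj[OF Y(1,2), of p] anc_jetJ[OF Y(1,2)] s(2) by (simp add: Y(3))
    with s(1) show ?thesis by blast
  qed
  then obtain \<sigma> where s: "\<And>b. \<sigma> b \<in> sections G" "\<And>b. anc (\<sigma> b) p = X b p" by metis
  have sv: "anc (\<sigma> b) \<in> VF A" for b by (rule anc_VF[OF G_JT[OF s(1)]])
  have "\<exists>c. (\<forall>j\<in>Basis. gsm p (c j)) \<and> (\<forall>i\<in>Basis. \<forall>\<^sub>F q in nhds p.
      (\<Sum>j\<in>Basis. anc (\<sigma> j) q (x i) * c j q) = (if k = i then 1 else 0))" for k :: 'e
  proof (rule smooth_solution_exists[OF finite_Basis])
    show "gsm p (\<lambda>q. anc (\<sigma> j) q (x i))" for i j by (rule gsm_Cinf[OF VF_Cinf[OF sv]])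
    show "anc (\<sigma> j) p (x i) = (if i = j then 1 else 0)" if "i \<in> Basis" "j \<in> Basis" for i j
      by (simp add: s(2) w(5)[OF w(2) that(2,1)] eq_commute)
    show "gsm p (\<lambda>q. if k = i then 1 else 0)" for i by (rule gsm_Cinf) simp
  qed
  then have "\<forall>k. \<exists>c. (\<forall>j\<in>Basis. gsm p (c j)) \<and> (\<forall>i\<in>Basis. \<forall>\<^sub>F q in nhds p.
      (\<Sum>j\<in>Basis. anc (\<sigma> j) q (x i) * c j q) = (if k = i then 1 else 0))" by (rule allI)
  from choice[OF this] obtain c where c': "\<forall>k. (\<forall>j\<in>Basis. gsm p (c k j)) \<and> (\<forall>i\<in>Basis. \<forall>\<^sub>F q in nhds p.
      (\<Sum>j\<in>Basis. anc (\<sigma> j) q (x i) * c k j q) = (if k = i then 1 else 0))" by (elim exE) (rule that)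
  have c: "gsm p (c k j)" if "j \<in> Basis" for k j using c' that by simp
  have c2: "\<forall>\<^sub>F q in nhds p. (\<Sum>j\<in>Basis. anc (\<sigma> j) q (x i) * c k j q) = (if k = i then 1 else 0)"
    if "i \<in> Basis" for k i using c' that by simp
  \<comment> \<open>The solutions of the linear system are smooth only as germs; \<open>h\<close>
    supplies global smooth functions with these germs, so that \<open>t k\<close> becomes a global
    section.\<close>
  define h where "h k j = (SOME h. h \<in> Cinf A \<and> (j \<in> Basis \<longrightarrow> (\<forall>\<^sub>F q in nhds p. c k j q = h q)))" for k j
  have ex: "\<exists>h. h \<in> Cinf A \<and> (j \<in> Basis \<longrightarrow> (\<forall>\<^sub>F q in nhds p. c k j q = h q))" for k j
  proof (cases "j \<in> Basis")
    case True
    then show ?thesis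
      using c[OF True, of k] unfolding gsm_def by (elim bexE) (intro exI conjI impI)
  next
    case False
    then show ?thesis by (intro exI[of _ "\<lambda>q. 0"]) simp
  qed
  have hh: "h k j \<in> Cinf A \<and> (j \<in> Basis \<longrightarrow> (\<forall>\<^sub>F q in nhds p. c k j q = h k j q))" for k j
    unfolding h_def by (rule someI_ex[OF ex])
  have h: "h k j \<in> Cinf A" for k j using hh by simp
  have h2: "\<forall>\<^sub>F q in nhds p. c k j q = h k j q" if "j \<in> Basis" for k j using hh that by simp
  define t where "t k = (\<Sum>j\<in>Basis. fmul (h k j) (\<sigma> j))" for k
  have t: "t k \<in> sections G" for k unfolding t_def by (rule G.sec_sum) (rule G.sec_fmul[OF h s(1)])
  have at: "anc (t k) = (\<Sum>j\<in>Basis. fmul (h k j) (anc (\<sigma> j)))" for k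
  proof -
    have "anc (\<Sum>j\<in>J. fmul (h k j) (\<sigma> j)) = (\<Sum>j\<in>J. fmul (h k j) (anc (\<sigma> j)))" if "finite J" for J
      using that
    proof (induction J)
      case empty
      show ?case using anc_diff[OF TJ.sec_zero TJ.sec_zero] by (simp only: sum.empty diff_self)
    next
      case (insert j J)
      have "(\<Sum>j\<in>J. fmul (h k j) (\<sigma> j)) \<in> JT"
        by (rule TJ.sec_sum) (rule TJ.sec_fmul[OF h G_JT[OF s(1)]])
      then show ?case unfolding sum.insert[OF insert.hyps]
        by (simp only: anc_add[OF TJ.sec_fmul[OF h G_JT[OF s(1)]]] anc_fmul[OF G_JT[OF s(1)] h] insert.IH)
    qed
    then show ?thesis unfolding t_def by simp
  qed
  have "\<forall>\<^sub>F q in nhds p. \<forall>k\<in>Basis. \<forall>i\<in>Basis. anc (t k) q (x i) = (if k = i then 1 else 0)"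
  proof (intro eventually_ball_finite[OF finite_Basis] ballI)
    fix k i :: 'e assume "k \<in> Basis" and i: "i \<in> Basis"
    have "\<forall>\<^sub>F q in nhds p. \<forall>j\<in>Basis. c k j q = h k j q"
      by (intro eventually_ball_finite[OF finite_Basis] ballI h2)
    with c2[OF i, of k] show "\<forall>\<^sub>F q in nhds p. anc (t k) q (x i) = (if k = i then 1 else 0)"
    proof eventually_elim
      case (elim q)
      have "anc (t k) q (x i) = (\<Sum>j\<in>Basis. anc (\<sigma> j) q (x i) * c k j q)"
        unfolding at sum_fun_apply by (rule sum.cong) (simp_all add: elim(2))
      with elim(1) show ?case by simp
    qed
  qed
  moreover have "\<forall>\<^sub>F q in nhds p. q \<in> W" using w(1,2) by (rule eventually_nhds_in_open)
  ultimately have "\<forall>\<^sub>F q in nhds p. q \<in> W \<and> (\<forall>k\<in>Basis. \<forall>i\<in>Basis. anc (t k) q (x i) = (if k = i then 1 else 0))"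
    by eventually_elim simp
  then obtain W' where W': "open W'" "p \<in> W'"
    "\<And>q. q \<in> W' \<Longrightarrow> q \<in> W \<and> (\<forall>k\<in>Basis. \<forall>i\<in>Basis. anc (t k) q (x i) = (if k = i then 1 else 0))"
    unfolding eventually_nhds by auto
  define S where "S = (\<Sum>k\<in>(Basis::'e set). dtens A (x k) (t k))"
  have S: "S \<in> sections (hom_bundle (TM A) G)" unfolding S_def
    by (rule GH.sec_sum) (rule G.dtens_Hom[OF w(3) t])
  have "anchor G q (S q v) = v" if q: "q \<in> W'" and v: "v \<in> tangent A q" for q v
  proof -
    have tX: "anchor G q (t k q) = X k q" if k: "k \<in> Basis" for k
    proof -
      have "anchor G q (t k q) = anc (t k) q" using fun_cong[OF ap_G_anchor[OF t]] by simp
      also have "\<dots> = (\<Sum>b\<in>Basis. anc (t k) q (x b) *\<^sub>R X b q)"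
        by (rule exp) (use W'(3)[OF q] VF_tangent[OF anc_VF[OF G_JT[OF t]]] in auto)
      also have "\<dots> = (\<Sum>b\<in>Basis. if b = k then X k q else 0)"
        by (rule sum.cong) (use W'(3)[OF q] k in auto)
      also have "\<dots> = X k q" using k by simp
      finally show ?thesis .
    qed
    have "S q v = (\<Sum>k\<in>Basis. v (x k) *\<^sub>R t k q)"
      using v by (simp add: S_def sum_fun_apply dtens_def)
    then have "anchor G q (S q v) = anchor G q (\<Sum>k\<in>Basis. v (x k) *\<^sub>R t k q)" by simp
    also have "\<dots> = (\<Sum>k\<in>Basis. v (x k) *\<^sub>R anchor G q (t k q))"
    proof -
      have "t k q \<in> fibre G q" for k using t by (simp add: G_sections)
      then show ?thesis by (rule G.hom_sum[OF G.anchor_hom])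
    qed
    also have "\<dots> = (\<Sum>k\<in>Basis. v (x k) *\<^sub>R X k q)" by (rule sum.cong) (simp_all add: tX)
    also have "\<dots> = v" by (rule exp[symmetric]) (use W'(3)[OF q] v in auto)
    finally show ?thesis .
  qed
  with W'(1,2) S show thesis by (rule that)
qed

text \<open>A combination of splittings with weights of sum 1 is a splitting. The sum is cut at the
  least index \<open>N q\<close> of a set \<open>V k\<close> containing \<open>q\<close>, because
  later weights vanish at \<open>q\<close>; on each \<open>V k\<close> the result is one fixed
  finite sum, hence smooth.\<close>

lemma global_splitting:
  obtains S where "S \<in> sections (hom_bundle (TM A) G)"
    and "\<And>q v. v \<in> tangent A q \<Longrightarrow> anchor G q (S q v) = v"
proof -
  have "\<exists>W S. open W \<and> p \<in> W \<and> S \<in> sections (hom_bundle (TM A) G) \<and>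
      (\<forall>q\<in>W. \<forall>v\<in>tangent A q. anchor G q (S q v) = v)" for p
    by (rule local_splitting[of p]) blast
  then obtain W S where W: "\<And>p. open (W p)" "\<And>p. p \<in> W p"
    and S: "\<And>p. S p \<in> sections (hom_bundle (TM A) G)"
    and aS: "\<And>p q v. q \<in> W p \<Longrightarrow> v \<in> tangent A q \<Longrightarrow> anchor G q (S p q v) = v"
    by metis
  obtain c :: "nat \<Rightarrow> 'm" and V \<rho> where \<rho>: "\<And>n. \<rho> n \<in> Cinf A" and V: "\<And>n. open (V n)" "(\<Union>n. V n) = UNIV"
    and supp: "\<And>n. \<exists>Q. open Q \<and> Q \<union> W (c n) = UNIV \<and> (\<forall>q\<in>Q. \<rho> n q = 0)"
    and van: "\<And>k n q. k < n \<Longrightarrow> q \<in> V k \<Longrightarrow> \<rho> n q = 0"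
    and one: "\<And>k q. q \<in> V k \<Longrightarrow> (\<Sum>n\<le>k. \<rho> n q) = 1"
    by (rule partition_of_unity[OF W]) (rule that; assumption)
  define N where "N q = (LEAST k. q \<in> V k)" for q
  have N: "q \<in> V (N q)" for q
  proof -
    have "q \<in> (\<Union>n. V n)" unfolding V(2) by (rule UNIV_I)
    then obtain k where "q \<in> V k" by (rule UN_E)
    then show ?thesis unfolding N_def by (rule LeastI)
  qed
  define T where "T k q = (\<Sum>n\<le>k. \<rho> n q *\<^sub>R S (c n) q)" for k q
  have stable: "T k q = T k' q" if "q \<in> V k" "k \<le> k'" for k k' q
    unfolding T_def by (rule sum.mono_neutral_left) (use that van[of k _ q] in \<open>auto simp: not_le\<close>)
  have TN: "T (N q) q = T k q" if "q \<in> V k" for k q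
  proof (rule stable[OF N])
    show "N q \<le> k" unfolding N_def by (rule Least_le) (rule that)
  qed
  have TH: "T k \<in> sections (hom_bundle (TM A) G)" for k
    unfolding T_def by (rule GH.sec_lincomb[OF \<rho> S])
  have "(\<lambda>q. T (N q) q) \<in> sections (hom_bundle (TM A) G)"
  proof (rule GH.sec_local)
    fix p
    show "\<exists>U. open U \<and> p \<in> U \<and> (\<exists>t\<in>sections (hom_bundle (TM A) G). \<forall>q\<in>U. T (N q) q = t q)"
      by (intro exI[of _ "V (N p)"] conjI bexI[of _ "T (N p)"] ballI V(1) N TN TH)
  qed
  moreover have "anchor G q (T (N q) q v) = v" if v: "v \<in> tangent A q" for q v
  proof -
    have Sg: "S p q v \<in> fibre G q" for p by (rule G.HomD(6)[OF S])
    have "T (N q) q v = (\<Sum>n\<le>N q. \<rho> n q *\<^sub>R S (c n) q v)"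
      unfolding T_def by (simp only: sum_fun_apply scaleR_fun_apply)
    then have "anchor G q (T (N q) q v) = anchor G q (\<Sum>n\<le>N q. \<rho> n q *\<^sub>R S (c n) q v)"
      by (rule arg_cong)
    also have "\<dots> = (\<Sum>n\<le>N q. \<rho> n q *\<^sub>R anchor G q (S (c n) q v))"
      by (rule G.hom_sum[OF G.anchor_hom Sg])
    also have "\<dots> = (\<Sum>n\<le>N q. \<rho> n q *\<^sub>R v)"
    proof (rule sum.cong[OF refl])
      fix n
      show "\<rho> n q *\<^sub>R anchor G q (S (c n) q v) = \<rho> n q *\<^sub>R v"
      proof (cases "q \<in> W (c n)")
        case True
        then show ?thesis by (simp add: aS[OF _ v])
      next
        case False
        obtain Q where "Q \<union> W (c n) = UNIV" "\<forall>q\<in>Q. \<rho> n q = 0" using supp[of n] by (elim exE conjE) (rule that)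
        then show ?thesis using False by auto
      qed
    qed
    also have "\<dots> = (\<Sum>n\<le>N q. \<rho> n q) *\<^sub>R v" by (simp only: scaleR_sum_left)
    also have "\<dots> = v" using one[OF N] by simp
    finally show ?thesis .
  qed
  ultimately show thesis by (rule that)
qed

lemma split_section_jetJ: "split_section A (TM A) D V = jetJ A (TM A) V (D V)"
  by (simp add: split_section_def jetJ_def)

text \<open>A splitting of the anchor has pair form \<open>(V, D V)\<close>, and its linearity over
  functions becomes the Leibniz rule of \<open>D\<close> by uniqueness of the pair. Existence
  matters twice: the connection of the theorem is not tied to a given generator, and without any
  generator the condition in \<open>intrinsic_torsion\<close> would hold for every
  candidate.\<close>

lemma generator_exists: "\<exists>D. generator A g D"
proof -
  obtain S where S: "S \<in> sections (hom_bundle (TM A) G)" "\<And>q v. v \<in> tangent A q \<Longrightarrow> anchor G q (S q v) = v"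
    by (rule global_splitting) (rule that; assumption)
  have SG: "ap S V \<in> sections G" if "V \<in> VF A" for V by (rule G.HomD(5)[OF S(1) that])
  have aS: "anc (ap S V) = V" if V: "V \<in> VF A" for V
    unfolding ap_G_anchor[OF SG[OF V], symmetric] by (rule ext) (simp add: S(2) VF_tangent[OF V])
  have "\<exists>\<phi>. \<phi> \<in> End \<and> ap S V = jetJ A (TM A) V \<phi>" if V: "V \<in> VF A" for V
  proof -
    obtain Y \<phi> where Y: "Y \<in> VF A" "\<phi> \<in> End" "ap S V = jetJ A (TM A) Y \<phi>"
      by (rule JT_obtain[OF G_JT[OF SG[OF V]]]) (rule that; assumption)
    have "Y = V" using aS[OF V] unfolding Y(3) anc_jetJ[OF Y(1,2)] .
    with Y show ?thesis by blast
  qed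
  then obtain D where D: "\<And>V. V \<in> VF A \<Longrightarrow> D V \<in> End" "\<And>V. V \<in> VF A \<Longrightarrow> ap S V = jetJ A (TM A) V (D V)" by metis
  have "generator A g D"
    unfolding generator_def linear_connection_def TM_simps
  proof (intro conjI ballI allI)
    show "D V \<in> End" if "V \<in> VF A" for V by (rule D(1)[OF that])
    show "split_section A (TM A) D V \<in> sections G" if "V \<in> VF A" for V
      using SG[OF that] unfolding split_section_jetJ D(2)[OF that] .
    show "D (V + W) = D V + D W" if V: "V \<in> VF A" and W: "W \<in> VF A" for V W
    proof -
      have "jetJ A (TM A) (V + W) (D (V + W)) = jetJ A (TM A) (V + W) (D V + D W)"
        unfolding D(2)[OF VF_add[OF V W], symmetric] G.Hom_add[OF S(1) V W] D(2)[OF V] D(2)[OF W]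
        by (rule TM_jetJ_add[OF V W D(1)[OF V] D(1)[OF W]])
      then show ?thesis
        using TM_jetJ_inject[OF VF_add[OF V W] VF_add[OF V W] D(1)[OF VF_add[OF V W]] TH.sec_add[OF D(1)[OF V] D(1)[OF W]]]
        by simp
    qed
    show "D (fmul f V) p v = v f *\<^sub>R V p + f p *\<^sub>R D V p v"
      if f: "f \<in> Cinf A" and V: "V \<in> VF A" and v: "v \<in> tangent A p" for f V p v
    proof -
      note E = TH.sec_add[OF TH.sec_fmul[OF f D(1)[OF V]] TM_dtens_End[OF f V]]
      have "jetJ A (TM A) (fmul f V) (D (fmul f V)) = jetJ A (TM A) (fmul f V) (fmul f (D V) + dtens A f V)"
        unfolding D(2)[OF VF_fmul[OF f V], symmetric] G.Hom_fmul[OF S(1) f V] D(2)[OF V]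
        by (rule TM_jetJ_fmul[OF f V D(1)[OF V]])
      then have "D (fmul f V) = fmul f (D V) + dtens A f V"
        using TM_jetJ_inject[OF VF_fmul[OF f V] VF_fmul[OF f V] D(1)[OF VF_fmul[OF f V]] E] by simp
      then show ?thesis using v by (simp add: dtens_def)
    qed
  qed
  then show ?thesis by blast
qed

end

section \<open>The structure kernel and torsion tensors\<close>

lemma (in sbundle) tensorial2_apply:
  assumes 1: "\<And>s. s \<in> sections E \<Longrightarrow> Clinear A E (F s)" and 2: "\<And>t. t \<in> sections E \<Longrightarrow> Clinear A E (\<lambda>s. F s t)"
    and st: "s \<in> sections E" "t \<in> sections E"
  shows "tensorial2 E F p (s p) (t p) = F s t p"
proof -
  note x = sec_fibre[OF st(1), of p] and y = sec_fibre[OF st(2), of p]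
  have "tensorial2 E F p (s p) (t p) = F (extend E p (s p)) (extend E p (t p)) p"
    using x y by (simp add: tensorial2_def)
  also have "\<dots> = F (extend E p (s p)) t p"
    by (rule Clinear_pointwise[OF 1[OF extend_sec(1)[OF x]] extend_sec(1)[OF y] st(2) extend_sec(2)[OF y]])
  also have "\<dots> = F s t p"
    by (rule Clinear_pointwise[OF 2[OF st(2)] extend_sec(1)[OF x] st(1) extend_sec(2)[OF x]])
  finally show ?thesis .
qed

definition tap :: "('m \<Rightarrow> 'v \<Rightarrow> 'v \<Rightarrow> 'w) \<Rightarrow> ('m \<Rightarrow> 'v) \<Rightarrow> ('m \<Rightarrow> 'v) \<Rightarrow> 'm \<Rightarrow> 'w" where
  "tap T U V = (\<lambda>q. T q (U q) (V q))"

lemma tap_apply [simp]: "tap T U V p = T p (U p) (V p)"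
  by (simp add: tap_def)

lemma Delta_add: "Delta (e + e') = Delta e + Delta e'"
  by (intro ext) (simp add: Delta_def)

lemma Delta_scaleR: "Delta (c *\<^sub>R e) = c *\<^sub>R Delta e"
  by (intro ext) (simp add: Delta_def algebra_simps)

lemma Delta_zero: "Delta 0 = 0"
  by (intro ext) (simp add: Delta_def)

context smooth_manifold
begin

interpretation T: algebroid_bundle A "TM A" by (rule TM_algebroid)
interpretation TH: mbundle A "EndTM A" by (rule hom_mbundle[OF TM_mbundle TM_mbundle])

abbreviation Tor where "Tor \<equiv> sections (tor_bundle A)"

lemma restrict_sections: "s \<in> sections (restrict_bundle E F) \<longleftrightarrow> s \<in> sections E \<and> (\<forall>p. s p \<in> F p)"
  by (simp add: restrict_bundle_def)

lemma tor_iff: "T \<in> Tor \<longleftrightarrow> T \<in> sections (hom_bundle (TM A) (EndTM A)) \<and> (\<forall>p u v. T p u v = - T p v u)"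
proof
  assume T: "T \<in> Tor"
  have "T \<in> sections (hom_bundle (TM A) (EndTM A)) \<and>
      (\<forall>p. T p \<in> {T \<in> fibre (hom_bundle (TM A) (EndTM A)) p. \<forall>u v. T u v = - T v u})"
    by (rule T[unfolded tor_bundle_def restrict_sections])
  then show "T \<in> sections (hom_bundle (TM A) (EndTM A)) \<and> (\<forall>p u v. T p u v = - T p v u)"
    apply (rule_tac conjI)
     apply (erule conjunct1)
    apply (rule allI, drule conjunct2, drule spec, drule CollectD, erule conjunct2)
    done
next
  assume h: "T \<in> sections (hom_bundle (TM A) (EndTM A)) \<and> (\<forall>p u v. T p u v = - T p v u)"
  have "T p \<in> {T \<in> fibre (hom_bundle (TM A) (EndTM A)) p. \<forall>u v. T u v = - T v u}" for p
    by (rule CollectI, rule conjI[OF mbundle.sec_fibre[OF hom_mbundle[OF TM_mbundle End_mbundle] h[THEN conjunct1]]])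
       (rule h[THEN conjunct2, THEN spec])
  then show "T \<in> Tor" unfolding tor_bundle_def restrict_sections
    by (intro conjI[OF h[THEN conjunct1]] allI)
qed

lemma tap_ap: "tap T U V = ap (ap T U) V"
  by (rule ext) simp

lemma torD:
  assumes T: "T \<in> Tor"
  shows "U \<in> VF A \<Longrightarrow> V \<in> VF A \<Longrightarrow> tap T U V \<in> VF A"
    and "U \<in> VF A \<Longrightarrow> V \<in> VF A \<Longrightarrow> W \<in> VF A \<Longrightarrow> tap T U (V + W) = tap T U V + tap T U W"
    and "U \<in> VF A \<Longrightarrow> V \<in> VF A \<Longrightarrow> f \<in> Cinf A \<Longrightarrow> tap T U (fmul f V) = fmul f (tap T U V)"
    and "U \<in> VF A \<Longrightarrow> V \<in> VF A \<Longrightarrow> W \<in> VF A \<Longrightarrow> tap T (U + W) V = tap T U V + tap T W V"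
    and "U \<in> VF A \<Longrightarrow> V \<in> VF A \<Longrightarrow> f \<in> Cinf A \<Longrightarrow> tap T (fmul f U) V = fmul f (tap T U V)"
    and "T p u v = - T p v u"
    and "u \<notin> tangent A p \<Longrightarrow> T p u v = 0" and "v \<notin> tangent A p \<Longrightarrow> T p u v = 0"
    and "T p 0 v = 0" and "T p u 0 = 0"
    and "T \<in> sections (hom_bundle (TM A) (EndTM A))"
proof -
  show H: "T \<in> sections (hom_bundle (TM A) (EndTM A))"
    by (rule T[unfolded tor_iff, THEN conjunct1])
  show anti: "T p u v = - T p v u" for p u v
    by (rule T[unfolded tor_iff, THEN conjunct2, THEN spec, THEN spec, THEN spec])
  note h = hom_secD[OF H, unfolded TM_simps]
  show U: "tap T U V \<in> VF A" if "U \<in> VF A" "V \<in> VF A" for U V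
    unfolding tap_ap by (rule End_closed[OF h(5)[OF that(1)] that(2)])
  show A2: "tap T U (V + W) = tap T U V + tap T U W" if "U \<in> VF A" "V \<in> VF A" "W \<in> VF A" for U V W
    unfolding tap_ap by (rule End_add[OF h(5)[OF that(1)] that(2,3)])
  show F2: "tap T U (fmul f V) = fmul f (tap T U V)" if "U \<in> VF A" "V \<in> VF A" "f \<in> Cinf A" for U V f
    unfolding tap_ap by (rule End_fmul[OF h(5)[OF that(1)] that(3,2)])
  have sw: "tap T U V = - tap T V U" for U V
    by (rule ext) (simp only: tap_apply uminus_apply anti[of _ "U _"])
  show "tap T (U + W) V = tap T U V + tap T W V" if "U \<in> VF A" "V \<in> VF A" "W \<in> VF A" for U V W
    unfolding sw[of _ V] A2[OF that(2,1,3)] by simp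
  have fm: "fmul f (- Y) = - fmul f Y" for f and Y :: "'m \<Rightarrow> 'm tvec" by (rule ext) simp
  show "tap T (fmul f U) V = fmul f (tap T U V)" if "U \<in> VF A" "V \<in> VF A" "f \<in> Cinf A" for U V f
    unfolding sw[of _ V] F2[OF that(2,1,3)] fm ..
  show off: "T p u v = 0" if "u \<notin> tangent A p" for p u v using h(4)[OF that] by simp
  show "T p u v = 0" if "v \<notin> tangent A p" for p u v using anti[of p u v] off[OF that, of u] by simp
  have "T p 0 = 0" for p using h(2)[OF tangent_closed(1), of p 0] by simp
  then show z: "T p 0 v = 0" for p v by simp
  show "T p u 0 = 0" for p u using anti[of p u 0] z[of p u] by simp
qed

text \<open>Antisymmetry transfers linearity over functions from the second argument to the first,
  so that only one argument has to be examined in each application.\<close>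

lemma tor_tensorial2:
  assumes add: "\<And>U V W. U \<in> VF A \<Longrightarrow> V \<in> VF A \<Longrightarrow> W \<in> VF A \<Longrightarrow> F U (V + W) = F U V + F U W"
    and fm: "\<And>U V f. U \<in> VF A \<Longrightarrow> V \<in> VF A \<Longrightarrow> f \<in> Cinf A \<Longrightarrow> F U (fmul f V) = fmul f (F U V)"
    and anti: "\<And>U V. U \<in> VF A \<Longrightarrow> V \<in> VF A \<Longrightarrow> F U V = - F V U"
    and cl: "\<And>U V. U \<in> VF A \<Longrightarrow> V \<in> VF A \<Longrightarrow> F U V \<in> VF A"
  shows "tensorial2 (TM A) F \<in> Tor"
    and "\<And>U V. U \<in> VF A \<Longrightarrow> V \<in> VF A \<Longrightarrow> tap (tensorial2 (TM A) F) U V = F U V"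
proof -
  let ?T = "tensorial2 (TM A) F"
  have c1: "Clinear A (TM A) (F U)" if "U \<in> VF A" for U
    by (rule ClinearI) (simp_all add: add fm that)
  have fmm: "fmul f (- Y) = - fmul f Y" for f and Y :: "'m \<Rightarrow> 'm tvec" by (rule ext) simp
  have c2: "Clinear A (TM A) (\<lambda>U. F U V)" if V: "V \<in> VF A" for V
  proof (rule ClinearI; unfold TM_simps)
    show "F (U + W) V = F U V + F W V" if U: "U \<in> VF A" and W: "W \<in> VF A" for U W
      unfolding anti[OF VF_add[OF U W] V] anti[OF U V] anti[OF W V] add[OF V U W] by simp
    show "F (fmul f U) V = fmul f (F U V)" if f: "f \<in> Cinf A" and U: "U \<in> VF A" for f U
      unfolding anti[OF VF_fmul[OF f U] V] anti[OF U V] fm[OF V U f] fmm ..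
  qed
  have val: "?T p (U p) (V p) = F U V p" if "U \<in> VF A" "V \<in> VF A" for U V p
    by (rule T.tensorial2_apply) (simp_all add: c1 c2 that)
  show tp: "tap ?T U V = F U V" if "U \<in> VF A" "V \<in> VF A" for U V
    by (rule ext) (simp add: val that)
  have off: "?T p u v = 0" if "u \<notin> tangent A p \<or> v \<notin> tangent A p" for p u v
    using that by (auto simp: tensorial2_def)
  have an: "?T p u v = - ?T p v u" for p u v
  proof (cases "u \<in> tangent A p \<and> v \<in> tangent A p")
    case True
    obtain U where U: "U \<in> VF A" "U p = u" by (rule TM_extend[OF True[THEN conjunct1]])
    obtain V where V: "V \<in> VF A" "V p = v" by (rule TM_extend[OF True[THEN conjunct2]])
    show ?thesis using fun_cong[OF anti[OF U(1) V(1)], of p] val[OF U(1) V(1), of p] val[OF V(1) U(1), of p] U(2) V(2) by simp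
  next
    case False
    then show ?thesis using off[of u p v] off[of v p u] by auto
  qed
  have E: "ap ?T U \<in> End" if U: "U \<in> VF A" for U
  proof (rule T.HomI; (unfold TM_simps)?)
    fix p v w c assume v: "v \<in> tangent A p"
    obtain V where V: "V \<in> VF A" "V p = v" by (rule TM_extend[OF v])
    show "ap ?T U p v \<in> tangent A p" using val[OF U V(1), of p] VF_tangent[OF cl[OF U V(1)]] V(2) by simp
    show "ap ?T U p (c *\<^sub>R v) = c *\<^sub>R ap ?T U p v"
      using val[OF U VF_fmul[OF Cinf_const[of c] V(1)], of p] val[OF U V(1), of p]
        fun_cong[OF fm[OF U V(1) Cinf_const[of c]], of p] V(2) by simp
    assume w: "w \<in> tangent A p"
    obtain W where W: "W \<in> VF A" "W p = w" by (rule TM_extend[OF w])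
    show "ap ?T U p (v + w) = ap ?T U p v + ap ?T U p w"
      using val[OF U VF_add[OF V(1) W(1)], of p] val[OF U V(1), of p] val[OF U W(1), of p]
        fun_cong[OF add[OF U V(1) W(1)], of p] V(2) W(2) by simp
  next
    show "ap ?T U p v = 0" if "v \<notin> tangent A p" for p v using off[of "U p" p v] that by simp
    show "ap (ap ?T U) V \<in> VF A" if V: "V \<in> VF A" for V
      using tp[OF U V] cl[OF U V] by (simp only: tap_ap)
  qed
  have "?T \<in> sections (hom_bundle (TM A) (EndTM A))"
    unfolding hom_sec_iff[of ?T] hom_fibre_iff[of "?T _" "TM A" "EndTM A"] TM_simps
  proof (intro conjI allI ballI impI)
    fix p u v c assume u: "u \<in> tangent A p"
    obtain U where U: "U \<in> VF A" "U p = u" by (rule TM_extend[OF u])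
    show "?T p u \<in> fibre (EndTM A) p" using TH.sec_fibre[OF E[OF U(1)], of p] U(2) by simp
    show "?T p (c *\<^sub>R u) = c *\<^sub>R ?T p u"
    proof
      fix w
      have "?T p w (c *\<^sub>R u) = c *\<^sub>R ?T p w u"
      proof (cases "w \<in> tangent A p")
        case True
        obtain W where W: "W \<in> VF A" "W p = w" by (rule TM_extend[OF True])
        show ?thesis using T.HomD(2)[OF E[OF W(1)], of u p c] u W(2) by simp
      qed (simp add: off)
      then show "?T p (c *\<^sub>R u) w = (c *\<^sub>R ?T p u) w" using an[of p "c *\<^sub>R u" w] an[of p u w] by simp
    qed
    assume v: "v \<in> tangent A p"
    show "?T p (u + v) = ?T p u + ?T p v"
    proof
      fix w
      have "?T p w (u + v) = ?T p w u + ?T p w v"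
      proof (cases "w \<in> tangent A p")
        case True
        obtain W where W: "W \<in> VF A" "W p = w" by (rule TM_extend[OF True])
        show ?thesis using T.HomD(1)[OF E[OF W(1)], of u p v] u v W(2) by simp
      qed (simp add: off)
      then show "?T p (u + v) w = (?T p u + ?T p v) w" using an[of p "u + v" w] an[of p u w] an[of p v w] by simp
    qed
  next
    show "?T p u = 0" if "u \<notin> tangent A p" for p u by (rule ext) (simp add: off that)
    show "ap ?T U \<in> End" if "U \<in> VF A" for U by (rule E[OF that])
  qed
  then show "?T \<in> Tor" unfolding tor_iff by (intro conjI allI) (assumption, rule an)
qed

text \<open>The derivative terms coming from the Leibniz rule of ad in the second argument occur in
  the first and in the last summand and cancel; the first argument follows by antisymmetry.\<close>

lemma act_tor_ad:
  assumes \<sigma>: "\<sigma> \<in> JT" and T: "T \<in> Tor" and U: "U \<in> VF A" and V: "V \<in> VF A"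
  shows "act_tor A (ad_op A \<sigma>) T p (U p) (V p) =
    (ad_op A \<sigma> (tap T U V) - tap T (ad_op A \<sigma> U) V - tap T U (ad_op A \<sigma> V)) p"
proof -
  let ?F = "\<lambda>U V. ad_op A \<sigma> (tap T U V) - tap T (ad_op A \<sigma> U) V - tap T U (ad_op A \<sigma> V)"
  note t = torD[OF T] and d = ad_VF[OF \<sigma>] ad_add[OF \<sigma>] ad_fmul[OF \<sigma>]
  have "act_tor A (ad_op A \<sigma>) T = tensorial2 (TM A) ?F"
    by (simp add: act_tor_def tap_def)
  moreover have "tap (tensorial2 (TM A) ?F) U V = ?F U V"
  proof (rule tor_tensorial2(2)[OF _ _ _ _ U V])
    fix U V W :: "'m \<Rightarrow> 'm tvec" and f :: "'m \<Rightarrow> real"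
    assume U: "U \<in> VF A" and V: "V \<in> VF A"
    show "?F U V \<in> VF A" by (intro VF_diff d(1) t(1) U V)
    have sw: "tap T X Y = - tap T Y X" for X Y :: "'m \<Rightarrow> 'm tvec"
      by (rule ext) (simp only: tap_apply uminus_apply t(6)[of _ "X _"])
    have "ad_op A \<sigma> (- Y) = - ad_op A \<sigma> Y" if "Y \<in> VF A" for Y
      using ad_diff[OF \<sigma> VF_zero that] ad_diff[OF \<sigma> VF_zero VF_zero] by simp
    then show "?F U V = - ?F V U"
      unfolding sw[of U V] sw[of "ad_op A \<sigma> U" V] sw[of U "ad_op A \<sigma> V"] using t(1)[OF V U] by simp
    show "?F U (fmul f V) = fmul f (?F U V)" if f: "f \<in> Cinf A"
    proof -
      note aV = anc_VF[OF \<sigma>]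
      have "tap T U (ad_op A \<sigma> (fmul f V)) = fmul f (tap T U (ad_op A \<sigma> V)) + fmul (\<lambda>p. anc \<sigma> p f) (tap T U V)"
        by (simp only: d(3)[OF f V] t(2)[OF U VF_fmul[OF f d(1)[OF V]] VF_fmul[OF VF_Cinf[OF aV] V]]
            t(3)[OF U d(1)[OF V] f] t(3)[OF U V VF_Cinf[OF aV]])
      moreover have "ad_op A \<sigma> (tap T U (fmul f V)) = fmul f (ad_op A \<sigma> (tap T U V)) + fmul (\<lambda>p. anc \<sigma> p f) (tap T U V)"
        by (simp only: t(3)[OF U V f] d(3)[OF f t(1)[OF U V]])
      moreover have "tap T (ad_op A \<sigma> U) (fmul f V) = fmul f (tap T (ad_op A \<sigma> U) V)"
        by (rule t(3)[OF d(1)[OF U] V f])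
      ultimately show ?thesis
        by (intro ext) (simp add: scaleR_diff_right algebra_simps)
    qed
    assume W: "W \<in> VF A"
    show "?F U (V + W) = ?F U V + ?F U W"
      by (simp add: t(2) d(1,2) t(1) U V W)
  qed
  ultimately have "tap (act_tor A (ad_op A \<sigma>) T) U V = ?F U V" by simp
  from fun_cong[OF this, of p] show ?thesis unfolding tap_apply .
qed

lemma act_tor_off: "u \<notin> tangent A p \<or> v \<notin> tangent A p \<Longrightarrow> act_tor A \<delta> T p u v = 0"
  by (auto simp: act_tor_def tensorial2_def)

lemma tangent2_ext:
  assumes "\<And>U V. U \<in> VF A \<Longrightarrow> V \<in> VF A \<Longrightarrow> S p (U p) (V p) = S' p (U p) (V p)"
    and "\<And>u v. u \<notin> tangent A p \<or> v \<notin> tangent A p \<Longrightarrow> S p u v = S' p u v"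
  shows "S p = S' p"
proof (rule ext, rule ext)
  fix u v :: "'m tvec"
  show "S p u v = S' p u v"
  proof (cases "u \<in> tangent A p \<and> v \<in> tangent A p")
    case True
    obtain U where U: "U \<in> VF A" "U p = u" by (rule TM_extend[OF True[THEN conjunct1]])
    obtain V where V: "V \<in> VF A" "V p = v" by (rule TM_extend[OF True[THEN conjunct2]])
    show ?thesis using assms(1)[OF U(1) V(1)] U(2) V(2) by simp
  next
    case False
    then show ?thesis using assms(2)[of u v] by blast
  qed
qed

text \<open>Endomorphism fields are known only as an \<open>mbundle\<close>, so
  \<open>fibre_extend\<close> is not at hand for them; the extension is a sum of tensors
  \<open>dx_b \<otimes> V_b\<close> in coordinates.\<close>

lemma End_fibre_extend:
  assumes h: "h \<in> fibre (EndTM A) p"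
  obtains \<phi> where "\<phi> \<in> End" "\<phi> p = h"
proof -
  obtain W x X where w: "open W" "p \<in> W" "\<And>b. x b \<in> Cinf A" "\<And>b. X b \<in> VF A"
    "\<And>q b b'. q \<in> W \<Longrightarrow> b \<in> Basis \<Longrightarrow> b' \<in> Basis \<Longrightarrow> X b q (x b') = (if b = b' then 1 else 0)"
    "\<And>q v f. q \<in> W \<Longrightarrow> v \<in> tangent A q \<Longrightarrow> v f = (\<Sum>b\<in>(Basis::'e set). v (x b) * X b q f)"
    by (rule coordinates_exist[where p = p]) (rule that; assumption)
  note hh = h[unfolded hom_fibre_iff TM_simps]
  have "\<exists>V. V \<in> VF A \<and> V p = h (X b p)" for b
  proof -
    have "h (X b p) \<in> tangent A p" using hh VF_tangent[OF w(4)] by blast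
    then show ?thesis using TM_extend by metis
  qed
  then obtain V where V: "\<And>b. V b \<in> VF A" "\<And>b. V b p = h (X b p)" by metis
  define \<phi> where "\<phi> = (\<Sum>b\<in>(Basis::'e set). dtens A (x b) (V b))"
  have \<phi>: "\<phi> \<in> End" unfolding \<phi>_def by (rule TH.sec_sum) (rule TM_dtens_End[OF w(3) V(1)])
  have "\<phi> p v = h v" for v
  proof (cases "v \<in> tangent A p")
    case True
    have hs: "h (\<Sum>b\<in>K. v (x b) *\<^sub>R X b p) = (\<Sum>b\<in>K. v (x b) *\<^sub>R h (X b p))" if "finite K" for K
    proof -
      have ext: "(\<Sum>b\<in>K. v (x b) *\<^sub>R X b p) \<in> tangent A p" for K
        by (rule subspace_sum[OF tangent_subspace]) (rule tangent_closed(5)[OF VF_tangent[OF w(4)]])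
      show ?thesis using that
      proof (induction K)
        case empty
        have "h (0 *\<^sub>R 0) = 0 *\<^sub>R h 0" using hh tangent_closed(1) by blast
        then show ?case by (simp only: sum.empty scaleR_zero_left)
      next
        case (insert b K)
        have "h (v (x b) *\<^sub>R X b p + (\<Sum>b\<in>K. v (x b) *\<^sub>R X b p)) = h (v (x b) *\<^sub>R X b p) + h (\<Sum>b\<in>K. v (x b) *\<^sub>R X b p)"
          using hh tangent_closed(5)[OF VF_tangent[OF w(4)]] ext by blast
        moreover have "h (v (x b) *\<^sub>R X b p) = v (x b) *\<^sub>R h (X b p)" using hh VF_tangent[OF w(4)] by blast
        ultimately show ?case by (simp only: sum.insert[OF insert.hyps] insert.IH)
      qed
    qed
    have "v = (\<Sum>b\<in>Basis. v (x b) *\<^sub>R X b p)"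
      by (rule ext) (simp add: sum_fun_apply w(6)[OF w(2) True, symmetric])
    then have "h v = h (\<Sum>b\<in>Basis. v (x b) *\<^sub>R X b p)" by (rule arg_cong)
    also have "\<dots> = \<phi> p v" unfolding hs[OF finite_Basis] using True
      by (simp add: \<phi>_def sum_fun_apply dtens_def V(2))
    finally show ?thesis ..
  next
    case False
    then show ?thesis using hh EndD(4)[OF \<phi>] by simp
  qed
  then have "\<phi> p = h" by (rule ext)
  with \<phi> show thesis by (rule that)
qed

lemma jet_incl_at: "\<phi> p = h \<Longrightarrow> jet_incl A (TM A) p h = jetJ A (TM A) 0 \<phi> p"
  by (simp add: jet_incl_jetJ[symmetric] incl_section_def)

lemma jet_incl_linear:
  assumes "h \<in> fibre (EndTM A) p" "k \<in> fibre (EndTM A) p"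
  shows "jet_incl A (TM A) p (h + k) = jet_incl A (TM A) p h + jet_incl A (TM A) p k"
    and "jet_incl A (TM A) p (c *\<^sub>R h) = c *\<^sub>R jet_incl A (TM A) p h"
proof -
  have tv: "h v \<in> tangent A p" "k v \<in> tangent A p" if "v \<in> tangent A p" for v
    using assms that by (simp_all add: hom_fibre_iff)
  show "jet_incl A (TM A) p (h + k) = jet_incl A (TM A) p h + jet_incl A (TM A) p k"
    by (intro ext) (simp add: jet_incl_def T.dual_add tv)
  show "jet_incl A (TM A) p (c *\<^sub>R h) = c *\<^sub>R jet_incl A (TM A) p h"
    by (intro ext) (simp add: jet_incl_def T.dual_scale tv)
qed

lemma jet_incl_inject:
  assumes "h \<in> fibre (EndTM A) p" "\<phi> \<in> End" "jet_incl A (TM A) p h = jetJ A (TM A) 0 \<phi> p"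
  shows "h = \<phi> p"
proof -
  obtain \<psi> where \<psi>: "\<psi> \<in> End" "\<psi> p = h" by (rule End_fibre_extend[OF assms(1)])
  have "jetJ A (TM A) 0 \<psi> p = jetJ A (TM A) 0 \<phi> p" using assms(3) jet_incl_at[of \<psi> p h, OF \<psi>(2)] by simp
  then show ?thesis using T.jetJ_eq_snd[OF \<psi>(1) assms(2)] \<psi>(2) by simp
qed

lemma ad_zero_jet: "\<phi> \<in> End \<Longrightarrow> Y \<in> VF A \<Longrightarrow> ad_op A (jetJ A (TM A) 0 \<phi>) Y = ap \<phi> Y"
proof -
  assume p: "\<phi> \<in> End" and Y: "Y \<in> VF A"
  have "vf_bracket 0 Y = 0" using vf_diff_left[OF Y Y Y] by simp
  then show ?thesis using ad_op_jetJ[OF VF_zero p Y] by simp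
qed

lemma jetJ0_anc: "\<sigma> \<in> JT \<Longrightarrow> anc \<sigma> = 0 \<Longrightarrow> \<exists>\<phi>\<in>End. \<sigma> = jetJ A (TM A) 0 \<phi>"
proof -
  assume s: "\<sigma> \<in> JT" and a: "anc \<sigma> = 0"
  obtain X \<phi> where *: "X \<in> VF A" "\<phi> \<in> End" "\<sigma> = jetJ A (TM A) X \<phi>" by (rule JT_obtain[OF s])
  have "X = 0" using a anc_jetJ[OF *(1,2)] *(3) by simp
  with * show ?thesis by auto
qed

end

section \<open>The structure kernel, and the equations of the prolongation\<close>

context igs_structure
begin

interpretation T: algebroid_bundle A "TM A" by (rule TM_algebroid)
interpretation TJ: mbundle A "jet_bundle A (TM A)" by (rule JT_mbundle)
interpretation TH: mbundle A "EndTM A" by (rule End_mbundle)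
interpretation G: algebroid_bundle A G by (rule G_algebroid)
interpretation GH: mbundle A "hom_bundle (TM A) G" by (rule hom_mbundle[OF TM_mbundle G_mbundle])

abbreviation K where "K \<equiv> kernel_bundle A g"
abbreviation GHom where "GHom \<equiv> sections (hom_bundle (TM A) G)"

lemma K_fibre: "h \<in> fibre K p \<longleftrightarrow> h \<in> fibre (EndTM A) p \<and> jet_incl A (TM A) p h \<in> g p"
  by (simp add: kernel_bundle_def restrict_bundle_def)

lemma K_sections: "\<phi> \<in> sections K \<longleftrightarrow> \<phi> \<in> End \<and> jetJ A (TM A) 0 \<phi> \<in> sections G"
proof -
  have "\<phi> \<in> sections K \<longleftrightarrow> \<phi> \<in> End \<and> (\<forall>p. jet_incl A (TM A) p (\<phi> p) \<in> g p)"
    using TH.sec_fibre by (auto simp: kernel_bundle_def restrict_bundle_def)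
  also have "\<dots> \<longleftrightarrow> \<phi> \<in> End \<and> jetJ A (TM A) 0 \<phi> \<in> sections G"
    using jetJ_JT[OF VF_zero, of \<phi>] by (auto simp: G_sections jet_incl_at[OF refl])
  finally show ?thesis .
qed

lemma K_mbundle: "mbundle A K"
proof
  note gs = subspace_0[OF G_subspace] subspace_add[OF G_subspace] subspace_scale[OF G_subspace]
  have z: "jet_incl A (TM A) p 0 = 0" for p
    using jet_incl_at[of 0 p 0] T.jetJ_zero by simp
  have sec: "\<phi> \<in> sections K \<longleftrightarrow> \<phi> \<in> End \<and> (\<forall>p. \<phi> p \<in> fibre K p)" for \<phi>
    by (simp add: kernel_bundle_def restrict_bundle_def)
  have sub: "subspace (fibre K p)" for p
  proof (rule subspaceI)
    show "0 \<in> fibre K p" using gs(1) by (simp add: K_fibre z)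
    show "x + y \<in> fibre K p" if "x \<in> fibre K p" "y \<in> fibre K p" for x y
      using that gs(2) by (simp add: K_fibre jet_incl_linear(1))
    show "c *\<^sub>R x \<in> fibre K p" if "x \<in> fibre K p" for x c
      using that gs(3) by (simp add: K_fibre jet_incl_linear(2)[OF _ TH.fib_closed(1)])
  qed
  show "subspace (fibre K p)" for p by (rule sub)
  show "\<phi> p \<in> fibre K p" if "\<phi> \<in> sections K" for \<phi> p using that by (simp add: sec)
  show "0 \<in> sections K" by (simp add: sec TH.sec_zero subspace_0[OF sub])
  show "\<phi> + \<psi> \<in> sections K" if "\<phi> \<in> sections K" "\<psi> \<in> sections K" for \<phi> \<psi>
    using that by (simp add: sec TH.sec_add subspace_add[OF sub])
  show "fmul f \<phi> \<in> sections K" if "f \<in> Cinf A" "\<phi> \<in> sections K" for f \<phi>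
    using that by (simp add: sec TH.sec_fmul subspace_scale[OF sub])
  show "\<phi> \<in> sections K" if loc: "\<And>p. \<exists>U. open U \<and> p \<in> U \<and> (\<exists>\<psi>\<in>sections K. \<forall>q\<in>U. \<phi> q = \<psi> q)" for \<phi>
    unfolding sec
  proof (intro conjI allI)
    show "\<phi> \<in> End"
    proof (rule TH.sec_local)
      fix p
      obtain U \<psi> where "open U" "p \<in> U" "\<psi> \<in> sections K" "\<forall>q\<in>U. \<phi> q = \<psi> q"
        using loc[of p] by (elim exE conjE bexE) (rule that)
      then show "\<exists>U. open U \<and> p \<in> U \<and> (\<exists>\<psi>\<in>End. \<forall>q\<in>U. \<phi> q = \<psi> q)"
        by (intro exI[of _ U] conjI bexI[of _ \<psi>]) (simp_all add: sec)
    qed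
    show "\<phi> p \<in> fibre K p" for p
    proof -
      obtain U \<psi> where "open U" "p \<in> U" "\<psi> \<in> sections K" "\<forall>q\<in>U. \<phi> q = \<psi> q"
        using loc[of p] by (elim exE conjE bexE) (rule that)
      then show ?thesis by (simp add: sec)
    qed
  qed
qed

interpretation K: mbundle A K by (rule K_mbundle)
interpretation DD: mbundle A "hom_bundle (TM A) K" by (rule hom_mbundle[OF TM_mbundle K_mbundle])

lemma K_End: "\<phi> \<in> sections K \<Longrightarrow> \<phi> \<in> End" by (simp add: K_sections)

lemma K_G: "\<phi> \<in> sections K \<Longrightarrow> jetJ A (TM A) 0 \<phi> \<in> sections G" by (simp add: K_sections)

lemma jetJ0_add: "\<phi> \<in> End \<Longrightarrow> \<psi> \<in> End \<Longrightarrow> jetJ A (TM A) 0 (\<phi> + \<psi>) = jetJ A (TM A) 0 \<phi> + jetJ A (TM A) 0 \<psi>"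
  using TM_jetJ_add[OF VF_zero VF_zero] by simp

lemma jetJ0_fmul: "f \<in> Cinf A \<Longrightarrow> \<phi> \<in> End \<Longrightarrow> jetJ A (TM A) 0 (fmul f \<phi>) = fmul f (jetJ A (TM A) 0 \<phi>)"
proof -
  assume f: "f \<in> Cinf A" and p: "\<phi> \<in> End"
  have "dtens A f 0 = (0 :: 'm \<Rightarrow> 'm endo)" by (intro ext) (simp add: dtens_def)
  then show ?thesis using TM_jetJ_fmul[OF f VF_zero p] by (simp add: fmul_zero)
qed

lemma jetJ0_inject: "\<phi> \<in> End \<Longrightarrow> \<psi> \<in> End \<Longrightarrow> jetJ A (TM A) 0 \<phi> = jetJ A (TM A) 0 \<psi> \<Longrightarrow> \<phi> = \<psi>"
  using TM_jetJ_inject[OF VF_zero VF_zero] by simp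

text \<open>A bundle map into \<open>g\<close> with zero anchor is the same as a section of
  \<open>T\<^sup>*M \<otimes> h\<close>. In this way differences of prolongations and differences of
  generators become arguments of \<open>\<Delta>\<close>.\<close>

lemma kernel_valued:
  assumes \<psi>: "\<psi> \<in> GHom" and z: "\<And>U. U \<in> VF A \<Longrightarrow> anc (ap \<psi> U) = 0"
  obtains e where "e \<in> sections (Delta_dom A g)" "\<And>U. U \<in> VF A \<Longrightarrow> ap \<psi> U = jetJ A (TM A) 0 (ap e U)"
proof -
  have "\<exists>\<phi>. \<phi> \<in> End \<and> ap \<psi> U = jetJ A (TM A) 0 \<phi>" if U: "U \<in> VF A" for U
    using jetJ0_anc[OF G_JT[OF G.HomD(5)[OF \<psi> U]] z[OF U]] by blast
  then obtain w where w: "\<And>U. U \<in> VF A \<Longrightarrow> w U \<in> End" "\<And>U. U \<in> VF A \<Longrightarrow> ap \<psi> U = jetJ A (TM A) 0 (w U)" by metis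
  have wK: "w U \<in> sections K" if U: "U \<in> VF A" for U
    unfolding K_sections using w(1)[OF U] G.HomD(5)[OF \<psi> U] w(2)[OF U] by simp
  have c: "Clinear A (TM A) w"
  proof (rule ClinearI; unfold TM_simps)
    fix U V assume U: "U \<in> VF A" and V: "V \<in> VF A"
    show "w (U + V) = w U + w V"
      by (rule jetJ0_inject[OF w(1)[OF VF_add[OF U V]] TH.sec_add[OF w(1)[OF U] w(1)[OF V]]])
         (simp only: jetJ0_add[OF w(1)[OF U] w(1)[OF V]] w(2)[OF U, symmetric] w(2)[OF V, symmetric]
           w(2)[OF VF_add[OF U V], symmetric] G.Hom_add[OF \<psi> U V])
  next
    fix f U assume f: "f \<in> Cinf A" and U: "U \<in> VF A"
    show "w (fmul f U) = fmul f (w U)"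
      by (rule jetJ0_inject[OF w(1)[OF VF_fmul[OF f U]] TH.sec_fmul[OF f w(1)[OF U]]])
         (simp only: jetJ0_fmul[OF f w(1)[OF U]] w(2)[OF U, symmetric]
           w(2)[OF VF_fmul[OF f U], symmetric] G.Hom_fmul[OF \<psi> f U])
  qed
  have e: "tensorial (TM A) w \<in> sections (Delta_dom A g)"
  proof (rule T.tensorial_hom[where E' = K])
    show "Clinear A (TM A) w" by (rule c)
  qed (simp_all add: wK K.sec_fibre)
  have "ap \<psi> U = jetJ A (TM A) 0 (ap (tensorial (TM A) w) U)" if U: "U \<in> VF A" for U
    using T.ap_tensorial[OF c, of U] w(2)[OF U] U by simp
  with e show thesis by (rule that)
qed

lemma Delta_domD:
  assumes "e \<in> sections (Delta_dom A g)"
  shows "U \<in> VF A \<Longrightarrow> ap e U \<in> sections K"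
    and "U \<in> VF A \<Longrightarrow> V \<in> VF A \<Longrightarrow> ap e (U + V) = ap e U + ap e V"
    and "U \<in> VF A \<Longrightarrow> f \<in> Cinf A \<Longrightarrow> ap e (fmul f U) = fmul f (ap e U)"
  using hom_secD(5)[OF assms] ClinearD[OF T.ap_Clinear[OF assms]] by simp_all

text \<open>\<open>prol \<sigma> \<psi>\<close> says that \<open>J\<^sup>1\<sigma> + \<psi>\<close> is a section of the prolongation \<open>g\<^sup>(\<^sup>1\<^sup>) = J\<^sup>1g \<inter> J\<^sup>2(TM)\<close>: the first equation
  says that the jet is semiholonomic and the second that it is holonomic.\<close>

definition prol :: "('m \<Rightarrow> 'm jet_TM) \<Rightarrow> ('m \<Rightarrow> 'm tvec \<Rightarrow> 'm jet_TM) \<Rightarrow> bool" where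
  "prol \<sigma> \<psi> \<longleftrightarrow> \<psi> \<in> GHom \<and>
     (\<forall>U\<in>VF A. anc (ap \<psi> U) = ad_op A \<sigma> U - vf_bracket (anc \<sigma>) U) \<and>
     (\<forall>U\<in>VF A. \<forall>V\<in>VF A. ad_op A \<sigma> (vf_bracket U V) - vf_bracket (ad_op A \<sigma> U) V - vf_bracket U (ad_op A \<sigma> V)
        = ad_op A (ap \<psi> V) U - ad_op A (ap \<psi> U) V)"

lemma prolD:
  assumes "prol \<sigma> \<psi>"
  shows "\<psi> \<in> GHom" "\<And>U. U \<in> VF A \<Longrightarrow> anc (ap \<psi> U) = ad_op A \<sigma> U - vf_bracket (anc \<sigma>) U"
    and "\<And>U V. U \<in> VF A \<Longrightarrow> V \<in> VF A \<Longrightarrow>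
      ad_op A \<sigma> (vf_bracket U V) - vf_bracket (ad_op A \<sigma> U) V - vf_bracket U (ad_op A \<sigma> V)
        = ad_op A (ap \<psi> V) U - ad_op A (ap \<psi> U) V"
  using assms by (simp_all add: prol_def)

lemma prolI:
  assumes "\<psi> \<in> GHom" "\<And>U. U \<in> VF A \<Longrightarrow> anc (ap \<psi> U) = ad_op A \<sigma> U - vf_bracket (anc \<sigma>) U"
    and "\<And>U V. U \<in> VF A \<Longrightarrow> V \<in> VF A \<Longrightarrow>
      ad_op A \<sigma> (vf_bracket U V) - vf_bracket (ad_op A \<sigma> U) V - vf_bracket U (ad_op A \<sigma> V)
        = ad_op A (ap \<psi> V) U - ad_op A (ap \<psi> U) V"
  shows "prol \<sigma> \<psi>"
  using assms by (simp add: prol_def)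

lemma GHom_JT: "\<psi> \<in> GHom \<Longrightarrow> U \<in> VF A \<Longrightarrow> ap \<psi> U \<in> JT"
  by (rule G_JT[OF G.HomD(5)])

lemma diff_swap_eq: "a - b = c - d \<Longrightarrow> a - c = b - d" for a :: "'z::ab_group_add"
  by (simp add: algebra_simps)

text \<open>The first equation puts the difference of two solutions into the structure kernel; the
  second makes it symmetric in its two vector arguments, and symmetric elements are exactly those
  annihilated by \<open>\<Delta>\<close>.\<close>

lemma prol_unique:
  assumes inj: "Delta_injective A g" and 1: "prol \<sigma> \<psi>" and 2: "prol \<sigma> \<xi>"
  shows "\<psi> = \<xi>"
proof -
  note h = prolD(1)[OF 1] prolD(1)[OF 2]
  have d: "\<psi> - \<xi> \<in> GHom" by (rule GH.sec_diff[OF h])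
  have az: "anc (ap (\<psi> - \<xi>) U) = 0" if U: "U \<in> VF A" for U
    unfolding ap_simps anc_diff[OF GHom_JT[OF h(1) U] GHom_JT[OF h(2) U]] prolD(2)[OF 1 U] prolD(2)[OF 2 U] by simp
  obtain e where e: "e \<in> sections (Delta_dom A g)" "\<And>U. U \<in> VF A \<Longrightarrow> ap (\<psi> - \<xi>) U = jetJ A (TM A) 0 (ap e U)"
    by (rule kernel_valued[OF d], erule az) (rule that; assumption)
  note eK = Delta_domD(1)[OF e(1)]
  have ev: "ap (ap e U) V = ad_op A (ap \<psi> U) V - ad_op A (ap \<xi> U) V" if U: "U \<in> VF A" and V: "V \<in> VF A" for U V
    using ad_zero_jet[OF K_End[OF eK[OF U]] V] e(2)[OF U] ad_diff_left[OF GHom_JT[OF h(1) U] GHom_JT[OF h(2) U] V]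
    by (simp add: ap_simps)
  have "e p = 0" for p
  proof -
    have "Delta (e p) = Delta 0"
    proof (rule tangent2_ext[where S = "\<lambda>p. Delta (e p)" and p = p and S' = "\<lambda>p. Delta 0"])
      fix U V assume U: "U \<in> VF A" and V: "V \<in> VF A"
      have "ap (ap e V) U = ap (ap e U) V"
        unfolding ev[OF U V] ev[OF V U]
        by (rule diff_swap_eq) (rule HOL.trans[OF prolD(3)[OF 1 U V, symmetric] prolD(3)[OF 2 U V]])
      from fun_cong[OF this, of p] show "Delta (e p) (U p) (V p) = Delta 0 (U p) (V p)"
        by (simp add: Delta_def)
    next
      fix u v :: "'m tvec" assume uv: "u \<notin> tangent A p \<or> v \<notin> tangent A p"
      have z: "e p w = 0" if "w \<notin> tangent A p" for w using hom_secD(4)[OF e(1)] that by simp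
      have z2: "e p w w' = 0" if "w' \<notin> tangent A p" for w w'
      proof (cases "w \<in> tangent A p")
        case True
        then have "e p w \<in> fibre (EndTM A) p" using hom_secD(3)[OF e(1), of w p] by (simp add: K_fibre)
        then show ?thesis using that by (simp add: hom_fibre_iff)
      qed (simp add: z)
      show "Delta (e p) u v = Delta 0 u v" using uv z z2 by (auto simp: Delta_def)
    qed
    then show ?thesis
      using inj[unfolded Delta_injective_def, THEN spec, of p] DD.sec_fibre[OF e(1), of p] DD.fib_closed(1)[of p]
      by (simp add: inj_on_def)
  qed
  then have "ap e U = 0" for U by (intro ext) simp
  then have "ap (\<psi> - \<xi>) U = 0" if "U \<in> VF A" for U using e(2)[OF that] T.jetJ_zero by simp
  then have "ap \<psi> U = ap \<xi> U" if "U \<in> VF A" for U using that by (simp add: ap_simps)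
  then show ?thesis by (rule G.Hom_ext[OF h])
qed

lemma prol_add:
  assumes s: "\<sigma> \<in> JT" "\<tau> \<in> JT" and 1: "prol \<sigma> \<psi>" and 2: "prol \<tau> \<xi>"
  shows "prol (\<sigma> + \<tau>) (\<psi> + \<xi>)"
proof (rule prolI)
  note h = prolD(1)[OF 1] prolD(1)[OF 2]
  show "\<psi> + \<xi> \<in> GHom" by (rule GH.sec_add[OF h])
  fix U assume U: "U \<in> VF A"
  show "anc (ap (\<psi> + \<xi>) U) = ad_op A (\<sigma> + \<tau>) U - vf_bracket (anc (\<sigma> + \<tau>)) U"
    unfolding ap_simps anc_add[OF GHom_JT[OF h(1) U] GHom_JT[OF h(2) U]] prolD(2)[OF 1 U] prolD(2)[OF 2 U]
      ad_add_left[OF s U] anc_add[OF s] vf_add_left[OF anc_VF[OF s(1)] anc_VF[OF s(2)] U] by simp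
  fix V assume V: "V \<in> VF A"
  show "ad_op A (\<sigma> + \<tau>) (vf_bracket U V) - vf_bracket (ad_op A (\<sigma> + \<tau>) U) V - vf_bracket U (ad_op A (\<sigma> + \<tau>) V)
      = ad_op A (ap (\<psi> + \<xi>) V) U - ad_op A (ap (\<psi> + \<xi>) U) V"
  proof -
    have "ad_op A (\<sigma> + \<tau>) (vf_bracket U V) - vf_bracket (ad_op A (\<sigma> + \<tau>) U) V - vf_bracket U (ad_op A (\<sigma> + \<tau>) V)
      = (ad_op A \<sigma> (vf_bracket U V) - vf_bracket (ad_op A \<sigma> U) V - vf_bracket U (ad_op A \<sigma> V))
      + (ad_op A \<tau> (vf_bracket U V) - vf_bracket (ad_op A \<tau> U) V - vf_bracket U (ad_op A \<tau> V))"
      by (simp add: ad_add_left s U V vf_closed vf_add_left vf_add_right ad_VF)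
    also have "\<dots> = ad_op A (ap (\<psi> + \<xi>) V) U - ad_op A (ap (\<psi> + \<xi>) U) V"
      unfolding prolD(3)[OF 1 U V] prolD(3)[OF 2 U V]
      by (simp add: ap_simps ad_add_left GHom_JT h U V)
    finally show ?thesis .
  qed
qed

text \<open>The bundle map is the one that \<open>jetJ_fmul\<close> assigns to \<open>f\<close>
  times the jet; with uniqueness it will give the Leibniz rule of the connection.\<close>

lemma prol_fmul:
  assumes s: "\<sigma> \<in> sections G" and f: "f \<in> Cinf A" and 1: "prol \<sigma> \<psi>"
  shows "prol (fmul f \<sigma>) (fmul f \<psi> + dtens A f \<sigma>)"
proof (rule prolI)
  note h = prolD(1)[OF 1] and j = G_JT[OF s]
  note dH = G.dtens_Hom[OF f s]
  show "fmul f \<psi> + dtens A f \<sigma> \<in> GHom" by (rule GH.sec_add[OF GH.sec_fmul[OF f h] dH])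
  have e: "ap (fmul f \<psi> + dtens A f \<sigma>) U = fmul f (ap \<psi> U) + fmul (\<lambda>p. U p f) \<sigma>" if "U \<in> VF A" for U
    by (simp only: ap_simps G.ap_dtens[OF that])
  have j2: "fmul f (ap \<psi> U) \<in> JT" "fmul (\<lambda>p. U p f) \<sigma> \<in> JT" if "U \<in> VF A" for U
    by (rule TJ.sec_fmul[OF f GHom_JT[OF h that]], rule TJ.sec_fmul[OF VF_Cinf[OF that] j])
  fix U assume U: "U \<in> VF A"
  show "anc (ap (fmul f \<psi> + dtens A f \<sigma>) U) = ad_op A (fmul f \<sigma>) U - vf_bracket (anc (fmul f \<sigma>)) U"
    unfolding e[OF U] anc_add[OF j2[OF U]] anc_fmul[OF GHom_JT[OF h U] f] anc_fmul[OF j VF_Cinf[OF U]]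
      ad_fmul_left[OF j f U] anc_fmul[OF j f] vf_fmul_left[OF f anc_VF[OF j] U] prolD(2)[OF 1 U]
    by (rule ext) (simp add: scaleR_diff_right)
  fix V assume V: "V \<in> VF A"
  have ea: "ad_op A (ap (fmul f \<psi> + dtens A f \<sigma>) W) Y = fmul f (ad_op A (ap \<psi> W) Y) + fmul (\<lambda>p. W p f) (ad_op A \<sigma> Y)"
    if W: "W \<in> VF A" and Y: "Y \<in> VF A" for W Y
    unfolding e[OF W] ad_add_left[OF j2[OF W] Y] ad_fmul_left[OF GHom_JT[OF h W] f Y] ad_fmul_left[OF j VF_Cinf[OF W] Y] ..
  have p: "ad_op A \<sigma> (vf_bracket U V) p - vf_bracket (ad_op A \<sigma> U) V p - vf_bracket U (ad_op A \<sigma> V) p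
        = ad_op A (ap \<psi> V) U p - ad_op A (ap \<psi> U) V p" for p
    using fun_cong[OF prolD(3)[OF 1 U V], of p] by simp
  show "ad_op A (fmul f \<sigma>) (vf_bracket U V) - vf_bracket (ad_op A (fmul f \<sigma>) U) V - vf_bracket U (ad_op A (fmul f \<sigma>) V)
      = ad_op A (ap (fmul f \<psi> + dtens A f \<sigma>) V) U - ad_op A (ap (fmul f \<psi> + dtens A f \<sigma>) U) V"
    unfolding ea[OF U V] ea[OF V U] ad_fmul_left[OF j f U] ad_fmul_left[OF j f V] ad_fmul_left[OF j f vf_closed[OF U V]]
      vf_fmul_left[OF f ad_VF[OF j U] V] vf_fmul_right[OF f U ad_VF[OF j V]]
  proof
    fix p
    have "f p *\<^sub>R (ad_op A \<sigma> (vf_bracket U V) p - vf_bracket (ad_op A \<sigma> U) V p - vf_bracket U (ad_op A \<sigma> V) p)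
        = f p *\<^sub>R (ad_op A (ap \<psi> V) U p - ad_op A (ap \<psi> U) V p)" unfolding p ..
    then show "(fmul f (ad_op A \<sigma> (vf_bracket U V)) - (fmul f (vf_bracket (ad_op A \<sigma> U) V) - fmul (\<lambda>p. V p f) (ad_op A \<sigma> U))
        - (fmul f (vf_bracket U (ad_op A \<sigma> V)) + fmul (\<lambda>p. U p f) (ad_op A \<sigma> V))) p
      = (fmul f (ad_op A (ap \<psi> V) U) + fmul (\<lambda>p. V p f) (ad_op A \<sigma> U)
        - (fmul f (ad_op A (ap \<psi> U) V) + fmul (\<lambda>p. U p f) (ad_op A \<sigma> V))) p"
      by (simp add: scaleR_diff_right algebra_simps)
  qed
qed

text \<open>The bundle map here belongs to the bracket of the jets
  \<open>J\<^sup>1 \<sigma> + \<psi>\<close> and \<open>J\<^sup>1 \<tau> + \<xi>\<close> of sections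
  of \<open>g\<close>; combined with uniqueness this will yield the morphism property of the
  splitting.\<close>

lemma prol_bracket:
  assumes s: "\<sigma> \<in> sections G" "\<tau> \<in> sections G" and 1: "prol \<sigma> \<psi>" and 2: "prol \<tau> \<xi>"
  shows "prol (jet_bracket A (TM A) \<sigma> \<tau>) (G.jbr \<sigma> \<psi> \<tau> \<xi>)"
proof (rule prolI)
  note h = prolD(1)[OF 1] prolD(1)[OF 2] and j = G_JT[OF s(1)] G_JT[OF s(2)]
  let ?x = "ad_op A \<sigma>" and ?y = "ad_op A \<tau>"
  note x = ad_VF[OF j(1)] ad_diff[OF j(1)] and y = ad_VF[OF j(2)] ad_diff[OF j(2)]
  show "G.jbr \<sigma> \<psi> \<tau> \<xi> \<in> GHom" by (rule G.jbr_Hom[OF s(1) h(1) s(2) h(2)])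
  note GG = G.HomD(5)[OF h(1)] G.HomD(5)[OF h(2)]
  \<comment> \<open>The first equation of the prolongation rewrites the anchors inside the
    composition terms of \<open>jbr\<close>. The terms with brackets of anchors then cancel, and
    \<open>ad_op\<close> remains in their place.\<close>
  have th: "ap (G.jbr \<sigma> \<psi> \<tau> \<xi>) V = (jet_bracket A (TM A) \<sigma> (ap \<xi> V) - ap \<xi> (?x V))
      - (jet_bracket A (TM A) \<tau> (ap \<psi> V) - ap \<psi> (?y V))" if V: "V \<in> VF A" for V
  proof -
    note a = anc_VF[OF j(1)] anc_VF[OF j(2)]
    have p1: "ap \<psi> (anc (ap \<xi> V)) = ap \<psi> (?y V) - ap \<psi> (vf_bracket (anc \<tau>) V)"
      unfolding prolD(2)[OF 2 V] by (rule G.Hom_diff[OF h(1) y(1)[OF V] vf_closed[OF a(2) V]])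
    have p2: "ap \<xi> (anc (ap \<psi> V)) = ap \<xi> (?x V) - ap \<xi> (vf_bracket (anc \<sigma>) V)"
      unfolding prolD(2)[OF 1 V] by (rule G.Hom_diff[OF h(2) x(1)[OF V] vf_closed[OF a(1) V]])
    show ?thesis
      unfolding G.ap_jbr[OF s(1) h(1) s(2) h(2) V] ap_G_anchor[OF s(1)] ap_G_anchor[OF s(2)]
        ap_G_anchor[OF GG(1)[OF V]] ap_G_anchor[OF GG(2)[OF V]] p1 p2 G_bracket[OF s(1) GG(2)[OF V]] G_bracket[OF s(2) GG(1)[OF V]]
      by (simp add: algebra_simps)
  qed
  have J: "jet_bracket A (TM A) \<sigma> (ap \<xi> V) \<in> JT" "ap \<xi> (?x V) \<in> JT" "jet_bracket A (TM A) \<tau> (ap \<psi> V) \<in> JT" "ap \<psi> (?y V) \<in> JT"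
    if V: "V \<in> VF A" for V
    using G_JT[OF G_bracket_closed[OF s(1) GG(2)[OF V]]] G_JT[OF G_bracket_closed[OF s(2) GG(1)[OF V]]]
      GHom_JT[OF h(1) y(1)[OF V]] GHom_JT[OF h(2) x(1)[OF V]] by simp_all
  note JD = TJ.sec_diff[OF J(1,2)] TJ.sec_diff[OF J(3,4)]
  note GJ = GHom_JT[OF h(1)] GHom_JT[OF h(2)]
  fix U assume U: "U \<in> VF A"
  have adt: "ad_op A (ap (G.jbr \<sigma> \<psi> \<tau> \<xi>) V) W = (?x (ad_op A (ap \<xi> V) W) - ad_op A (ap \<xi> V) (?x W) - ad_op A (ap \<xi> (?x V)) W)
      - (?y (ad_op A (ap \<psi> V) W) - ad_op A (ap \<psi> V) (?y W) - ad_op A (ap \<psi> (?y V)) W)"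
    if V: "V \<in> VF A" and W: "W \<in> VF A" for V W
    unfolding th[OF V] ad_diff_left[OF JD(1)[OF V V] JD(2)[OF V V] W] ad_diff_left[OF J(1)[OF V] J(2)[OF V] W]
      ad_diff_left[OF J(3)[OF V] J(4)[OF V] W] ad_bracket[OF j(1) GJ(2)[OF V] W] ad_bracket[OF j(2) GJ(1)[OF V] W] ..
  note a = anc_VF[OF j(1)] anc_VF[OF j(2)]
  show "anc (ap (G.jbr \<sigma> \<psi> \<tau> \<xi>) U) = ad_op A (jet_bracket A (TM A) \<sigma> \<tau>) U - vf_bracket (anc (jet_bracket A (TM A) \<sigma> \<tau>)) U"
    unfolding th[OF U] anc_diff[OF JD(1)[OF U U] JD(2)[OF U U]] anc_diff[OF J(1)[OF U] J(2)[OF U]] anc_diff[OF J(3)[OF U] J(4)[OF U]]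
      anc_bracket[OF j(1) GJ(2)[OF U]] anc_bracket[OF j(2) GJ(1)[OF U]] prolD(2)[OF 1 U] prolD(2)[OF 2 U]
      prolD(2)[OF 1 y(1)[OF U]] prolD(2)[OF 2 x(1)[OF U]] vf_diff_right[OF a(1) y(1)[OF U] vf_closed[OF a(2) U]]
      vf_diff_right[OF a(2) x(1)[OF U] vf_closed[OF a(1) U]] ad_bracket[OF j U] anc_bracket[OF j] vf_jacobi[OF a U]
    by (simp add: algebra_simps)
  fix V assume V: "V \<in> VF A"
  note xU = x(1)[OF U] and xV = x(1)[OF V] and yU = y(1)[OF U] and yV = y(1)[OF V]
  note UV = vf_closed[OF U V]
  \<comment> \<open>This applies ad of \<open>\<sigma>\<close> to the second equation for
    \<open>\<tau>\<close>, and \<open>e2\<close> does the opposite. Together with four instances of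
    the second equations, in which one argument has already been acted on, they add up to the
    claim.\<close>
  have e1: "?x (?y (vf_bracket U V)) - ?x (vf_bracket (?y U) V) - ?x (vf_bracket U (?y V))
      = ?x (ad_op A (ap \<xi> V) U) - ?x (ad_op A (ap \<xi> U) V)"
  proof -
    have "?x (?y (vf_bracket U V) - vf_bracket (?y U) V - vf_bracket U (?y V)) = ?x (ad_op A (ap \<xi> V) U - ad_op A (ap \<xi> U) V)"
      unfolding prolD(3)[OF 2 U V] ..
    then show ?thesis
      by (simp only: x(2)[OF VF_diff[OF y(1)[OF UV] vf_closed[OF yU V]] vf_closed[OF U yV]] x(2)[OF y(1)[OF UV] vf_closed[OF yU V]]
        x(2)[OF ad_VF[OF GJ(2)[OF V] U] ad_VF[OF GJ(2)[OF U] V]])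
  qed
  have e2: "?y (?x (vf_bracket U V)) - ?y (vf_bracket (?x U) V) - ?y (vf_bracket U (?x V))
      = ?y (ad_op A (ap \<psi> V) U) - ?y (ad_op A (ap \<psi> U) V)"
  proof -
    have "?y (?x (vf_bracket U V) - vf_bracket (?x U) V - vf_bracket U (?x V)) = ?y (ad_op A (ap \<psi> V) U - ad_op A (ap \<psi> U) V)"
      unfolding prolD(3)[OF 1 U V] ..
    then show ?thesis
      by (simp only: y(2)[OF VF_diff[OF x(1)[OF UV] vf_closed[OF xU V]] vf_closed[OF U xV]] y(2)[OF x(1)[OF UV] vf_closed[OF xU V]]
        y(2)[OF ad_VF[OF GJ(1)[OF V] U] ad_VF[OF GJ(1)[OF U] V]])
  qed
  show "ad_op A (jet_bracket A (TM A) \<sigma> \<tau>) (vf_bracket U V) - vf_bracket (ad_op A (jet_bracket A (TM A) \<sigma> \<tau>) U) V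
      - vf_bracket U (ad_op A (jet_bracket A (TM A) \<sigma> \<tau>) V)
      = ad_op A (ap (G.jbr \<sigma> \<psi> \<tau> \<xi>) V) U - ad_op A (ap (G.jbr \<sigma> \<psi> \<tau> \<xi>) U) V"
    unfolding adt[OF U V] adt[OF V U] ad_bracket[OF j UV] ad_bracket[OF j U] ad_bracket[OF j V]
      vf_diff_left[OF x(1)[OF yU] y(1)[OF xU] V] vf_diff_right[OF U x(1)[OF yV] y(1)[OF xV]]

  \<comment> \<open>Tangent vectors are real-valued functions, so the identity is evaluated at a
    point and a function, where it is a linear combination of real equations.\<close>
  proof (intro ext)
    fix p f
    note E = fun_cong[OF fun_cong, of _ _ p f]
    show "(?x (?y (vf_bracket U V)) - ?y (?x (vf_bracket U V)) - (vf_bracket (?x (?y U)) V - vf_bracket (?y (?x U)) V)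
        - (vf_bracket U (?x (?y V)) - vf_bracket U (?y (?x V)))) p f
      = (?x (ad_op A (ap \<xi> V) U) - ad_op A (ap \<xi> V) (?x U) - ad_op A (ap \<xi> (?x V)) U
        - (?y (ad_op A (ap \<psi> V) U) - ad_op A (ap \<psi> V) (?y U) - ad_op A (ap \<psi> (?y V)) U)
        - (?x (ad_op A (ap \<xi> U) V) - ad_op A (ap \<xi> U) (?x V) - ad_op A (ap \<xi> (?x U)) V
        - (?y (ad_op A (ap \<psi> U) V) - ad_op A (ap \<psi> U) (?y V) - ad_op A (ap \<psi> (?y U)) V))) p f"
      using E[OF e1] E[OF e2] E[OF prolD(3)[OF 1 yU V]] E[OF prolD(3)[OF 1 U yV]] E[OF prolD(3)[OF 2 xU V]] E[OF prolD(3)[OF 2 U xV]]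
      unfolding minus_apply by linarith
  qed
qed

text \<open>With zero bundle map the second equation is the Jacobi identity. This is the source of
  the parallel sections.\<close>

lemma prol_jet1:
  assumes W: "W \<in> VF A"
  shows "prol (jet1 A (TM A) W) 0"
proof (rule prolI)
  show "0 \<in> GHom" by (rule GH.sec_zero)
  have a: "ad_op A (jet1 A (TM A) W) Y = vf_bracket W Y" if "Y \<in> VF A" for Y
    unfolding TM_jet1 ad_op_jetJ[OF W TH.sec_zero that] by (simp add: ap_simps)
  have b: "anc (jet1 A (TM A) W) = W" unfolding TM_jet1 by (rule anc_jetJ[OF W TH.sec_zero])
  have z: "anc 0 = 0" using anc_diff[OF TJ.sec_zero TJ.sec_zero] by (simp only: diff_self)
  have az: "ad_op A 0 Y = 0" if "Y \<in> VF A" for Y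
    using ad_diff_left[OF TJ.sec_zero TJ.sec_zero that] by (simp only: diff_self)
  fix U assume U: "U \<in> VF A"
  show "anc (ap 0 U) = ad_op A (jet1 A (TM A) W) U - vf_bracket (anc (jet1 A (TM A) W)) U"
    unfolding a[OF U] b ap_simps z by simp
  fix V assume V: "V \<in> VF A"
  have "vf_bracket W (vf_bracket U V) - vf_bracket (vf_bracket W U) V - vf_bracket U (vf_bracket W V) = 0"
    unfolding vf_jacobi[OF W U V] by simp
  then show "ad_op A (jet1 A (TM A) W) (vf_bracket U V) - vf_bracket (ad_op A (jet1 A (TM A) W) U) V
      - vf_bracket U (ad_op A (jet1 A (TM A) W) V) = ad_op A (ap 0 V) U - ad_op A (ap 0 U) V"
    unfolding a[OF U] a[OF V] a[OF vf_closed[OF U V]] ap_simps az[OF U] az[OF V] by simp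
qed

end

section \<open>Generators and the intrinsic torsion\<close>

text \<open>Constant coefficients allow fibrewise linear algebra to be done with honest sections; in
  \<open>Delta_smooth\<close> a linear combination at one point is extended in this way before
  anchor and ad are applied.\<close>

lemma (in mbundle) Clinear_lincomb:
  fixes F :: "('m \<Rightarrow> 'v) \<Rightarrow> 'm \<Rightarrow> 'w::real_vector"
  assumes F: "Clinear A E F" and "finite M" "\<And>j. j \<in> M \<Longrightarrow> b j \<in> sections E"
  shows "F (\<Sum>j\<in>M. fmul (\<lambda>_. c j) (b j)) q = (\<Sum>j\<in>M. c j *\<^sub>R F (b j) q)"
  using assms(2,3)
proof (induction M)
  case empty
  have "F (fmul (\<lambda>_. 0) 0) = fmul (\<lambda>_. 0) (F 0)" by (rule ClinearD(2)[OF F Cinf_const sec_zero])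
  then have "F 0 q = (fmul (\<lambda>_. 0) (F 0)) q" by (simp only: fmul_zero)
  then show ?case by (simp only: sum.empty fmul_apply scaleR_zero_left)
next
  case (insert k M)
  have b: "b k \<in> sections E" and M: "(\<Sum>j\<in>M. fmul (\<lambda>_. c j) (b j)) \<in> sections E"
    using insert.prems by (simp_all add: sec_sum sec_fmul)
  have IH: "F (\<Sum>j\<in>M. fmul (\<lambda>_. c j) (b j)) q = (\<Sum>j\<in>M. c j *\<^sub>R F (b j) q)"
    by (rule insert.IH) (rule insert.prems, erule insertI2)
  show ?case
    unfolding sum.insert[OF insert.hyps] ClinearD(1)[OF F sec_fmul[OF Cinf_const b] M] ClinearD(2)[OF F Cinf_const b]
    by (simp only: plus_fun_apply fmul_apply IH)
qed

context smooth_manifold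
begin

interpretation T: algebroid_bundle A "TM A" by (rule TM_algebroid)
interpretation TJ: mbundle A "jet_bundle A (TM A)" by (rule JT_mbundle)

lemma lincomb_ops:
  fixes r :: nat
  assumes b: "\<And>j. j < r \<Longrightarrow> b j \<in> JT"
  shows "(\<Sum>j<r. fmul (\<lambda>_. c j) (b j)) q = (\<Sum>j<r. c j *\<^sub>R b j q)"
    and "anc (\<Sum>j<r. fmul (\<lambda>_. c j) (b j)) q = (\<Sum>j<r. c j *\<^sub>R anc (b j) q)"
    and "Y \<in> VF A \<Longrightarrow> ad_op A (\<Sum>j<r. fmul (\<lambda>_. c j) (b j)) Y q = (\<Sum>j<r. c j *\<^sub>R ad_op A (b j) Y q)"
proof -
  show "(\<Sum>j<r. fmul (\<lambda>_. c j) (b j)) q = (\<Sum>j<r. c j *\<^sub>R b j q)"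
    by (simp only: sum_fun_apply fmul_apply)
  have "Clinear A (jet_bundle A (TM A)) anc" by (rule ClinearI) (rule anc_add anc_fmul; assumption)+
  from this finite_lessThan
  show "anc (\<Sum>j<r. fmul (\<lambda>_. c j) (b j)) q = (\<Sum>j<r. c j *\<^sub>R anc (b j) q)"
    by (rule TJ.Clinear_lincomb) (simp add: b)
  assume Y: "Y \<in> VF A"
  have "Clinear A (jet_bundle A (TM A)) (\<lambda>\<sigma>. ad_op A \<sigma> Y)"
    by (rule ClinearI) (rule ad_add_left ad_fmul_left; (assumption | rule Y))+
  from this finite_lessThan
  show "ad_op A (\<Sum>j<r. fmul (\<lambda>_. c j) (b j)) Y q = (\<Sum>j<r. c j *\<^sub>R ad_op A (b j) Y q)"
    by (rule TJ.Clinear_lincomb[where F = "\<lambda>\<sigma>. ad_op A \<sigma> Y"]) (simp add: b)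
qed

text \<open>Only the value of \<open>\<sigma>\<close> at \<open>p\<close> comes from an
  endomorphism. Anchor and ad depend on \<open>\<sigma>\<close> pointwise, so
  \<open>\<sigma>\<close> may be replaced by any extension of \<open>h\<close>.\<close>

lemma anc_incl:
  assumes h: "h \<in> fibre (EndTM A) p" and s: "\<sigma> p = jet_incl A (TM A) p h"
  shows "anc \<sigma> p = 0" and "Y \<in> VF A \<Longrightarrow> ad_op A \<sigma> Y p = h (Y p)"
proof -
  obtain \<phi> where \<phi>: "\<phi> \<in> End" "\<phi> p = h" by (rule End_fibre_extend[OF h])
  have e: "\<sigma> p = jetJ A (TM A) 0 \<phi> p" using s jet_incl_at[of \<phi> p h, OF \<phi>(2)] by simp
  show "anc \<sigma> p = 0" unfolding anc_local[where \<sigma> = \<sigma> and p = p and \<tau> = "jetJ A (TM A) 0 \<phi>", OF e] anc_jetJ[OF VF_zero \<phi>(1)] by simp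
  show "ad_op A \<sigma> Y p = h (Y p)" if Y: "Y \<in> VF A"
    unfolding ad_op_local[where \<sigma> = \<sigma> and p = p and \<tau> = "jetJ A (TM A) 0 \<phi>", OF e] ad_zero_jet[OF \<phi>(1) Y] by (simp add: \<phi>(2))
qed

lemma act_tor_cong:
  assumes T: "T \<in> Tor" and d: "\<And>Y. Y \<in> VF A \<Longrightarrow> \<delta> Y = \<delta>' Y"
  shows "act_tor A \<delta> T = act_tor A \<delta>' T"
proof (rule ext, rule ext, rule ext)
  fix p u v
  show "act_tor A \<delta> T p u v = act_tor A \<delta>' T p u v"
  proof (cases "u \<in> tangent A p \<and> v \<in> tangent A p")
    case True
    then have u: "u \<in> fibre (TM A) p" and v: "v \<in> fibre (TM A) p" by simp_all
    note e = T.extend_sec(1)[OF u, unfolded TM_simps] T.extend_sec(1)[OF v, unfolded TM_simps]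
    show ?thesis
      unfolding act_tor_def tensorial2_def tap_def[symmetric] d[OF e(1)] d[OF e(2)] d[OF torD(1)[OF T e]] ..
  qed (simp only: act_tor_off[of u p v] de_Morgan_conj)
qed

end

section \<open>Cosets of the image of \<open>\<Delta>\<close>\<close>

context igs_structure
begin

interpretation DD: mbundle A "hom_bundle (TM A) K" by (rule hom_mbundle[OF TM_mbundle K_mbundle])

lemma im_Delta_add:
  "S \<in> im_Delta A g p \<Longrightarrow> S' \<in> im_Delta A g p \<Longrightarrow> S + S' \<in> im_Delta A g p"
  unfolding im_Delta_def by (elim imageE) (simp only: Delta_add[symmetric] imageI DD.fib_closed(2))

lemma im_Delta_minus: "S \<in> im_Delta A g p \<Longrightarrow> - S \<in> im_Delta A g p"
proof -
  assume "S \<in> im_Delta A g p"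
  then obtain e where e: "e \<in> fibre (Delta_dom A g) p" "S = Delta e" unfolding im_Delta_def by blast
  have "- S = Delta ((- 1) *\<^sub>R e)" unfolding e(2) Delta_scaleR by simp
  then show ?thesis unfolding im_Delta_def using DD.fib_closed(5)[OF e(1), of "-1"] by blast
qed

lemma H_class_eq:
  assumes S: "S \<in> im_Delta A g p"
  shows "H_class A g p (T + S) = H_class A g p T"
proof -
  have "\<exists>R. T + S + Q = T + R \<and> R \<in> im_Delta A g p" if "Q \<in> im_Delta A g p" for Q
    using im_Delta_add[OF S that] by (intro exI[of _ "S + Q"]) (simp add: add.assoc)
  moreover have "\<exists>R. T + Q = T + S + R \<and> R \<in> im_Delta A g p" if "Q \<in> im_Delta A g p" for Q
    using im_Delta_add[OF im_Delta_minus[OF S] that] by (intro exI[of _ "- S + Q"]) (simp add: algebra_simps)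
  ultimately show ?thesis unfolding H_class_def by (intro equalityI subsetI; elim CollectE exE conjE; simp)
qed

lemma H_class_zeroD: "H_class A g p S = H_class A g p 0 \<Longrightarrow> S \<in> im_Delta A g p"
proof -
  assume e: "H_class A g p S = H_class A g p 0"
  have "0 \<in> im_Delta A g p" unfolding im_Delta_def using DD.fib_closed(1) Delta_zero by (metis imageI)
  then have "S \<in> H_class A g p S" unfolding H_class_def by (intro CollectI exI[of _ 0]) simp
  then show ?thesis unfolding e by (simp add: H_class_def)
qed

end

section \<open>Calculus with a fixed generator\<close>

locale igs_generator = igs_structure A g
  for A :: "('m::{t2_space, second_countable_topology}, 'e::euclidean_space) atlas" and g +
  fixes D
  assumes gen: "generator A g D"
begin

interpretation T: algebroid_bundle A "TM A" by (rule TM_algebroid)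
interpretation TH: mbundle A "EndTM A" by (rule End_mbundle)
interpretation G: algebroid_bundle A G by (rule G_algebroid)
interpretation K: mbundle A K by (rule K_mbundle)
interpretation DD: mbundle A "hom_bundle (TM A) K" by (rule hom_mbundle[OF TM_mbundle K_mbundle])

abbreviation nb where "nb \<equiv> dual_conn D"
abbreviation spl where "spl V \<equiv> jetJ A (TM A) V (D V)"

lemma D_End: "V \<in> VF A \<Longrightarrow> D V \<in> End"
  and spl_G: "V \<in> VF A \<Longrightarrow> spl V \<in> sections G"
  using gen by (simp_all add: generator_def linear_connection_def split_section_jetJ)

lemma spl_JT: "V \<in> VF A \<Longrightarrow> spl V \<in> JT" by (rule G_JT[OF spl_G])

lemma spl_add: "V \<in> VF A \<Longrightarrow> W \<in> VF A \<Longrightarrow> spl (V + W) = spl V + spl W"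
proof -
  assume V: "V \<in> VF A" and W: "W \<in> VF A"
  have "D (V + W) = D V + D W" using gen V W by (simp add: generator_def linear_connection_def)
  then show ?thesis using TM_jetJ_add[OF V W D_End[OF V] D_End[OF W]] by simp
qed

lemma spl_fmul: "f \<in> Cinf A \<Longrightarrow> V \<in> VF A \<Longrightarrow> spl (fmul f V) = fmul f (spl V)"
proof -
  assume f: "f \<in> Cinf A" and V: "V \<in> VF A"
  have 1: "D (fmul f V) p v = v f *\<^sub>R V p + f p *\<^sub>R D V p v" if "v \<in> tangent A p" for p v
    using gen f V that by (simp add: generator_def linear_connection_def)
  have "D (fmul f V) = fmul f (D V) + dtens A f V"
  proof (rule ext, rule ext)
    fix p v show "D (fmul f V) p v = (fmul f (D V) + dtens A f V) p v"
    proof (cases "v \<in> tangent A p")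
      case True then show ?thesis using 1[OF True] by (simp add: dtens_def)
    next
      case False
      then show ?thesis using EndD(4)[OF D_End[OF V] False] EndD(4)[OF D_End[OF VF_fmul[OF f V]] False]
        by (simp add: dtens_def)
    qed
  qed
  then show ?thesis using TM_jetJ_fmul[OF f V D_End[OF V]] by simp
qed

lemma anc_spl: "V \<in> VF A \<Longrightarrow> anc (spl V) = V" by (rule anc_jetJ[OF _ D_End])

text \<open>This identity is why the dual connection appears at all: it is ad along the splitting of
  the generator. Its calculus rules are therefore inherited from ad.\<close>

lemma ad_spl: "V \<in> VF A \<Longrightarrow> Y \<in> VF A \<Longrightarrow> ad_op A (spl V) Y = nb V Y"
proof -
  assume V: "V \<in> VF A" and Y: "Y \<in> VF A"
  have "cov D Y V = ap (D V) Y" by (rule ext) (simp add: cov_def)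
  then show ?thesis by (simp add: ad_op_jetJ[OF V D_End[OF V] Y] dual_conn_def add.commute)
qed

lemma nb_VF: "V \<in> VF A \<Longrightarrow> Y \<in> VF A \<Longrightarrow> nb V Y \<in> VF A"
  using ad_VF[OF spl_JT, of V Y] ad_spl[of V Y] by simp

lemma nb_add: "V \<in> VF A \<Longrightarrow> Y \<in> VF A \<Longrightarrow> Z \<in> VF A \<Longrightarrow> nb V (Y + Z) = nb V Y + nb V Z"
  using ad_add[OF spl_JT, of V Y Z] by (simp add: ad_spl VF_add)

lemma nb_fmul: "V \<in> VF A \<Longrightarrow> f \<in> Cinf A \<Longrightarrow> Y \<in> VF A \<Longrightarrow> nb V (fmul f Y) = fmul f (nb V Y) + fmul (\<lambda>p. V p f) Y"
  using ad_fmul[OF spl_JT, of V f Y] by (simp add: ad_spl VF_fmul anc_spl)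

lemma nb_add_left: "V \<in> VF A \<Longrightarrow> W \<in> VF A \<Longrightarrow> Y \<in> VF A \<Longrightarrow> nb (V + W) Y = nb V Y + nb W Y"
  using ad_add_left[OF spl_JT spl_JT, of V W Y] by (simp add: ad_spl VF_add spl_add[symmetric])

lemma nb_fmul_left: "f \<in> Cinf A \<Longrightarrow> V \<in> VF A \<Longrightarrow> Y \<in> VF A \<Longrightarrow> nb (fmul f V) Y = fmul f (nb V Y)"
  using ad_fmul_left[OF spl_JT, of V f Y] by (simp add: ad_spl VF_fmul spl_fmul[symmetric])

lemma gen_eq: "gen_section A D V \<phi> = spl V + jetJ A (TM A) 0 \<phi>"
  by (simp add: gen_section_def split_section_jetJ jet_incl_jetJ)

lemma
  assumes V: "V \<in> VF A" and \<phi>: "\<phi> \<in> sections K"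
  shows gen_G: "gen_section A D V \<phi> \<in> sections G"
    and anc_gen: "anc (gen_section A D V \<phi>) = V"
    and ad_gen: "Y \<in> VF A \<Longrightarrow> ad_op A (gen_section A D V \<phi>) Y = nb V Y + ap \<phi> Y"
proof -
  note s = spl_G[OF V] K_G[OF \<phi>]
  show "gen_section A D V \<phi> \<in> sections G" unfolding gen_eq by (rule G.sec_add[OF s])
  show "anc (gen_section A D V \<phi>) = V"
    unfolding gen_eq anc_add[OF G_JT[OF s(1)] G_JT[OF s(2)]] anc_spl[OF V] anc_jetJ[OF VF_zero K_End[OF \<phi>]] by simp
  show "ad_op A (gen_section A D V \<phi>) Y = nb V Y + ap \<phi> Y" if Y: "Y \<in> VF A"
    unfolding gen_eq ad_add_left[OF G_JT[OF s(1)] G_JT[OF s(2)] Y] ad_spl[OF V Y] ad_zero_jet[OF K_End[OF \<phi>] Y] ..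
qed

lemma kernel_section:
  assumes s: "\<sigma> \<in> sections G" and a: "anc \<sigma> = 0"
  obtains \<phi> where "\<phi> \<in> sections K" "\<sigma> = jetJ A (TM A) 0 \<phi>" "\<And>Y. Y \<in> VF A \<Longrightarrow> ap \<phi> Y = ad_op A \<sigma> Y"
proof -
  obtain \<phi> where p: "\<phi> \<in> End" "\<sigma> = jetJ A (TM A) 0 \<phi>" using jetJ0_anc[OF G_JT[OF s] a] by blast
  have 1: "\<phi> \<in> sections K" using p s by (simp add: K_sections)
  have 3: "ap \<phi> Y = ad_op A \<sigma> Y" if "Y \<in> VF A" for Y unfolding p(2) ad_zero_jet[OF p(1) that] ..
  show thesis by (rule that[of \<phi>, OF 1 p(2)]) (rule 3)
qed

text \<open>The identification of \<open>g\<close> with the sum of the tangent bundle and the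
  structure kernel: subtracting the splitting of its anchor leaves a section with anchor
  zero.\<close>

lemma gen_obtain:
  assumes s: "\<sigma> \<in> sections G"
  obtains \<phi> where "\<phi> \<in> sections K" "\<sigma> = gen_section A D (anc \<sigma>) \<phi>"
proof -
  note a = anc_VF[OF G_JT[OF s]]
  note sp = spl_G[OF a]
  have z: "anc (\<sigma> - spl (anc \<sigma>)) = 0" unfolding anc_diff[OF G_JT[OF s] G_JT[OF sp]] anc_spl[OF a] by simp
  obtain \<phi> where \<phi>: "\<phi> \<in> sections K" "\<sigma> - spl (anc \<sigma>) = jetJ A (TM A) 0 \<phi>"
    by (rule kernel_section[OF G.sec_diff[OF s sp] z]) (rule that; assumption)
  from \<phi>(2) have "\<sigma> = gen_section A D (anc \<sigma>) \<phi>" unfolding gen_eq by (simp only: diff_eq_eq add.commute)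
  with \<phi>(1) show thesis by (rule that)
qed

text \<open>The anchor vanishes at \<open>p\<close> only, so \<open>\<sigma>\<close> need not be a
  kernel section. Its kernel component has the same value at \<open>p\<close>, because the splitting
  of the anchor vanishes there by tensoriality.\<close>

lemma kernel_at:
  assumes s: "\<sigma> \<in> sections G" and a: "anc \<sigma> p = 0"
  obtains \<phi> where "\<phi> \<in> sections K" "jetJ A (TM A) 0 \<phi> p = \<sigma> p"
proof -
  obtain \<phi> where \<phi>: "\<phi> \<in> sections K" "\<sigma> = gen_section A D (anc \<sigma>) \<phi>" by (rule gen_obtain[OF s])
  have c: "Clinear A (TM A) (\<lambda>V. spl V)" by (rule ClinearI) (simp_all add: spl_add spl_fmul)
  have "spl (fmul (\<lambda>_. 0) 0) = fmul (\<lambda>_. 0) (spl 0)" by (rule spl_fmul[OF Cinf_const VF_zero])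
  from fun_cong[OF this[unfolded fmul_zero], where x = p] have z: "spl 0 p = 0" by simp
  have "spl (anc \<sigma>) p = spl 0 p"
    by (rule T.Clinear_pointwise[OF c]) (simp_all add: anc_VF G_JT s VF_zero a)
  with z have "spl (anc \<sigma>) p = 0" by simp
  then have "jetJ A (TM A) 0 \<phi> p = \<sigma> p" using fun_cong[OF \<phi>(2)[unfolded gen_eq], of p] by simp
  with \<phi>(1) show thesis by (rule that)
qed

text \<open>Frames of the structure kernel are not at hand; the element is extended as a section of
  \<open>g\<close> and then corrected by \<open>kernel_at\<close>.\<close>

lemma kernel_extend:
  assumes h: "h \<in> fibre K p"
  obtains \<phi> where "\<phi> \<in> sections K" "\<phi> p = h"
proof -
  have hh: "h \<in> fibre (EndTM A) p" "jet_incl A (TM A) p h \<in> fibre G p" using h by (simp_all add: K_fibre)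
  obtain \<sigma> where s: "\<sigma> \<in> sections G" "\<sigma> p = jet_incl A (TM A) p h" by (rule G.fibre_extend[OF hh(2)])
  obtain \<phi> where \<phi>: "\<phi> \<in> sections K" "jetJ A (TM A) 0 \<phi> p = \<sigma> p"
    by (rule kernel_at[OF s(1) anc_incl(1)[of h p \<sigma>, OF hh(1) s(2)]])
  have "h = \<phi> p" by (rule jet_incl_inject[OF hh(1) K_End[OF \<phi>(1)]]) (simp add: s(2) \<phi>(2))
  then show thesis using that[OF \<phi>(1)] by simp
qed

abbreviation dt where "dt \<equiv> dual_tor A D"

lemma
  shows dt_Tor: "dt \<in> Tor"
    and dt_val: "U \<in> VF A \<Longrightarrow> V \<in> VF A \<Longrightarrow> tap dt U V = nb U V - nb V U - vf_bracket U V"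
proof -
  let ?F = "\<lambda>U V. nb U V - nb V U - vf_bracket U V"
  have 1: "?F U (V + W) = ?F U V + ?F U W" if "U \<in> VF A" "V \<in> VF A" "W \<in> VF A" for U V W
    unfolding nb_add[OF that] nb_add_left[OF that(2,3,1)] vf_add_right[OF that] by simp
  have 2: "?F U (fmul f V) = fmul f (?F U V)" if "U \<in> VF A" "V \<in> VF A" "f \<in> Cinf A" for U V f
    unfolding nb_fmul[OF that(1,3,2)] nb_fmul_left[OF that(3,2,1)] vf_fmul_right[OF that(3,1,2)]
    by (rule ext) (simp add: scaleR_diff_right)
  have 3: "?F U V = - ?F V U" for U V
    unfolding vf_antisym[of U V] by simp
  have 4: "?F U V \<in> VF A" if "U \<in> VF A" "V \<in> VF A" for U V
    by (intro VF_diff nb_VF vf_closed that)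
  show "dt \<in> Tor"
    unfolding dual_tor_def by (rule tor_tensorial2(1)[where F = ?F]; (rule 1 2 3 4)?; assumption)
  show "tap dt U V = nb U V - nb V U - vf_bracket U V" if "U \<in> VF A" "V \<in> VF A"
    unfolding dual_tor_def by (rule tor_tensorial2(2)[where F = ?F, OF _ _ _ _ that]; (rule 1 2 3 4)?; assumption)
qed

text \<open>Two splittings differ by a section \<open>e\<close> of
  \<open>T\<^sup>*M \<otimes> h\<close>. By \<open>ad_spl\<close> the dual connection changes by
  \<open>e\<close>, and antisymmetrizing, the torsion changes by \<open>\<Delta> e\<close>.\<close>

lemma dual_tor_change:
  assumes D': "generator A g D'"
  shows "\<exists>S\<in>im_Delta A g p. dual_tor A D' p = dt p + S"
proof -
  interpret D': igs_generator A g D' by unfold_locales (rule D')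
  let ?F = "\<lambda>U. jetJ A (TM A) U (D' U) - spl U"
  have F: "?F U \<in> sections G" if "U \<in> VF A" for U by (rule G.sec_diff[OF D'.spl_G[OF that] spl_G[OF that]])
  have h: "tensorial (TM A) ?F \<in> GHom" "\<And>U. U \<in> VF A \<Longrightarrow> ap (tensorial (TM A) ?F) U = ?F U"
    by (rule G.hom_of; simp add: D'.spl_add D'.spl_fmul spl_add spl_fmul F; rule ext; simp add: scaleR_diff_right)+
  have a: "anc (ap (tensorial (TM A) ?F) U) = 0" if U: "U \<in> VF A" for U
    unfolding h(2)[OF U] anc_diff[OF D'.spl_JT[OF U] spl_JT[OF U]] anc_spl[OF U] D'.anc_spl[OF U] by simp
  obtain e where e: "e \<in> sections (Delta_dom A g)"
    "\<And>U. U \<in> VF A \<Longrightarrow> ap (tensorial (TM A) ?F) U = jetJ A (TM A) 0 (ap e U)"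
    by (rule kernel_valued[OF h(1)], erule a) (rule that; assumption)
  have ev: "dual_conn D' U V = nb U V + ap (ap e U) V" if U: "U \<in> VF A" and V: "V \<in> VF A" for U V
  proof -
    have "ap (ap e U) V = ad_op A (?F U) V"
      using ad_zero_jet[OF K_End[OF Delta_domD(1)[OF e(1) U]] V] e(2)[OF U] h(2)[OF U] by simp
    then show ?thesis
      unfolding ad_diff_left[OF D'.spl_JT[OF U] spl_JT[OF U] V] ad_spl[OF U V] D'.ad_spl[OF U V] by simp
  qed
  have "dual_tor A D' p = (\<lambda>p. dt p + Delta (e p)) p"
  proof (rule tangent2_ext[where S = "dual_tor A D'" and S' = "\<lambda>p. dt p + Delta (e p)"])
    fix U V assume U: "U \<in> VF A" and V: "V \<in> VF A"
    have "tap (dual_tor A D') U V p = tap dt U V p + (ap (ap e U) V p - ap (ap e V) U p)"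
      unfolding D'.dt_val[OF U V] dt_val[OF U V] ev[OF U V] ev[OF V U] by (simp add: algebra_simps)
    then show "dual_tor A D' p (U p) (V p) = (dt p + Delta (e p)) (U p) (V p)" by (simp add: Delta_def)
  next
    fix u v :: "'m tvec" assume uv: "u \<notin> tangent A p \<or> v \<notin> tangent A p"
    have "Delta (e p) u v = 0"
    proof -
      have z: "e p w = 0" if "w \<notin> tangent A p" for w using hom_secD(4)[OF e(1)] that by simp
      have z2: "e p w w' = 0" if "w' \<notin> tangent A p" for w w'
      proof (cases "w \<in> tangent A p")
        case True
        then have "e p w \<in> fibre (EndTM A) p" using hom_secD(3)[OF e(1), of w p] by (simp add: K_fibre)
        then show ?thesis using that by (simp add: hom_fibre_iff)
      qed (simp add: z)
      show ?thesis using uv z z2 by (auto simp: Delta_def)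
    qed
    moreover have "dual_tor A D' p u v = 0" "dt p u v = 0"
      using uv torD(7,8)[OF D'.dt_Tor] torD(7,8)[OF dt_Tor] by blast+
    ultimately show "dual_tor A D' p u v = (dt p + Delta (e p)) u v" by simp
  qed
  moreover have "Delta (e p) \<in> im_Delta A g p" unfolding im_Delta_def by (rule imageI[OF DD.sec_fibre[OF e(1)]])
  ultimately show ?thesis by (intro bexI[of _ "Delta (e p)"]) simp_all
qed

text \<open>In the definite description, existence is the independence from
  \<open>dual_tor_change\<close>, and uniqueness holds because there is a generator to compare
  with.\<close>

lemma intrinsic_torsion_eq: "intrinsic_torsion A g = (\<lambda>p. H_class A g p (dt p))"
  unfolding intrinsic_torsion_def
proof (rule the_equality)
  show "\<forall>D'. generator A g D' \<longrightarrow> (\<lambda>p. H_class A g p (dt p)) = (\<lambda>p. H_class A g p (dual_tor A D' p))"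
  proof (intro allI impI ext)
    fix D' p assume "generator A g D'"
    then obtain S where "S \<in> im_Delta A g p" "dual_tor A D' p = dt p + S" using dual_tor_change by blast
    then show "H_class A g p (dt p) = H_class A g p (dual_tor A D' p)" using H_class_eq by simp
  qed
  show "\<tau> = (\<lambda>p. H_class A g p (dt p))"
    if "\<forall>D. generator A g D \<longrightarrow> \<tau> = (\<lambda>p. H_class A g p (dual_tor A D p))" for \<tau> using that gen by blast
qed

text \<open>Invariance is formulated for all global representatives of the intrinsic torsion, and
  the dual torsion of the generator is one of them.\<close>

lemma torsion_reduced_im:
  assumes tr: "torsion_reduced A g" and s: "\<sigma> \<in> sections G"
  shows "act_tor A (ad_op A \<sigma>) dt p \<in> im_Delta A g p"
proof (rule H_class_zeroD)
  from tr[unfolded torsion_reduced_def H_invariant_def intrinsic_torsion_eq, THEN bspec, OF s, THEN bspec, OF dt_Tor]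
  show "H_class A g p (act_tor A (ad_op A \<sigma>) dt p) = H_class A g p 0" by simp
qed

text \<open>By \<open>ad_gen\<close>, the derivative along \<open>V\<close> and the algebraic action
  of \<open>\<phi>\<close> are the two parts of the ad-action of the section
  \<open>V \<oplus> \<phi>\<close> of \<open>g\<close>. This makes \<open>torsion_reduced_im\<close>
  applicable to the equation for \<open>\<epsilon>\<close>.\<close>

lemma rhs_eq:
  assumes V: "V \<in> VF A" and \<phi>: "\<phi> \<in> sections K"
  shows "act_tor A (nb V) dt p + endo_act (\<phi> p) (dt p) = act_tor A (ad_op A (gen_section A D V \<phi>)) dt p"
proof -
  note s = G_JT[OF gen_G[OF V \<phi>]] and E = K_End[OF \<phi>] and t = torD[OF dt_Tor]
  have nb: "act_tor A (nb V) dt = act_tor A (ad_op A (spl V)) dt"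
    by (rule act_tor_cong[OF dt_Tor]) (simp add: ad_spl V)
  have "(\<lambda>p. act_tor A (nb V) dt p + endo_act (\<phi> p) (dt p)) p = act_tor A (ad_op A (gen_section A D V \<phi>)) dt p"
  proof (rule tangent2_ext[where S = "\<lambda>p. act_tor A (nb V) dt p + endo_act (\<phi> p) (dt p)"])
    fix U W assume U: "U \<in> VF A" and W: "W \<in> VF A"
    note e = End_closed[OF E]
    have 1: "tap dt (nb V U + ap \<phi> U) W = tap dt (nb V U) W + tap dt (ap \<phi> U) W"
      by (rule t(4)[OF nb_VF[OF V U] W e[OF U]])
    have 2: "tap dt U (nb V W + ap \<phi> W) = tap dt U (nb V W) + tap dt U (ap \<phi> W)"
      by (rule t(2)[OF U nb_VF[OF V W] e[OF W]])
    have "act_tor A (ad_op A (gen_section A D V \<phi>)) dt p (U p) (W p) =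
      (nb V (tap dt U W) + ap \<phi> (tap dt U W) - (tap dt (nb V U) W + tap dt (ap \<phi> U) W)
        - (tap dt U (nb V W) + tap dt U (ap \<phi> W))) p"
      unfolding act_tor_ad[OF s dt_Tor U W] ad_gen[OF V \<phi> U] ad_gen[OF V \<phi> W] ad_gen[OF V \<phi> t(1)[OF U W]] 1 2 ..
    moreover have "act_tor A (nb V) dt p (U p) (W p) = (nb V (tap dt U W) - tap dt (nb V U) W - tap dt U (nb V W)) p"
      unfolding nb act_tor_ad[OF spl_JT[OF V] dt_Tor U W] ad_spl[OF V U] ad_spl[OF V W] ad_spl[OF V t(1)[OF U W]] ..
    ultimately show "(act_tor A (nb V) dt p + endo_act (\<phi> p) (dt p)) (U p) (W p)
        = act_tor A (ad_op A (gen_section A D V \<phi>)) dt p (U p) (W p)"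
      by (simp add: endo_act_def)
  next
    fix u v :: "'m tvec" assume uv: "u \<notin> tangent A p \<or> v \<notin> tangent A p"
    have "\<phi> p 0 = 0" using EndD(2)[OF E tangent_closed(1), of p 0] by simp
    then have "endo_act (\<phi> p) (dt p) u v = 0"
      using uv by (auto simp: endo_act_def t(7,8,9,10) EndD(4)[OF E])
    then show "(act_tor A (nb V) dt p + endo_act (\<phi> p) (dt p)) u v = act_tor A (ad_op A (gen_section A D V \<phi>)) dt p u v"
      using act_tor_off[OF uv] by simp
  qed
  then show ?thesis .
qed

text \<open>Since \<open>\<Delta>\<close> is injective, the components of \<open>E\<close> solve an overdetermined linear system with smooth coefficients
  whose matrix is injective, so that they are smooth.\<close>

lemma Delta_smooth:
  assumes inj: "Delta_injective A g" and E: "\<And>q. E q \<in> fibre (Delta_dom A g) q"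
    and y: "\<And>U W. U \<in> VF A \<Longrightarrow> W \<in> VF A \<Longrightarrow> (\<lambda>q. Delta (E q) (U q) (W q)) \<in> VF A"
  shows "E \<in> sections (Delta_dom A g)"
proof -
  note Ef = E[unfolded hom_fibre_iff TM_simps]
  have EK: "E q u \<in> fibre K q" if "u \<in> tangent A q" for q u using Ef that by blast
  have EE: "E q u \<in> fibre (EndTM A) q" if "u \<in> tangent A q" for q u using EK[OF that] by (simp add: K_fibre)
  have Eoff: "E q u = 0" if "u \<notin> tangent A q" for q u using Ef that by blast
  \<comment> \<open>Smoothness is shown for the images in \<open>g\<close>, which has frames, and
    carried back to the structure kernel at the end.\<close>
  have J: "(\<lambda>q. jet_incl A (TM A) q (E q (U q))) \<in> sections G" if U: "U \<in> VF A" for U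
  proof (rule G.sec_eventually)
    fix p
    obtain W x X where w: "open W" "p \<in> W" "\<And>b. x b \<in> Cinf A" "\<And>b. X b \<in> VF A"
      "\<And>q b b'. q \<in> W \<Longrightarrow> b \<in> Basis \<Longrightarrow> b' \<in> Basis \<Longrightarrow> X b q (x b') = (if b = b' then 1 else 0)"
      "\<And>q v f. q \<in> W \<Longrightarrow> v \<in> tangent A q \<Longrightarrow> v f = (\<Sum>b\<in>(Basis::'e set). v (x b) * X b q f)"
      by (rule coordinates_exist[where p = p]) (rule that; assumption)
    have exp: "v = (\<Sum>b\<in>Basis. v (x b) *\<^sub>R X b q)" if "q \<in> W" "v \<in> tangent A q" for q v
      by (rule ext) (simp add: sum_fun_apply w(6)[OF that, symmetric])
    obtain N r b where f: "open N" "p \<in> N" "local_frame G N r b" "\<And>i. i < r \<Longrightarrow> b i \<in> sections G"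
      by (rule G.frame_obtain[where p = p]) (rule that; assumption)
    have bJ: "b j \<in> JT" if "j < r" for j by (rule G_JT[OF f(4)[OF that]])
    \<comment> \<open>Coefficients of the values of \<open>E\<close> on coordinate fields, in the
      frame of \<open>g\<close>. They are chosen separately at each \<open>q\<close>, so nothing is
      known yet about their dependence on \<open>q\<close>.\<close>
    define c0 where "c0 i q = (SOME c. jet_incl A (TM A) q (E q (X i q)) = (\<Sum>j<r. c j *\<^sub>R b j q))" for i q
    have c0: "jet_incl A (TM A) q (E q (X i q)) = (\<Sum>j<r. c0 i q j *\<^sub>R b j q)" if q: "q \<in> N" for i q
    proof -
      have "jet_incl A (TM A) q (E q (X i q)) \<in> fibre G q" using EK[OF VF_tangent[OF w(4)]] by (simp add: K_fibre)
      then obtain c where "jet_incl A (TM A) q (E q (X i q)) = (\<Sum>j<r. c j *\<^sub>R b j q)"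
        by (rule G.frame_expansion[OF f(3) q])
      then show ?thesis
        unfolding c0_def by (rule someI[where P = "\<lambda>c. jet_incl A (TM A) q (E q (X i q)) = (\<Sum>j<r. c j *\<^sub>R b j q)"])
    qed
    have lin: "(\<Sum>j<r. c0 i q j *\<^sub>R anc (b j) q) = 0"
      "Y \<in> VF A \<Longrightarrow> (\<Sum>j<r. c0 i q j *\<^sub>R ad_op A (b j) Y q) = E q (X i q) (Y q)" if q: "q \<in> N" for i q Y
    proof -
      let ?s = "\<Sum>j<r. fmul (\<lambda>_. c0 i q j) (b j)"
      have e: "?s q = jet_incl A (TM A) q (E q (X i q))" unfolding c0[OF q] by (rule lincomb_ops(1)[OF bJ])
      show "(\<Sum>j<r. c0 i q j *\<^sub>R anc (b j) q) = 0"
        by (rule HOL.trans[OF lincomb_ops(2)[OF bJ, symmetric] anc_incl(1)[where \<sigma> = ?s, OF EE[OF VF_tangent[OF w(4)]] e]])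
      show "(\<Sum>j<r. c0 i q j *\<^sub>R ad_op A (b j) Y q) = E q (X i q) (Y q)" if Y: "Y \<in> VF A"
        by (rule HOL.trans[OF lincomb_ops(3)[OF bJ Y, symmetric] anc_incl(2)[where \<sigma> = ?s, OF EE[OF VF_tangent[OF w(4)]] e Y]])
    qed
    define I where "I = (Basis :: 'e set) \<times> {..<r}"
    have fI: "finite I" by (simp add: I_def)
    define c where "c i q = c0 (fst i) q (snd i)" for i q
    have sumI: "(\<Sum>i\<in>I. h i) = (\<Sum>k\<in>Basis. \<Sum>j<r. h (k, j))" for h :: "'e \<times> nat \<Rightarrow> real"
      unfolding I_def by (rule sum.cartesian_product[symmetric, where g = "\<lambda>k j. h (k, j)", simplified])
    \<comment> \<open>Admissible rows of the system: smooth coefficients whose pairing with the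
      unknowns \<open>c\<close> is smooth near \<open>p\<close>. Their values at \<open>p\<close>
      form the space \<open>\<Lambda>\<close> to which \<open>unit_functionals\<close> is
      applied.\<close>
    define Test where "Test a \<longleftrightarrow> (\<forall>i\<in>I. gsm p (a i)) \<and> (\<exists>y. gsm p y \<and> (\<forall>\<^sub>F q in nhds p. (\<Sum>i\<in>I. a i q * c i q) = y q))" for a
    define \<Lambda> where "\<Lambda> = {l. \<exists>a. Test a \<and> (\<forall>i. l i = a i p)}"
    have nearN: "\<forall>\<^sub>F q in nhds p. q \<in> N" using f(1,2) by (rule eventually_nhds_in_open)
    \<comment> \<open>First kind of row: the values of \<open>E\<close> are kernel elements, so the
      anchor of their expansion is zero.\<close>
    have ta: "Test (\<lambda>i q. if fst i = k then anc (b (snd i)) q h else 0)" if k: "k \<in> Basis" for k h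
      unfolding Test_def
    proof (intro conjI exI)
      show "\<forall>i\<in>I. gsm p (\<lambda>q. if fst i = k then anc (b (snd i)) q h else 0)"
      proof
        fix i assume i: "i \<in> I"
        then have "anc (b (snd i)) \<in> VF A" by (intro anc_VF bJ) (auto simp: I_def)
        from gsm_Cinf[OF VF_Cinf[OF this, of h]] show "gsm p (\<lambda>q. if fst i = k then anc (b (snd i)) q h else 0)"
          by (cases "fst i = k") (simp_all add: gsm_Cinf)
      qed
      show "gsm p (\<lambda>q. 0)" by (rule gsm_Cinf) simp
      show "\<forall>\<^sub>F q in nhds p. (\<Sum>i\<in>I. (if fst i = k then anc (b (snd i)) q h else 0) * c i q) = 0"
        using nearN
      proof eventually_elim
        case (elim q)
        have "(\<Sum>i\<in>I. (if fst i = k then anc (b (snd i)) q h else 0) * c i q)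
            = (\<Sum>k'\<in>Basis. if k' = k then (\<Sum>j<r. c0 k q j *\<^sub>R anc (b j) q) h else 0)"
          unfolding sumI by (rule sum.cong[OF refl]) (simp add: c_def sum_fun_apply mult.commute)
        then show ?case by (simp add: lin(1)[OF elim])
      qed
    qed
    \<comment> \<open>Second kind of row: a component of \<open>Delta (E q)\<close> on two
      coordinate fields, smooth by assumption although \<open>E\<close> itself is not yet known to
      be.\<close>
    have tb: "Test (\<lambda>i q. (if fst i = k then ad_op A (b (snd i)) (X l) q h else 0) - (if fst i = l then ad_op A (b (snd i)) (X k) q h else 0))"
      if k: "k \<in> Basis" and l: "l \<in> Basis" for k l h
      unfolding Test_def
    proof (intro conjI exI)
      show "\<forall>i\<in>I. gsm p (\<lambda>q. (if fst i = k then ad_op A (b (snd i)) (X l) q h else 0) - (if fst i = l then ad_op A (b (snd i)) (X k) q h else 0))"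
      proof
        fix i assume i: "i \<in> I"
        then have bi: "b (snd i) \<in> JT" by (intro bJ) (auto simp: I_def)
        have "gsm p (\<lambda>q. if fst i = m then ad_op A (b (snd i)) (X m') q h else 0)" for m m'
          using gsm_Cinf[OF VF_Cinf[OF ad_VF[OF bi w(4)[of m']], where f = h]]
          by (cases "fst i = m") (simp_all add: gsm_Cinf)
        then show "gsm p (\<lambda>q. (if fst i = k then ad_op A (b (snd i)) (X l) q h else 0) - (if fst i = l then ad_op A (b (snd i)) (X k) q h else 0))"
          by (intro gsm_diff)
      qed
      show "gsm p (\<lambda>q. Delta (E q) (X k q) (X l q) h)" by (rule gsm_Cinf[OF VF_Cinf[OF y[OF w(4) w(4)]]])
      show "\<forall>\<^sub>F q in nhds p. (\<Sum>i\<in>I. ((if fst i = k then ad_op A (b (snd i)) (X l) q h else 0)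
          - (if fst i = l then ad_op A (b (snd i)) (X k) q h else 0)) * c i q) = Delta (E q) (X k q) (X l q) h"
        using nearN
      proof eventually_elim
        case (elim q)
        have 1: "(\<Sum>i\<in>I. (if fst i = m then ad_op A (b (snd i)) (X m') q h else 0) * c i q) = E q (X m q) (X m' q) h"
          if m: "m \<in> Basis" for m m'
        proof -
          have "(\<Sum>i\<in>I. (if fst i = m then ad_op A (b (snd i)) (X m') q h else 0) * c i q)
            = (\<Sum>k'\<in>Basis. if k' = m then (\<Sum>j<r. c0 m q j *\<^sub>R ad_op A (b j) (X m') q) h else 0)"
            unfolding sumI by (rule sum.cong[OF refl]) (simp add: c_def sum_fun_apply mult.commute)
          then show ?thesis using m by (simp add: lin(2)[OF elim w(4)])
        qed
        show ?case unfolding left_diff_distrib sum_subtractf 1[OF k] 1[OF l] by (simp add: Delta_def)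
      qed
    qed
    have "\<exists>e. \<forall>i\<in>I. e i \<in> \<Lambda> \<and> (\<forall>j\<in>I. e i j = (if i = j then 1 else 0))"
    proof (rule unit_functionals[OF fI])
      have "Test (\<lambda>i q. 0)" unfolding Test_def by (intro conjI ballI exI[of _ "\<lambda>q. 0"]) (simp_all add: gsm_Cinf)
      then show "(\<lambda>i. 0) \<in> \<Lambda>" unfolding \<Lambda>_def by (intro CollectI exI[of _ "\<lambda>i q. 0"]) simp
      show "(\<lambda>i. l i + d * m i) \<in> \<Lambda>" if lm: "l \<in> \<Lambda>" "m \<in> \<Lambda>" for l m d
      proof -
        obtain a where a: "Test a" "\<forall>i. l i = a i p" using lm(1) unfolding \<Lambda>_def by (elim CollectE exE conjE) (rule that)
        obtain a' where a': "Test a'" "\<forall>i. m i = a' i p" using lm(2) unfolding \<Lambda>_def by (elim CollectE exE conjE) (rule that)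
        obtain z where z: "gsm p z" "\<forall>\<^sub>F q in nhds p. (\<Sum>i\<in>I. a i q * c i q) = z q"
          using a(1) unfolding Test_def by (elim conjE exE) (rule that)
        obtain z' where z': "gsm p z'" "\<forall>\<^sub>F q in nhds p. (\<Sum>i\<in>I. a' i q * c i q) = z' q"
          using a'(1) unfolding Test_def by (elim conjE exE) (rule that)
        have "Test (\<lambda>i q. a i q + d * a' i q)"
          unfolding Test_def
        proof (intro conjI ballI exI)
          show "gsm p (\<lambda>q. a i q + d * a' i q)" if "i \<in> I" for i
            using a(1) a'(1) that unfolding Test_def by (intro gsm_add gsm_mult gsm_Cinf[OF Cinf_const]) simp_all
          show "gsm p (\<lambda>q. z q + d * z' q)" by (intro gsm_add gsm_mult gsm_Cinf[OF Cinf_const] z z')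
          show "\<forall>\<^sub>F q in nhds p. (\<Sum>i\<in>I. (a i q + d * a' i q) * c i q) = z q + d * z' q"
            using z(2) z'(2)
            by eventually_elim (simp add: ring_distribs sum.distrib sum_distrib_left[symmetric] mult.assoc)
        qed
        then show ?thesis unfolding \<Lambda>_def
          by (intro CollectI exI[of _ "\<lambda>i q. a i q + d * a' i q"]) (simp add: a(2) a'(2))
      qed
      \<comment> \<open>Suppose \<open>cc\<close> is annihilated by all rows at \<open>p\<close>.
        The rows of the first kind make the elements \<open>s k\<close> of \<open>g\<close> at
        \<open>p\<close> kernel elements \<open>\<phi> k\<close>; those of the second kind make the
        family symmetric. So \<open>cc\<close> encodes an element \<open>e\<close> in the kernel of
        \<open>\<Delta>\<close> at \<open>p\<close>.\<close>
      fix cc assume cc: "\<And>l. l \<in> \<Lambda> \<Longrightarrow> (\<Sum>i\<in>I. cc i * l i) = 0"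
      have ccT: "(\<Sum>i\<in>I. cc i * a i p) = 0" if "Test a" for a
        by (rule cc) (use that in \<open>auto simp: \<Lambda>_def\<close>)
      define s where "s k = (\<Sum>j<r. fmul (\<lambda>_. cc (k, j)) (b j))" for k
      have sG: "s k \<in> sections G" for k unfolding s_def by (rule G.sec_sum) (simp add: G.sec_fmul f(4))
      have sl: "s k p = (\<Sum>j<r. cc (k, j) *\<^sub>R b j p)" "anc (s k) p = (\<Sum>j<r. cc (k, j) *\<^sub>R anc (b j) p)"
        "Y \<in> VF A \<Longrightarrow> ad_op A (s k) Y p = (\<Sum>j<r. cc (k, j) *\<^sub>R ad_op A (b j) Y p)" for k Y
        unfolding s_def by (rule lincomb_ops(1)[OF bJ], assumption, rule lincomb_ops(2)[OF bJ], assumption,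
          rule lincomb_ops(3)[OF bJ], assumption+)
      have "anc (s k) p h = 0" if k: "k \<in> Basis" for k h
      proof -
        have "(\<Sum>i\<in>I. cc i * (if fst i = k then anc (b (snd i)) p h else 0))
          = (\<Sum>k'\<in>Basis. if k' = k then anc (s k) p h else 0)"
          unfolding sumI by (rule sum.cong[OF refl]) (simp add: sl(2) sum_fun_apply)
        then show ?thesis using ccT[OF ta[OF k, of h]] k by simp
      qed
      then have as: "anc (s k) p = 0" if "k \<in> Basis" for k using that by (intro ext) simp
      define \<phi> where "\<phi> k = (SOME \<phi>. \<phi> \<in> sections K \<and> jetJ A (TM A) 0 \<phi> p = s k p)" for k
      have \<phi>': "\<phi> k \<in> sections K \<and> jetJ A (TM A) 0 (\<phi> k) p = s k p" if k: "k \<in> Basis" for k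
      proof -
        obtain \<psi> where "\<psi> \<in> sections K" "jetJ A (TM A) 0 \<psi> p = s k p"
          by (rule kernel_at[OF sG as[OF k]]) (rule that; assumption)
        then have "\<exists>\<psi>. \<psi> \<in> sections K \<and> jetJ A (TM A) 0 \<psi> p = s k p" by (intro exI[of _ \<psi>] conjI)
        then show ?thesis unfolding \<phi>_def by (rule someI_ex)
      qed
      have \<phi>: "\<phi> k \<in> sections K" "jetJ A (TM A) 0 (\<phi> k) p = s k p" if "k \<in> Basis" for k using \<phi>'[OF that] by simp_all
      have ads: "\<phi> k p (Y p) = ad_op A (s k) Y p" if k: "k \<in> Basis" and Y: "Y \<in> VF A" for k Y
        using ad_op_local[where \<sigma> = "jetJ A (TM A) 0 (\<phi> k)" and p = p and \<tau> = "s k" and Y = Y, OF \<phi>(2)[OF k]] ad_zero_jet[OF K_End[OF \<phi>(1)[OF k]] Y] by simp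
      have sym: "\<phi> k p (X l p) = \<phi> l p (X k p)" if k: "k \<in> Basis" and l: "l \<in> Basis" for k l
      proof
        fix h
        have 1: "(\<Sum>i\<in>I. cc i * (if fst i = m then ad_op A (b (snd i)) (X m') p h else 0)) = \<phi> m p (X m' p) h"
          if m: "m \<in> Basis" for m m'
        proof -
          have "(\<Sum>i\<in>I. cc i * (if fst i = m then ad_op A (b (snd i)) (X m') p h else 0))
            = (\<Sum>k'\<in>Basis. if k' = m then ad_op A (s m) (X m') p h else 0)"
            unfolding sumI by (rule sum.cong[OF refl]) (simp add: sl(3)[OF w(4)] sum_fun_apply)
          then show ?thesis using m by (simp add: ads[OF m w(4)])
        qed
        show "\<phi> k p (X l p) h = \<phi> l p (X k p) h"
          using ccT[OF tb[OF k l, of h]] unfolding right_diff_distrib sum_subtractf 1[OF k] 1[OF l] by simp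
      qed
      define e where "e v = (if v \<in> tangent A p then \<Sum>k\<in>Basis. v (x k) *\<^sub>R \<phi> k p else 0)" for v
      have \<phi>f: "\<phi> k p \<in> fibre K p" if "k \<in> Basis" for k by (rule K.sec_fibre[OF \<phi>(1)[OF that]])
      have eF: "e \<in> fibre (Delta_dom A g) p"
        unfolding hom_fibre_iff TM_simps
      proof (intro conjI ballI allI impI)
        show "e (u + v) = e u + e v" if "u \<in> tangent A p" "v \<in> tangent A p" for u v
          using that by (simp add: e_def tangent_closed scaleR_add_left sum.distrib)
        show "e (d *\<^sub>R u) = d *\<^sub>R e u" if "u \<in> tangent A p" for u d
          using that by (simp add: e_def tangent_closed scaleR_sum_right)
        show "e u \<in> fibre K p" if "u \<in> tangent A p" for u
          using that by (simp only: e_def if_True) (rule subspace_sum[OF K.fib_subspace], rule K.fib_closed(5)[OF \<phi>f])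
        show "e u = 0" if "u \<notin> tangent A p" for u using that by (simp add: e_def)
      qed
      have ev: "e u v = (\<Sum>k\<in>Basis. \<Sum>l\<in>Basis. (u (x k) * v (x l)) *\<^sub>R \<phi> k p (X l p))"
        if u: "u \<in> tangent A p" and v: "v \<in> tangent A p" for u v
      proof -
        have "\<phi> k p v = (\<Sum>l\<in>Basis. v (x l) *\<^sub>R \<phi> k p (X l p))" if k: "k \<in> Basis" for k
        proof -
          have "\<phi> k p v = \<phi> k p (\<Sum>l\<in>Basis. v (x l) *\<^sub>R X l p)" by (rule arg_cong[where f = "\<phi> k p"]) (rule exp[OF w(2) v])
          also have "\<dots> = (\<Sum>l\<in>Basis. v (x l) *\<^sub>R \<phi> k p (X l p))"
            by (rule T.Hom_sum[OF K_End[OF \<phi>(1)[OF k]]]) (simp add: VF_tangent w(4))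
          finally show ?thesis .
        qed
        then show ?thesis using u by (simp add: e_def sum_fun_apply scaleR_sum_right)
      qed
      have "Delta e = 0"
      proof (rule ext, rule ext)
        fix u v
        show "Delta e u v = (0 :: 'm tor) u v"
        proof (cases "u \<in> tangent A p \<and> v \<in> tangent A p")
          case True
          have "e v u = (\<Sum>k\<in>Basis. \<Sum>l\<in>Basis. (v (x l) * u (x k)) *\<^sub>R \<phi> l p (X k p))"
            using True by (simp only: ev) (rule sum.swap)
          also have "\<dots> = e u v" using True by (simp only: ev) (intro sum.cong refl, simp add: sym mult.commute)
          finally show ?thesis by (simp add: Delta_def)
        next
          case False
          have off: "e u v = 0" if "v \<notin> tangent A p" for u v
            using EndD(4)[OF K_End[OF \<phi>(1)] that] by (simp add: e_def sum_fun_apply)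
          have off2: "e u v = 0" if "u \<notin> tangent A p" for u v using that by (simp add: e_def)
          show ?thesis using False off[of v u] off[of u v] off2[of u v] off2[of v u] by (auto simp: Delta_def)
        qed
      qed
      \<comment> \<open>Injectivity of \<open>\<Delta>\<close> at the single point \<open>p\<close>
        is what excludes a common kernel of the rows.\<close>
      then have e0: "e = 0"
        using inj[unfolded Delta_injective_def, THEN spec, of p] eF DD.fib_closed(1)[of p]
        by (simp add: inj_on_def Delta_zero)
      show "\<forall>i\<in>I. cc i = 0"
      proof
        fix i assume i: "i \<in> I"
        obtain k j where kj: "i = (k, j)" "k \<in> Basis" "j < r" using i by (auto simp: I_def)
        have "e (X k p) = (\<Sum>l\<in>Basis. X k p (x l) *\<^sub>R \<phi> l p)" by (simp only: e_def VF_tangent[OF w(4)] if_True)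
        also have "\<dots> = (\<Sum>l\<in>Basis. if k = l then \<phi> l p else 0)"
          by (rule sum.cong[OF refl]) (simp only: w(5)[OF w(2) kj(2)] scaleR_one scaleR_zero_left split: if_split, simp)
        also have "\<dots> = \<phi> k p" by (simp only: sum.delta'[OF finite_Basis] kj(2) if_True)
        finally have "\<phi> k p = 0" by (simp add: e0)
        then have "jetJ A (TM A) 0 (\<phi> k) p = jetJ A (TM A) 0 0 p"
          using jet_incl_at[of "\<phi> k" p 0] jet_incl_at[of 0 p 0] by simp
        then have "s k p = 0" using \<phi>(2)[OF kj(2)] T.jetJ_zero by simp
        then have "(\<Sum>j<r. cc (k, j) *\<^sub>R b j p) = 0" by (simp add: sl(1))
        from G.frame_independent[OF f(3,2) this kj(3)] show "cc i = 0" by (simp add: kj(1))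
      qed
    qed
    then obtain e where e': "\<forall>i\<in>I. e i \<in> \<Lambda> \<and> (\<forall>j\<in>I. e i j = (if i = j then 1 else 0))" by (elim exE) (rule that)
    have e: "e i j = (if i = j then 1 else 0)" if "i \<in> I" "j \<in> I" for i j using e' that by simp
    define a where "a i = (SOME a. Test a \<and> (\<forall>j. e i j = a j p))" for i
    have a': "Test (a i) \<and> (\<forall>j. e i j = a i j p)" if i: "i \<in> I" for i
    proof -
      have "\<exists>a. Test a \<and> (\<forall>j. e i j = a j p)" using e'[THEN bspec, OF i] unfolding \<Lambda>_def by (elim conjE CollectE)
      then show ?thesis unfolding a_def by (rule someI_ex)
    qed
    have a: "Test (a i)" "e i j = a i j p" if "i \<in> I" for i j
      by (rule a'[OF that, THEN conjunct1], rule a'[OF that, THEN conjunct2, THEN spec])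
    define z where "z i = (SOME z. gsm p z \<and> (\<forall>\<^sub>F q in nhds p. (\<Sum>j\<in>I. a i j q * c j q) = z q))" for i
    have z': "gsm p (z i) \<and> (\<forall>\<^sub>F q in nhds p. (\<Sum>j\<in>I. a i j q * c j q) = z i q)" if i: "i \<in> I" for i
    proof -
      have "\<exists>z. gsm p z \<and> (\<forall>\<^sub>F q in nhds p. (\<Sum>j\<in>I. a i j q * c j q) = z q)"
        using a(1)[OF i] unfolding Test_def by (elim conjE)
      then show ?thesis unfolding z_def by (rule someI_ex)
    qed
    have z: "gsm p (z i)" "\<forall>\<^sub>F q in nhds p. (\<Sum>j\<in>I. a i j q * c j q) = z i q" if "i \<in> I" for i using z'[OF that] by simp_all
    \<comment> \<open>The selected rows form the identity matrix at \<open>p\<close>, and their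
      right-hand sides are smooth, so the pointwise chosen coefficients are smooth germs after
      all.\<close>
    have cs: "\<forall>j\<in>I. gsm p (c j)"
    proof (rule smooth_solution[OF fI, where a = a and y = z and c = c and p = p])
      show "gsm p (a i j)" if "i \<in> I" "j \<in> I" for i j using a(1)[OF that(1)] that(2) unfolding Test_def by simp
      show "a i j p = (if i = j then 1 else 0)" if "i \<in> I" "j \<in> I" for i j using a(2)[OF that(1), of j] e[OF that] by simp
    qed (rule z(1), assumption, rule z(2))
    define h where "h i = (SOME h. h \<in> Cinf A \<and> (i \<in> I \<longrightarrow> (\<forall>\<^sub>F q in nhds p. c i q = h q)))" for i
    have h': "h i \<in> Cinf A \<and> (i \<in> I \<longrightarrow> (\<forall>\<^sub>F q in nhds p. c i q = h i q))" for i
    proof -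
      have "\<exists>h. h \<in> Cinf A \<and> (i \<in> I \<longrightarrow> (\<forall>\<^sub>F q in nhds p. c i q = h q))"
      proof (cases "i \<in> I")
        case True
        then have "gsm p (c i)" using cs by simp
        then show ?thesis unfolding gsm_def by (elim bexE) (intro exI conjI impI)
      next
        case False
        then show ?thesis by (intro exI[of _ "\<lambda>q. 0"]) simp
      qed
      then show ?thesis unfolding h_def by (rule someI_ex)
    qed
    have h: "h i \<in> Cinf A" for i using h' by simp
    have h2: "\<forall>\<^sub>F q in nhds p. c i q = h i q" if "i \<in> I" for i using h' that by simp
    let ?t = "\<Sum>k\<in>(Basis::'e set). fmul (\<lambda>q. U q (x k)) (\<Sum>j<r. fmul (h (k, j)) (b j))"
    show "\<exists>t\<in>sections G. \<forall>\<^sub>F q in nhds p. jet_incl A (TM A) q (E q (U q)) = t q"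
    proof
      show "?t \<in> sections G"
        by (intro G.sec_sum G.sec_fmul VF_Cinf[OF U] h) (simp add: f(4))
      have "\<forall>\<^sub>F q in nhds p. \<forall>i\<in>I. c i q = h i q" by (rule eventually_ball_finite[OF fI]) (simp add: h2)
      moreover have "\<forall>\<^sub>F q in nhds p. q \<in> W" using w(1,2) by (rule eventually_nhds_in_open)
      ultimately show "\<forall>\<^sub>F q in nhds p. jet_incl A (TM A) q (E q (U q)) = ?t q"
        using nearN
      proof eventually_elim
        case (elim q)
        have ls: "(\<Sum>k\<in>M. u k *\<^sub>R H k) \<in> fibre (EndTM A) q \<and>
            jet_incl A (TM A) q (\<Sum>k\<in>M. u k *\<^sub>R H k) = (\<Sum>k\<in>M. u k *\<^sub>R jet_incl A (TM A) q (H k))"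
          if "finite M" "\<And>k. H k \<in> fibre (EndTM A) q" for M :: "'e set" and u :: "'e \<Rightarrow> real" and H :: "'e \<Rightarrow> 'm endo"
          using that(1)
        proof (induction M)
          case empty
          have "jet_incl A (TM A) q 0 = 0" using jet_incl_at[of 0 q 0] T.jetJ_zero by simp
          then show ?case by (simp only: sum.empty TH.fib_closed(1) simp_thms)
        next
          case (insert k M)
          note m = TH.fib_closed(5)[OF that(2)[of k], of "u k"] insert.IH[THEN conjunct1]
          show ?case
            by (simp only: sum.insert[OF insert.hyps] jet_incl_linear(1)[OF m] jet_incl_linear(2)[OF that(2) TH.fib_closed(1)]
              TH.fib_closed(2)[OF m] insert.IH[THEN conjunct2] simp_thms)
        qed
        have Es: "E q (\<Sum>k\<in>M. u k *\<^sub>R X k q) = (\<Sum>k\<in>M. u k *\<^sub>R E q (X k q))" if M: "finite M" for M :: "'e set" and u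
        proof -
          have ext: "(\<Sum>k\<in>M. u k *\<^sub>R X k q) \<in> tangent A q" for M
            by (rule subspace_sum[OF tangent_subspace]) (rule tangent_closed(5)[OF VF_tangent[OF w(4)]])
          show ?thesis using M
          proof (induction M)
            case empty
            have "E q (0 *\<^sub>R 0) = 0 *\<^sub>R E q 0" using Ef[of q] tangent_closed(1) by blast
            then show ?case by (simp only: sum.empty scaleR_zero_left)
          next
            case (insert k M)
            have "E q (u k *\<^sub>R X k q + (\<Sum>k\<in>M. u k *\<^sub>R X k q)) = E q (u k *\<^sub>R X k q) + E q (\<Sum>k\<in>M. u k *\<^sub>R X k q)"
              using Ef[of q] tangent_closed(5)[OF VF_tangent[OF w(4)]] ext by blast
            moreover have "E q (u k *\<^sub>R X k q) = u k *\<^sub>R E q (X k q)" using Ef[of q] VF_tangent[OF w(4)] by blast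
            ultimately show ?case by (simp only: sum.insert[OF insert.hyps] insert.IH)
          qed
        qed
        have "E q (U q) = E q (\<Sum>k\<in>Basis. U q (x k) *\<^sub>R X k q)"
          by (rule arg_cong[where f = "E q"]) (rule exp[OF elim(2) VF_tangent[OF U]])
        also have "\<dots> = (\<Sum>k\<in>Basis. U q (x k) *\<^sub>R E q (X k q))" by (rule Es[OF finite_Basis])
        finally have "jet_incl A (TM A) q (E q (U q)) = jet_incl A (TM A) q (\<Sum>k\<in>Basis. U q (x k) *\<^sub>R E q (X k q))"
          by (rule arg_cong[where f = "jet_incl A (TM A) q"])
        also have "\<dots> = (\<Sum>k\<in>Basis. U q (x k) *\<^sub>R jet_incl A (TM A) q (E q (X k q)))"
          by (rule ls[THEN conjunct2, OF finite_Basis EE[OF VF_tangent[OF w(4)]]])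
        also have "\<dots> = (\<Sum>k\<in>Basis. U q (x k) *\<^sub>R (\<Sum>j<r. h (k, j) q *\<^sub>R b j q))"
        proof (rule sum.cong[OF refl])
          fix k :: 'e assume k: "k \<in> Basis"
          have "c0 k q j = h (k, j) q" if "j < r" for j using elim(1) k that by (auto simp: I_def c_def)
          then have "(\<Sum>j<r. c0 k q j *\<^sub>R b j q) = (\<Sum>j<r. h (k, j) q *\<^sub>R b j q)" by (intro sum.cong) simp_all
          then show "U q (x k) *\<^sub>R jet_incl A (TM A) q (E q (X k q)) = U q (x k) *\<^sub>R (\<Sum>j<r. h (k, j) q *\<^sub>R b j q)"
            by (simp only: c0[OF elim(3)])
        qed
        also have "\<dots> = ?t q" by (simp only: sum_fun_apply fmul_apply)
        finally show ?case .
      qed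
    qed
  qed
  show ?thesis
    unfolding hom_sec_iff TM_simps
  proof (intro conjI allI ballI)
    show "E q \<in> fibre (Delta_dom A g) q" for q by (rule E)
    fix U assume U: "U \<in> VF A"
    have z: "anc (\<lambda>q. jet_incl A (TM A) q (E q (U q))) = 0"
    proof (rule ext)
      fix q
      have "anc (\<lambda>q. jet_incl A (TM A) q (E q (U q))) q = 0"
        by (rule anc_incl(1)[OF EE[OF VF_tangent[OF U]]]) (rule refl)
      then show "anc (\<lambda>q. jet_incl A (TM A) q (E q (U q))) q = 0 q" by (simp only: zero_fun_apply)
    qed
    obtain \<phi> where \<phi>: "\<phi> \<in> sections K" "(\<lambda>q. jet_incl A (TM A) q (E q (U q))) = jetJ A (TM A) 0 \<phi>"
      by (rule kernel_section[OF J[OF U] z]) (rule that; assumption)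
    have "E q (U q) = \<phi> q" for q
      by (rule jet_incl_inject[OF EE[OF VF_tangent[OF U]] K_End[OF \<phi>(1)]]) (rule fun_cong[OF \<phi>(2)])
    then have "ap E U = \<phi>" by (intro ext) simp
    with \<phi>(1) show "ap E U \<in> sections K" by simp
  qed
qed

end

section \<open>Solving for \<open>\<epsilon>\<close>\<close>

context igs_generator
begin

interpretation T: algebroid_bundle A "TM A" by (rule TM_algebroid)
interpretation TJ: mbundle A "jet_bundle A (TM A)" by (rule JT_mbundle)
interpretation G: algebroid_bundle A G by (rule G_algebroid)
interpretation K: mbundle A K by (rule K_mbundle)
interpretation DD: mbundle A "hom_bundle (TM A) K" by (rule hom_mbundle[OF TM_mbundle K_mbundle])

abbreviation R where "R \<sigma> \<equiv> act_tor A (ad_op A \<sigma>) dt"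

lemma R_ext:
  assumes "\<And>U W. U \<in> VF A \<Longrightarrow> W \<in> VF A \<Longrightarrow> R \<sigma> p (U p) (W p) = S (U p) (W p)"
    and "\<And>u v. u \<notin> tangent A p \<or> v \<notin> tangent A p \<Longrightarrow> S u v = 0"
  shows "R \<sigma> p = S"
proof -
  have "R \<sigma> p = (\<lambda>_. S) p"
    by (rule tangent2_ext[where S = "R \<sigma>" and S' = "\<lambda>_. S"]) (simp_all only: assms act_tor_off)
  then show ?thesis .
qed

lemma R_val:
  assumes "\<sigma> \<in> sections G" "U \<in> VF A" "W \<in> VF A"
  shows "R \<sigma> p (U p) (W p) = (ad_op A \<sigma> (tap dt U W) - tap dt (ad_op A \<sigma> U) W - tap dt U (ad_op A \<sigma> W)) p"
  by (rule act_tor_ad[OF G_JT[OF assms(1)] dt_Tor assms(2,3)])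

lemma R_add:
  assumes s: "\<sigma> \<in> sections G" and t: "\<tau> \<in> sections G"
  shows "R (\<sigma> + \<tau>) p = R \<sigma> p + R \<tau> p"
proof (rule R_ext)
  fix U W assume U: "U \<in> VF A" and W: "W \<in> VF A"
  note T = torD[OF dt_Tor] and j = G_JT[OF s] G_JT[OF t]
  show "R (\<sigma> + \<tau>) p (U p) (W p) = (R \<sigma> p + R \<tau> p) (U p) (W p)"
    unfolding R_val[OF G.sec_add[OF s t] U W] ad_add_left[OF j U] ad_add_left[OF j W] ad_add_left[OF j T(1)[OF U W]]
      T(4)[OF ad_VF[OF j(1) U] W ad_VF[OF j(2) U]] T(2)[OF U ad_VF[OF j(1) W] ad_VF[OF j(2) W]]
    by (simp add: R_val[OF s U W] R_val[OF t U W] del: tap_apply)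
next
  fix u v assume "u \<notin> tangent A p \<or> v \<notin> tangent A p"
  from act_tor_off[OF this] show "(R \<sigma> p + R \<tau> p) u v = 0" by simp
qed

lemma R_fmul:
  assumes f: "f \<in> Cinf A" and s: "\<sigma> \<in> sections G"
  shows "R (fmul f \<sigma>) p = f p *\<^sub>R R \<sigma> p"
proof (rule R_ext)
  fix U W assume U: "U \<in> VF A" and W: "W \<in> VF A"
  note T = torD[OF dt_Tor] and j = G_JT[OF s]
  show "R (fmul f \<sigma>) p (U p) (W p) = (f p *\<^sub>R R \<sigma> p) (U p) (W p)"
    unfolding R_val[OF G.sec_fmul[OF f s] U W] ad_fmul_left[OF j f U] ad_fmul_left[OF j f W] ad_fmul_left[OF j f T(1)[OF U W]]
      T(5)[OF ad_VF[OF j U] W f] T(3)[OF U ad_VF[OF j W] f]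
    by (simp add: R_val[OF s U W] scaleR_diff_right del: tap_apply)
next
  fix u v assume "u \<notin> tangent A p \<or> v \<notin> tangent A p"
  from act_tor_off[OF this] show "(f p *\<^sub>R R \<sigma> p) u v = 0" by simp
qed

text \<open>The choice is made separately at each point. When \<open>\<Delta>\<close> is injective
  it is forced, and \<open>Delta_smooth\<close> supplies smoothness; \<open>\<epsilon>\<close> will
  be this operator transported through the identification by the generator.\<close>

definition \<kappa> :: "('m \<Rightarrow> 'm jet_TM) \<Rightarrow> 'm \<Rightarrow> 'm tvec \<Rightarrow> 'm endo" where
  "\<kappa> \<sigma> p = (SOME e. e \<in> fibre (Delta_dom A g) p \<and> Delta e = R \<sigma> p)"

lemma Delta_inject:
  assumes "Delta_injective A g" "e \<in> fibre (Delta_dom A g) p" "e' \<in> fibre (Delta_dom A g) p" "Delta e = Delta e'"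
  shows "e = e'"
  using assms by (simp add: Delta_injective_def inj_on_def)

context
  assumes tr: "torsion_reduced A g" and inj: "Delta_injective A g"
begin

lemma \<kappa>: "\<sigma> \<in> sections G \<Longrightarrow> \<kappa> \<sigma> p \<in> fibre (Delta_dom A g) p"
  and Delta_\<kappa>: "\<sigma> \<in> sections G \<Longrightarrow> Delta (\<kappa> \<sigma> p) = R \<sigma> p"
proof -
  assume s: "\<sigma> \<in> sections G"
  have "\<exists>e. e \<in> fibre (Delta_dom A g) p \<and> Delta e = R \<sigma> p"
    using torsion_reduced_im[OF tr s, of p] unfolding im_Delta_def by (elim imageE) (rule exI, rule conjI, assumption, rule sym)
  from someI_ex[OF this]
  show "\<kappa> \<sigma> p \<in> fibre (Delta_dom A g) p" "Delta (\<kappa> \<sigma> p) = R \<sigma> p" unfolding \<kappa>_def by simp_all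
qed

text \<open>Both sides have the same image under \<open>\<Delta>\<close>, since the action
  \<open>R\<close> on the torsion is linear over functions in the section; injectivity of
  \<open>\<Delta>\<close> concludes.\<close>

lemma \<kappa>_Clinear: "Clinear A G \<kappa>"
proof (rule ClinearI; rule ext)
  fix \<sigma> \<tau> p assume s: "\<sigma> \<in> sections G" and t: "\<tau> \<in> sections G"
  have "\<kappa> (\<sigma> + \<tau>) p = \<kappa> \<sigma> p + \<kappa> \<tau> p"
    by (rule Delta_inject[OF inj \<kappa>[OF G.sec_add[OF s t]] DD.fib_closed(2)[OF \<kappa>[OF s] \<kappa>[OF t]]])
       (simp only: Delta_add Delta_\<kappa>[OF s] Delta_\<kappa>[OF t] Delta_\<kappa>[OF G.sec_add[OF s t]] R_add[OF s t])
  then show "\<kappa> (\<sigma> + \<tau>) p = (\<kappa> \<sigma> + \<kappa> \<tau>) p" by (simp only: plus_fun_apply)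
next
  fix f \<sigma> p assume f: "f \<in> Cinf A" and s: "\<sigma> \<in> sections G"
  have "\<kappa> (fmul f \<sigma>) p = f p *\<^sub>R \<kappa> \<sigma> p"
    by (rule Delta_inject[OF inj \<kappa>[OF G.sec_fmul[OF f s]] DD.fib_closed(5)[OF \<kappa>[OF s]]])
       (simp only: Delta_scaleR Delta_\<kappa>[OF s] Delta_\<kappa>[OF G.sec_fmul[OF f s]] R_fmul[OF f s])
  then show "\<kappa> (fmul f \<sigma>) p = fmul f (\<kappa> \<sigma>) p" by (simp only: fmul_apply)
qed

lemma \<kappa>_section:
  assumes s: "\<sigma> \<in> sections G"
  shows "\<kappa> \<sigma> \<in> sections (Delta_dom A g)"
proof (rule Delta_smooth[OF inj \<kappa>[OF s]])
  fix U W assume U: "U \<in> VF A" and W: "W \<in> VF A"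
  note T = torD[OF dt_Tor] and d = ad_VF[OF G_JT[OF s]]
  have "(\<lambda>q. Delta (\<kappa> \<sigma> q) (U q) (W q)) = ad_op A \<sigma> (tap dt U W) - tap dt (ad_op A \<sigma> U) W - tap dt U (ad_op A \<sigma> W)"
    by (rule ext) (simp only: Delta_\<kappa>[OF s] R_val[OF s U W])
  then show "(\<lambda>q. Delta (\<kappa> \<sigma> q) (U q) (W q)) \<in> VF A"
    using VF_diff[OF VF_diff[OF d[OF T(1)[OF U W]] T(1)[OF d[OF U] W]] T(1)[OF U d[OF W]]] by simp
qed

text \<open>By \<open>kernel_extend\<close> every element of the sum fibre is the value of a pair of
  sections, so the equation on sections determines \<open>\<Delta>\<close> of each value, and
  injectivity determines the value.\<close>

lemma epsilon_unique:
  assumes 1: "epsilon_solution A g D \<epsilon>" and 2: "epsilon_solution A g D \<epsilon>'"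
  shows "\<epsilon> = \<epsilon>'"
proof (rule ext, rule ext)
  fix p x
  note h1 = 1[unfolded epsilon_solution_def] and h2 = 2[unfolded epsilon_solution_def]
  note d1 = hom_secD[OF h1[THEN conjunct1]] and d2 = hom_secD[OF h2[THEN conjunct1]]
  show "\<epsilon> p x = \<epsilon>' p x"
  proof (cases "x \<in> fibre (sum_bundle (TM A) K) p")
    case True
    then have x: "fst x \<in> tangent A p" "snd x \<in> fibre K p" by (auto simp: sum_bundle_def)
    obtain V where V: "V \<in> VF A" "V p = fst x" by (rule TM_extend[OF x(1)])
    obtain \<phi> where \<phi>: "\<phi> \<in> sections K" "\<phi> p = snd x" by (rule kernel_extend[OF x(2)])
    have "Delta (\<epsilon> p (V p, \<phi> p)) = Delta (\<epsilon>' p (V p, \<phi> p))"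
      using h1[THEN conjunct2] h2[THEN conjunct2] V(1) \<phi>(1) by simp
    then have "Delta (\<epsilon> p x) = Delta (\<epsilon>' p x)" unfolding V(2) \<phi>(2) prod.collapse .
    then show ?thesis by (rule Delta_inject[OF inj d1(3)[OF True] d2(3)[OF True]])
  next
    case False
    then show ?thesis using d1(4) d2(4) by simp
  qed
qed

lemma epsilon_exists: "\<exists>\<epsilon>. epsilon_solution A g D \<epsilon>"
proof -
  let ?S = "sum_bundle (TM A) K"
  define s' where "s' = tensorial (TM A) (\<lambda>V. spl V)"
  define k' where "k' = tensorial G \<kappa>"
  \<comment> \<open>\<open>k'\<close> is \<open>\<kappa>\<close> as a map on fibres of
    \<open>g\<close>, precomposed with the fibrewise identification that adds the splitting of a
    vector and a kernel element. The value zero off the fibre is the convention of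
    \<open>hom_bundle\<close>.\<close>
  define \<epsilon> where "\<epsilon> p x = (if x \<in> fibre ?S p then k' p (s' p (fst x) + jet_incl A (TM A) p (snd x)) else 0)" for p x
  have c: "Clinear A (TM A) (\<lambda>V. spl V)" by (rule ClinearI) (simp_all add: spl_add spl_fmul)
  have val: "\<epsilon> p (V p, \<phi> p) = \<kappa> (gen_section A D V \<phi>) p" if V: "V \<in> VF A" and \<phi>: "\<phi> \<in> sections K" for V \<phi> p
  proof -
    have m: "(V p, \<phi> p) \<in> fibre ?S p" using VF_tangent[OF V] K.sec_fibre[OF \<phi>] by (simp add: sum_bundle_def)
    have "s' p (V p) = spl V p" unfolding s'_def by (rule T.tensorial_apply[OF c]) (simp add: V)
    moreover have "jet_incl A (TM A) p (\<phi> p) = jetJ A (TM A) 0 \<phi> p" by (rule jet_incl_at) (rule refl)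
    ultimately have "s' p (V p) + jet_incl A (TM A) p (\<phi> p) = gen_section A D V \<phi> p" by (simp only: gen_eq plus_fun_apply)
    moreover have "k' p (gen_section A D V \<phi> p) = \<kappa> (gen_section A D V \<phi>) p"
      unfolding k'_def by (rule G.tensorial_apply[OF \<kappa>_Clinear gen_G[OF V \<phi>]])
    ultimately show ?thesis using m by (simp only: \<epsilon>_def if_True fst_conv snd_conv)
  qed
  have fx: "\<exists>V\<in>VF A. \<exists>\<phi>\<in>sections K. x = (V p, \<phi> p)" if "x \<in> fibre ?S p" for x p
  proof -
    have x: "fst x \<in> tangent A p" "snd x \<in> fibre K p" using that by (auto simp: sum_bundle_def)
    obtain V where V: "V \<in> VF A" "V p = fst x" by (rule TM_extend[OF x(1)])
    obtain \<phi> where \<phi>: "\<phi> \<in> sections K" "\<phi> p = snd x" by (rule kernel_extend[OF x(2)])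
    show ?thesis by (rule bexI[OF _ V(1)], rule bexI[OF _ \<phi>(1)]) (simp only: V(2) \<phi>(2) prod.collapse)
  qed
  have gadd: "gen_section A D (V + W) (\<phi> + \<psi>) = gen_section A D V \<phi> + gen_section A D W \<psi>"
    if "V \<in> VF A" "W \<in> VF A" "\<phi> \<in> sections K" "\<psi> \<in> sections K" for V W \<phi> \<psi>
    unfolding gen_eq spl_add[OF that(1,2)] jetJ0_add[OF K_End[OF that(3)] K_End[OF that(4)]] by (simp add: algebra_simps)
  have gfm: "gen_section A D (fmul f V) (fmul f \<phi>) = fmul f (gen_section A D V \<phi>)"
    if "f \<in> Cinf A" "V \<in> VF A" "\<phi> \<in> sections K" for V f \<phi>
    unfolding gen_eq spl_fmul[OF that(1,2)] jetJ0_fmul[OF that(1) K_End[OF that(3)]] by (rule ext) (simp add: scaleR_add_right)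
  have "\<epsilon> \<in> sections (hom_bundle ?S (Delta_dom A g))"
    unfolding hom_sec_iff[of \<epsilon>] hom_fibre_iff[of "\<epsilon> _" ?S]
  proof (intro conjI allI ballI impI)
    fix p x d assume x: "x \<in> fibre ?S p"
    obtain V \<phi> where V: "V \<in> VF A" "\<phi> \<in> sections K" "x = (V p, \<phi> p)" using fx[OF x] by (elim bexE) (rule that)
    show "\<epsilon> p x \<in> fibre (Delta_dom A g) p" unfolding V(3) val[OF V(1,2)] by (rule \<kappa>[OF gen_G[OF V(1,2)]])
    note fV = VF_fmul[OF Cinf_const[of d] V(1)] K.sec_fmul[OF Cinf_const[of d] V(2)]
    have "d *\<^sub>R x = (fmul (\<lambda>_. d) V p, fmul (\<lambda>_. d) \<phi> p)" by (simp only: V(3) scaleR_Pair fmul_apply)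
    then have "\<epsilon> p (d *\<^sub>R x) = \<kappa> (gen_section A D (fmul (\<lambda>_. d) V) (fmul (\<lambda>_. d) \<phi>)) p" using val[OF fV, of p] by (simp only:)
    also have "\<dots> = d *\<^sub>R \<epsilon> p x"
      by (simp only: gfm[OF Cinf_const V(1,2)] ClinearD(2)[OF \<kappa>_Clinear Cinf_const gen_G[OF V(1,2)]] fmul_apply V(3) val[OF V(1,2)])
    finally show "\<epsilon> p (d *\<^sub>R x) = d *\<^sub>R \<epsilon> p x" .
    fix y assume y: "y \<in> fibre ?S p"
    obtain W \<psi> where W: "W \<in> VF A" "\<psi> \<in> sections K" "y = (W p, \<psi> p)" using fx[OF y] by (elim bexE) (rule that)
    note aV = VF_add[OF V(1) W(1)] K.sec_add[OF V(2) W(2)]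
    have "x + y = ((V + W) p, (\<phi> + \<psi>) p)" by (simp only: V(3) W(3) add_Pair plus_fun_apply)
    then have "\<epsilon> p (x + y) = \<kappa> (gen_section A D (V + W) (\<phi> + \<psi>)) p" using val[OF aV, of p] by (simp only:)
    also have "\<dots> = \<epsilon> p x + \<epsilon> p y"
      by (simp only: gadd[OF V(1) W(1) V(2) W(2)] ClinearD(1)[OF \<kappa>_Clinear gen_G[OF V(1,2)] gen_G[OF W(1,2)]] plus_fun_apply
        V(3) W(3) val[OF V(1,2)] val[OF W(1,2)])
    finally show "\<epsilon> p (x + y) = \<epsilon> p x + \<epsilon> p y" .
  next
    show "\<epsilon> p x = 0" if "x \<notin> fibre ?S p" for p x using that by (simp only: \<epsilon>_def if_False)
    fix s assume "s \<in> sections ?S"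
    then have s: "(\<lambda>p. fst (s p)) \<in> VF A" "(\<lambda>p. snd (s p)) \<in> sections K" by (simp_all add: sum_bundle_def)
    have "ap \<epsilon> s = \<kappa> (gen_section A D (\<lambda>p. fst (s p)) (\<lambda>p. snd (s p)))"
    proof
      fix p show "ap \<epsilon> s p = \<kappa> (gen_section A D (\<lambda>p. fst (s p)) (\<lambda>p. snd (s p))) p"
        using val[OF s, of p] by (simp only: ap_apply prod.collapse)
    qed
    then show "ap \<epsilon> s \<in> sections (Delta_dom A g)" using \<kappa>_section[OF gen_G[OF s]] by (simp only:)
  qed
  moreover have "Delta (\<epsilon> p (V p, \<phi> p)) = act_tor A (nb V) dt p + endo_act (\<phi> p) (dt p)"
    if "V \<in> VF A" "\<phi> \<in> sections K" for V \<phi> p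
    unfolding val[OF that] rhs_eq[OF that] by (rule Delta_\<kappa>[OF gen_G[OF that]])
  ultimately have "epsilon_solution A g D \<epsilon>" unfolding epsilon_solution_def by (intro conjI ballI allI)
  then show ?thesis by (rule exI[of _ \<epsilon>])
qed

end

section \<open>The canonical prolongation\<close>

text \<open>A field defined through \<open>tensorial\<close> is identified as soon as its operator
  agrees on vector fields with a known bundle map; linearity of the operator is then
  inherited.\<close>

lemma tensorial_endo:
  assumes \<xi>: "\<xi> \<in> End" and F: "\<And>W. W \<in> VF A \<Longrightarrow> F W = ap \<xi> W"
  shows "tensorial (TM A) F = \<xi>"
proof (rule ext, rule ext)
  fix p x
  have c: "Clinear A (TM A) F"
    by (rule ClinearI) (simp_all only: TM_simps F VF_add VF_fmul End_add[OF \<xi>] End_fmul[OF \<xi>])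
  show "tensorial (TM A) F p x = \<xi> p x"
  proof (cases "x \<in> tangent A p")
    case True
    obtain V where V: "V \<in> VF A" "V p = x" by (rule TM_extend[OF True])
    show ?thesis using T.tensorial_apply[OF c, of V p] V by (simp only: TM_simps F ap_apply)
  next
    case False
    then show ?thesis by (simp add: tensorial_def EndD(4)[OF \<xi> False])
  qed
qed

text \<open>The derivative of \<open>\<phi>\<close> along \<open>U\<close> is the bracket, in
  \<open>g\<close>, of the splitting of \<open>U\<close> with \<open>\<phi>\<close>; its anchor is
  zero. Closure of \<open>g\<close> under brackets is what keeps the derivative in the structure
  kernel.\<close>

lemma act_endo_K:
  assumes U: "U \<in> VF A" and \<phi>: "\<phi> \<in> sections K"
  shows "act_endo A (nb U) \<phi> \<in> sections K"
    and "W \<in> VF A \<Longrightarrow> ap (act_endo A (nb U) \<phi>) W = nb U (ap \<phi> W) - ap \<phi> (nb U W)"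
proof -
  let ?B = "jet_bracket A (TM A) (spl U) (jetJ A (TM A) 0 \<phi>)"
  note j = spl_JT[OF U] G_JT[OF K_G[OF \<phi>]] and E = K_End[OF \<phi>]
  have B: "?B \<in> sections G" by (rule G_bracket_closed[OF spl_G[OF U] K_G[OF \<phi>]])
  have a: "anc ?B = 0"
    unfolding anc_bracket[OF j] anc_spl[OF U] anc_jetJ[OF VF_zero E] using vf_diff_right[OF U VF_zero VF_zero] by simp
  obtain \<xi> where \<xi>: "\<xi> \<in> sections K" "?B = jetJ A (TM A) 0 \<xi>" "\<And>Y. Y \<in> VF A \<Longrightarrow> ap \<xi> Y = ad_op A ?B Y"
    by (rule kernel_section[OF B a]) (rule that; assumption)
  have v: "ap \<xi> W = nb U (ap \<phi> W) - ap \<phi> (nb U W)" if W: "W \<in> VF A" for W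
    unfolding \<xi>(3)[OF W] ad_bracket[OF j W] ad_zero_jet[OF E W] ad_spl[OF U W] ad_spl[OF U End_closed[OF E W]]
      ad_zero_jet[OF E nb_VF[OF U W]] ..
  have "act_endo A (nb U) \<phi> = \<xi>"
    unfolding act_endo_def
  proof (rule tensorial_endo[OF K_End[OF \<xi>(1)]])
    fix W assume W: "W \<in> VF A"
    show "nb U (\<lambda>q. \<phi> q (W q)) - (\<lambda>q. \<phi> q (nb U W q)) = ap \<xi> W" unfolding v[OF W] by (simp only: ap_def)
  qed
  with \<xi>(1) v show "act_endo A (nb U) \<phi> \<in> sections K"
    "W \<in> VF A \<Longrightarrow> ap (act_endo A (nb U) \<phi>) W = nb U (ap \<phi> W) - ap \<phi> (nb U W)" by simp_all
qed

text \<open>The curvature is the failure of the splitting to preserve brackets,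
  \<open>[s U, s V] - s [U, V]\<close>: a section of \<open>g\<close> whose anchor vanishes.\<close>

lemma dual_curv_K:
  assumes U: "U \<in> VF A" and V: "V \<in> VF A"
  shows "dual_curv A D U V \<in> sections K"
    and "W \<in> VF A \<Longrightarrow> ap (dual_curv A D U V) W = nb U (nb V W) - nb V (nb U W) - nb (vf_bracket U V) W"
proof -
  let ?B = "jet_bracket A (TM A) (spl U) (spl V)"
  note j = spl_JT[OF U] spl_JT[OF V] and UV = vf_closed[OF U V]
  have B: "?B \<in> sections G" by (rule G_bracket_closed[OF spl_G[OF U] spl_G[OF V]])
  note jB = G_JT[OF B] spl_JT[OF UV]
  have a: "anc (?B - spl (vf_bracket U V)) = 0"
    unfolding anc_diff[OF jB] anc_bracket[OF j] anc_spl[OF U] anc_spl[OF V] anc_spl[OF UV] by simp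
  obtain \<xi> where \<xi>: "\<xi> \<in> sections K" "?B - spl (vf_bracket U V) = jetJ A (TM A) 0 \<xi>"
    "\<And>Y. Y \<in> VF A \<Longrightarrow> ap \<xi> Y = ad_op A (?B - spl (vf_bracket U V)) Y"
    by (rule kernel_section[OF G.sec_diff[OF B spl_G[OF UV]] a]) (rule that; assumption)
  have v: "ap \<xi> W = nb U (nb V W) - nb V (nb U W) - nb (vf_bracket U V) W" if W: "W \<in> VF A" for W
    unfolding \<xi>(3)[OF W] ad_diff_left[OF jB W] ad_bracket[OF j W] ad_spl[OF U W] ad_spl[OF V W]
      ad_spl[OF U nb_VF[OF V W]] ad_spl[OF V nb_VF[OF U W]] ad_spl[OF UV W] ..
  have "dual_curv A D U V = \<xi>"
    unfolding dual_curv_def by (rule tensorial_endo[OF K_End[OF \<xi>(1)]]) (rule v[symmetric])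
  with \<xi>(1) v show "dual_curv A D U V \<in> sections K"
    "W \<in> VF A \<Longrightarrow> ap (dual_curv A D U V) W = nb U (nb V W) - nb V (nb U W) - nb (vf_bracket U V) W" by simp_all
qed

text \<open>The bundle map is given only on vector fields; its linearity over functions is checked
  on anchor and ad, by faithfulness. With \<open>ad_op\<close> written through
  \<open>\<delta>\<close>, the second prolongation equation becomes the statement that
  \<open>\<Delta> E\<close> is the action of \<open>\<delta>\<close> on the torsion.\<close>

lemma gen_prol:
  assumes V: "V \<in> VF A" and \<phi>: "\<phi> \<in> sections K" and E: "E \<in> sections (Delta_dom A g)"
    and DE: "\<And>p. Delta (E p) = R (gen_section A D V \<phi>) p"
  obtains \<psi> where "prol (gen_section A D V \<phi>) \<psi>"
    "\<And>U. U \<in> VF A \<Longrightarrow> ap \<psi> U = gen_section A D (cov D U V + ap \<phi> U) (act_endo A (nb U) \<phi> + ap E U + dual_curv A D U V)"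
proof -
  let ?\<sigma> = "gen_section A D V \<phi>"
  define \<delta> where "\<delta> = ad_op A ?\<sigma>"
  define F where "F U = gen_section A D (cov D U V + ap \<phi> U) (act_endo A (nb U) \<phi> + ap E U + dual_curv A D U V)" for U
  note sG = gen_G[OF V \<phi>] and j = G_JT[OF gen_G[OF V \<phi>]]
  note P = K_End[OF \<phi>]
  have \<delta>e: "\<delta> Y = nb V Y + ap \<phi> Y" if "Y \<in> VF A" for Y unfolding \<delta>_def by (rule ad_gen[OF V \<phi> that])
  have \<delta>VF: "\<delta> Y \<in> VF A" if "Y \<in> VF A" for Y unfolding \<delta>_def by (rule ad_VF[OF j that])
  have \<delta>add: "\<delta> (Y + Z) = \<delta> Y + \<delta> Z" if "Y \<in> VF A" "Z \<in> VF A" for Y Z unfolding \<delta>_def by (rule ad_add[OF j that])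
  have \<delta>diff: "\<delta> (Y - Z) = \<delta> Y - \<delta> Z" if "Y \<in> VF A" "Z \<in> VF A" for Y Z unfolding \<delta>_def by (rule ad_diff[OF j that])
  have \<delta>fmul: "\<delta> (fmul f Y) = fmul f (\<delta> Y) + fmul (\<lambda>p. V p f) Y" if "f \<in> Cinf A" "Y \<in> VF A" for f Y
    unfolding \<delta>_def ad_fmul[OF j that] anc_gen[OF V \<phi>] ..
  have \<zeta>: "cov D U V + ap \<phi> U = \<delta> U - vf_bracket V U" if U: "U \<in> VF A" for U
    unfolding \<delta>e[OF U] by (simp add: dual_conn_def algebra_simps)
  have \<zeta>VF: "cov D U V + ap \<phi> U \<in> VF A" if U: "U \<in> VF A" for U
    unfolding \<zeta>[OF U] by (rule VF_diff[OF \<delta>VF[OF U] vf_closed[OF V U]])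
  note EK = Delta_domD(1)[OF E]
  have kK: "act_endo A (nb U) \<phi> + ap E U + dual_curv A D U V \<in> sections K" if U: "U \<in> VF A" for U
    by (intro K.sec_add act_endo_K(1) dual_curv_K(1) EK U V \<phi>)
  have FG: "F U \<in> sections G" if U: "U \<in> VF A" for U
    unfolding F_def by (rule gen_G[OF \<zeta>VF[OF U] kK[OF U]])
  have aF: "anc (F U) = \<delta> U - vf_bracket V U" if U: "U \<in> VF A" for U
    unfolding F_def anc_gen[OF \<zeta>VF[OF U] kK[OF U]] by (rule \<zeta>[OF U])
  \<comment> \<open>Here \<open>V\<close> and \<open>\<phi>\<close> survive only through
    \<open>\<delta>\<close>: the derivative and curvature terms of the formula combine into the
    commutator of \<open>nb U\<close> with \<open>\<delta>\<close>, while the bracket of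
    \<open>U\<close> and \<open>V\<close> in the first component is absorbed by the
    curvature.\<close>
  have adF: "ad_op A (F U) W = nb (\<delta> U) W + nb U (\<delta> W) - \<delta> (nb U W) + ap (ap E U) W"
    if U: "U \<in> VF A" and W: "W \<in> VF A" for U W
  proof -
    note UV = vf_closed[OF U V]
    have z: "cov D U V + ap \<phi> U = \<delta> U + vf_bracket U V"
      unfolding \<zeta>[OF U] vf_antisym[of V U] by simp
    have 1: "ad_op A (F U) W = nb (cov D U V + ap \<phi> U) W + ap (act_endo A (nb U) \<phi> + ap E U + dual_curv A D U V) W"
      unfolding F_def by (rule ad_gen[OF \<zeta>VF[OF U] kK[OF U] W])
    show ?thesis
      unfolding 1 ap_simps act_endo_K(2)[OF U \<phi> W] dual_curv_K(2)[OF U V W]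
        \<delta>e[OF W] \<delta>e[OF nb_VF[OF U W]] nb_add[OF U nb_VF[OF V W] End_closed[OF P W]]
        z nb_add_left[OF \<delta>VF[OF U] UV W]
      by (simp add: algebra_simps)
  qed
  have Fadd: "F (X + Y) = F X + F Y" if X: "X \<in> VF A" and Y: "Y \<in> VF A" for X Y
  proof -
    note XY = VF_add[OF X Y]
    show ?thesis
    proof (rule jet_faithful_section[OF G_JT[OF FG[OF XY]] TJ.sec_add[OF G_JT[OF FG[OF X]] G_JT[OF FG[OF Y]]]])
      show "anc (F (X + Y)) = anc (F X + F Y)"
        unfolding anc_add[OF G_JT[OF FG[OF X]] G_JT[OF FG[OF Y]]] aF[OF X] aF[OF Y] aF[OF XY] \<delta>add[OF X Y] vf_add_right[OF V X Y]
        by simp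
      fix W assume W: "W \<in> VF A"
      show "ad_op A (F (X + Y)) W = ad_op A (F X + F Y) W"
        unfolding ad_add_left[OF G_JT[OF FG[OF X]] G_JT[OF FG[OF Y]] W] adF[OF X W] adF[OF Y W] adF[OF XY W] \<delta>add[OF X Y]
          nb_add_left[OF \<delta>VF[OF X] \<delta>VF[OF Y] W] nb_add_left[OF X Y W] nb_add_left[OF X Y \<delta>VF[OF W]]
          \<delta>add[OF nb_VF[OF X W] nb_VF[OF Y W]] Delta_domD(2)[OF E X Y] ap_simps
        by (simp add: algebra_simps)
    qed
  qed
  have Ffm: "F (fmul f X) = fmul f (F X)" if f: "f \<in> Cinf A" and X: "X \<in> VF A" for f X
  proof -
    note fX = VF_fmul[OF f X] and Vf = VF_Cinf[OF V, of f]
    show ?thesis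
    proof (rule jet_faithful_section[OF G_JT[OF FG[OF fX]] TJ.sec_fmul[OF f G_JT[OF FG[OF X]]]])
      show "anc (F (fmul f X)) = anc (fmul f (F X))"
        unfolding anc_fmul[OF G_JT[OF FG[OF X]] f] aF[OF X] aF[OF fX] \<delta>fmul[OF f X] vf_fmul_right[OF f V X]
        by (rule ext) (simp add: scaleR_diff_right)
      fix W assume W: "W \<in> VF A"
      show "ad_op A (F (fmul f X)) W = ad_op A (fmul f (F X)) W"
        unfolding ad_fmul_left[OF G_JT[OF FG[OF X]] f W] adF[OF X W] adF[OF fX W] \<delta>fmul[OF f X]
          nb_add_left[OF VF_fmul[OF f \<delta>VF[OF X]] VF_fmul[OF Vf X] W] nb_fmul_left[OF f \<delta>VF[OF X] W] nb_fmul_left[OF Vf X W]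
          nb_fmul_left[OF f X W] nb_fmul_left[OF f X \<delta>VF[OF W]]
          \<delta>fmul[OF f nb_VF[OF X W]] Delta_domD(3)[OF E X f] ap_simps
        by (rule ext) (simp add: scaleR_diff_right scaleR_add_right)
    qed
  qed
  have h1: "tensorial (TM A) F \<in> GHom"
    by (rule G.hom_of(1)) (rule Fadd Ffm FG; assumption)+
  have h2: "ap (tensorial (TM A) F) U = F U" if "U \<in> VF A" for U
    by (rule G.hom_of(2)[OF _ _ _ that]) (rule Fadd Ffm FG; assumption)+
  have "prol ?\<sigma> (tensorial (TM A) F)"
  proof (rule prolI[OF h1])
    fix U assume U: "U \<in> VF A"
    show "anc (ap (tensorial (TM A) F) U) = ad_op A ?\<sigma> U - vf_bracket (anc ?\<sigma>) U"
      unfolding h2[OF U] aF[OF U] \<delta>_def anc_gen[OF V \<phi>] ..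
    fix W assume W: "W \<in> VF A"
    note T = dt_val and UW = vf_closed[OF U W]
    have D1: "Delta (E p) (U p) (W p) = (\<delta> (tap dt U W) - tap dt (\<delta> U) W - tap dt U (\<delta> W)) p" for p
      unfolding DE R_val[OF sG U W] \<delta>_def ..
    \<comment> \<open>The equation for \<open>E\<close> on two vector fields. Expanding the torsions
      through \<open>dt_val\<close>, all terms with \<open>nb\<close> match those of
      \<open>adF\<close>, and only brackets of vector fields remain.\<close>
    have D2: "ap (ap E U) W - ap (ap E W) U = \<delta> (tap dt U W) - tap dt (\<delta> U) W - tap dt U (\<delta> W)"
    proof
      fix p show "(ap (ap E U) W - ap (ap E W) U) p = (\<delta> (tap dt U W) - tap dt (\<delta> U) W - tap dt U (\<delta> W)) p"
        unfolding D1[symmetric] by (simp only: minus_apply ap_apply Delta_def)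
    qed
    have D3: "\<delta> (tap dt U W) = \<delta> (nb U W) - \<delta> (nb W U) - \<delta> (vf_bracket U W)"
      unfolding T[OF U W] \<delta>diff[OF VF_diff[OF nb_VF[OF U W] nb_VF[OF W U]] UW] \<delta>diff[OF nb_VF[OF U W] nb_VF[OF W U]] ..
    show "ad_op A ?\<sigma> (vf_bracket U W) - vf_bracket (ad_op A ?\<sigma> U) W - vf_bracket U (ad_op A ?\<sigma> W)
        = ad_op A (ap (tensorial (TM A) F) W) U - ad_op A (ap (tensorial (TM A) F) U) W"
      unfolding h2[OF U] h2[OF W] adF[OF U W] adF[OF W U] \<delta>_def[symmetric]
    proof (rule ext, rule ext)
      fix p f
      note fc = fun_cong[OF fun_cong, of _ _ p f]
      show "(\<delta> (vf_bracket U W) - vf_bracket (\<delta> U) W - vf_bracket U (\<delta> W)) p f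
        = (nb (\<delta> W) U + nb W (\<delta> U) - \<delta> (nb W U) + ap (ap E W) U
          - (nb (\<delta> U) W + nb U (\<delta> W) - \<delta> (nb U W) + ap (ap E U) W)) p f"
        using fc[OF D2] fc[OF D3] fc[OF T[OF \<delta>VF[OF U] W]] fc[OF T[OF U \<delta>VF[OF W]]]
        unfolding minus_apply plus_fun_apply by linarith
    qed
  qed
  then show thesis
    by (rule that) (simp only: h2 F_def)
qed

end

section \<open>The connection determined by the prolongation equations\<close>

context igs_structure
begin

interpretation G: algebroid_bundle A G by (rule G_algebroid)
interpretation GJ: mbundle A "jet_bundle A G" by (rule G.jet_mbundle)

text \<open>Described by the equations alone, hence independent of generators; the expression in a
  given generator is recovered by uniqueness.\<close>

definition D1 :: "('m \<Rightarrow> 'm jet_TM) \<Rightarrow> 'm \<Rightarrow> 'm tvec \<Rightarrow> 'm jet_TM" where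
  "D1 \<sigma> = (THE \<psi>. prol \<sigma> \<psi>)"

context
  assumes tr: "torsion_reduced A g" and inj: "Delta_injective A g"
begin

lemma D1_eq: "prol \<sigma> \<psi> \<Longrightarrow> D1 \<sigma> = \<psi>"
  unfolding D1_def by (rule the_equality) (assumption, rule prol_unique[OF inj])

text \<open>Any generator serves for existence, and by uniqueness the result does not remember which
  one was taken.\<close>

lemma D1_prol:
  assumes s: "\<sigma> \<in> sections G"
  shows "prol \<sigma> (D1 \<sigma>)"
proof -
  obtain D where D: "generator A g D" using generator_exists by (elim exE)
  interpret igs_generator A g D by unfold_locales (rule D)
  obtain \<phi> where \<phi>: "\<phi> \<in> sections K" "\<sigma> = gen_section A D (anc \<sigma>) \<phi>" by (rule gen_obtain[OF s])
  note a = anc_VF[OF G_JT[OF s]]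
  note sG = gen_G[OF a \<phi>(1)]
  obtain \<psi> where "prol (gen_section A D (anc \<sigma>) \<phi>) \<psi>"
    by (rule gen_prol[OF a \<phi>(1) \<kappa>_section[OF tr inj sG] Delta_\<kappa>[OF tr inj sG]]) (rule that; assumption)
  then have "prol \<sigma> \<psi>" unfolding \<phi>(2)[symmetric] .
  with D1_eq[OF this] show ?thesis by simp
qed

text \<open>Each axiom is a closure property of \<open>prol\<close> followed by uniqueness: sums and
  multiples give a linear connection, and \<open>prol_bracket\<close> gives the morphism property,
  since \<open>jbr\<close> over \<open>g\<close> describes the bracket of its jets.\<close>

lemma D1_cartan: "cartan_algebroid A G D1"
proof -
  note p = D1_prol
  have H: "D1 s \<in> GHom" if "s \<in> sections G" for s by (rule prolD(1)[OF p[OF that]])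
  have add: "D1 (s + t) = D1 s + D1 t" if "s \<in> sections G" "t \<in> sections G" for s t
    by (rule D1_eq[OF prol_add[OF G_JT[OF that(1)] G_JT[OF that(2)] p[OF that(1)] p[OF that(2)]]])
  have fm: "D1 (fmul f s) = fmul f (D1 s) + dtens A f s" if "f \<in> Cinf A" "s \<in> sections G" for f s
    by (rule D1_eq[OF prol_fmul[OF that(2,1) p[OF that(2)]]])
  have lc: "linear_connection A G D1"
    unfolding linear_connection_def
    by (intro conjI ballI allI) (simp_all only: H add fm plus_fun_apply fmul_apply scaleR_fun_apply dtens_def if_True add.commute)
  let ?S = "split_section A G D1"
  have S: "?S s = jetJ A G s (D1 s)" for s by (simp only: split_section_def jetJ_def)
  have c: "Clinear A G ?S"
    by (rule ClinearI) (simp_all only: S add fm G.jetJ_add[symmetric, OF _ _ H H] G.jetJ_fmul[OF _ _ H])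
  have SJ: "?S s \<in> sections (jet_bundle A G)" if "s \<in> sections G" for s
    unfolding S by (rule G.jetJ_section[OF that H[OF that]])
  have apS: "tensorial G ?S p (s p) = jetJ A G s (D1 s) p" if "s \<in> sections G" for s p
    unfolding G.tensorial_apply[OF c that] S ..
  have "algebroid_morphism G (jet_algebroid A G) (tensorial G ?S)"
    unfolding algebroid_morphism_def
  proof (intro conjI allI ballI)
    show "tensorial G ?S \<in> sections (hom_bundle G (jet_algebroid A G))"
      by (rule G.tensorial_hom[OF c]) (simp_all add: SJ GJ.sec_fibre)
    fix p x assume "x \<in> fibre G p"
    then obtain s where s: "s \<in> sections G" "s p = x" by (rule G.fibre_extend)
    show "anchor (jet_algebroid A G) p (tensorial G ?S p x) = anchor G p x"
      unfolding s(2)[symmetric] apS[OF s(1)] jet_algebroid_simps G.jet_anchor_jetJ[OF s(1) H[OF s(1)]] by (simp only: ap_apply)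
  next
    fix s t assume s: "s \<in> sections G" and t: "t \<in> sections G"
    have b: "bracket G s t \<in> sections G" unfolding G_bracket[OF s t] by (rule G_bracket_closed[OF s t])
    have D: "D1 (bracket G s t) = G.jbr s (D1 s) t (D1 t)"
      unfolding G_bracket[OF s t] by (rule D1_eq[OF prol_bracket[OF s t p[OF s] p[OF t]]])
    have "(\<lambda>p. tensorial G ?S p (bracket G s t p)) = jetJ A G (bracket G s t) (G.jbr s (D1 s) t (D1 t))"
      unfolding apS[OF b] D ..
    also have "\<dots> = jet_bracket A G (jetJ A G s (D1 s)) (jetJ A G t (D1 t))"
      by (rule G.jet_bracket_jetJ[OF s H[OF s] t H[OF t], symmetric])
    finally show "(\<lambda>p. tensorial G ?S p (bracket G s t p))
        = bracket (jet_algebroid A G) (\<lambda>p. tensorial G ?S p (s p)) (\<lambda>p. tensorial G ?S p (t p))"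
      unfolding apS[OF s] apS[OF t] jet_algebroid_simps .
  qed
  with lc show ?thesis
    unfolding cartan_algebroid_def cartan_connection_def by (intro conjI G_lie_algebroid)
qed

lemma D1_parallel: "bij_betw (jet1 A (TM A)) (symmetries A g) (parallel_sections G D1)"
  unfolding bij_betw_def
proof
  have a: "anc (jet1 A (TM A) W) = W" if "W \<in> VF A" for W
    unfolding TM_jet1 by (rule anc_jetJ[OF that mbundle.sec_zero[OF End_mbundle]])
  show "inj_on (jet1 A (TM A)) (symmetries A g)"
    by (rule inj_on_inverseI[where g = anc]) (simp add: symmetries_def a)
  show "jet1 A (TM A) ` symmetries A g = parallel_sections G D1"
  proof (intro equalityI subsetI)
    fix \<sigma> assume "\<sigma> \<in> jet1 A (TM A) ` symmetries A g"
    then obtain W where W: "W \<in> VF A" "jet1 A (TM A) W \<in> sections G" "\<sigma> = jet1 A (TM A) W"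
      by (auto simp: symmetries_def)
    then show "\<sigma> \<in> parallel_sections G D1" using D1_eq[OF prol_jet1[OF W(1)]] by (simp add: parallel_sections_def)
  next
    fix \<sigma> assume "\<sigma> \<in> parallel_sections G D1"
    then have s: "\<sigma> \<in> sections G" "D1 \<sigma> = 0" by (simp_all add: parallel_sections_def)
    note j = G_JT[OF s(1)]
    note X = anc_VF[OF j]
    have "\<sigma> = jet1 A (TM A) (anc \<sigma>)"
    proof (rule jet_faithful_section[OF j])
      show "jet1 A (TM A) (anc \<sigma>) \<in> JT" unfolding TM_jet1 by (rule jetJ_JT[OF X mbundle.sec_zero[OF End_mbundle]])
      show "anc \<sigma> = anc (jet1 A (TM A) (anc \<sigma>))" by (rule a[OF X, symmetric])
      fix Y assume Y: "Y \<in> VF A"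
      have z: "anc 0 = 0" using anc_diff[OF j j] by (simp only: diff_self)
      \<comment> \<open>For zero bundle map the first equation says that ad of
        \<open>\<sigma>\<close> is the bracket with its anchor; the prolongation of the anchor has
        the same anchor and the same ad, so faithfulness identifies the two.\<close>
      have e: "0 = ad_op A \<sigma> Y - vf_bracket (anc \<sigma>) Y"
        using prolD(2)[OF D1_prol[OF s(1)] Y] by (simp only: s(2) ap_simps z)
      have "ad_op A \<sigma> Y = vf_bracket (anc \<sigma>) Y" by (rule eq_iff_diff_eq_0[THEN iffD2, OF e[symmetric]])
      also have "\<dots> = ad_op A (jet1 A (TM A) (anc \<sigma>)) Y"
        unfolding TM_jet1 ad_op_jetJ[OF X mbundle.sec_zero[OF End_mbundle] Y] ap_simps by simp
      finally show "ad_op A \<sigma> Y = ad_op A (jet1 A (TM A) (anc \<sigma>)) Y" .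
    qed
    then show "\<sigma> \<in> jet1 A (TM A) ` symmetries A g"
      using s(1) X by (intro image_eqI[where x = "anc \<sigma>"]) (simp_all add: symmetries_def)
  qed
qed

end

end

section \<open>The formula in a generator, and the vanishing of \<open>\<epsilon>\<close>\<close>

context igs_generator
begin

interpretation DD: mbundle A "hom_bundle (TM A) K" by (rule hom_mbundle[OF TM_mbundle K_mbundle])

text \<open>Evaluated on the sections \<open>V\<close> and \<open>\<phi>\<close>, the solution
  \<open>\<epsilon>\<close> is a bundle map of the kind required by \<open>gen_prol\<close>;
  uniqueness of the prolongation then identifies the two expressions.\<close>

lemma D1_formula:
  assumes tr: "torsion_reduced A g" and inj: "Delta_injective A g" and \<epsilon>: "epsilon_solution A g D \<epsilon>"
    and U: "U \<in> VF A" and V: "V \<in> VF A" and \<phi>: "\<phi> \<in> sections K"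
  shows "cov D1 U (gen_section A D V \<phi>) =
    gen_section A D (cov D U V + (\<lambda>p. \<phi> p (U p)))
      (act_endo A (nb U) \<phi> + (\<lambda>p. \<epsilon> p (V p, \<phi> p) (U p)) + dual_curv A D U V)"
proof -
  define E where "E = (\<lambda>p. \<epsilon> p (V p, \<phi> p))"
  have s: "(\<lambda>p. (V p, \<phi> p)) \<in> sections (sum_bundle (TM A) K)" using V \<phi> by (simp add: sum_bundle_def)
  have E: "E \<in> sections (Delta_dom A g)"
    using hom_secD(5)[OF \<epsilon>[unfolded epsilon_solution_def, THEN conjunct1] s] by (simp only: E_def ap_def)
  have DE: "Delta (E p) = R (gen_section A D V \<phi>) p" for p
    using \<epsilon>[unfolded epsilon_solution_def, THEN conjunct2, THEN bspec, OF V, THEN bspec, OF \<phi>, THEN spec, of p]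
    by (simp only: E_def rhs_eq[OF V \<phi>])
  obtain \<psi> where \<psi>: "prol (gen_section A D V \<phi>) \<psi>"
    "\<And>U. U \<in> VF A \<Longrightarrow> ap \<psi> U = gen_section A D (cov D U V + ap \<phi> U) (act_endo A (nb U) \<phi> + ap E U + dual_curv A D U V)"
    by (rule gen_prol[OF V \<phi> E DE]) (rule that; assumption)
  have "cov D1 U (gen_section A D V \<phi>) = ap \<psi> U"
    unfolding cov_def D1_eq[OF tr inj \<psi>(1)] by (simp only: ap_def)
  then show ?thesis unfolding \<psi>(2)[OF U] by (simp only: ap_def E_def)
qed

text \<open>The common criterion for both cases of vanishing. The membership in the image of
  \<open>\<Delta>\<close> that \<open>z\<close> may use is provided by the equation for
  \<open>\<epsilon>\<close> itself.\<close>

lemma epsilon_zero: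
  assumes inj: "Delta_injective A g" and \<epsilon>: "epsilon_solution A g D \<epsilon>"
    and z: "\<And>\<sigma> p. \<sigma> \<in> sections G \<Longrightarrow> R \<sigma> p \<in> im_Delta A g p \<Longrightarrow> R \<sigma> p = 0"
  shows "\<epsilon> = 0"
proof (rule ext, rule ext)
  fix p x
  note h = \<epsilon>[unfolded epsilon_solution_def]
  note d = hom_secD[OF h[THEN conjunct1]]
  have "\<epsilon> p x = 0"
  proof (cases "x \<in> fibre (sum_bundle (TM A) K) p")
    case True
    then have x: "fst x \<in> tangent A p" "snd x \<in> fibre K p" by (auto simp: sum_bundle_def)
    obtain V where V: "V \<in> VF A" "V p = fst x" by (rule TM_extend[OF x(1)])
    obtain \<phi> where \<phi>: "\<phi> \<in> sections K" "\<phi> p = snd x" by (rule kernel_extend[OF x(2)])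
    have "Delta (\<epsilon> p (V p, \<phi> p)) = R (gen_section A D V \<phi>) p"
      using h[THEN conjunct2, THEN bspec, OF V(1), THEN bspec, OF \<phi>(1), THEN spec, of p]
      by (simp only: rhs_eq[OF V(1) \<phi>(1)])
    then have 1: "Delta (\<epsilon> p x) = R (gen_section A D V \<phi>) p" unfolding V(2) \<phi>(2) prod.collapse .
    have "Delta (\<epsilon> p x) \<in> im_Delta A g p" unfolding im_Delta_def by (rule imageI[OF d(3)[OF True]])
    then have "Delta (\<epsilon> p x) = Delta 0" unfolding 1 Delta_zero by (rule z[OF gen_G[OF V(1) \<phi>(1)]])
    then show ?thesis by (rule Delta_inject[OF inj d(3)[OF True] DD.fib_closed(1)])
  qed (rule d(4))
  then show "\<epsilon> p x = 0 p x" by (simp only: zero_fun_apply)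
qed

text \<open>Invariance of the complement \<open>C\<close> keeps the action of \<open>g\<close> on
  the torsion inside \<open>C\<close>, which meets the image of \<open>\<Delta>\<close> only in
  zero.\<close>

lemma epsilon_zero_normal:
  assumes inj: "Delta_injective A g" and \<epsilon>: "epsilon_solution A g D \<epsilon>" and n: "normal_generator A g D"
  shows "\<epsilon> = 0"
proof (rule epsilon_zero[OF inj \<epsilon>])
  obtain C where C: "invariant_complement A g C" "dt \<in> sections (restrict_bundle (tor_bundle A) C)"
    using n unfolding normal_generator_def by (elim conjE exE) (rule that)
  fix \<sigma> p assume s: "\<sigma> \<in> sections G" and im: "R \<sigma> p \<in> im_Delta A g p"
  note c = C(1)[unfolded invariant_complement_def, THEN conjunct2]
  have "R \<sigma> \<in> sections (restrict_bundle (tor_bundle A) C)"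
    by (rule bspec[OF bspec[OF c[THEN conjunct2] s] C(2)])
  from this[unfolded restrict_sections, THEN conjunct2] have "R \<sigma> p \<in> C p" by (rule spec)
  moreover have "im_Delta A g p \<inter> C p = {0}" by (rule c[THEN conjunct1, THEN spec, THEN conjunct1])
  ultimately show "R \<sigma> p = 0" using im by blast
qed

text \<open>The torsion of the dual connection is minus the torsion of the generator, so it
  vanishes, and with it everything obtained by acting on it.\<close>

lemma epsilon_zero_torsion_free:
  assumes inj: "Delta_injective A g" and \<epsilon>: "epsilon_solution A g D \<epsilon>" and t: "torsion_free A D"
  shows "\<epsilon> = 0"
proof (rule epsilon_zero[OF inj \<epsilon>])
  have z: "tap dt U V = 0" if U: "U \<in> VF A" and V: "V \<in> VF A" for U V
  proof -
    have "cov D U V - cov D V U - vf_bracket U V = 0" using t U V unfolding torsion_free_def by simp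
    then show ?thesis unfolding dt_val[OF U V] dual_conn_def vf_antisym[of V U] by (simp add: algebra_simps)
  qed
  fix \<sigma> p assume s: "\<sigma> \<in> sections G"
  show "R \<sigma> p = 0"
  proof (rule R_ext)
    fix U W assume U: "U \<in> VF A" and W: "W \<in> VF A"
    have "ad_op A \<sigma> 0 = 0" using ad_diff[OF G_JT[OF s] U U] by (simp only: diff_self)
    then show "R \<sigma> p (U p) (W p) = 0 (U p) (W p)"
      by (simp only: R_val[OF s U W] z[OF U W] z[OF ad_VF[OF G_JT[OF s] U] W] z[OF U ad_VF[OF G_JT[OF s] W]] diff_self zero_fun_apply)
  qed (simp only: zero_fun_apply)
qed

end

text \<open>The connection can be exhibited before any generator is chosen because it is
  characterized by the prolongation equations; the natural correspondence between symmetries and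
  parallel sections is made concrete as the prolongation map.\<close>

theorem theorem9p5:
  fixes A :: "('m::{t2_space, second_countable_topology}, 'e::euclidean_space) atlas"
    and g :: "'m \<Rightarrow> 'm jet_TM set"
  assumes "smooth_atlas A"
    and "igs A g"
    and "transitive A g"
    and "torsion_reduced A g"
    and "Delta_injective A g"
  shows "\<exists>D1.
    cartan_algebroid A (igs_algebroid A g) D1 \<and>
    bij_betw (jet1 A (TM A)) (symmetries A g) (parallel_sections (igs_algebroid A g) D1) \<and>
    (\<forall>D. generator A g D \<longrightarrow>
      (\<exists>!\<epsilon>. epsilon_solution A g D \<epsilon>) \<and>
      (\<forall>\<epsilon>. epsilon_solution A g D \<epsilon> \<longrightarrow>
        (\<forall>U\<in>VF A. \<forall>V\<in>VF A. \<forall>\<phi>\<in>sections (kernel_bundle A g).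
           cov D1 U (gen_section A D V \<phi>) =
           gen_section A D
             (cov D U V + (\<lambda>p. \<phi> p (U p)))
             (act_endo A (dual_conn D U) \<phi> + (\<lambda>p. \<epsilon> p (V p, \<phi> p) (U p)) + dual_curv A D U V)) \<and>
        ((reductive A g \<and> normal_generator A g D) \<or>
         ((\<forall>p. intrinsic_torsion A g p = H_class A g p 0) \<and> torsion_free A D) \<longrightarrow>
         \<epsilon> = 0)))"
proof -
  interpret S: igs_structure A g by unfold_locales (rule assms)+
  note tr = assms(4) and inj = assms(5)
  have gen: "(\<exists>!\<epsilon>. epsilon_solution A g D \<epsilon>) \<and>
      (\<forall>\<epsilon>. epsilon_solution A g D \<epsilon> \<longrightarrow>
        (\<forall>U\<in>VF A. \<forall>V\<in>VF A. \<forall>\<phi>\<in>sections (kernel_bundle A g).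
           cov S.D1 U (gen_section A D V \<phi>) =
           gen_section A D
             (cov D U V + (\<lambda>p. \<phi> p (U p)))
             (act_endo A (dual_conn D U) \<phi> + (\<lambda>p. \<epsilon> p (V p, \<phi> p) (U p)) + dual_curv A D U V)) \<and>
        ((reductive A g \<and> normal_generator A g D) \<or>
         ((\<forall>p. intrinsic_torsion A g p = H_class A g p 0) \<and> torsion_free A D) \<longrightarrow>
         \<epsilon> = 0))" if D: "generator A g D" for D
  proof -
    interpret igs_generator A g D by unfold_locales (rule D)
    obtain \<epsilon> where \<epsilon>: "epsilon_solution A g D \<epsilon>" using epsilon_exists[OF tr inj] by (elim exE)
    show ?thesis
    proof (intro conjI allI impI ballI)
      show "\<exists>!\<epsilon>. epsilon_solution A g D \<epsilon>"
        by (rule ex1I[of "epsilon_solution A g D" \<epsilon>, OF \<epsilon>]) (rule epsilon_unique[OF tr inj _ \<epsilon>])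
      fix \<epsilon>' assume \<epsilon>': "epsilon_solution A g D \<epsilon>'"
      show "cov S.D1 U (gen_section A D V \<phi>) = gen_section A D (cov D U V + (\<lambda>p. \<phi> p (U p)))
          (act_endo A (dual_conn D U) \<phi> + (\<lambda>p. \<epsilon>' p (V p, \<phi> p) (U p)) + dual_curv A D U V)"
        if "U \<in> VF A" "V \<in> VF A" "\<phi> \<in> sections (kernel_bundle A g)" for U V \<phi>
        by (rule D1_formula[OF tr inj \<epsilon>' that])
      assume "(reductive A g \<and> normal_generator A g D) \<or>
         ((\<forall>p. intrinsic_torsion A g p = H_class A g p 0) \<and> torsion_free A D)"
      then show "\<epsilon>' = 0"
        using epsilon_zero_normal[OF inj \<epsilon>'] epsilon_zero_torsion_free[OF inj \<epsilon>'] by (elim disjE conjE)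
    qed
  qed
  show ?thesis
    by (rule exI[of _ S.D1]) (intro conjI allI impI S.D1_cartan[OF tr inj] S.D1_parallel[OF tr inj] gen)
qed

end
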